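(* Let $W$ be a graphon and let $\mathcal H=\{H_1,\dots,H_r\}$ be a finite collection of non-empty graphs such that, for some $1\le q\le r$, $W$ is irregular with respect to $H_1,\dots,H_q$ and regular with respect to $H_{q+1},\dots,H_r$. Let $G_n\sim G(n,W)$. Then, as $n\to\infty$, $$(Z(H_1,G_n),\dots,Z(H_r,G_n))^\top \xrightarrow{D} \boldsymbol Z(\mathcal H,W):=(Z(H_1,W),\dots,Z(H_r,W))^\top,$$ where, with $\{B_t\}_{t\in[0,1]}$ a standard Brownian motion (the same for all coordinates), (i) for $1\le i\le q$, $$Z(H_i,W)=\int_0^1\Big\{\frac{1}{|\mathrm{Aut}(H_i)|}\sum_{a=1}^{|V(H_i)|}t_a(x,H_i,W)-\frac{|V(H_i)|}{|\mathrm{Aut}(H_i)|}t(H_i,W)\Big\}\,\mathrm dB_x;$$ (ii) for $q+1\le i\le r$, $$Z(H_i,W)=G_i+\int_0^1\int_0^1\Big\{W_{H_i}(x,y)-\frac{|V(H_i)|(|V(H_i)|-1)}{2|\mathrm{Aut}(H_i)|}t(H_i,W)\Big\}\,\mathrm dB_x\,\mathrm dB_y,$$ where $(G_{q+1},\dots,G_r)\sim N_{r-q}(\boldsymbol 0,\Sigma)$ is independent of $\{B_t\}_{t\in[0,1]}$ and $\Sigma=((\sigma_{ij}))_{q+1\le i,j\le r}$ is given by $$\sigma_{ij}=\frac{1}{2|\mathrm{Aut}(H_i)||\mathrm{Aut}(H_j)|}\sum_{\substack{(a,b)\in E^+(H_i)\\(c,d)\in E^+(H_j)}}\Big[t\B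ig(H_i\ominus_{(a,b),(c,d)}H_j,W\Big)-t\Big(H_i\oplus_{(a,b),(c,d)}H_j,W\Big)\Big].$$
   Context: A graphon is a measurable symmetric function $W:[0,1]^2\to[0,1]$. $G(n,W)$ is the random graph on $[n]=\{1,\dots,n\}$ obtained from independent i.i.d. $U[0,1]$ families $(U_i)_{i\le n}$ and $(Y_{ij})_{i<j\le n}$ by putting the edge $(i,j)$ iff $Y_{ij}\le W(U_i,U_j)$. Graphs $H$ are finite and simple with $V(H)=\{1,\dots,|V(H)|\}$, $|V(H)|\ge2$; non-empty means having at least one edge. $\mathrm{Aut}(H)$ is the automorphism group of $H$, and $X(H,G_n)$ is the number of (unlabelled, not necessarily induced) copies of $H$ in $G_n$. $(n)_k=n(n-1)\cdots(n-k+1)$. For a loopless multigraph $F$, $t(F,W)=\int_{[0,1]^{|V(F)|}}\prod_{(a,b)\in E(F)}W(x_a,x_b)\prod_a\mathrm dx_a$ (edges counted with multiplicity). For $a\ne b\in V(H)$, $t_a(x,H,W)=\mathbb E[\prod_{(c,d)\in E(H)}W(U_c,U_d)\mid U_a=x]$ and $t_{a,b}(x,y,H,W)=\mathbb E[\prod_{(c,d)\in E(H)}W(U_c,U_d)\mid U_a=x,U_b=y]$. $W$ is $H$-regular if $\frac1{|V(H)|}\sum_{a}t_a(x,H,W)=t(H,W)$ for almost every $x$, and $H$-irregular otherwise. $W_H(x,y)=\frac{1}{2|\mathrm{Aut}(H)|}\sum_{1\le a\ne b\le|V(H)|}t_{a,b}(x,y,H,W)$ (sum over ordered pairs). $E^+(H)=\{(a,b):a\ne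 b,\ (a,b)\text{ or }(b,a)\in E(H)\}$ is the set of ordered edges. For $(a,b)\in E^+(H_1)$, $(c,d)\in E^+(H_2)$: the weak edge join $H_1\ominus_{(a,b),(c,d)}H_2$ is obtained from disjoint copies of $H_1,H_2$ by identifying $a$ with $c$ and $b$ with $d$ and keeping a single edge between the two identified vertices; the strong edge join $H_1\oplus_{(a,b),(c,d)}H_2$ is the multigraph obtained in the same way but keeping both edges. $Z(H,G_n)=n^{-|V(H)|+1/2}\big(X(H,G_n)-\frac{(n)_{|V(H)|}t(H,W)}{|\mathrm{Aut}(H)|}\big)$ if $W$ is $H$-irregular, and $Z(H,G_n)=n^{-|V(H)|+1}\big(X(H,G_n)-\frac{(n)_{|V(H)|}t(H,W)}{|\mathrm{Aut}(H)|}\big)$ if $W$ is $H$-regular. Integrals against $\mathrm dB_x$ and $\mathrm dB_x\mathrm dB_y$ over $[0,1]$ and $[0,1]^2$ are the one- and two-fold (multiple) Wiener–Itô integrals (diagonal excluded, so e.g. $\int\int f(x)g(y)\,\mathrm dB_x\mathrm dB_y=\int f\,\mathrm dB\int g\,\mathrm dB-\int fg$). *)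

theory Defs
  imports "HOL-Probability.Probability" "HOL-Combinatorics.Combinatorics"
begin

section \<open>Graphs, automorphisms, copies, edge joins\<close>

text \<open>
  An undirected edge between \<open>a < b\<close> is stored once, as the pair \<open>(a, b)\<close>.
\<close>

record sgraph =
  verts :: "nat set"
  edges :: "(nat \<times> nat) set"

definition simple_graph :: "sgraph \<Rightarrow> bool" where
  "simple_graph G \<longleftrightarrow> finite (verts G) \<and> edges G \<subseteq> {(a, b). a \<in> verts G \<and> b \<in> verts G \<and> a < b}"

definition pattern_graph :: "sgraph \<Rightarrow> bool" where
  "pattern_graph H \<longleftrightarrow> simple_graph H \<and> verts H = {1..card (verts H)} \<and> 2 \<le> card (verts H)"

definition ordered_edges :: "sgraph \<Rightarrow> (nat \<times> nat) set" where
  "ordered_edges G = {(a, b). a \<noteq> b \<and> ((a, b) \<in> edges G \<or> (b, a) \<in> edges G)}"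

definition graph_iso :: "(nat \<Rightarrow> nat) \<Rightarrow> sgraph \<Rightarrow> sgraph \<Rightarrow> bool" where
  "graph_iso f G G' \<longleftrightarrow> bij_betw f (verts G) (verts G') \<and>
     (\<forall>a\<in>verts G. \<forall>b\<in>verts G. (a, b) \<in> ordered_edges G \<longleftrightarrow> (f a, f b) \<in> ordered_edges G')"

definition Aut :: "sgraph \<Rightarrow> (nat \<Rightarrow> nat) set" where
  "Aut H = {f. f permutes verts H \<and> graph_iso f H H}"

definition copies :: "sgraph \<Rightarrow> sgraph \<Rightarrow> sgraph set" where
  "copies H G = {S. simple_graph S \<and> verts S \<subseteq> verts G \<and> edges S \<subseteq> edges G \<and> (\<exists>f. graph_iso f H S)}"

definition subgraph_count :: "sgraph \<Rightarrow> sgraph \<Rightarrow> nat" where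
  "subgraph_count H G = card (copies H G)"

text \<open>
  In a multigraph an edge is listed in either orientation, with multiplicity.  The orientation is
  irrelevant below because graphons are symmetric.
\<close>

record 'v multigraph =
  mverts :: "'v set"
  medges :: "('v \<times> 'v) multiset"

definition to_multigraph :: "sgraph \<Rightarrow> nat multigraph" where
  "to_multigraph H = \<lparr>mverts = verts H, medges = mset_set (edges H)\<rparr>"

text \<open>
  In an edge join the first graph keeps its vertices under \<open>Inl\<close>; the second one is embedded by
  \<open>Inr\<close>, except that \<open>c\<close> and \<open>d\<close> go to the images of \<open>a\<close> and \<open>b\<close>.
\<close>

definition join_embed :: "nat \<times> nat \<Rightarrow> nat \<times> nat \<Rightarrow> nat \<Rightarrow> nat + nat" where
  "join_embed e e' v = (if v = fst e' then Inl (fst e) else if v = snd e' then Inl (snd e) else Inr v)"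

definition strong_join :: "sgraph \<Rightarrow> nat \<times> nat \<Rightarrow> sgraph \<Rightarrow> nat \<times> nat \<Rightarrow> (nat + nat) multigraph" where
  "strong_join H e H' e' =
     \<lparr>mverts = Inl ` verts H \<union> join_embed e e' ` verts H',
      medges = image_mset (map_prod Inl Inl) (mset_set (edges H)) +
               image_mset (map_prod (join_embed e e') (join_embed e e')) (mset_set (edges H'))\<rparr>"

definition weak_join :: "sgraph \<Rightarrow> nat \<times> nat \<Rightarrow> sgraph \<Rightarrow> nat \<times> nat \<Rightarrow> (nat + nat) multigraph" where
  "weak_join H e H' e' =
     \<lparr>mverts = Inl ` verts H \<union> join_embed e e' ` verts H',
      medges = image_mset (map_prod Inl Inl) (mset_set (edges H)) +
               image_mset (map_prod (join_embed e e') (join_embed e e'))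
                 (mset_set (edges H' - {e', prod.swap e'}))\<rparr>"

section \<open>Graphons, densities, and the random graph\<close>

definition unit_unif :: "real measure" where
  "unit_unif = restrict_space lborel {0..1}"

definition graphon :: "(real \<Rightarrow> real \<Rightarrow> real) \<Rightarrow> bool" where
  "graphon W \<longleftrightarrow> case_prod W \<in> borel_measurable (unit_unif \<Otimes>\<^sub>M unit_unif) \<and>
     (\<forall>x\<in>{0..1}. \<forall>y\<in>{0..1}. W x y \<in> {0..1} \<and> W x y = W y x)"

definition edge_weight :: "(real \<Rightarrow> real \<Rightarrow> real) \<Rightarrow> 'v multigraph \<Rightarrow> ('v \<Rightarrow> real) \<Rightarrow> real" where
  "edge_weight W F x = (\<Prod>(a, b)\<in>#medges F. W (x a) (x b))"

definition hom_density :: "'v multigraph \<Rightarrow> (real \<Rightarrow> real \<Rightarrow> real) \<Rightarrow> real" where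
  "hom_density F W = (\<integral>x. edge_weight W F x \<partial>(\<Pi>\<^sub>M a\<in>mverts F. unit_unif))"

abbreviation tdens :: "sgraph \<Rightarrow> (real \<Rightarrow> real \<Rightarrow> real) \<Rightarrow> real" where
  "tdens H W \<equiv> hom_density (to_multigraph H) W"

text \<open>
  The conditional densities given \<open>U\<^sub>a = x\<close>, respectively \<open>U\<^sub>a = x\<close> and \<open>U\<^sub>b = y\<close>, with the
  independent remaining variables integrated out.  The lemmas \<open>tdens1_cond_exp\<close> and
  \<open>tdens2_cond_exp\<close> below show that they are versions of the conditional expectations.
\<close>

definition tdens1 :: "nat \<Rightarrow> real \<Rightarrow> sgraph \<Rightarrow> (real \<Rightarrow> real \<Rightarrow> real) \<Rightarrow> real" where
  "tdens1 a x H W =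
     (\<integral>z. edge_weight W (to_multigraph H) (z(a := x)) \<partial>(\<Pi>\<^sub>M c\<in>verts H - {a}. unit_unif))"

definition tdens2 :: "nat \<Rightarrow> nat \<Rightarrow> real \<Rightarrow> real \<Rightarrow> sgraph \<Rightarrow> (real \<Rightarrow> real \<Rightarrow> real) \<Rightarrow> real" where
  "tdens2 a b x y H W =
     (\<integral>z. edge_weight W (to_multigraph H) (z(a := x, b := y)) \<partial>(\<Pi>\<^sub>M c\<in>verts H - {a, b}. unit_unif))"

definition H_regular :: "sgraph \<Rightarrow> (real \<Rightarrow> real \<Rightarrow> real) \<Rightarrow> bool" where
  "H_regular H W \<longleftrightarrow>
     (AE x in unit_unif. (1 / real (card (verts H))) * (\<Sum>a\<in>verts H. tdens1 a x H W) = tdens H W)"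

definition two_point_kernel :: "sgraph \<Rightarrow> (real \<Rightarrow> real \<Rightarrow> real) \<Rightarrow> real \<Rightarrow> real \<Rightarrow> real" where
  "two_point_kernel H W x y = (1 / (2 * real (card (Aut H)))) *
     (\<Sum>(a, b)\<in>{(a, b). a \<in> verts H \<and> b \<in> verts H \<and> a \<noteq> b}. tdens2 a b x y H W)"

definition vertex_pairs :: "nat \<Rightarrow> (nat \<times> nat) set" where
  "vertex_pairs n = {(i, j). 1 \<le> i \<and> i < j \<and> j \<le> n}"

definition graphs_on :: "nat \<Rightarrow> sgraph set" where
  "graphs_on n = {G. simple_graph G \<and> verts G = {1..n}}"

definition threshold_graph ::
  "nat \<Rightarrow> (real \<Rightarrow> real \<Rightarrow> real) \<Rightarrow> (nat \<Rightarrow> real) \<times> (nat \<times> nat \<Rightarrow> real) \<Rightarrow> sgraph" where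
  "threshold_graph n W = (\<lambda>(u, y).
     \<lparr>verts = {1..n}, edges = {(i, j) \<in> vertex_pairs n. y (i, j) \<le> W (u i) (u j)}\<rparr>)"

definition graphon_random_graph :: "nat \<Rightarrow> (real \<Rightarrow> real \<Rightarrow> real) \<Rightarrow> sgraph measure" where
  "graphon_random_graph n W =
     distr ((\<Pi>\<^sub>M i\<in>{1..n}. unit_unif) \<Otimes>\<^sub>M (\<Pi>\<^sub>M e\<in>vertex_pairs n. unit_unif))
       (count_space (graphs_on n)) (threshold_graph n W)"

definition falling_factorial :: "nat \<Rightarrow> nat \<Rightarrow> real" where
  "falling_factorial n k = (\<Prod>i<k. real n - real i)"

definition Z_stat :: "nat \<Rightarrow> sgraph \<Rightarrow> (real \<Rightarrow> real \<Rightarrow> real) \<Rightarrow> sgraph \<Rightarrow> real" where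
  "Z_stat n H W G =
     (let k = card (verts H)
      in real n powr (- real k + (if H_regular H W then 1 else 1 / 2)) *
         (real (subgraph_count H G) - falling_factorial n k * tdens H W / real (card (Aut H))))"

definition limit_cov :: "sgraph \<Rightarrow> sgraph \<Rightarrow> (real \<Rightarrow> real \<Rightarrow> real) \<Rightarrow> real" where
  "limit_cov H H' W = (1 / (2 * real (card (Aut H)) * real (card (Aut H')))) *
     (\<Sum>(e, e')\<in>ordered_edges H \<times> ordered_edges H'.
        hom_density (weak_join H e H' e') W - hom_density (strong_join H e H' e') W)"

section \<open>Brownian motion and multiple Wiener--Ito integrals\<close>

definition brownian_motion :: "'a measure \<Rightarrow> (real \<Rightarrow> 'a \<Rightarrow> real) \<Rightarrow> bool" where
  "brownian_motion M B \<longleftrightarrow> prob_space M \<and>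
     (\<forall>t\<in>{0..1}. B t \<in> borel_measurable M) \<and>
     (AE \<omega> in M. B 0 \<omega> = 0) \<and>
     (\<forall>s t. 0 \<le> s \<and> s < t \<and> t \<le> 1 \<longrightarrow>
        distributed M lborel (\<lambda>\<omega>. B t \<omega> - B s \<omega>) (normal_density 0 (sqrt (t - s)))) \<and>
     (\<forall>m t. (\<forall>k<m. t k < t (Suc k)) \<and> 0 \<le> t 0 \<and> t m \<le> 1 \<longrightarrow>
        prob_space.indep_vars M (\<lambda>_. borel) (\<lambda>k \<omega>. B (t (Suc k)) \<omega> - B (t k) \<omega>) {..<m}) \<and>
     (AE \<omega> in M. continuous_on {0..1} (\<lambda>t. B t \<omega>))"

definition unit_partition :: "nat \<Rightarrow> (nat \<Rightarrow> real) \<Rightarrow> bool" where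
  "unit_partition m t \<longleftrightarrow> t 0 = 0 \<and> t m = 1 \<and> (\<forall>k<m. t k < t (Suc k))"

definition step1 :: "nat \<Rightarrow> (nat \<Rightarrow> real) \<Rightarrow> (nat \<Rightarrow> real) \<Rightarrow> real \<Rightarrow> real" where
  "step1 m t c x = (\<Sum>k<m. c k * indicator {t k<..t (Suc k)} x)"

definition step1_integral ::
  "(real \<Rightarrow> 'a \<Rightarrow> real) \<Rightarrow> nat \<Rightarrow> (nat \<Rightarrow> real) \<Rightarrow> (nat \<Rightarrow> real) \<Rightarrow> 'a \<Rightarrow> real" where
  "step1_integral B m t c \<omega> = (\<Sum>k<m. c k * (B (t (Suc k)) \<omega> - B (t k) \<omega>))"

definition step2 :: "nat \<Rightarrow> (nat \<Rightarrow> real) \<Rightarrow> (nat \<Rightarrow> nat \<Rightarrow> real) \<Rightarrow> real \<Rightarrow> real \<Rightarrow> real" where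
  "step2 m t c x y = (\<Sum>(j, k)\<in>{(j, k). j < m \<and> k < m \<and> j \<noteq> k}.
     c j k * indicator {t j<..t (Suc j)} x * indicator {t k<..t (Suc k)} y)"

definition step2_integral ::
  "(real \<Rightarrow> 'a \<Rightarrow> real) \<Rightarrow> nat \<Rightarrow> (nat \<Rightarrow> real) \<Rightarrow> (nat \<Rightarrow> nat \<Rightarrow> real) \<Rightarrow> 'a \<Rightarrow> real" where
  "step2_integral B m t c \<omega> = (\<Sum>(j, k)\<in>{(j, k). j < m \<and> k < m \<and> j \<noteq> k}.
     c j k * (B (t (Suc j)) \<omega> - B (t j) \<omega>) * (B (t (Suc k)) \<omega> - B (t k) \<omega>))"

text \<open>
  The integrals extend the step function integrals by \<open>L\<^sup>2\<close>-continuity, so they are determined up to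
  null sets; \<open>wiener1\<close> and \<open>wiener2\<close> select a version.  Step functions of two variables vanish on
  the diagonal blocks, which makes the two-fold integral the (diagonal-free) multiple integral.
\<close>

definition has_wiener1 ::
  "'a measure \<Rightarrow> (real \<Rightarrow> 'a \<Rightarrow> real) \<Rightarrow> (real \<Rightarrow> real) \<Rightarrow> ('a \<Rightarrow> real) \<Rightarrow> bool" where
  "has_wiener1 M B f X \<longleftrightarrow> f \<in> borel_measurable unit_unif \<and> X \<in> borel_measurable M \<and>
     (\<exists>m t c. (\<forall>n. unit_partition (m n) (t n)) \<and>
        (\<lambda>n. \<integral>\<^sup>+x. ennreal ((f x - step1 (m n) (t n) (c n) x)\<^sup>2) \<partial>unit_unif) \<longlonglongrightarrow> 0 \<and>
        (\<lambda>n. \<integral>\<^sup>+\<omega>. ennreal ((X \<omega> - step1_integral B (m n) (t n) (c n) \<omega>)\<^sup>2) \<partial>M) \<longlonglongrightarrow> 0)"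

definition wiener1 :: "'a measure \<Rightarrow> (real \<Rightarrow> 'a \<Rightarrow> real) \<Rightarrow> (real \<Rightarrow> real) \<Rightarrow> 'a \<Rightarrow> real" where
  "wiener1 M B f = (SOME X. has_wiener1 M B f X)"

definition has_wiener2 ::
  "'a measure \<Rightarrow> (real \<Rightarrow> 'a \<Rightarrow> real) \<Rightarrow> (real \<Rightarrow> real \<Rightarrow> real) \<Rightarrow> ('a \<Rightarrow> real) \<Rightarrow> bool" where
  "has_wiener2 M B f X \<longleftrightarrow>
     case_prod f \<in> borel_measurable (unit_unif \<Otimes>\<^sub>M unit_unif) \<and> X \<in> borel_measurable M \<and>
     (\<exists>m t c. (\<forall>n. unit_partition (m n) (t n)) \<and>
        (\<lambda>n. \<integral>\<^sup>+(x, y). ennreal ((f x y - step2 (m n) (t n) (c n) x y)\<^sup>2)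
               \<partial>(unit_unif \<Otimes>\<^sub>M unit_unif)) \<longlonglongrightarrow> 0 \<and>
        (\<lambda>n. \<integral>\<^sup>+\<omega>. ennreal ((X \<omega> - step2_integral B (m n) (t n) (c n) \<omega>)\<^sup>2) \<partial>M) \<longlonglongrightarrow> 0)"

definition wiener2 :: "'a measure \<Rightarrow> (real \<Rightarrow> 'a \<Rightarrow> real) \<Rightarrow> (real \<Rightarrow> real \<Rightarrow> real) \<Rightarrow> 'a \<Rightarrow> real" where
  "wiener2 M B f = (SOME X. has_wiener2 M B f X)"

section \<open>The limit vector and convergence in distribution\<close>

text \<open>
  The law \<open>N(0, S)\<close> is specified by its characteristic function, so that \<open>S\<close> may be singular.
\<close>

definition centred_gaussian ::
  "'a measure \<Rightarrow> 'i set \<Rightarrow> ('i \<Rightarrow> 'i \<Rightarrow> real) \<Rightarrow> ('i \<Rightarrow> 'a \<Rightarrow> real) \<Rightarrow> bool" where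
  "centred_gaussian M J S g \<longleftrightarrow> (\<forall>i\<in>J. g i \<in> borel_measurable M) \<and>
     (\<forall>\<theta>. (CLINT \<omega>|M. iexp (\<Sum>i\<in>J. \<theta> i * g i \<omega>)) =
           complex_of_real (exp (- (1 / 2) * (\<Sum>i\<in>J. \<Sum>j\<in>J. \<theta> i * S i j * \<theta> j))))"

definition independent_families ::
  "'a measure \<Rightarrow> 'i set \<Rightarrow> ('i \<Rightarrow> 'a \<Rightarrow> real) \<Rightarrow> 'j set \<Rightarrow> ('j \<Rightarrow> 'a \<Rightarrow> real) \<Rightarrow> bool" where
  "independent_families M I X J Y \<longleftrightarrow> prob_space.indep_set M
     (sets (vimage_algebra (space M) (\<lambda>\<omega>. \<lambda>i\<in>I. X i \<omega>) (\<Pi>\<^sub>M i\<in>I. borel)))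
     (sets (vimage_algebra (space M) (\<lambda>\<omega>. \<lambda>j\<in>J. Y j \<omega>) (\<Pi>\<^sub>M j\<in>J. borel)))"

definition Z_irregular ::
  "'a measure \<Rightarrow> (real \<Rightarrow> 'a \<Rightarrow> real) \<Rightarrow> sgraph \<Rightarrow> (real \<Rightarrow> real \<Rightarrow> real) \<Rightarrow> 'a \<Rightarrow> real" where
  "Z_irregular M B H W = wiener1 M B (\<lambda>x.
     (1 / real (card (Aut H))) * (\<Sum>a\<in>verts H. tdens1 a x H W)
       - real (card (verts H)) / real (card (Aut H)) * tdens H W)"

definition Z_regular ::
  "'a measure \<Rightarrow> (real \<Rightarrow> 'a \<Rightarrow> real) \<Rightarrow> ('a \<Rightarrow> real) \<Rightarrow> sgraph \<Rightarrow> (real \<Rightarrow> real \<Rightarrow> real) \<Rightarrow> 'a \<Rightarrow> real" where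
  "Z_regular M B g H W = (\<lambda>\<omega>. g \<omega> + wiener2 M B (\<lambda>x y.
     two_point_kernel H W x y
       - real (card (verts H)) * (real (card (verts H)) - 1) / (2 * real (card (Aut H))) * tdens H W) \<omega>)"

definition converges_in_distribution ::
  "'i set \<Rightarrow> (nat \<Rightarrow> 'a measure) \<Rightarrow> (nat \<Rightarrow> 'a \<Rightarrow> 'i \<Rightarrow> real) \<Rightarrow> 'b measure \<Rightarrow> ('b \<Rightarrow> 'i \<Rightarrow> real) \<Rightarrow> bool" where
  "converges_in_distribution J M X N Y \<longleftrightarrow>
     (\<forall>n. X n \<in> M n \<rightarrow>\<^sub>M (\<Pi>\<^sub>M i\<in>J. borel)) \<and> Y \<in> N \<rightarrow>\<^sub>M (\<Pi>\<^sub>M i\<in>J. borel) \<and>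
     (\<forall>f. continuous_map (product_topology (\<lambda>_. euclideanreal) J) euclideanreal f \<and>
          bounded (f ` (\<Pi>\<^sub>E i\<in>J. UNIV)) \<longrightarrow>
          (\<lambda>n. \<integral>\<omega>. f (X n \<omega>) \<partial>M n) \<longlonglongrightarrow> (\<integral>\<omega>. f (Y \<omega>) \<partial>N))"

section \<open>Consistency of the definitions\<close>

lemma space_unit_unif [simp]: "space unit_unif = {0..1}"
  by (simp add: unit_unif_def space_restrict_space)

lemma prob_space_unit_unif: "prob_space unit_unif"
  by (rule prob_spaceI) (simp add: unit_unif_def space_restrict_space emeasure_restrict_space)

lemma measurable_graphon:
  assumes "graphon W" "f \<in> M \<rightarrow>\<^sub>M unit_unif" "g \<in> M \<rightarrow>\<^sub>M unit_unif"
  shows "(\<lambda>x. W (f x) (g x)) \<in> borel_measurable M"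
proof -
  have "case_prod W \<in> borel_measurable (unit_unif \<Otimes>\<^sub>M unit_unif)"
    using assms(1) by (simp add: graphon_def)
  from measurable_compose[OF measurable_Pair[OF assms(2,3)] this] show ?thesis by simp
qed

lemma prod_mset_unit:
  assumes "\<And>e. e \<in># E \<Longrightarrow> f e \<in> {0..1::real}"
  shows "prod_mset (image_mset f E) \<in> {0..1}"
  using assms
proof (induction E)
  case (add x E)
  from add.IH add.prems have "f x \<in> {0..1}" "prod_mset (image_mset f E) \<in> {0..1}" by auto
  then show ?case by (auto simp: mult_le_one)
qed auto

lemma edge_weight_unit:
  assumes "graphon W" "\<And>a b. (a, b) \<in># medges F \<Longrightarrow> x a \<in> {0..1} \<and> x b \<in> {0..1}"
  shows "edge_weight W F x \<in> {0..1}"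
  unfolding edge_weight_def
  by (rule prod_mset_unit) (use assms in \<open>fastforce simp: graphon_def\<close>)

lemma measurable_prod_mset':
  fixes f :: "'e \<Rightarrow> 'x \<Rightarrow> real"
  assumes "\<And>e. e \<in># E \<Longrightarrow> f e \<in> borel_measurable M"
  shows "(\<lambda>x. prod_mset (image_mset (\<lambda>e. f e x) E)) \<in> borel_measurable M"
  using assms
proof (induction E)
  case (add e E)
  have [measurable]: "f e \<in> borel_measurable M"
    "(\<lambda>x. prod_mset (image_mset (\<lambda>e. f e x) E)) \<in> borel_measurable M"
    using add by auto
  show ?case by simp
qed simp

lemma measurable_edge_weight:
  assumes "graphon W" "\<And>a b. (a, b) \<in># medges F \<Longrightarrow> a \<in> mverts F \<and> b \<in> mverts F"
  shows "edge_weight W F \<in> borel_measurable (\<Pi>\<^sub>M a\<in>mverts F. unit_unif)"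
proof -
  have "(\<lambda>x. case e of (a, b) \<Rightarrow> W (x a) (x b)) \<in> borel_measurable (\<Pi>\<^sub>M a\<in>mverts F. unit_unif)"
    if "e \<in># medges F" for e
  proof (cases e)
    case (Pair a b)
    with that assms(2) have "a \<in> mverts F" "b \<in> mverts F" by auto
    then have "(\<lambda>x. W (x a) (x b)) \<in> borel_measurable (\<Pi>\<^sub>M a\<in>mverts F. unit_unif)"
      by (intro measurable_graphon[OF assms(1)] measurable_component_singleton)
    then show ?thesis by (simp add: Pair)
  qed
  from measurable_prod_mset'[OF this] show ?thesis
    unfolding edge_weight_def by (simp cong: image_mset_cong)
qed

lemma pattern_graph_medges:
  assumes "pattern_graph H" "(a, b) \<in># medges (to_multigraph H)"
  shows "a \<in> verts H \<and> b \<in> verts H"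
proof -
  have "finite (edges H)"
    by (rule finite_subset[of _ "verts H \<times> verts H"])
      (use assms in \<open>auto simp: pattern_graph_def simple_graph_def\<close>)
  then show ?thesis using assms by (auto simp: to_multigraph_def pattern_graph_def simple_graph_def)
qed

lemma cond_exp_by_integrating_out:
  fixes f :: "('i \<Rightarrow> real) \<Rightarrow> real" and h :: "'s \<Rightarrow> real"
  defines "P \<equiv> \<lambda>V::'i set. (\<Pi>\<^sub>M a\<in>V. unit_unif)"
  assumes V: "finite V" "A \<subseteq> V"
    and f [measurable]: "f \<in> borel_measurable (P V)" and f1: "\<And>x. x \<in> space (P V) \<Longrightarrow> \<bar>f x\<bar> \<le> 1"
    and K [measurable]: "K \<in> P V \<rightarrow>\<^sub>M S" and h [measurable]: "h \<in> borel_measurable S"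
    and hK: "\<And>x. x \<in> space (P V) \<Longrightarrow> h (K x) = (\<integral>z. f (merge A (V - A) (x, z)) \<partial>P (V - A))"
    and Km: "\<And>x z. x \<in> space (P V) \<Longrightarrow> z \<in> space (P (V - A)) \<Longrightarrow> K (merge A (V - A) (x, z)) = K x"
  shows "AE x in P V. real_cond_exp (P V) (vimage_algebra (space (P V)) K S) f x = h (K x)"
proof -
  interpret U: prob_space unit_unif by (rule prob_space_unit_unif)
  interpret product_prob_space "\<lambda>_::'i. unit_unif" by unfold_locales
  interpret PV: prob_space "P V" unfolding P_def by (rule prob_space_PiM) unfold_locales
  interpret PC: prob_space "P (V - A)" unfolding P_def by (rule prob_space_PiM) unfold_locales
  let ?F = "vimage_algebra (space (P V)) K S"
  have KS: "K \<in> space (P V) \<rightarrow> space S" using K by (rule measurable_space[THEN funcsetI])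
  have sub: "subalgebra (P V) ?F"
    unfolding subalgebra_def using sets_vimage_algebra2[OF KS] measurable_sets[OF K] by auto
  interpret finite_measure_subalgebra "P V" ?F by unfold_locales (rule sub)
  have intf: "integrable (P V) f"
    by (rule PV.integrable_const_bound[where B = 1]) (auto intro!: AE_I2 f1)
  let ?g = "\<lambda>x. h (K x)"
  let ?m = "merge A (V - A)"
  have U: "A \<union> (V - A) = V" using V by auto
  have m_in: "?m (x, z) \<in> space (P V)" if "x \<in> space (P A)" "z \<in> space (P (V - A))" for x z
    using that U by (auto simp: P_def space_PiM PiE_iff merge_def extensional_def)
  have g1: "\<bar>?g x\<bar> \<le> 1" if "x \<in> space (P V)" for x
  proof -
    have b: "\<bar>f (?m (x, z))\<bar> \<le> 1" if "z \<in> space (P (V - A))" for z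
      using that \<open>x \<in> space (P V)\<close> V
      by (intro f1) (auto simp: P_def space_PiM PiE_iff merge_def extensional_def)
    then have "\<bar>\<integral>z. f (?m (x, z)) \<partial>P (V - A)\<bar> \<le> 1"
    proof (cases "integrable (P (V - A)) (\<lambda>z. f (?m (x, z)))")
      case True
      have "(\<integral>z. f (?m (x, z)) \<partial>P (V - A)) \<le> 1"
        by (rule PC.integral_le_const[OF True AE_I2]) (use b in \<open>auto simp: abs_le_iff\<close>)
      moreover have "-1 \<le> (\<integral>z. f (?m (x, z)) \<partial>P (V - A))"
        by (rule PC.integral_ge_const[OF True AE_I2]) (use b in \<open>fastforce simp: abs_le_iff\<close>)
      ultimately show ?thesis by (simp add: abs_le_iff)
    qed (simp add: not_integrable_integral_eq)
    then show ?thesis using hK[OF that] by simp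
  qed
  have intg: "integrable (P V) ?g"
    by (rule PV.integrable_const_bound[where B = 1]) (auto intro!: AE_I2 g1)
  show ?thesis
  proof (rule real_cond_exp_charact[OF _ intf intg])
    show "?g \<in> borel_measurable ?F"
      by (rule measurable_compose[OF measurable_vimage_algebra1[OF KS] h])
    fix X assume "X \<in> sets ?F"
    then obtain B where X: "X = K -` B \<inter> space (P V)" and B [measurable]: "B \<in> sets S"
      using sets_vimage_algebra2[OF KS] by auto
    have Xm [measurable]: "X \<in> sets (P V)" unfolding X by measurable
    have fold: "(\<integral>x\<in>X. k x \<partial>P V) = (\<integral>x. (\<integral>y. indicator X (?m (x, y)) * k (?m (x, y)) \<partial>P (V - A)) \<partial>P A)"
      if "integrable (P V) k" for k :: "_ \<Rightarrow> real"
      unfolding set_lebesgue_integral_def P_def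
      by (subst product_integral_fold[of A "V - A", unfolded U])
        (use V that integrable_mult_indicator[OF Xm that] in
          \<open>auto intro: finite_subset simp: P_def\<close>)
    show "(\<integral>x\<in>X. f x \<partial>P V) = (\<integral>x\<in>X. ?g x \<partial>P V)"
      unfolding fold[OF intf] fold[OF intg]
    proof (rule Bochner_Integration.integral_cong[OF refl])
      fix x assume x: "x \<in> space (P A)"
      obtain y0 where y0: "y0 \<in> space (P (V - A))" using PC.not_empty by auto
      have mm: "?m (?m (x, y), z) = ?m (x, z)" for y z by (auto simp: merge_def fun_eq_iff)
      have K0: "K (?m (x, y)) = K (?m (x, y0))" if "y \<in> space (P (V - A))" for y
        using Km[OF m_in[OF x y0] that] by (simp add: mm)
      have I0: "indicator X (?m (x, y)) = (indicator B (K (?m (x, y0))) :: real)"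
        if "y \<in> space (P (V - A))" for y
        using m_in[OF x that] K0[OF that] by (auto simp: X indicator_def)
      have g0: "?g (?m (x, y)) = (\<integral>z. f (?m (x, z)) \<partial>P (V - A))"
        if "y \<in> space (P (V - A))" for y
        using hK[OF m_in[OF x that]] by (simp add: mm)
      have "(\<integral>y. indicator X (?m (x, y)) * f (?m (x, y)) \<partial>P (V - A)) =
            (\<integral>y. indicator B (K (?m (x, y0))) * f (?m (x, y)) \<partial>P (V - A))"
        by (rule Bochner_Integration.integral_cong) (auto simp: I0)
      also have "\<dots> = indicator B (K (?m (x, y0))) * (\<integral>z. f (?m (x, z)) \<partial>P (V - A))" by simp
      also have "\<dots> = (\<integral>y. indicator B (K (?m (x, y0))) * (\<integral>z. f (?m (x, z)) \<partial>P (V - A)) \<partial>P (V - A))"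
        by (simp add: PC.prob_space)
      also have "\<dots> = (\<integral>y. indicator X (?m (x, y)) * ?g (?m (x, y)) \<partial>P (V - A))"
        by (rule Bochner_Integration.integral_cong) (auto simp: I0 g0)
      finally show "(\<integral>y. indicator X (?m (x, y)) * f (?m (x, y)) \<partial>P (V - A)) =
        (\<integral>y. indicator X (?m (x, y)) * ?g (?m (x, y)) \<partial>P (V - A))" .
    qed
  qed
qed

lemma edge_weight_cond_exp:
  fixes W H
  defines "P \<equiv> \<lambda>V::nat set. (\<Pi>\<^sub>M c\<in>V. unit_unif)"
  assumes W: "graphon W" and H: "pattern_graph H" and A: "A \<subseteq> verts H"
    and "K \<in> P (verts H) \<rightarrow>\<^sub>M S" "h \<in> borel_measurable S"
    and "\<And>x. x \<in> space (P (verts H)) \<Longrightarrow> h (K x) =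
      (\<integral>z. edge_weight W (to_multigraph H) (merge A (verts H - A) (x, z)) \<partial>P (verts H - A))"
    and "\<And>x z. x \<in> space (P (verts H)) \<Longrightarrow> z \<in> space (P (verts H - A)) \<Longrightarrow>
      K (merge A (verts H - A) (x, z)) = K x"
  shows "AE x in P (verts H). real_cond_exp (P (verts H)) (vimage_algebra (space (P (verts H))) K S)
           (edge_weight W (to_multigraph H)) x = h (K x)"
  unfolding P_def
proof (rule cond_exp_by_integrating_out[where A = A])
  show "finite (verts H)" using H by (simp add: pattern_graph_def simple_graph_def)
  show "edge_weight W (to_multigraph H) \<in> borel_measurable (\<Pi>\<^sub>M a\<in>verts H. unit_unif)"
    using measurable_edge_weight[OF W, of "to_multigraph H"] pattern_graph_medges[OF H]
    by (auto simp: to_multigraph_def)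
  show "\<bar>edge_weight W (to_multigraph H) x\<bar> \<le> 1"
    if "x \<in> space (\<Pi>\<^sub>M a\<in>verts H. unit_unif)" for x
    using edge_weight_unit[OF W, of "to_multigraph H" x] pattern_graph_medges[OF H] that
    by (fastforce simp: space_PiM PiE_iff)
qed (use assms in \<open>auto simp: P_def\<close>)

lemma tdens1_cond_exp:
  fixes H
  defines "P \<equiv> (\<Pi>\<^sub>M c\<in>verts H. unit_unif)"
  assumes W: "graphon W" and H: "pattern_graph H" and a: "a \<in> verts H"
  shows "AE U in P. real_cond_exp P (vimage_algebra (space P) (\<lambda>U. U a) unit_unif)
           (edge_weight W (to_multigraph H)) U = tdens1 a (U a) H W"
  unfolding P_def
proof (rule edge_weight_cond_exp[OF W H, where A = "{a}"])
  interpret U: prob_space unit_unif by (rule prob_space_unit_unif)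
  interpret PC: prob_space "\<Pi>\<^sub>M c\<in>verts H - {a}. unit_unif" by (rule prob_space_PiM) unfold_locales
  have [measurable]: "edge_weight W (to_multigraph H) \<in> borel_measurable (\<Pi>\<^sub>M a\<in>verts H. unit_unif)"
    using measurable_edge_weight[OF W, of "to_multigraph H"] pattern_graph_medges[OF H]
    by (auto simp: to_multigraph_def)
  have ins: "insert a (verts H - {a}) = verts H" using a by auto
  have [measurable]: "(\<lambda>(x, z). z(a := x)) \<in>
      unit_unif \<Otimes>\<^sub>M (\<Pi>\<^sub>M c\<in>verts H - {a}. unit_unif) \<rightarrow>\<^sub>M (\<Pi>\<^sub>M a\<in>verts H. unit_unif)"
    unfolding split_beta'
    by (rule measurable_fun_upd[where J = "verts H - {a}"]) (use ins in auto)
  show "(\<lambda>x. tdens1 a x H W) \<in> borel_measurable unit_unif"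
    unfolding tdens1_def by measurable
  show "tdens1 a (x a) H W = (\<integral>z. edge_weight W (to_multigraph H) (merge {a} (verts H - {a}) (x, z))
      \<partial>(\<Pi>\<^sub>M c\<in>verts H - {a}. unit_unif))" for x
    unfolding tdens1_def
    by (rule Bochner_Integration.integral_cong[OF refl], rule arg_cong[where f = "edge_weight _ _"])
      (auto simp: merge_def fun_eq_iff space_PiM PiE_iff extensional_def)
qed (use a in \<open>auto simp: merge_def\<close>)

lemma tdens2_cond_exp:
  fixes H
  defines "P \<equiv> (\<Pi>\<^sub>M c\<in>verts H. unit_unif)"
  assumes W: "graphon W" and H: "pattern_graph H" and ab: "a \<in> verts H" "b \<in> verts H" "a \<noteq> b"
  shows "AE U in P. real_cond_exp P
           (vimage_algebra (space P) (\<lambda>U. (U a, U b)) (unit_unif \<Otimes>\<^sub>M unit_unif))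
           (edge_weight W (to_multigraph H)) U = tdens2 a b (U a) (U b) H W"
proof -
  have "AE U in P. real_cond_exp P
           (vimage_algebra (space P) (\<lambda>U. (U a, U b)) (unit_unif \<Otimes>\<^sub>M unit_unif))
           (edge_weight W (to_multigraph H)) U = (\<lambda>(x, y). tdens2 a b x y H W) (U a, U b)"
    unfolding P_def
  proof (rule edge_weight_cond_exp[OF W H, where A = "{a, b}"])
    interpret U: prob_space unit_unif by (rule prob_space_unit_unif)
    interpret PC: prob_space "\<Pi>\<^sub>M c\<in>verts H - {a, b}. unit_unif" by (rule prob_space_PiM) unfold_locales
    have [measurable]: "edge_weight W (to_multigraph H) \<in> borel_measurable (\<Pi>\<^sub>M a\<in>verts H. unit_unif)"
      using measurable_edge_weight[OF W, of "to_multigraph H"] pattern_graph_medges[OF H]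
      by (auto simp: to_multigraph_def)
    have "(\<lambda>((x, y), z). z(a := x, b := y)) \<in> (unit_unif \<Otimes>\<^sub>M unit_unif) \<Otimes>\<^sub>M
        (\<Pi>\<^sub>M c\<in>verts H - {a, b}. unit_unif) \<rightarrow>\<^sub>M (\<Pi>\<^sub>M a\<in>verts H. unit_unif)"
      unfolding split_beta'
      by (rule measurable_fun_upd[where J = "verts H - {b}"],
          (use ab in auto)[1], rule measurable_fun_upd[where J = "verts H - {a, b}"])
        (use ab in auto)
    then have [measurable]: "(\<lambda>(p, z). z(a := fst p, b := snd p)) \<in> (unit_unif \<Otimes>\<^sub>M unit_unif) \<Otimes>\<^sub>M
        (\<Pi>\<^sub>M c\<in>verts H - {a, b}. unit_unif) \<rightarrow>\<^sub>M (\<Pi>\<^sub>M a\<in>verts H. unit_unif)"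
      by (simp add: split_beta')
    show "(\<lambda>(x, y). tdens2 a b x y H W) \<in> borel_measurable (unit_unif \<Otimes>\<^sub>M unit_unif)"
      unfolding tdens2_def split_beta' by measurable
    show "(\<lambda>(x, y). tdens2 a b x y H W) (x a, x b) =
        (\<integral>z. edge_weight W (to_multigraph H) (merge {a, b} (verts H - {a, b}) (x, z))
          \<partial>(\<Pi>\<^sub>M c\<in>verts H - {a, b}. unit_unif))" for x
      unfolding tdens2_def prod.case
      by (rule Bochner_Integration.integral_cong[OF refl], rule arg_cong[where f = "edge_weight _ _"])
        (use ab in \<open>auto simp: merge_def fun_eq_iff space_PiM PiE_iff extensional_def\<close>)
  qed (use ab in \<open>auto simp: merge_def\<close>)
  then show ?thesis by simp
qed

lemma finite_graphs_on: "finite (graphs_on n)"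
proof (rule finite_subset)
  show "graphs_on n \<subseteq> (\<lambda>E. \<lparr>verts = {1..n}, edges = E\<rparr>) ` Pow ({1..n} \<times> {1..n})"
  proof
    fix G assume "G \<in> graphs_on n"
    then show "G \<in> (\<lambda>E. \<lparr>verts = {1..n}, edges = E\<rparr>) ` Pow ({1..n} \<times> {1..n})"
      by (intro image_eqI[of _ _ "edges G"] sgraph.equality)
        (auto simp: graphs_on_def simple_graph_def simp del: atLeastAtMost_iff)
  qed
qed simp

lemma measurable_threshold_graph:
  assumes W: "graphon W"
  shows "threshold_graph n W \<in>
    (\<Pi>\<^sub>M i\<in>{1..n}. unit_unif) \<Otimes>\<^sub>M (\<Pi>\<^sub>M e\<in>vertex_pairs n. unit_unif) \<rightarrow>\<^sub>M count_space (graphs_on n)"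
    (is "_ \<in> ?P \<rightarrow>\<^sub>M _")
  unfolding measurable_count_space_eq2[OF finite_graphs_on]
proof (intro conjI ballI)
  show "threshold_graph n W \<in> space ?P \<rightarrow> graphs_on n"
    by (auto simp: threshold_graph_def graphs_on_def simple_graph_def vertex_pairs_def)
  fix G assume "G \<in> graphs_on n"
  then have G: "verts G = {1..n}" "edges G \<subseteq> vertex_pairs n"
    by (auto simp: graphs_on_def simple_graph_def vertex_pairs_def)
  have fin: "finite (vertex_pairs n)"
    by (rule finite_subset[of _ "{1..n} \<times> {1..n}"]) (auto simp: vertex_pairs_def)
  define Q :: "nat \<times> nat \<Rightarrow> (nat \<Rightarrow> real) \<times> (nat \<times> nat \<Rightarrow> real) \<Rightarrow> bool"
    where "Q = (\<lambda>e p. snd p e \<le> W (fst p (fst e)) (fst p (snd e)))"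
  have eq: "threshold_graph n W -` {G} \<inter> space ?P =
      {p \<in> space ?P. \<forall>e\<in>vertex_pairs n. Q e p \<longleftrightarrow> e \<in> edges G}"
  proof -
    have "threshold_graph n W p = G \<longleftrightarrow> (\<forall>e\<in>vertex_pairs n. Q e p \<longleftrightarrow> e \<in> edges G)" for p
    proof -
      have "edges (threshold_graph n W p) = {e \<in> vertex_pairs n. Q e p}"
        by (auto simp: threshold_graph_def split_beta' Q_def)
      moreover have "verts (threshold_graph n W p) = verts G"
        by (simp add: threshold_graph_def G split_beta')
      ultimately have "threshold_graph n W p = G \<longleftrightarrow> {e \<in> vertex_pairs n. Q e p} = edges G"
        by (auto intro!: sgraph.equality)
      moreover have "{e \<in> A. Q e} = E \<longleftrightarrow> (\<forall>e\<in>A. Q e \<longleftrightarrow> e \<in> E)" if "E \<subseteq> A"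
        for A E :: "(nat \<times> nat) set" and Q
        using that by blast
      ultimately show ?thesis using G(2) by simp
    qed
    then show ?thesis by auto
  qed
  have Qm: "{p \<in> space ?P. Q e p} \<in> sets ?P" if "e \<in> vertex_pairs n" for e
  proof -
    have e: "fst e \<in> {1..n}" "snd e \<in> {1..n}" using that by (auto simp: vertex_pairs_def)
    have cm: "(\<lambda>u. u i) \<in> (\<Pi>\<^sub>M i\<in>{1..n}. unit_unif) \<rightarrow>\<^sub>M unit_unif" if "i \<in> {1..n}" for i
      by (rule measurable_component_singleton[OF that])
    have w [measurable]: "(\<lambda>p. W (fst p (fst e)) (fst p (snd e))) \<in> borel_measurable ?P"
      by (rule measurable_graphon[OF W]; rule measurable_compose[OF measurable_fst cm]; fact e)
    have "(\<lambda>x. x) \<in> borel_measurable unit_unif"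
      by (auto simp: unit_unif_def intro: measurable_restrict_space1)
    from measurable_compose[OF measurable_compose[OF measurable_snd
          measurable_component_singleton[OF that]] this]
    have y [measurable]: "(\<lambda>p. snd p e) \<in> borel_measurable ?P" by simp
    show ?thesis unfolding Q_def by measurable
  qed
  show "threshold_graph n W -` {G} \<inter> space ?P \<in> sets ?P"
    unfolding eq
  proof (rule sets.sets_Collect_finite_All[where P = "\<lambda>e p. Q e p \<longleftrightarrow> e \<in> edges G", OF _ fin])
    fix e assume "e \<in> vertex_pairs n"
    note Qe = Qm[OF this]
    show "{p \<in> space ?P. Q e p \<longleftrightarrow> e \<in> edges G} \<in> sets ?P"
      using Qe sets.sets_Collect_neg[OF Qe] by (cases "e \<in> edges G") simp_all
  qed
qed

end

theory Submission
 imports Defs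
begin

text \<open>
  All graphs \<open>G\<^sub>n\<close> are realised on one infinite product of unit intervals.  Up to an error that vanishes in
  \<open>L\<^sup>2\<close>, the Hoeffding decomposition of the number of injective homomorphisms reduces \<open>Z(H, G\<^sub>n)\<close> to a linear
  statistic of the \<open>U\<^sub>i\<close> in the irregular case, and in the regular case to a degenerate quadratic statistic
  of the \<open>U\<^sub>i\<close> plus a sum over pairs of the centred edge indicators times a kernel.  Given the \<open>U\<^sub>i\<close> the
  edge indicators are independent, so the last sum contributes a deterministic Gaussian factor to the
  joint characteristic function; this produces \<open>\<Sigma>\<close>.  For step kernels the remaining statistics are polynomials
  in the normalised cell counts, which converge to the increments of a Brownian bridge; the passage from
  the bridge to Brownian motion costs little because the kernels are (nearly) degenerate, and general
  kernels follow by \<open>L\<^sup>2\<close>-approximation.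
\<close>

section \<open>Averaging over coordinates of the infinite unit cube\<close>

text \<open>Edge noise and vertex part become independent only in the limit: given the vertices, the
  variance of the noise concentrates at a constant, and this makes the joint characteristic function
  factor. So characteristic functions are the natural carrier of the joint law. They do not suffice
  for the quadratic part, which is a polynomial in the cell counts and not a linear combination of
  them. Hence the continuity theorem is needed twice: once to turn the central limit theorem for the
  cell counts into weak convergence, so that bounded continuous functions of the polynomial may be
  integrated, and once for the conclusion itself. A bridge appears because the cell counts add up to
  the deterministic number n. A second correction comes from the products of cell counts: they
  contain pairs of equal vertices, which a multiple integral leaves out, and whose contribution
  tends to a nonzero constant. That constant has to be compensated in the polynomial. All error
  terms are controlled by second moments alone, and those are counted by the number of vertices that
  two embeddings share.\<close>

abbreviation unit_square :: "(real \<times> real) measure" where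
 "unit_square \<equiv> unit_unif \<Otimes>\<^sub>M unit_unif"

abbreviation borm :: "'a measure => ('a => 'b::topological_space) set" where
 "borm M \<equiv> borel_measurable M"

section \<open>Bounded measurable functions\<close>

lemmas lint_diff = Bochner_Integration.integral_diff
lemmas lint_sum = Bochner_Integration.integral_sum
lemmas lint_add = Bochner_Integration.integral_add
lemmas lintb_diff = Bochner_Integration.integrable_diff
lemmas lintb_sum = Bochner_Integration.integrable_sum
lemmas lintb_add = Bochner_Integration.integrable_add
lemmas lint_cong = Bochner_Integration.integral_cong

text \<open>Every statistic of the random graph and every kernel below is bounded on its space, so
  closure of this one class under algebra settles measurability and integrability together. The
  bound is asked on \<open>space M\<close> only, since a graphon is controlled only on the unit
  square.\<close>

definition bdm :: "'a measure => ('a => 'b::real_normed_vector) => bool" where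
 "bdm M f \<longleftrightarrow> f : borm M & (EX C. ALL x:space M. norm (f x) <= C)"

lemma bdmI:
 "f : borm M ==> (!!x. x : space M ==> norm (f x) <= C) ==> bdm M f"
 by (auto simp: bdm_def)

lemma bdm_measurable: "bdm M f ==> f : borm M"
 by (simp add: bdm_def)

lemma bdmE:
 assumes "bdm M f"
 obtains C where "0 <= C" "!!x. x : space M ==> norm (f x) <= C"
proof -
 obtain C where "ALL x:space M. norm (f x) <= C" using assms by (auto simp: bdm_def)
 then have "0 <= max C 0" "!!x. x : space M ==> norm (f x) <= max C 0" by (auto simp: le_max_iff_disj)
 then show ?thesis by (rule that)
qed

lemma bdm_integrable:
 fixes f :: "'a => 'b::{banach, second_countable_topology}"
 assumes "finite_measure M" "bdm M f"
 shows "integrable M f"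
proof -
 interpret finite_measure M by fact
 obtain C where "!!x. x : space M ==> norm (f x) <= C" using bdmE[OF assms(2)] by auto
 then show ?thesis
  by (intro integrable_const_bound[where B = C] AE_I2) (auto intro: bdm_measurable assms)
qed

lemma bdm_const [intro, simp]: "bdm M (%_. c)"
 by (rule bdmI[where C = "norm c"]) auto

lemma bdm_add:
 fixes f g :: "'a => 'b::{second_countable_topology, real_normed_vector}"
 assumes "bdm M f" "bdm M g"
 shows "bdm M (%x. f x + g x)"
proof -
 obtain C D where "!!x. x : space M ==> norm (f x) <= C" "!!x. x : space M ==> norm (g x) <= D"
  using assms bdmE by metis
 then show ?thesis using assms[THEN bdm_measurable]
  by (intro bdmI[where C = "C + D"]) (auto intro: norm_triangle_mono)
qed

lemma bdm_mult:
 fixes f g :: "'a => 'b::{second_countable_topology, real_normed_field}"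
 assumes "bdm M f" "bdm M g"
 shows "bdm M (%x. f x * g x)"
proof -
 obtain C where C: "0 <= C" "!!x. x : space M ==> norm (f x) <= C"
  using assms bdmE by metis
 obtain D where "0 <= D" "!!x. x : space M ==> norm (g x) <= D"
  using assms bdmE by metis
 with C show ?thesis using assms[THEN bdm_measurable]
  by (intro bdmI[where C = "C * D"]) (auto simp: norm_mult intro!: mult_mono)
qed

lemma bdm_uminus:
 fixes f :: "'a => 'b::{second_countable_topology, real_normed_vector}"
 shows "bdm M f ==> bdm M (%x. - f x)"
 by (auto simp: bdm_def)

lemma bdm_diff:
 fixes f g :: "'a => 'b::{second_countable_topology, real_normed_vector}"
 assumes "bdm M f" "bdm M g"
 shows "bdm M (%x. f x - g x)"
 using bdm_add[OF assms(1) bdm_uminus[OF assms(2)]] by simp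

lemma bdm_sum:
 fixes f :: "'i => 'a => 'b::{second_countable_topology, real_normed_vector}"
 assumes "!!i. i : I ==> bdm M (f i)"
 shows "bdm M (%x. SUM i:I. f i x)"
 using assms by (induction I rule: infinite_finite_induct) (auto intro: bdm_add)

lemma bdm_prod:
 fixes f :: "'i => 'a => 'b::{second_countable_topology, real_normed_field}"
 assumes "!!i. i : I ==> bdm M (f i)"
 shows "bdm M (%x. \<Prod>i\<in>I. f i x)"
 using assms by (induction I rule: infinite_finite_induct) (auto intro: bdm_mult)

lemma bdm_power:
 fixes f :: "'a => 'b::{second_countable_topology, real_normed_field}"
 shows "bdm M f ==> bdm M (%x. f x ^ n)"
 by (induction n) (auto intro: bdm_mult)

lemma bdm_compose:
 assumes "bdm N f" "h : M \<rightarrow>\<^sub>M N"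
 shows "bdm M (%x. f (h x))"
 using assms measurable_space[OF assms(2)] by (auto simp: bdm_def)

lemma bdm_iexp:
 "f : borm M ==> bdm M (%x. iexp (f x))"
 by (rule bdmI[where C = 1]) auto

lemma bdm_integral:
 fixes f :: "'a \<times> 'b => 'c::{banach, second_countable_topology}"
 assumes "prob_space N" "bdm (M \<Otimes>\<^sub>M N) f"
 shows "bdm M (%x. LINT y|N. f (x, y))"
proof -
 interpret prob_space N by fact
 have [measurable]: "f : borm (M \<Otimes>\<^sub>M N)" by (rule bdm_measurable) fact
 obtain C where C: "0 <= C" "!!z. z : space (M \<Otimes>\<^sub>M N) ==> norm (f z) <= C"
  using bdmE[OF assms(2)] by metis
 show ?thesis
 proof (rule bdmI[where C = C])
  fix x assume x: "x : space M"
  have i: "integrable N (%y. f (x, y))"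
   using x by (intro integrable_const_bound[where B = C] AE_I2 C) (auto simp: space_pair_measure)
  have "norm (LINT y|N. f (x, y)) <= (LINT y|N. norm (f (x, y)))" by (rule integral_norm_bound)
  also have "... <= C"
   using x by (intro integral_le_const integrable_norm i AE_I2 C) (auto simp: space_pair_measure)
  finally show "norm (LINT y|N. f (x, y)) <= C" .
 qed measurable
qed

lemmas bdm_intros =
 bdm_const bdm_add bdm_mult bdm_diff bdm_uminus
 bdm_sum bdm_prod bdm_power

text \<open>One infinite product carries the graphs of all sizes. The index type stays free: pairs
  of naturals for the random graph, naturals for the vertices of a pattern, a sum type for the
  vertices of an edge join.\<close>

definition cube :: "('i => real) measure" where
 "cube = (\<Pi>\<^sub>M i\<in>UNIV. unit_unif)"

lemma prob_space_cube: "prob_space cube"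
 unfolding cube_def by (rule prob_space_PiM) (rule prob_space_unit_unif)

lemma finite_measure_cube: "finite_measure cube"
 by (rule prob_space.finite_measure) (rule prob_space_cube)

lemma finite_measure_unit_unif: "finite_measure unit_unif"
 by (rule prob_space.finite_measure) (rule prob_space_unit_unif)

lemma space_cube: "space cube = {w. ALL i. w i : {0..1}}"
 by (auto simp: cube_def space_PiM PiE_iff)

lemma measurable_cube_component [measurable]: "(%w. w i) : cube \<rightarrow>\<^sub>M unit_unif"
 unfolding cube_def by measurable

lemma measurable_cubeI:
 assumes "!!i. (%x. f x i) : M \<rightarrow>\<^sub>M unit_unif"
 shows "f : M \<rightarrow>\<^sub>M cube"
 unfolding cube_def
proof (rule measurable_PiM_single')
 show "f : space M \<rightarrow> UNIV \<rightarrow>\<^sub>E space unit_unif"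
  using measurable_space[OF assms] by (auto simp: PiE_iff)
qed (use assms in auto)

lemma measurable_unit_unif_borel [measurable]: "(%x. x) : borm unit_unif"
 by (auto simp: unit_unif_def intro: measurable_restrict_space1)

lemma distr_cube_PiM:
 fixes \<rho> :: "'j => 'i"
 assumes "inj_on \<rho> I"
 shows "distr cube (\<Pi>\<^sub>M i\<in>I. unit_unif) (%w. \<lambda>i\<in>I. w (\<rho> i)) = (\<Pi>\<^sub>M i\<in>I. unit_unif)"
 unfolding cube_def
 by (rule distr_PiM_reindex[of UNIV "%_. unit_unif"]) (use assms prob_space_unit_unif in auto)

text \<open>Moves the finite product integrals in the definitions of the densities onto the cube,
  along any injective labelling of the vertices by coordinates, where resampling arguments are
  available.\<close>

lemma integral_PiM_cube:
 fixes f :: "('j => real) => 'b::{banach, second_countable_topology}" and \<rho> :: "'j => 'i"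
 assumes "inj_on \<rho> I" "f : borm (\<Pi>\<^sub>M i\<in>I. unit_unif)"
 shows "(LINT z|(\<Pi>\<^sub>M i\<in>I. unit_unif). f z) = (LINT w|cube. f (\<lambda>i\<in>I. w (\<rho> i)))"
proof -
 have "(%w. \<lambda>i\<in>I. w (\<rho> i)) : cube \<rightarrow>\<^sub>M (\<Pi>\<^sub>M i\<in>I. unit_unif)"
  by (rule measurable_restrict) measurable
 from integral_distr[OF this assms(2)] show ?thesis
  by (simp add: distr_cube_PiM[OF assms(1)])
qed

lemma distr_cube_component: "distr cube unit_unif (%w. w i) = unit_unif"
 unfolding cube_def by (rule distr_PiM_component) (auto intro: prob_space_unit_unif)

lemma emeasure_cube_box:
 assumes "finite J" "!!j. j : J ==> A j : sets unit_unif"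
 shows "emeasure cube {w\<in>space cube. ALL j:J. w j : A j} = (\<Prod>j\<in>J. emeasure unit_unif (A j))"
proof -
 interpret product_prob_space "%_. unit_unif" UNIV
  by (intro product_prob_spaceI prob_space_unit_unif)
 show ?thesis unfolding cube_def using assms by (intro emeasure_PiM_Collect) auto
qed

lemma distr_cube_pair:
 assumes "i ~= j"
 shows "distr cube unit_square (%w. (w i, w j)) = unit_unif \<Otimes>\<^sub>M unit_unif"
proof (rule pair_measure_eqI[symmetric])
 show "sigma_finite_measure unit_unif"
  using prob_space_unit_unif by (simp add: prob_space_imp_sigma_finite)
 then show "sigma_finite_measure unit_unif" .
 fix A B assume AB [measurable]: "A : sets unit_unif" "B : sets unit_unif"
 have "emeasure (distr cube unit_square (%w. (w i, w j))) (A \<times> B) =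
   emeasure cube {w\<in>space cube. ALL k:{i, j}. w k : (if k = i then A else B)}"
  using assms by (subst emeasure_distr) (auto intro!: arg_cong[where f = "emeasure cube"])
 also have "... = emeasure unit_unif A * emeasure unit_unif B"
  by (subst emeasure_cube_box) (use assms in auto)
 finally show "emeasure unit_unif A * emeasure unit_unif B =
  emeasure (distr cube unit_square (%w. (w i, w j))) (A \<times> B)" by simp
qed simp

lemma integral_cube_component:
 fixes f :: "real => 'b::{banach, second_countable_topology}"
 assumes "f : borm unit_unif"
 shows "(LINT w|cube. f (w i)) = (LINT x|unit_unif. f x)"
 using integral_distr[OF measurable_cube_component assms, of i] by (simp add: distr_cube_component)

lemma integral_cube_pair:
 fixes f :: "real \<times> real => 'b::{banach, second_countable_topology}"
 assumes "i ~= j" "f : borm unit_square"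
 shows "(LINT w|cube. f (w i, w j)) = (LINT p|unit_square. f p)"
proof -
 have "(%w. (w i, w j)) : cube \<rightarrow>\<^sub>M unit_unif \<Otimes>\<^sub>M unit_unif" by measurable
 from integral_distr[OF this assms(2)] show ?thesis by (simp add: distr_cube_pair[OF assms(1)])
qed

lemma AE_cube_component: "AE x in unit_unif. P x ==> AE w in cube. P (w i)"
 unfolding cube_def by (rule AE_PiM_component) (auto intro: prob_space_unit_unif)

section \<open>Gluing independent samples and averaging out coordinates\<close>

lemma measurable_override_on [measurable]:
 "(%(w, w'). override_on w' w A) : cube \<Otimes>\<^sub>M cube \<rightarrow>\<^sub>M cube"
proof (rule measurable_cubeI)
 show "(%x. (case x of (w, w') => override_on w' w A) i) : cube \<Otimes>\<^sub>M cube \<rightarrow>\<^sub>M unit_unif" for i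
  by (cases "i : A") (simp_all add: override_on_def split_beta')
qed

lemma override_on_cube:
 "w : space cube ==> w' : space cube ==> override_on w' w A : space cube"
 by (auto simp: space_cube override_on_def)

lemma measurable_override_on2:
 assumes "w : space cube"
 shows "(%w'. override_on w' w A) : cube \<rightarrow>\<^sub>M cube"
 using measurable_compose[OF measurable_Pair1'[OF assms] measurable_override_on] by simp

text \<open>Coordinates in \<open>A\<close> from one sample and the others from an independent
  sample again form a sample: a box constraint splits into one on \<open>J Int A\<close> for the
  first and one on \<open>J - A\<close> for the second, and both measures are products over these
  indices. This plays the role of Fubini for every splitting of the index set.\<close>

lemma distr_cube_override_on:
 "distr (cube \<Otimes>\<^sub>M cube) cube (%(w, w'). override_on w' w A) = (cube :: ('i => real) measure)"
 (is "?D = _")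
proof -
 interpret product_prob_space "%_. unit_unif" "UNIV :: 'i set"
  by (intro product_prob_spaceI prob_space_unit_unif)
 interpret C: prob_space "cube :: ('i => real) measure" by (rule prob_space_cube)
 have "?D = PiM UNIV (%_. unit_unif)"
 proof (rule PiM_eq)
  show "sets ?D = sets (Pi\<^sub>M UNIV (%_. unit_unif))" by (simp add: cube_def)
  fix J :: "'i set" and F :: "'i => real set"
  assume J: "finite J" and F: "!!j. j : J ==> F j : sets unit_unif"
  have box: "{w\<in>space cube. ALL j:K. w j : F j} : sets cube" if "finite K" "K <= J" for K
  proof -
   have "{w\<in>space cube. ALL j:K. w j : F j} = space cube Int (\<Inter>j\<in>K. (%w. w j) -` F j Int space cube)"
    by auto
   also have "... : sets cube"
   proof (cases "K = {}")
    case False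
    with that F show ?thesis
     by (intro sets.Int sets.finite_INT measurable_sets[OF measurable_cube_component]) auto
   qed simp
   finally show ?thesis .
  qed
  have e: "prod_emb UNIV (%_. unit_unif) J (\<Pi>\<^sub>E j\<in>J. F j) = {w\<in>space cube. ALL j:J. w j : F j}"
   using F sets.sets_into_space by (auto simp: prod_emb_def cube_def space_PiM PiE_iff)
  have m: "(%(w, w'). override_on w' w A) : cube \<Otimes>\<^sub>M cube \<rightarrow>\<^sub>M cube" by (rule measurable_override_on)
  have "(%(w, w'). override_on w' w A) -` {w\<in>space cube. ALL j:J. w j : F j} Int space (cube \<Otimes>\<^sub>M cube) =
    {w\<in>space cube. ALL j:J Int A. w j : F j} \<times> {w\<in>space cube. ALL j:J - A. w j : F j}"
   (is "?L = ?R")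
  proof (intro set_eqI)
   fix p :: "('i => real) \<times> ('i => real)"
   obtain w w' where p: "p = (w, w')" by (cases p)
   have "(ALL j:J. override_on w' w A j : F j) \<longleftrightarrow> (ALL j:J Int A. w j : F j) & (ALL j:J - A. w' j : F j)"
    unfolding override_on_def by (metis DiffE DiffI IntE IntI)
   then show "p : ?L \<longleftrightarrow> p : ?R"
    using override_on_cube[of w w' A] by (simp add: p space_pair_measure) blast
  qed
  then have "emeasure ?D {w\<in>space cube. ALL j:J. w j : F j} =
    emeasure (cube \<Otimes>\<^sub>M cube) ({w\<in>space cube. ALL j:J Int A. w j : F j} \<times> {w\<in>space cube. ALL j:J - A. w j : F j})"
   by (simp only: emeasure_distr[OF m box[OF J subset_refl]])
  also have "... = emeasure cube {w\<in>space cube. ALL j:J Int A. w j : F j} *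
    emeasure cube {w\<in>space cube. ALL j:J - A. w j : F j}"
   by (intro C.emeasure_pair_measure_Times box) (use J in auto)
  also have "emeasure cube {w\<in>space cube. ALL j:J Int A. w j : F j} = (\<Prod>j\<in>J Int A. emeasure unit_unif (F j))"
   by (rule emeasure_cube_box) (use J F in auto)
  also have "emeasure cube {w\<in>space cube. ALL j:J - A. w j : F j} = (\<Prod>j\<in>J - A. emeasure unit_unif (F j))"
   by (rule emeasure_cube_box) (use J F in auto)
  also have "(\<Prod>j\<in>J Int A. emeasure unit_unif (F j)) * (\<Prod>j\<in>J - A. emeasure unit_unif (F j)) =
    (\<Prod>j\<in>J. emeasure unit_unif (F j))"
   using J by (subst prod.union_disjoint[symmetric]) (auto intro: prod.cong)
  finally show "emeasure ?D (prod_emb UNIV (%_. unit_unif) J (\<Pi>\<^sub>E j\<in>J. F j)) =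
   (\<Prod>j\<in>J. emeasure unit_unif (F j))" by (simp add: e)
 qed
 then show ?thesis by (simp add: cube_def)
qed

text \<open>An everywhere defined version of the conditional expectation given the coordinates in
  \<open>A\<close>: these are kept and all others are resampled. The tower property and the pull-out
  rule then hold at every point of the cube instead of almost everywhere.\<close>

definition cond_mean ::
 "'i set => (('i => real) => 'b::{banach, second_countable_topology}) => ('i => real) => 'b" where
 "cond_mean A f w = (LINT w'|cube. f (override_on w' w A))"

text \<open>The pointwise counterpart of measurability with respect to the coordinates in
  \<open>A\<close>, matching the pointwise conditional mean.\<close>

definition depends_on :: "'i set => (('i => real) => 'b) => bool" where
 "depends_on A f \<longleftrightarrow>
   (ALL w:space cube. ALL w':space cube. (ALL i:A. w i = w' i) --> f w = f w')"

lemma depends_onD: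
 "depends_on A f ==> w : space cube ==> w' : space cube ==> (!!i. i : A ==> w i = w' i) ==> f w = f w'"
 unfolding depends_on_def by blast

lemma depends_on_mono: "depends_on A f ==> A <= B ==> depends_on B f"
 unfolding depends_on_def by (meson subsetD)

lemma depends_on_cond_mean: "depends_on A (cond_mean A f)"
 unfolding depends_on_def cond_mean_def
proof (intro ballI impI lint_cong refl arg_cong[where f = f])
 fix w w' x :: "'a => real"
 assume "ALL i:A. w i = w' i"
 then show "override_on x w A = override_on x w' A" by (auto simp: override_on_def fun_eq_iff)
qed

lemma bdm_override_on:
 "bdm cube f ==> bdm (cube \<Otimes>\<^sub>M cube) (%(w, w'). f (override_on w' w A))"
 using bdm_compose[OF _ measurable_override_on] by (simp add: split_beta')

lemma bdm_override_on2:
 "bdm cube f ==> w : space cube ==> bdm cube (%w'. f (override_on w' w A))"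
 by (rule bdm_compose[OF _ measurable_override_on2])

lemma integrable_cube: "bdm cube f ==> integrable cube f"
 for f :: "_ => 'b::{banach, second_countable_topology}"
 by (rule bdm_integrable[OF finite_measure_cube])

lemma bdm_cond_mean: "bdm cube f ==> bdm cube (cond_mean A f)"
 using bdm_integral[OF prob_space_cube bdm_override_on]
 by (simp add: cond_mean_def[abs_def])

lemma integral_override_on:
 fixes f :: "('i => real) => 'b::{banach, second_countable_topology}"
 assumes f: "bdm cube f"
 shows "(LINT w|cube. LINT w'|cube. f (override_on w' w A)) = (LINT w|cube. f w)"
proof -
 interpret C: prob_space "cube :: ('i => real) measure" by (rule prob_space_cube)
 interpret P: pair_prob_space "cube :: ('i => real) measure" "cube :: ('i => real) measure" ..
 have "(LINT w|cube. f w) = (LINT p|(cube \<Otimes>\<^sub>M cube). f (case p of (w, w') => override_on w' w A))"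
  using f by (subst distr_cube_override_on[symmetric, of A], subst integral_distr)
   (auto intro: bdm_measurable)
 also have "... = (LINT p|(cube \<Otimes>\<^sub>M cube). case_prod (%w w'. f (override_on w' w A)) p)"
  by (simp add: split_beta')
 also have "... = (LINT w|cube. LINT w'|cube. f (override_on w' w A))"
  by (subst P.integral_fst'[symmetric])
   (auto intro!: bdm_integrable P.finite_measure bdm_override_on f)
 finally show ?thesis by simp
qed

lemma integral_cond_mean:
 "bdm cube f ==> (LINT w|cube. cond_mean A f w) = (LINT w|cube. f w)"
 by (simp add: cond_mean_def integral_override_on)

text \<open>Under successive resampling a coordinate keeps its value only if both steps keep it. For
  independent coordinates the projections therefore commute and compose by intersection, which is
  what makes a Hoeffding decomposition work.\<close>

lemma cond_mean_cond_mean: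
 assumes f: "bdm cube f" and w: "w : space cube"
 shows "cond_mean A (cond_mean B f) w = cond_mean (A Int B) f w"
proof -
 have "cond_mean A (cond_mean B f) w =
   (LINT w'|cube. LINT w''|cube. f (override_on (override_on w'' w' B) w (A Int B)))"
  unfolding cond_mean_def
  by (intro lint_cong refl arg_cong[where f = f]) (auto simp: override_on_def)
 also have "... = cond_mean (A Int B) f w"
  using integral_override_on[OF bdm_override_on2[OF f w, of "A Int B"]]
  by (simp add: cond_mean_def)
 finally show ?thesis .
qed

lemma cond_mean_mult:
 fixes f g :: "('i => real) => 'b::{banach, second_countable_topology, real_normed_field}"
 assumes g: "depends_on A g" and w: "w : space cube"
 shows "cond_mean A (%w. f w * g w) w = cond_mean A f w * g w"
proof -
 have "cond_mean A (%w. f w * g w) w = (LINT w'|cube. f (override_on w' w A) * g w)"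
  unfolding cond_mean_def
 proof (intro lint_cong refl arg_cong2[where f = times])
  fix w' :: "'i => real" assume "w' : space cube"
  then show "g (override_on w' w A) = g w"
   by (intro depends_onD[OF g] override_on_cube w) auto
 qed
 then show ?thesis by (simp add: cond_mean_def)
qed

lemma cond_mean_depends:
 assumes "depends_on A f" "w : space cube"
 shows "cond_mean A f w = f w"
proof -
 interpret C: prob_space "cube :: ('a => real) measure" by (rule prob_space_cube)
 have "cond_mean A f w = (LINT w'|(cube :: ('a => real) measure). f w)"
  unfolding cond_mean_def
  by (intro lint_cong refl depends_onD[OF assms(1)] override_on_cube assms) auto
 then show ?thesis by (simp add: C.prob_space)
qed

lemma cond_mean_cong:
 assumes "!!w. w : space cube ==> f w = g w" "w : space cube"
 shows "cond_mean A f w = cond_mean A g w"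
 unfolding cond_mean_def by (intro lint_cong refl assms override_on_cube)

lemma cond_mean_depends_Int:
 assumes "bdm cube f" "depends_on B f" "w : space cube"
 shows "cond_mean A f w = cond_mean (A Int B) f w"
proof -
 have "cond_mean A f w = cond_mean A (cond_mean B f) w"
  by (rule cond_mean_cong) (use cond_mean_depends[OF assms(2)] assms(3) in auto)
 also have "... = cond_mean (A Int B) f w" by (rule cond_mean_cond_mean) fact+
 finally show ?thesis .
qed

lemma cond_mean_disjoint:
 assumes "depends_on B f" "A Int B = {}" "w : space cube"
 shows "cond_mean A f w = (LINT w|cube. f w)"
 unfolding cond_mean_def
 by (intro lint_cong refl depends_onD[OF assms(1)] override_on_cube assms)
  (use assms(2) in \<open>auto simp: override_on_def\<close>)

lemma cond_mean_empty: "cond_mean {} f w = (LINT w|cube. f w)"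
 by (simp add: cond_mean_def)

lemma cond_mean_add:
 "bdm cube f ==> bdm cube g ==> w : space cube ==>
  cond_mean A (%w. f w + g w) w = cond_mean A f w + cond_mean A g w"
 unfolding cond_mean_def
 by (intro lint_add integrable_cube bdm_override_on2)

lemma cond_mean_diff:
 "bdm cube f ==> bdm cube g ==> w : space cube ==>
  cond_mean A (%w. f w - g w) w = cond_mean A f w - cond_mean A g w"
 unfolding cond_mean_def
 by (intro lint_diff integrable_cube bdm_override_on2)

lemma cond_mean_sum:
 "(!!i. i : I ==> bdm cube (f i)) ==> w : space cube ==>
  cond_mean A (%w. SUM i:I. f i w) w = (SUM i:I. cond_mean A (f i) w)"
 unfolding cond_mean_def
 by (intro lint_sum integrable_cube bdm_override_on2)

lemma cond_mean_cmult:
 fixes f :: "('i => real) => 'b::{banach, second_countable_topology, real_normed_field}"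
 shows "cond_mean A (%w. c * f w) w = c * cond_mean A f w"
 by (simp add: cond_mean_def)

text \<open>Self-adjointness of the projection: against a function of the coordinates in
  \<open>A\<close> only the projection of \<open>f\<close> counts. Through this identity degeneracy
  kills covariances and the edge coordinates are averaged out.\<close>

lemma integral_mult_cond_mean:
 fixes f g :: "('i => real) => 'b::{banach, second_countable_topology, real_normed_field}"
 assumes "bdm cube f" "bdm cube g" "depends_on A g"
 shows "(LINT w|cube. f w * g w) = (LINT w|cube. cond_mean A f w * g w)"
 by (subst integral_cond_mean[symmetric, of _ A])
  (auto intro!: bdm_mult assms lint_cong cond_mean_mult)

lemma integral_mult_depends_on:
 fixes f g :: "('i => real) => 'b::{banach, second_countable_topology, real_normed_field}"
 assumes "bdm cube f" "bdm cube g" "depends_on A f" "depends_on B g" "A Int B = {}"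
 shows "(LINT w|cube. f w * g w) = (LINT w|cube. f w) * (LINT w|cube. g w)"
proof -
 have "(LINT w|cube. f w * g w) = (LINT w|cube. (LINT w|cube. f w) * g w)"
  unfolding integral_mult_cond_mean[OF assms(1,2,4)]
  by (intro lint_cong refl arg_cong2[where f = times] cond_mean_disjoint[OF assms(3)])
   (use assms(5) in auto)
 then show ?thesis by simp
qed

lemma depends_on_prod:
 assumes "!!e. e : E ==> depends_on A (f e)"
 shows "depends_on A (%w. \<Prod>e\<in>E. f e w)"
 unfolding depends_on_def
proof (intro ballI impI prod.cong refl)
 fix w w' e assume "w : space cube" "w' : space cube" "ALL i:A. w i = w' i" "e : E"
 then show "f e w = f e w'" using assms[of e] unfolding depends_on_def by blast
qed

text \<open>Independence of functions that read disjoint sets of coordinates, in the multiplicative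
  form in which characteristic functions of sums need it.\<close>

lemma integral_prod_depends_on:
 fixes f :: "'e => ('i => real) => 'b::{banach, second_countable_topology, real_normed_field}"
 assumes "finite E" "!!e. e : E ==> bdm cube (f e)" "!!e. e : E ==> depends_on (A e) (f e)"
  "disjoint_family_on A E"
 shows "(LINT w|cube. (\<Prod>e\<in>E. f e w)) = (\<Prod>e\<in>E. LINT w|cube. f e w)"
 using assms
proof (induction E)
 case empty
 interpret C: prob_space "cube :: ('i => real) measure" by (rule prob_space_cube)
 show ?case by (simp add: C.prob_space)
next
 case (insert e E)
 have "A e Int (\<Union>e\<in>E. A e) = {}"
  using insert.prems(3) insert.hyps by (auto simp: disjoint_family_on_def)
 moreover have "depends_on (\<Union>e\<in>E. A e) (%w. \<Prod>e\<in>E. f e w)"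
  by (rule depends_on_prod, rule depends_on_mono, rule insert.prems(2)) auto
 ultimately have "(LINT w|cube. f e w * (\<Prod>e\<in>E. f e w)) = (LINT w|cube. f e w) * (LINT w|cube. (\<Prod>e\<in>E. f e w))"
  using insert.prems by (intro integral_mult_depends_on[where A = "A e" and B = "\<Union>e\<in>E. A e"] bdm_prod)
   auto
 with insert show ?case by (simp add: disjoint_family_on_def)
qed

section \<open>Convergence in distribution from characteristic functions\<close>

inductive trig_poly :: "'i set => (('i => real) => complex) => bool" for I where
 trig_poly_exp: "trig_poly I (%x. c * iexp (SUM i:I. \<theta> i * x i))"
| trig_poly_add: "trig_poly I f ==> trig_poly I g ==> trig_poly I (%x. f x + g x)"

lemma trig_poly_mult:
 assumes "trig_poly I f" "trig_poly I g"
 shows "trig_poly I (%x. f x * g x)"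
 using assms
proof (induction arbitrary: g)
 case (trig_poly_exp c \<theta>)
 from trig_poly_exp show ?case
 proof (induction g)
  case (trig_poly_exp d \<theta>')
  have "(%x. c * iexp (SUM i:I. \<theta> i * x i) * (d * iexp (SUM i:I. \<theta>' i * x i))) =
    (%x. (c * d) * iexp (SUM i:I. (\<theta> i + \<theta>' i) * x i))"
   by (simp add: fun_eq_iff sum.distrib distrib_right distrib_left exp_add mult_ac)
  then show ?case using trig_poly.trig_poly_exp[of I "c * d" "%i. \<theta> i + \<theta>' i"] by (simp only:)
 next
  case (trig_poly_add f g)
  then show ?case unfolding distrib_left by (intro trig_poly.trig_poly_add)
 qed
next
 case (trig_poly_add f1 f2)
 then show ?case unfolding distrib_right by (intro trig_poly.trig_poly_add)
qed

text \<open>The algebra for Stone-Weierstrass. It is generated by sines of single coordinates, so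
  its members are combinations of exponentials, hence accessible to characteristic functions, and
  they see a coordinate only through its sine, which allows global bounds.\<close>

inductive sin_poly :: "real => 'i set => (('i => real) => real) => bool" for \<alpha> I where
 sin_poly_const: "sin_poly \<alpha> I (%_. c)"
| sin_poly_sin: "i : I ==> sin_poly \<alpha> I (%x. sin (\<alpha> * x i))"
| sin_poly_add: "sin_poly \<alpha> I f ==> sin_poly \<alpha> I g ==> sin_poly \<alpha> I (%x. f x + g x)"
| sin_poly_mult: "sin_poly \<alpha> I f ==> sin_poly \<alpha> I g ==> sin_poly \<alpha> I (%x. f x * g x)"

lemma trig_poly_sin_poly:
 assumes "sin_poly \<alpha> I f" "finite I"
 shows "trig_poly I (%x. complex_of_real (f x))"
 using assms
proof induction
 case (sin_poly_const c)
 show ?case using trig_poly_exp[of I c "%_. 0"] by simp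
next
 case (sin_poly_sin i)
 have s: "(SUM j:I. (if j = i then b else 0) * x j) = b * x i" for b :: real and x :: "'a => real"
  using sin_poly_sin by (simp add: if_distrib[of "%a. a * _"] cong: if_cong)
 have "complex_of_real (sin (\<alpha> * x i)) =
   (1 / (2 * \<i>)) * iexp (SUM j:I. (if j = i then \<alpha> else 0) * x j) +
   (- 1 / (2 * \<i>)) * iexp (SUM j:I. (if j = i then - \<alpha> else 0) * x j)" for x
  unfolding s by (simp add: sin_of_real[symmetric] sin_exp_eq field_simps)
 then show ?case by (simp only: trig_poly_add trig_poly_exp)
next
 case (sin_poly_add f g)
 then show ?case unfolding of_real_add by (intro trig_poly_add)
next
 case (sin_poly_mult f g)
 then show ?case unfolding of_real_mult by (intro trig_poly_mult)
qed

lemma continuous_on_sin_poly: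
 fixes f :: "('i::countable => real) => real"
 assumes "sin_poly \<alpha> I f"
 shows "continuous_on S f"
 using assms
proof induction
 case (sin_poly_sin i)
 have "continuous_on S (%x. x i :: real)" by (rule continuous_on_subset[OF continuous_on_product_coordinates]) auto
 from continuous_on_sin[OF continuous_on_mult[OF continuous_on_const this]] show ?case .
qed (auto intro: continuous_intros)

lemma sin_poly_cong:
 assumes "sin_poly \<alpha> I f" "!!i. i : I ==> sin (\<alpha> * x i) = sin (\<alpha> * y i)"
 shows "f x = f y"
 using assms by induction auto

lemma continuous_on_restrict_product:
 fixes f :: "('i => real) => real"
 assumes "continuous_map (product_topology (%_. euclideanreal) I) euclideanreal f"
 shows "continuous_on UNIV (%x. f (restrict x I))"
proof -
 have "continuous_map euclidean (product_topology (%_. euclideanreal) I) (%x. restrict x I)"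
  unfolding continuous_map_componentwise
  by (auto simp: continuous_on_product_coordinates)
 from continuous_map_compose[OF this assms] show ?thesis by (simp add: o_def)
qed

text \<open>Stone-Weierstrass controls \<open>g\<close> on the box only, while the tail estimate
  needs a bound everywhere. The frequency \<open>pi / (2 * L)\<close> is chosen such that the sine
  is injective on \<open>{-L..L}\<close>, so that points are separated, and already attains all its
  values there, so that \<open>g\<close> takes no value outside the box that it does not take
  inside.\<close>

lemma sin_poly_approx:
 fixes f :: "('i::countable => real) => real"
 assumes f: "continuous_map (product_topology (%_. euclideanreal) I) euclideanreal f"
  and C: "!!x. x : (\<Pi>\<^sub>E i\<in>I. UNIV) ==> \<bar>f x\<bar> <= C" and L: "0 < L" and e: "0 < e"
 obtains g where "sin_poly (pi / (2 * L)) I g"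
  "!!x. x : (\<Pi>\<^sub>E i\<in>I. UNIV) ==> (!!i. i : I ==> \<bar>x i\<bar> <= L) ==> \<bar>f x - g x\<bar> <= e"
  "!!x. \<bar>g x\<bar> <= C + e"
proof -
 let ?\<alpha> = "pi / (2 * L)"
 \<comment> \<open>Off \<open>I\<close> the coordinates are pinned to the default value of
   extensional functions; this makes the box a compact subset of the full function space, where the
   approximation theorem applies.\<close>
 define S where "S = (\<Pi>\<^sub>E i\<in>UNIV. if i : I then {-L..L} else {undefined :: real})"
 have S: "x : S \<longleftrightarrow> x : (\<Pi>\<^sub>E i\<in>I. UNIV) & (ALL i:I. \<bar>x i\<bar> <= L)" for x
  by (auto simp: S_def PiE_iff extensional_def abs_le_iff split: if_splits)
 have inj: "a = b" if "\<bar>a\<bar> <= L" "\<bar>b\<bar> <= L" "sin (?\<alpha> * a) = sin (?\<alpha> * b)" for a b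
 proof -
  have "-(pi/2) <= ?\<alpha> * c & ?\<alpha> * c <= pi/2" if "\<bar>c\<bar> <= L" for c
  proof -
   have "\<bar>?\<alpha> * c\<bar> <= ?\<alpha> * L" using that L unfolding abs_mult by (intro mult_mono) auto
   also have "... = pi / 2" using L by simp
   finally have "\<bar>?\<alpha> * c\<bar> <= pi / 2" .
   then show ?thesis unfolding abs_le_iff by linarith
  qed
  then have "?\<alpha> * a = ?\<alpha> * b" using that sin_inj_pi[of "?\<alpha> * a" "?\<alpha> * b"] by auto
  then show ?thesis using L by simp
 qed
 interpret function_ring_on "{g. sin_poly ?\<alpha> I g}" S
 proof
  have "compactin (product_topology (%_. euclidean) UNIV) S"
   unfolding S_def compactin_PiE by auto
  then show "compact S" by (simp add: euclidean_product_topology)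
  fix x y assume xy: "x : S" "y : S" "x ~= y"
  then obtain i where "x i ~= y i" by auto
  moreover have i: "i : I"
  proof (rule ccontr)
   assume "i ~: I"
   then have "x i = undefined" "y i = undefined" using xy by (auto simp: S PiE_iff extensional_def)
   with \<open>x i ~= y i\<close> show False by simp
  qed
  ultimately have "sin (?\<alpha> * x i) ~= sin (?\<alpha> * y i)"
   using inj[of "x i" "y i"] xy by (auto simp: S)
  then show "EX f:{g. sin_poly ?\<alpha> I g}. f x ~= f y"
   unfolding Bex_def mem_Collect_eq
   by (intro exI[where x = "%x. sin (?\<alpha> * x i)"] conjI sin_poly_sin i)
 qed (simp_all only: mem_Collect_eq, erule continuous_on_sin_poly, erule (1) sin_poly_add,
   erule (1) sin_poly_mult, rule sin_poly_const)
 obtain g where g: "sin_poly ?\<alpha> I g" "!!x. x : S ==> \<bar>f (restrict x I) - g x\<bar> < e"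
  using Stone_Weierstrass_basic[of "%x. f (restrict x I)" e]
   continuous_on_subset[OF continuous_on_restrict_product[OF f]] e by auto
 have gS: "\<bar>f x - g x\<bar> <= e" if "x : S" for x
 proof -
  have "restrict x I = x" using that by (auto simp: S PiE_restrict)
  then show ?thesis using g(2)[OF that] by simp
 qed
 have bound: "\<bar>g x\<bar> <= C + e" for x
 proof -
  \<comment> \<open>folding the line onto the interval leaves the sines unchanged\<close>
  define y where "y = (\<lambda>i\<in>I. arcsin (sin (?\<alpha> * x i)) / ?\<alpha>)"
  have "y : S"
  proof -
   have "\<bar>arcsin s / ?\<alpha>\<bar> <= L" if "s : {-1..1}" for s
   proof -
    have "\<bar>arcsin s\<bar> <= pi / 2" using arcsin_bounded[of s] that unfolding abs_le_iff by auto
    then show ?thesis using L by (simp add: field_simps abs_mult)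
   qed
   then show ?thesis by (auto simp: S y_def)
  qed
  moreover have "g x = g y"
   using L by (intro sin_poly_cong[OF g(1)]) (auto simp: y_def)
  ultimately show ?thesis
   using gS[of y] C[of y] by (simp add: S)
 qed
 show ?thesis
  by (rule that[OF g(1) gS bound]) (auto simp: S)
qed

text \<open>The Borel sets of a function space over a countable index type are those of the product
  over all indices. A vector over \<open>I\<close> is constantly \<open>undefined\<close> elsewhere,
  so it is measurable into this larger product as well.\<close>

lemma measurable_extend_PiM:
 assumes "X : M \<rightarrow>\<^sub>M (\<Pi>\<^sub>M i\<in>I. borel)"
 shows "X : M \<rightarrow>\<^sub>M (\<Pi>\<^sub>M i\<in>(UNIV::'i::countable set). (borel :: real measure))"
proof (rule measurable_PiM_single')
 fix i :: 'i
 show "(%x. X x i) : borm M"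
 proof (cases "i : I")
  case True
  then show ?thesis using measurable_compose[OF assms measurable_component_singleton] by simp
 next
  case False
  then have "X x i = undefined" if "x : space M" for x
   using measurable_space[OF assms that] by (auto simp: space_PiM PiE_iff extensional_def)
  then show ?thesis by (simp cong: measurable_cong)
 qed
qed auto

lemma measurable_continuous_map_PiM:
 fixes f :: "('i::countable => real) => real"
 assumes f: "continuous_map (product_topology (%_. euclideanreal) I) euclideanreal f"
  and X: "X : M \<rightarrow>\<^sub>M (\<Pi>\<^sub>M i\<in>I. borel)"
 shows "(%ww. f (X ww)) : borm M"
proof -
 have "(%x. f (restrict x I)) : borm borel"
  by (rule borel_measurable_continuous_onI[OF continuous_on_restrict_product[OF f]])
 moreover have "X : borm M"
  using measurable_extend_PiM[OF X] measurable_cong_sets[OF refl sets_PiM_equal_borel] by blast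
 ultimately have "(%ww. f (restrict (X ww) I)) : borm M"
  by (rule measurable_compose[rotated])
 moreover have "restrict (X ww) I = X ww" if "ww : space M" for ww
  using measurable_space[OF X that] by (simp add: space_PiM PiE_restrict)
 ultimately show ?thesis by (simp cong: measurable_cong)
qed

lemma trig_poly_integral_tendsto:
 fixes X :: "nat => 'a => 'i => real" and Y :: "'b => 'i => real"
 assumes h: "trig_poly I h"
  and "!!n. prob_space (M n)" and "prob_space N"
  and X: "!!n i. i : I ==> (%ww. X n ww i) : borm (M n)"
  and Y: "!!i. i : I ==> (%ww. Y ww i) : borm N"
  and char: "!!\<theta>. (%n. CLINT ww|M n. iexp (SUM i:I. \<theta> i * X n ww i)) \<longlonglongrightarrow>
   (CLINT ww|N. iexp (SUM i:I. \<theta> i * Y ww i))"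
 shows "(ALL n. bdm (M n) (%ww. h (X n ww))) & bdm N (%ww. h (Y ww)) &
  (%n. CLINT ww|M n. h (X n ww)) \<longlonglongrightarrow> (CLINT ww|N. h (Y ww))"
 using h
proof induction
 case (trig_poly_exp c \<theta>)
 have "bdm (M n) (%ww. iexp (SUM i:I. \<theta> i * X n ww i))" for n
  by (rule bdm_iexp) (auto intro!: borel_measurable_sum borel_measurable_times X)
 moreover have "bdm N (%ww. iexp (SUM i:I. \<theta> i * Y ww i))"
  by (rule bdm_iexp) (auto intro!: borel_measurable_sum borel_measurable_times Y)
 ultimately show ?case
  using char[of \<theta>]
  by (simp add: bdm_mult tendsto_mult_left)
next
 case (trig_poly_add f g)
 have fm: "finite_measure (M n)" "finite_measure N" for n
  using assms(2,3) by (auto intro: prob_space.finite_measure)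
 have "(CLINT ww|M n. f (X n ww) + g (X n ww)) = (CLINT ww|M n. f (X n ww)) + (CLINT ww|M n. g (X n ww))" for n
  using trig_poly_add by (intro lint_add bdm_integrable[OF fm(1)]) auto
 moreover have "(CLINT ww|N. f (Y ww) + g (Y ww)) = (CLINT ww|N. f (Y ww)) + (CLINT ww|N. g (Y ww))"
  using trig_poly_add by (intro lint_add bdm_integrable[OF fm(2)]) auto
 ultimately show ?case using trig_poly_add by (auto intro!: bdm_add tendsto_add)
qed

lemma bdm_of_real:
 fixes f :: "'a => real"
 assumes "bdm M (%x. complex_of_real (f x))"
 shows "bdm M f"
proof -
 have "(%x. Re (complex_of_real (f x))) : borm M"
  by (rule measurable_compose[OF bdm_measurable[OF assms] borel_measurable_Re])
 then show ?thesis using assms by (simp add: bdm_def)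
qed

section \<open>Truncation to a box and tightness\<close>

lemma integral_diff_box_le:
 fixes X :: "'a => 'i => real"
 assumes "prob_space M" and I: "finite I"
  and X: "!!i. i : I ==> (%ww. X ww i) : borm M"
  and f: "bdm M f" and g: "bdm M g" and pos: "0 <= e" "0 <= D"
  and close: "!!ww. ww : space M ==> (!!i. i : I ==> \<bar>X ww i\<bar> <= L) ==> \<bar>f ww - g ww\<bar> <= e"
  and far: "!!ww. ww : space M ==> \<bar>f ww - g ww\<bar> <= D"
 shows "\<bar>(LINT ww|M. f ww) - (LINT ww|M. g ww)\<bar> <= e + D * (SUM i:I. measure M {ww\<in>space M. L < \<bar>X ww i\<bar>})"
proof -
 interpret prob_space M by fact
 let ?A = "%i. {ww\<in>space M. L < \<bar>X ww i\<bar>}"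
 have A: "?A i : sets M" if "i : I" for i using X[OF that] by measurable
 note int = bdm_integrable[OF finite_measure_axioms]
 have "\<bar>(LINT ww|M. f ww) - (LINT ww|M. g ww)\<bar> = \<bar>\<integral>ww. f ww - g ww \<partial>M\<bar>"
  using int[OF f] int[OF g] by simp
 also have "... <= (LINT ww|M. \<bar>f ww - g ww\<bar>)" by (rule integral_abs_bound)
 also have "... <= (LINT ww|M. e + D * (SUM i:I. indicator (?A i) ww))"
 proof (rule integral_mono)
  show "integrable M (%ww. \<bar>f ww - g ww\<bar>)"
   using int[OF bdm_diff[OF f g]] by auto
  show "integrable M (%ww. e + D * (SUM i:I. indicator (?A i) ww))"
   using A by (intro lintb_add integrable_mult_right lintb_sum)
    (auto simp: integrable_indicator_iff less_top[symmetric])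
  fix ww assume w: "ww : space M"
  show "\<bar>f ww - g ww\<bar> <= e + D * (SUM i:I. indicator (?A i) ww)"
  proof (cases "ALL i:I. \<bar>X ww i\<bar> <= L")
   case True
   then have "\<bar>f ww - g ww\<bar> <= e" using close[OF w] by auto
   moreover have "0 <= D * (SUM i:I. indicator (?A i) ww)" using pos by (intro mult_nonneg_nonneg sum_nonneg) auto
   ultimately show ?thesis by linarith
  next
   case False
   then obtain i where i: "i : I" "ww : ?A i" using w by (auto simp: not_le)
   have "1 <= (SUM i:I. indicator (?A i) ww :: real)"
    using i I member_le_sum[of i I "%i. indicator (?A i) ww :: real"] by auto
   then have "D * 1 <= D * (SUM i:I. indicator (?A i) ww)" using pos by (intro mult_left_mono)
   then show ?thesis using far[OF w] pos by linarith
  qed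
 qed
 also have "... = e + D * (SUM i:I. measure M (?A i))"
  using A by (simp add: lint_add lint_sum
   integrable_indicator_iff less_top[symmetric] prob_space Int_absorb2 sets.sets_into_space)
 finally show ?thesis .
qed

lemma measure_tail_tendsto_0:
 fixes Y :: "'a => real"
 assumes "prob_space M" "Y : borm M"
 shows "(%n. measure M {ww\<in>space M. real n < \<bar>Y ww\<bar>}) \<longlonglongrightarrow> 0"
proof -
 interpret prob_space M by fact
 have [measurable]: "Y : borm M" by fact
 have "(%n. measure M {ww\<in>space M. real n < \<bar>Y ww\<bar>}) \<longlonglongrightarrow>
   measure M (\<Inter>n. {ww\<in>space M. real n < \<bar>Y ww\<bar>})"
  by (rule finite_Lim_measure_decseq) (auto simp: decseq_def)
 also have "(\<Inter>n. {ww\<in>space M. real n < \<bar>Y ww\<bar>}) = {}"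
 proof -
  have False if "ALL n. real n < \<bar>Y ww\<bar>" for ww
   using that real_arch_simple[of "\<bar>Y ww\<bar>"] by (meson not_less)
  then show ?thesis by blast
 qed
 finally show ?thesis by simp
qed

text \<open>A form of Levy's continuity theorem. Second moments give tightness by Markov's
  inequality, so up to small mass everything happens in a box; there a test function is uniformly
  close to a trigonometric polynomial, whose integrals converge by hypothesis.\<close>

theorem converges_in_distribution_char:
 fixes X :: "nat => 'a => 'i::countable => real" and Y :: "'b => 'i => real"
 assumes I: "finite I" and M: "!!n. prob_space (M n)" and N: "prob_space N"
  and X: "!!n. X n : M n \<rightarrow>\<^sub>M (\<Pi>\<^sub>M i\<in>I. borel)" and Y: "Y : N \<rightarrow>\<^sub>M (\<Pi>\<^sub>M i\<in>I. borel)"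
  and char: "!!\<theta>. (%n. CLINT ww|M n. iexp (SUM i:I. \<theta> i * X n ww i)) \<longlonglongrightarrow>
   (CLINT ww|N. iexp (SUM i:I. \<theta> i * Y ww i))"
  and tight: "!!i. i : I ==> EX C. \<forall>\<^sub>F n in sequentially.
   integrable (M n) (%ww. (X n ww i)^2) & (LINT ww|M n. (X n ww i)^2) <= C"
 shows "converges_in_distribution I M X N Y"
 unfolding converges_in_distribution_def
proof (intro conjI allI impI X Y)
 fix f :: "('i => real) => real"
 assume "continuous_map (product_topology (%_. euclideanreal) I) euclideanreal f & bounded (f ` (\<Pi>\<^sub>E i\<in>I. UNIV))"
 then have f: "continuous_map (product_topology (%_. euclideanreal) I) euclideanreal f"
  and "bounded (f ` (\<Pi>\<^sub>E i\<in>I. UNIV))" by auto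
 then obtain C0 where C0: "!!x. x : (\<Pi>\<^sub>E i\<in>I. UNIV) ==> \<bar>f x\<bar> <= C0"
  unfolding bounded_iff by auto
 define C where "C = max C0 0"
 have C: "0 <= C" "!!x. x : (\<Pi>\<^sub>E i\<in>I. UNIV) ==> \<bar>f x\<bar> <= C"
  using C0 by (auto simp: C_def le_max_iff_disj)
 have Xi: "(%ww. X n ww i) : borm (M n)" if "i : I" for n i
  using measurable_compose[OF X measurable_component_singleton[OF that]] .
 have Yi: "(%ww. Y ww i) : borm N" if "i : I" for i
  using measurable_compose[OF Y measurable_component_singleton[OF that]] .
 have XP: "X n ww : (\<Pi>\<^sub>E i\<in>I. UNIV)" if "ww : space (M n)" for n ww
  using measurable_space[OF X that] by (simp add: space_PiM)
 have YP: "Y ww : (\<Pi>\<^sub>E i\<in>I. UNIV)" if "ww : space N" for ww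
  using measurable_space[OF Y that] by (simp add: space_PiM)
 have bX: "bdm (M n) (%ww. f (X n ww))" for n
  by (rule bdmI[OF measurable_continuous_map_PiM[OF f X]]) (use C(2)[OF XP] in auto)
 have bY: "bdm N (%ww. f (Y ww))"
  by (rule bdmI[OF measurable_continuous_map_PiM[OF f Y]]) (use C(2)[OF YP] in auto)
 have "EX K0. ALL i:I. \<forall>\<^sub>F n in sequentially.
   integrable (M n) (%ww. (X n ww i)^2) & (LINT ww|M n. (X n ww i)^2) <= K0 i"
  by (rule bchoice, rule ballI, rule tight)
 then obtain K0 where K0: "ALL i:I. \<forall>\<^sub>F n in sequentially.
   integrable (M n) (%ww. (X n ww i)^2) & (LINT ww|M n. (X n ww i)^2) <= K0 i"
  by (rule exE)
 \<comment> \<open>Mass outside the box of size \<open>L\<close>: the first sum for the limit, the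
   second bounding that of the approximating laws uniformly in large n.\<close>
 define s where "s L = (SUM i:I. measure N {ww\<in>space N. real L < \<bar>Y ww i\<bar>}) + (SUM i:I. K0 i / (real L)^2)" for L
 have "s \<longlonglongrightarrow> (SUM i:I. 0) + (SUM i:I. 0)"
  unfolding s_def
  by (intro tendsto_add tendsto_sum measure_tail_tendsto_0[OF N Yi] tendsto_divide_0[OF tendsto_const])
   (auto intro!: filterlim_at_top_imp_at_infinity filterlim_pow_at_top filterlim_real_sequentially)
 then have s0: "s \<longlonglongrightarrow> 0" by simp
 show "(%n. LINT ww|M n. f (X n ww)) \<longlonglongrightarrow> (LINT ww|N. f (Y ww))"
 proof (rule LIMSEQ_I)
  fix r :: real assume r: "0 < r"
  \<comment> \<open>Since \<open>e <= 1\<close>, the difference of \<open>f\<close> and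
    \<open>g\<close> is at most \<open>2 * C + 1\<close> everywhere. The budget is \<open>e\<close>
    on each side for the approximation, \<open>r / 6\<close> for all tails together and
    \<open>r / 6\<close> for the convergence, which stays below \<open>r\<close>.\<close>
  define e where "e = min 1 (r / 6)"
  have e: "0 < e" "e <= 1" "e <= r / 6" using r by (auto simp: e_def)
  have "\<forall>\<^sub>F L in sequentially. s L < r / (6 * (2 * C + 1))"
   using r C by (intro order_tendstoD(2)[OF s0]) auto
  then have "\<forall>\<^sub>F L in sequentially. s L < r / (6 * (2 * C + 1)) & 0 < L"
   using eventually_gt_at_top[of 0] by eventually_elim auto
  then obtain L where L: "s L < r / (6 * (2 * C + 1))" "0 < L"
   using eventually_sequentially by auto
  obtain g where g: "sin_poly (pi / (2 * real L)) I g"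
   "!!x. x : (\<Pi>\<^sub>E i\<in>I. UNIV) ==> (!!i. i : I ==> \<bar>x i\<bar> <= real L) ==> \<bar>f x - g x\<bar> <= e"
   "!!x. \<bar>g x\<bar> <= C + e"
   using sin_poly_approx[OF f C(2) _ e(1), of "real L"] L(2) by auto
  have tg: "(ALL n. bdm (M n) (%ww. complex_of_real (g (X n ww)))) &
    bdm N (%ww. complex_of_real (g (Y ww))) &
    (%n. CLINT ww|M n. complex_of_real (g (X n ww))) \<longlonglongrightarrow> (CLINT ww|N. complex_of_real (g (Y ww)))"
   by (rule trig_poly_integral_tendsto[OF trig_poly_sin_poly[OF g(1) I] M N Xi Yi char])
  then have gX: "bdm (M n) (%ww. g (X n ww))" and gY: "bdm N (%ww. g (Y ww))" for n
   by (simp_all add: bdm_of_real)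
  have "(%n. complex_of_real (LINT ww|M n. g (X n ww))) \<longlonglongrightarrow> complex_of_real (LINT ww|N. g (Y ww))"
   using tg by simp
  then have "(%n. LINT ww|M n. g (X n ww)) \<longlonglongrightarrow> (LINT ww|N. g (Y ww))"
   by (simp only: tendsto_of_real_iff)
  then have "\<forall>\<^sub>F n in sequentially. \<bar>(LINT ww|M n. g (X n ww)) - (LINT ww|N. g (Y ww))\<bar> < r / 6"
   using r by (auto dest!: tendstoD[of _ _ _ "r / 6"] simp: dist_real_def)
  moreover have "\<forall>\<^sub>F n in sequentially. ALL i:I. integrable (M n) (%ww. (X n ww i)^2) & (LINT ww|M n. (X n ww i)^2) <= K0 i"
   using I K0 by (simp add: eventually_ball_finite)
  ultimately have "\<forall>\<^sub>F n in sequentially. norm ((LINT ww|M n. f (X n ww)) - (LINT ww|N. f (Y ww))) < r"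
  proof eventually_elim
   case (elim n)
   have D: "\<bar>f x - g x\<bar> <= 2 * C + 1" if "x : (\<Pi>\<^sub>E i\<in>I. UNIV)" for x
    using C(2)[OF that] g(3)[of x] e by linarith
   have m: "measure (M n) {ww\<in>space (M n). real L < \<bar>X n ww i\<bar>} <= K0 i / (real L)^2" if i: "i : I" for i
   proof -
    interpret prob_space "M n" by (rule M)
    note [measurable] = Xi[OF i, of n]
    have "measure (M n) {ww\<in>space (M n). real L < \<bar>X n ww i\<bar>} <=
      measure (M n) {ww\<in>space (M n). (real L)^2 <= (X n ww i)^2}"
    proof (rule finite_measure_mono)
     show "{ww\<in>space (M n). real L < \<bar>X n ww i\<bar>} <= {ww\<in>space (M n). (real L)^2 <= (X n ww i)^2}"
     proof -
      have "(real L)^2 <= x^2" if "real L < \<bar>x\<bar>" for x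
       using that abs_le_square_iff[of "real L" x] by simp
      then show ?thesis by blast
     qed
     show "{ww\<in>space (M n). (real L)^2 <= (X n ww i)^2} : sets (M n)" by measurable
    qed
    also have "... <= (LINT ww|M n. (X n ww i)^2) / (real L)^2"
     using elim(2) i L(2) by (intro integral_Markov_inequality_measure[where A = "{}"]) auto
    also have "... <= K0 i / (real L)^2" using elim(2) i by (intro divide_right_mono) auto
    finally show ?thesis .
   qed
   have "\<bar>(LINT ww|M n. f (X n ww)) - (LINT ww|M n. g (X n ww))\<bar> <=
     e + (2 * C + 1) * (SUM i:I. measure (M n) {ww\<in>space (M n). real L < \<bar>X n ww i\<bar>})"
    using C(1) e by (intro integral_diff_box_le M I Xi bX gX g(2) XP D) auto
   also have "... <= e + (2 * C + 1) * (SUM i:I. K0 i / (real L)^2)"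
    using C(1) m by (intro add_left_mono mult_left_mono sum_mono) auto
   finally have 1: "\<bar>(LINT ww|M n. f (X n ww)) - (LINT ww|M n. g (X n ww))\<bar> <=
     e + (2 * C + 1) * (SUM i:I. K0 i / (real L)^2)" .
   have 2: "\<bar>(LINT ww|N. f (Y ww)) - (LINT ww|N. g (Y ww))\<bar> <=
     e + (2 * C + 1) * (SUM i:I. measure N {ww\<in>space N. real L < \<bar>Y ww i\<bar>})"
    using C(1) e by (intro integral_diff_box_le N I Yi bY gY g(2) YP D) auto
   have "(2 * C + 1) * s L < (2 * C + 1) * (r / (6 * (2 * C + 1)))"
    using L(1) C(1) by (intro mult_strict_left_mono) auto
   also have "... = r / 6" using C(1) by (simp add: field_simps)
   finally have "(2 * C + 1) * (SUM i:I. K0 i / (real L)^2) +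
     (2 * C + 1) * (SUM i:I. measure N {ww\<in>space N. real L < \<bar>Y ww i\<bar>}) < r / 6"
    by (simp add: s_def distrib_left)
   with 1 2 elim(1) e r show ?case unfolding real_norm_def by linarith
  qed
  then show "EX no. \<forall>n\<ge>no. norm ((LINT ww|M n. f (X n ww)) - (LINT ww|N. f (Y ww))) < r"
   by (simp add: eventually_sequentially)
 qed
qed

section \<open>Square-integrable functions\<close>

text \<open>The squared norm with values in the extended reals, in the shape in which the Wiener
  integrals are defined. Being squared, it satisfies a triangle inequality with factors 2.\<close>

definition sq_norm :: "'a measure => ('a => real) => ennreal" where
 "sq_norm M f = (\<integral>\<^sup>+x. ennreal ((f x)^2) \<partial>M)"

lemma sq_norm_cong: "(!!x. x : space M ==> f x = g x) ==> sq_norm M f = sq_norm M g"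
 unfolding sq_norm_def by (intro nn_integral_cong) simp

lemma sq_norm_cong_AE: "AE x in M. f x = g x ==> sq_norm M f = sq_norm M g"
 unfolding sq_norm_def by (intro nn_integral_cong_AE) (auto elim: eventually_mono)

lemma sq_norm_cmult: "f : borm M ==> sq_norm M (%x. a * f x) = ennreal (a^2) * sq_norm M f"
 unfolding sq_norm_def by (subst nn_integral_cmult[symmetric]) (auto simp: power_mult_distrib ennreal_mult)

lemma sq_norm_add_le:
 assumes [measurable]: "f : borm M" "g : borm M"
 shows "sq_norm M (%x. f x + g x) <= 2 * sq_norm M f + 2 * sq_norm M g"
proof -
 have "sq_norm M (%x. f x + g x) <= (\<integral>\<^sup>+x. 2 * ennreal ((f x)^2) + 2 * ennreal ((g x)^2) \<partial>M)"
  unfolding sq_norm_def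
 proof (rule nn_integral_mono)
  fix x
  have "(f x + g x)^2 <= 2 * (f x)^2 + 2 * (g x)^2"
   using sum_squares_bound[of "f x" "g x"] by (simp add: power2_sum)
  then have "ennreal ((f x + g x)^2) <= ennreal (2 * (f x)^2 + 2 * (g x)^2)" by (rule ennreal_leI)
  also have "... = 2 * ennreal ((f x)^2) + 2 * ennreal ((g x)^2)"
   by (simp add: ennreal_plus ennreal_mult)
  finally show "ennreal ((f x + g x)^2) <= 2 * ennreal ((f x)^2) + 2 * ennreal ((g x)^2)" .
 qed
 also have "... = 2 * sq_norm M f + 2 * sq_norm M g"
  unfolding sq_norm_def by (subst nn_integral_add) (auto simp: nn_integral_cmult)
 finally show ?thesis .
qed

lemma sq_norm_commute: "sq_norm M (%x. f x - g x) = sq_norm M (%x. g x - f x)"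
 by (simp add: sq_norm_def power2_commute)

lemma sq_norm_triangle:
 assumes "f : borm M" "g : borm M" "h : borm M"
 shows "sq_norm M (%x. f x - h x) <= 2 * sq_norm M (%x. f x - g x) + 2 * sq_norm M (%x. g x - h x)"
 using sq_norm_add_le[of "%x. f x - g x" M "%x. g x - h x"] assms by simp

lemma sq_norm_eq_integral:
 assumes "integrable M (%x. (f x)^2)"
 shows "sq_norm M f = ennreal (LINT x|M. (f x)^2)"
 unfolding sq_norm_def using assms by (intro nn_integral_eq_integral) auto

text \<open>Markov-type interpolation \<open>2\<bar>a\<bar> \<le> s + a\<^sup>2/s\<close> replaces the Cauchy--Schwarz inequality.\<close>

lemma nn_integral_abs_le_sq_norm:
 assumes "prob_space M" "f : borm M" "sq_norm M f <= ennreal (s^2)" "0 < s"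
 shows "(\<integral>\<^sup>+x. ennreal \<bar>f x\<bar> \<partial>M) <= ennreal s"
proof -
 interpret prob_space M by fact
 have [measurable]: "f : borm M" by fact
 have "(\<integral>\<^sup>+x. ennreal \<bar>f x\<bar> \<partial>M) <= (\<integral>\<^sup>+x. ennreal (s / 2) + ennreal (1 / (2 * s)) * ennreal ((f x)^2) \<partial>M)"
 proof (rule nn_integral_mono)
  fix x
  have "0 <= (\<bar>f x\<bar> - s)^2" by simp
  then have "2 * s * \<bar>f x\<bar> <= (f x)^2 + s^2" by (simp add: power2_diff mult_ac)
  then have "\<bar>f x\<bar> <= s / 2 + 1 / (2 * s) * (f x)^2"
   using \<open>0 < s\<close> by (simp add: field_simps power2_eq_square)
  then have "ennreal \<bar>f x\<bar> <= ennreal (s / 2 + 1 / (2 * s) * (f x)^2)" by (rule ennreal_leI)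
  also have "... = ennreal (s / 2) + ennreal (1 / (2 * s)) * ennreal ((f x)^2)"
   using \<open>0 < s\<close> by (subst ennreal_plus) (auto simp: ennreal_mult[symmetric])
  finally show "ennreal \<bar>f x\<bar> <= ennreal (s / 2) + ennreal (1 / (2 * s)) * ennreal ((f x)^2)" .
 qed
 also have "... = ennreal (s / 2) + ennreal (1 / (2 * s)) * sq_norm M f"
  unfolding sq_norm_def by (subst nn_integral_add) (auto simp: nn_integral_cmult emeasure_space_1)
 also have "... <= ennreal (s / 2) + ennreal (1 / (2 * s)) * ennreal (s^2)"
  by (intro add_left_mono mult_left_mono assms) auto
 also have "... = ennreal (s / 2 + 1 / (2 * s) * s^2)"
  using \<open>0 < s\<close> by (subst ennreal_mult[symmetric]) (auto simp: ennreal_plus[symmetric] simp del: ennreal_plus)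
 also have "s / 2 + 1 / (2 * s) * s^2 = s" using \<open>0 < s\<close> by (simp add: field_simps power2_eq_square)
 finally show ?thesis .
qed

text \<open>The geometric rate makes the increments summable in L1, so the sequence converges almost
  surely. Fatou's lemma carries the Cauchy bound over to the limit.\<close>

lemma L2_complete:
 fixes Y :: "nat => 'a => real"
 assumes "prob_space M" and Y [measurable]: "!!n. Y n : borm M"
  and C: "0 < C" "!!n k. n <= k ==> sq_norm M (%x. Y k x - Y n x) <= ennreal ((C * (1 / 2) ^ n)^2)"
 shows "EX X. X : borm M & (%n. sq_norm M (%x. X x - Y n x)) \<longlonglongrightarrow> 0"
proof -
 interpret prob_space M by fact
 define X where "X x = lim (%n. Y n x)" for x
 have [measurable]: "X : borm M" unfolding X_def[abs_def] by measurable
 have "(\<integral>\<^sup>+x. (\<Sum>n. ennreal \<bar>Y (Suc n) x - Y n x\<bar>) \<partial>M) = (\<Sum>n. \<integral>\<^sup>+x. ennreal \<bar>Y (Suc n) x - Y n x\<bar> \<partial>M)"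
  by (rule nn_integral_suminf) measurable
 also have "... <= (\<Sum>n. ennreal (C * (1 / 2) ^ n))"
  by (intro suminf_le nn_integral_abs_le_sq_norm prob_space_axioms C summableI)
   (use C(1) in \<open>auto intro!: C(2)[of "n" "Suc n" for n]\<close>)
 also have "... = ennreal (\<Sum>n. C * (1 / 2) ^ n)"
  using C(1) by (intro suminf_ennreal2) (auto intro!: summable_mult summable_geometric)
 finally have fin: "(\<integral>\<^sup>+x. (\<Sum>n. ennreal \<bar>Y (Suc n) x - Y n x\<bar>) \<partial>M) ~= \<infinity>"
  by (auto simp: top_unique)
 have "AE x in M. (\<Sum>n. ennreal \<bar>Y (Suc n) x - Y n x\<bar>) ~= \<infinity>"
  by (rule nn_integral_PInf_AE[OF _ fin]) measurable
 then have conv: "AE x in M. (%n. Y n x) \<longlonglongrightarrow> X x"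
 proof eventually_elim
  case (elim x)
  have "summable (%n. \<bar>Y (Suc n) x - Y n x\<bar>)"
   by (rule summable_suminf_not_top) (use elim in auto)
  then have "summable (%n. Y (Suc n) x - Y n x)" by (rule summable_rabs_cancel)
  then have "convergent (%n. SUM i<n. Y (Suc i) x - Y i x)" by (simp add: summable_iff_convergent)
  then have "convergent (%n. Y n x - Y 0 x)"
   unfolding sum_lessThan_telescope[of "%i. Y i x"] .
  from convergent_add[OF convergent_const[of "Y 0 x"] this] have "convergent (%n. Y 0 x + (Y n x - Y 0 x))" .
  then show ?case by (simp add: X_def convergent_LIMSEQ_iff)
 qed
 have bound: "sq_norm M (%x. X x - Y n x) <= ennreal ((C * (1 / 2) ^ n)^2)" for n
 proof -
  have "sq_norm M (%x. X x - Y n x) = (\<integral>\<^sup>+x. liminf (%k. ennreal ((Y k x - Y n x)^2)) \<partial>M)"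
   unfolding sq_norm_def
  proof (rule nn_integral_cong_AE, use conv in eventually_elim)
   case (elim x)
   then have "(%k. ennreal ((Y k x - Y n x)^2)) \<longlonglongrightarrow> ennreal ((X x - Y n x)^2)"
    by (intro tendsto_ennrealI tendsto_intros)
   then show ?case by (intro lim_imp_Liminf[symmetric]) auto
  qed
  also have "... <= liminf (%k. sq_norm M (%x. Y k x - Y n x))"
   unfolding sq_norm_def by (rule nn_integral_liminf) measurable
  also have "... <= ennreal ((C * (1 / 2) ^ n)^2)"
   using C(2)[of n]
   by (intro Liminf_le) (auto intro!: eventually_sequentiallyI[of n])
  finally show ?thesis .
 qed
 have "(%n. ennreal ((C * (1 / 2) ^ n)^2)) \<longlonglongrightarrow> ennreal ((C * 0)^2)"
  by (intro tendsto_ennrealI tendsto_intros LIMSEQ_power_zero) auto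
 then have lim: "(%n. ennreal ((C * (1 / 2) ^ n)^2)) \<longlonglongrightarrow> 0" by simp
 have "(%n. sq_norm M (%x. X x - Y n x)) \<longlonglongrightarrow> 0"
 proof (rule tendsto_sandwich[OF _ _ tendsto_const lim])
  show "\<forall>\<^sub>F n in sequentially. 0 <= sq_norm M (%x. X x - Y n x)" by simp
  show "\<forall>\<^sub>F n in sequentially. sq_norm M (%x. X x - Y n x) <= ennreal ((C * (1 / 2) ^ n)^2)"
   using bound by (rule eventuallyI)
 qed
 with \<open>X : borm M\<close> show ?thesis by blast
qed

text \<open>A monotone class argument for properties closed under L2 limits. The property spreads
  from indicators of an intersection-stable generator to those of all measurable sets by Dynkin's
  theorem, and to bounded functions by quantisation.\<close>

lemma L2_induct:
 fixes P :: "('a => real) => bool"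
 assumes "prob_space M"
  and G: "sets M = sigma_sets (space M) G" "Int_stable G" "G <= Pow (space M)"
  and gen: "!!A. A : G ==> P (indicator A)"
  and one: "P (%_. 1)"
  and lin: "!!a b f g. P f ==> P g ==> P (%x. a * f x + b * g x)"
  and lim: "!!f. f : borm M ==>
   (!!e. 0 < e ==> EX g. g : borm M & P g & sq_norm M (%x. f x - g x) <= ennreal e) ==> P f"
  and f: "bdm M f"
 shows "P f"
proof -
 interpret prob_space M by fact
 have zero: "P (%_. 0)" using lin[OF one one, of 0 0] by simp
 have sum: "P (%x. SUM i:I. a i * h i x)" if "finite I" "!!i. i : I ==> P (h i)" for I :: "int set" and a h
  using that
 proof (induction I)
  case (insert i I)
  then have "P (%x. a i * h i x + 1 * (SUM i:I. a i * h i x))" by (intro lin) auto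
  with insert show ?case by simp
 qed (simp add: zero)
 have ind: "P (indicator A)" if "A : sets M" for A
 proof -
  from that have "A : sigma_sets (space M) G" by (simp add: G(1))
  with G(2,3) show ?thesis
  proof (induction rule: sigma_sets_induct_disjoint)
   case (basic A)
   then show ?case by (rule gen)
  next
   case empty
   show ?case using zero by (simp add: indicator_def[abs_def])
  next
   case (compl A)
   have A [measurable]: "A : sets M" using compl by (simp add: G(1))
   show ?case
   proof (rule lim)
    show "indicator (space M - A) : borm M" by measurable
    fix e :: real assume "0 < e"
    have "sq_norm M (%x. indicator (space M - A) x - (1 * 1 + (-1) * indicator A x)) = sq_norm M (%_. 0)"
     by (rule sq_norm_cong) (auto simp: indicator_def)
    also have "... <= ennreal e" by (simp add: sq_norm_def)
    finally show "EX g. g : borm M & P g & sq_norm M (%x. indicator (space M - A) x - g x) <= ennreal e"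
     by (intro exI[of _ "%x. 1 * 1 + (-1) * indicator A x"] conjI lin one compl) measurable
   qed
  next
   case (union A)
   have A [measurable]: "A n : sets M" for n using union(2) by (auto simp: G(1))
   have fin: "P (indicator (\<Union>i<n. A i))" for n
   proof (induction n)
    case 0
    show ?case using zero by (simp add: indicator_def[abs_def])
   next
    case (Suc n)
    have "A n Int (\<Union>i<n. A i) = {}" 
    proof -
     have "A n Int A i = {}" if "i < n" for i
      by (rule disjoint_family_onD[OF union(1)]) (use that in simp_all)
     then show ?thesis by blast
    qed
    then have eq: "indicator (\<Union>i<Suc n. A i) = (%x. 1 * indicator (A n) x + 1 * indicator (\<Union>i<n. A i) x :: real)"
    proof (intro ext)
     fix x
     have "(\<Union>i<Suc n. A i) = A n \<union> (\<Union>i<n. A i)" by (simp add: lessThan_Suc)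
     with \<open>A n Int (\<Union>i<n. A i) = {}\<close>
     show "indicator (\<Union>i<Suc n. A i) x = (1 * indicator (A n) x + 1 * indicator (\<Union>i<n. A i) x :: real)"
      by (simp only: indicator_disj_union mult_1_left)
    qed
    show ?case unfolding eq by (intro lin union Suc)
   qed
   show ?case
   proof (rule lim)
    show "indicator (\<Union>i. A i) : borm M" by measurable
    fix e :: real assume e: "0 < e"
    have "(%n. measure M (\<Union>i<n. A i)) \<longlonglongrightarrow> measure M (\<Union>n. \<Union>i<n. A i)"
     by (rule finite_Lim_measure_incseq) (auto simp: incseq_def intro: less_le_trans)
    moreover have "(\<Union>n. \<Union>i<n. A i) = (\<Union>i. A i)" by auto
    ultimately have "(%n. measure M (\<Union>i<n. A i)) \<longlonglongrightarrow> measure M (\<Union>i. A i)" by simp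
    then have "\<forall>\<^sub>F n in sequentially. dist (measure M (\<Union>i<n. A i)) (measure M (\<Union>i. A i)) < e"
     using e by (rule tendstoD)
    then obtain n where n: "dist (measure M (\<Union>i<n. A i)) (measure M (\<Union>i. A i)) < e"
     by (auto simp: eventually_sequentially)
    have "sq_norm M (%x. indicator (\<Union>i. A i) x - indicator (\<Union>i<n. A i) x) =
      (\<integral>\<^sup>+x. indicator ((\<Union>i. A i) - (\<Union>i<n. A i)) x \<partial>M)"
     unfolding sq_norm_def by (intro nn_integral_cong) (auto simp: indicator_def)
    also have "... = emeasure M ((\<Union>i. A i) - (\<Union>i<n. A i))" by (rule nn_integral_indicator) measurable
    also have "... = ennreal (measure M (\<Union>i. A i) - measure M (\<Union>i<n. A i))"
     by (subst emeasure_eq_measure, subst finite_measure_Diff) auto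
    also have "... <= ennreal e" using n by (intro ennreal_leI) (simp add: dist_real_def)
    finally show "EX g. g : borm M & P g & sq_norm M (%x. indicator (\<Union>i. A i) x - g x) <= ennreal e"
     by (intro exI[of _ "indicator (\<Union>i<n. A i)"] conjI fin) measurable
   qed
  qed
 qed
 have [measurable]: "f : borm M" using f by (rule bdm_measurable)
 obtain C where C: "0 <= C" "!!x. x : space M ==> norm (f x) <= C" using bdmE[OF f] by metis
 show ?thesis
 proof (rule lim)
  fix e :: real assume e: "0 < e"
  obtain k where k: "inverse (real (Suc k)) < min 1 e"
   using reals_Archimedean[of "min 1 e"] e by auto
  define n where "n = Suc k"
  have n: "0 < n" "1 / real n < min 1 e" using k by (simp_all add: n_def inverse_eq_divide)
  \<comment> \<open>The quantisation \<open>floor (n * f) / n\<close> takes finitely many values,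
    with levels in \<open>{-N..N}\<close>, hence is a finite combination of indicators. Its squared
    error is at most \<open>(1 / n)^2 <= 1 / n\<close>, and \<open>1 / n\<close> was made smaller
    than \<open>e\<close>.\<close>
  define N where "N = \<lceil>real n * C\<rceil> + 1"
  define g where "g x = (SUM i:{-N..N}. (of_int i / real n) * indicator {y\<in>space M. \<lfloor>real n * f y\<rfloor> = i} x)" for x
  have "P g" unfolding g_def[abs_def] by (intro sum ind) measurable
  moreover have [measurable]: "g : borm M" unfolding g_def[abs_def] by measurable
  moreover have "sq_norm M (%x. f x - g x) <= ennreal e"
  proof -
   have "\<bar>f x - g x\<bar> <= 1 / real n" if x: "x : space M" for x
   proof -
    have "\<bar>real n * f x\<bar> <= real n * C" using C(2)[OF x] by (simp add: abs_mult mult_left_mono)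
    then have "\<lfloor>real n * f x\<rfloor> : {-N..N}" unfolding N_def abs_le_iff atLeastAtMost_iff by linarith
    moreover have "g x = (SUM i:{-N..N}. if i = \<lfloor>real n * f x\<rfloor> then of_int i / real n else 0)"
     unfolding g_def using x by (intro sum.cong refl) auto
    ultimately have "g x = of_int \<lfloor>real n * f x\<rfloor> / real n" by simp
    moreover have "\<bar>real n * f x - of_int \<lfloor>real n * f x\<rfloor>\<bar> <= 1" by linarith
    then have "\<bar>real n * (f x - of_int \<lfloor>real n * f x\<rfloor> / real n)\<bar> <= 1"
     using n by (simp add: right_diff_distrib)
    ultimately have "real n * \<bar>f x - g x\<bar> <= 1" by (simp add: abs_mult)
    then show ?thesis using n by (simp add: field_simps)
   qed
   then have "sq_norm M (%x. f x - g x) <= (\<integral>\<^sup>+x. ennreal ((1 / real n)^2) \<partial>M)"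
    unfolding sq_norm_def by (intro nn_integral_mono ennreal_leI) (simp add: abs_le_square_iff[symmetric])
   also have "... = ennreal ((1 / real n)^2)" by (simp add: emeasure_space_1)
   also have "(1 / real n)^2 <= 1 / real n * 1"
    using n unfolding power2_eq_square by (intro mult_left_mono) auto
   then have "ennreal ((1 / real n)^2) <= ennreal e" using n by (intro ennreal_leI) auto
   finally show ?thesis .
  qed
  ultimately show "EX g. g : borm M & P g & sq_norm M (%x. f x - g x) <= ennreal e" by blast
 qed measurable
qed

section \<open>Step functions and their refinements\<close>

text \<open>The cells of a unit partition tile the half-open interval from 0 to 1. The point 0 lies
  in none of them and is the exceptional null case in all arguments by cells.\<close>

definition cell :: "(nat => real) => nat => real set" where
 "cell t k = {t k<..t (Suc k)}"

lemma unit_partition_strict_mono: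
 assumes "unit_partition m t" "i < j" "j <= m"
 shows "t i < t j"
 using assms(2,3)
proof (induction j)
 case (Suc j)
 then have "t j < t (Suc j)" using assms(1) by (auto simp: unit_partition_def)
 with Suc show ?case by (cases "i = j") auto
qed simp

lemma unit_partition_mono: "unit_partition m t ==> i <= j ==> j <= m ==> t i <= t j"
 using unit_partition_strict_mono[of m t i j] by (cases "i = j") auto

lemma unit_partition_less_iff:
 "unit_partition m t ==> i <= m ==> j <= m ==> t i < t j \<longleftrightarrow> i < j"
 using unit_partition_strict_mono[of m t i j] unit_partition_mono[of m t j i] by force

lemma unit_partition_range: "unit_partition m t ==> k <= m ==> t k : {0..1}"
 using unit_partition_mono[of m t 0 k] unit_partition_mono[of m t k m] by (auto simp: unit_partition_def)

lemma unit_partition_sum: "unit_partition m t ==> (SUM k<m. t (Suc k) - t k) = 1"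
 by (simp add: sum_lessThan_telescope unit_partition_def)

lemma cell_range_iff:
 assumes t: "unit_partition m t" and y: "y : cell t j" "j < m" and ab: "a <= m" "b <= m"
 shows "y : {t a<..t b} \<longleftrightarrow> a <= j & j < b"
proof -
 have "t a < y \<longleftrightarrow> a <= j"
  using unit_partition_mono[OF t, of a j] unit_partition_mono[OF t, of "Suc j" a] y ab
  by (cases "a <= j") (auto simp: cell_def not_le Suc_le_eq)
 moreover have "y <= t b \<longleftrightarrow> j < b"
  using unit_partition_mono[OF t, of "Suc j" b] unit_partition_mono[OF t, of b j] y ab
  by (cases "j < b") (auto simp: cell_def not_less)
 ultimately show ?thesis by simp
qed

lemma indicator_cell:
 assumes "unit_partition m t" "y : cell t j" "j < m" "k < m"
 shows "indicator (cell t k) y = (if k = j then 1 else 0 :: real)"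
 using cell_range_iff[OF assms(1-3), of k "Suc k"] assms(4) by (auto simp: indicator_def cell_def)

lemma cell_cases:
 assumes t: "unit_partition m t" and x: "x : {0..1}"
 obtains "x = 0" | j where "j < m" "x : cell t j"
proof (cases "x = 0")
 case False
 define j where "j = (LEAST i. x <= t i)"
 have e: "x <= t m" using x t by (auto simp: unit_partition_def)
 have j: "x <= t j" "j <= m" unfolding j_def using e by (auto intro: LeastI Least_le)
 have "j ~= 0"
 proof
  assume "j = 0"
  then have "x <= 0" using j(1) t by (simp add: unit_partition_def)
  then show False using False x by simp
 qed
 then obtain i where i: "j = Suc i" by (cases j) auto
 have "\<not> x <= t i" using not_less_Least[of i "%i. x <= t i"] i by (auto simp: j_def)
 then show ?thesis using that(2)[of i] j i by (auto simp: cell_def)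
qed (use that in auto)

lemma indicator_cell_0: "unit_partition m t ==> k < m ==> indicator (cell t k) 0 = (0 :: real)"
 using unit_partition_range[of m t k] by (auto simp: cell_def)

lemma step1_alt: "step1 m t c x = (SUM k<m. c k * indicator (cell t k) x)"
 by (simp add: step1_def cell_def)

lemma step2_alt: "step2 m t d x y = (SUM (j, k):{(j, k). j < m & k < m & j ~= k}.
  d j k * indicator (cell t j) x * indicator (cell t k) y)"
 by (simp add: step2_def cell_def)

lemma finite_off_diag [simp]: "finite {(j, k). j < m & k < m & j ~= (k :: nat)}"
 by (rule finite_subset[of _ "{..<m} \<times> {..<m}"]) auto

lemma sum_off_diag:
 fixes f :: "nat => nat => 'a::comm_monoid_add"
 shows "(SUM (j, k):{(j, k). j < m & k < m & j ~= k}. f j k) = (SUM j<m. SUM k<m. if j ~= k then f j k else 0)"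
proof -
 have "(SUM j<m. SUM k<m. if j ~= k then f j k else 0) = (SUM (j, k):{..<m} \<times> {..<m}. if j ~= k then f j k else 0)"
  by (simp add: sum.cartesian_product)
 also have "... = (SUM (j, k):{(j, k). j < m & k < m & j ~= k}. f j k)"
  by (rule sum.mono_neutral_cong_right) auto
 finally show ?thesis ..
qed

lemma step1_cell: "unit_partition m t ==> x : cell t j ==> j < m ==> step1 m t c x = c j"
 by (simp add: step1_alt indicator_cell if_distrib[of "%a. _ * a"] cong: if_cong)

lemma step1_0: "unit_partition m t ==> step1 m t c 0 = 0"
 by (simp add: step1_alt indicator_cell_0)

lemma step2_cell:
 assumes "unit_partition m t" "x : cell t j" "y : cell t k" "j < m" "k < m"
 shows "step2 m t d x y = (if j = k then 0 else d j k)"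
proof -
 have "step2 m t d x y = (SUM i<m. SUM l<m. if i = j & l = k & j ~= k then d j k else 0)"
  unfolding step2_alt sum_off_diag
  by (intro sum.cong refl) (auto simp: indicator_cell[OF assms(1,2,4)] indicator_cell[OF assms(1,3,5)])
 also have "... = (SUM i<m. if i = j then if j ~= k then d j k else 0 else 0)"
  using assms(5) by (intro sum.cong refl) (auto simp: if_distrib cong: if_cong)
 finally show ?thesis using assms(4) by simp
qed

lemma step2_0: "unit_partition m t ==> x = 0 \<or> y = 0 ==> step2 m t d x y = 0"
 unfolding step2_alt by (rule sum.neutral) (auto simp: indicator_cell_0)

lemma measurable_indicator_cell [measurable]: "indicator (cell t k) : borm unit_unif"
proof -
 have "indicator (cell t k) : borm borel" by (auto simp: cell_def)
 then have "indicator (cell t k) : borm lborel" by simp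
 then show ?thesis unfolding unit_unif_def by (rule measurable_restrict_space1)
qed

lemma measurable_step1 [measurable]: "step1 m t c : borm unit_unif"
 unfolding step1_alt[abs_def]
 by (intro borel_measurable_sum borel_measurable_times borel_measurable_const measurable_indicator_cell)

lemma measurable_indicator_cell_fst:
 "(%p. indicator (cell t k) (fst p) :: real) : borm unit_square"
 by (rule measurable_compose[OF measurable_fst measurable_indicator_cell])

lemma measurable_indicator_cell_snd:
 "(%p. indicator (cell t k) (snd p) :: real) : borm unit_square"
 by (rule measurable_compose[OF measurable_snd measurable_indicator_cell])

lemma measurable_step2 [measurable]: "case_prod (step2 m t d) : borm unit_square"
 unfolding step2_alt[abs_def] split_beta'
 by (intro borel_measurable_sum borel_measurable_times borel_measurable_const
   measurable_indicator_cell_fst measurable_indicator_cell_snd)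

lemma integral_indicator_cell:
 assumes "unit_partition m t" "k < m"
 shows "(LINT x|unit_unif. indicator (cell t k) x) = t (Suc k) - t k"
proof -
 have r: "t k : {0..1}" "t (Suc k) : {0..1}" "t k <= t (Suc k)"
  using unit_partition_range[OF assms(1)] unit_partition_mono[OF assms(1), of k "Suc k"] assms(2) by auto
 then have c: "cell t k <= {0..1}" by (auto simp: cell_def)
 have "(LINT x|unit_unif. indicator (cell t k) x) = measure unit_unif (cell t k)"
  using c by (simp add: Int_absorb2)
 also have "... = measure lborel (cell t k)"
  unfolding unit_unif_def using c by (intro measure_restrict_space) auto
 also have "... = t (Suc k) - t k" using r by (simp add: cell_def)
 finally show ?thesis .
qed

lemma integrable_indicator_cell: "integrable unit_unif (indicator (cell t k) :: real => real)"
 by (rule bdm_integrable[OF finite_measure_unit_unif bdmI[where C = 1]]) (auto simp: indicator_def)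

lemma bdm_step1: "bdm unit_unif (step1 m t c)"
 unfolding step1_alt[abs_def]
 by (intro bdm_sum bdm_mult bdm_const bdmI[where C = 1] measurable_indicator_cell)
  (auto simp: indicator_def)

lemma bdm_step2: "bdm unit_square (case_prod (step2 m t d))"
 unfolding step2_alt[abs_def] split_beta'
 by (intro bdm_sum bdm_mult bdm_const bdmI[where C = 1]
   measurable_indicator_cell_fst measurable_indicator_cell_snd) (auto simp: indicator_def)

lemma integral_step1:
 assumes "unit_partition m t"
 shows "(LINT x|unit_unif. step1 m t c x) = (SUM k<m. c k * (t (Suc k) - t k))"
 unfolding step1_alt using integrable_indicator_cell integral_indicator_cell[OF assms]
 by (subst lint_sum) (auto intro!: integrable_mult_right sum.cong)

lemma integral_indicator_cell2:
 assumes "unit_partition m t" "j < m" "k < m"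
 shows "(LINT p|unit_square. indicator (cell t j) (fst p) * indicator (cell t k) (snd p)) =
  (t (Suc j) - t j) * (t (Suc k) - t k)"
proof -
 interpret U: prob_space unit_unif by (rule prob_space_unit_unif)
 interpret P: pair_prob_space unit_unif unit_unif ..
 have i: "integrable unit_square (%p. indicator (cell t j) (fst p) * indicator (cell t k) (snd p) :: real)"
  by (rule bdm_integrable[OF P.finite_measure_axioms bdmI[where C = 1]],
    intro borel_measurable_times measurable_indicator_cell_fst measurable_indicator_cell_snd)
   (auto simp: indicator_def)
 show ?thesis
  using P.integral_fst'[OF i] integral_indicator_cell[OF assms(1)] assms(2,3) by simp
qed

lemma integral_step2:
 assumes "unit_partition m t"
 shows "(LINT p|unit_square. case_prod (step2 m t d) p) =
  (SUM (j, k):{(j, k). j < m & k < m & j ~= k}. d j k * (t (Suc j) - t j) * (t (Suc k) - t k))"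
proof -
 interpret U: prob_space unit_unif by (rule prob_space_unit_unif)
 interpret P: pair_prob_space unit_unif unit_unif ..
 have i: "integrable unit_square (%p. indicator (cell t j) (fst p) * indicator (cell t k) (snd p) :: real)" for j k
  by (rule bdm_integrable[OF P.finite_measure_axioms bdmI[where C = 1]],
    intro borel_measurable_times measurable_indicator_cell_fst measurable_indicator_cell_snd)
   (auto simp: indicator_def)
 show ?thesis
  unfolding step2_alt split_beta' mult.assoc
  by (subst lint_sum)
   (auto intro!: sum.cong integrable_mult_right i simp: integral_indicator_cell2[OF assms])
qed

lemma sq_norm_step1:
 assumes "unit_partition m t"
 shows "sq_norm unit_unif (step1 m t c) = ennreal (SUM k<m. (c k)^2 * (t (Suc k) - t k))"
proof -
 have sq: "(step1 m t c x)^2 = step1 m t (%k. (c k)^2) x" if "x : {0..1}" for x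
  using that by (cases rule: cell_cases[OF assms that]) (auto simp: step1_cell[OF assms] step1_0[OF assms])
 have "sq_norm unit_unif (step1 m t c) = ennreal (LINT x|unit_unif. (step1 m t c x)^2)"
  by (rule sq_norm_eq_integral[OF bdm_integrable[OF finite_measure_unit_unif bdm_power[OF bdm_step1]]])
 also have "(LINT x|unit_unif. (step1 m t c x)^2) = (LINT x|unit_unif. step1 m t (%k. (c k)^2) x)"
  by (intro lint_cong refl sq) simp
 finally show ?thesis by (simp add: integral_step1[OF assms])
qed

lemma sq_norm_step2:
 assumes "unit_partition m t"
 shows "sq_norm unit_square (case_prod (step2 m t d)) =
  ennreal (SUM (j, k):{(j, k). j < m & k < m & j ~= k}. (d j k)^2 * (t (Suc j) - t j) * (t (Suc k) - t k))"
proof -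
 interpret U: prob_space unit_unif by (rule prob_space_unit_unif)
 interpret P: pair_prob_space unit_unif unit_unif ..
 have sq: "(step2 m t d x y)^2 = step2 m t (%j k. (d j k)^2) x y" if x: "x : {0..1}" and y: "y : {0..1}" for x y
 proof (cases rule: cell_cases[OF assms x])
  case (2 j)
  note j = this
  show ?thesis
   by (cases rule: cell_cases[OF assms y]) (auto simp: step2_cell[OF assms j(2) _ j(1)] step2_0[OF assms])
 qed (simp add: step2_0[OF assms])
 have "sq_norm unit_square (case_prod (step2 m t d)) =
   ennreal (LINT p|unit_square. (case_prod (step2 m t d) p)^2)"
  by (rule sq_norm_eq_integral[OF bdm_integrable[OF P.finite_measure_axioms bdm_power[OF bdm_step2]]])
 also have "(LINT p|unit_square. (case_prod (step2 m t d) p)^2) =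
   (LINT p|unit_square. case_prod (step2 m t (%j k. (d j k)^2)) p)"
  by (intro lint_cong refl) (auto simp: space_pair_measure sq)
 finally show ?thesis by (simp add: integral_step2[OF assms])
qed

section \<open>Refinement of partitions\<close>

lemma exists_unit_partition:
 assumes P: "finite P" "P <= {0..1}" "0 : P" "1 : P"
 shows "EX m t. unit_partition m t & t ` {..m} = P"
proof -
 define xs where "xs = sorted_list_of_set P"
 have xs: "set xs = P" "sorted_wrt (<) xs" "length xs = card P"
  using P(1) by (auto simp: xs_def)
 define m where "m = length xs - 1"
 have ne: "length xs = Suc m" using xs P(3) by (cases xs) (auto simp: m_def)
 have less: "xs ! i < xs ! j" if "i < j" "j <= m" for i j
  using that ne by (intro sorted_wrt_nth_less[OF xs(2)]) auto
 have img: "(!) xs ` {..m} = P"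
  using xs(1) ne by (auto simp: set_conv_nth less_Suc_eq_le image_def)
 obtain i where i: "i <= m" "xs ! i = 0" using img P(3) by (metis (no_types, lifting) atMost_iff imageE)
 obtain j where j: "j <= m" "xs ! j = 1" using img P(4) by (metis (no_types, lifting) atMost_iff imageE)
 have r: "xs ! k : {0..1}" if "k <= m" for k using img that P(2) by auto
 have "i = 0" using less[of 0 i] i r[of 0] by (cases "i = 0") auto
 moreover have "j = m" using less[of j m] j r[of m] by (cases "j = m") auto
 ultimately have "unit_partition m ((!) xs)"
  unfolding unit_partition_def using i j less[of k "Suc k" for k] by auto
 with img show ?thesis by blast
qed

text \<open>A coarse cell is a run of consecutive fine cells, because both its endpoints occur in
  the finer partition, at the indices \<open>a\<close> and \<open>b\<close>.\<close>

lemma indicator_cell_refine: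
 assumes t: "unit_partition m t" and t': "unit_partition m' t'" and ref: "t ` {..m} <= t' ` {..m'}"
  and k: "k < m"
 obtains a b where "a <= b" "b <= m'" "t k = t' a" "t (Suc k) = t' b"
  "!!y j. y : cell t' j ==> j < m' ==> indicator (cell t k) y = (if a <= j & j < b then 1 else 0 :: real)"
proof -
 have "t k : t' ` {..m'}" "t (Suc k) : t' ` {..m'}" using ref k by auto
 then obtain a b where ab: "a <= m'" "b <= m'" "t k = t' a" "t (Suc k) = t' b" by (auto simp: image_iff)
 have "t k < t (Suc k)" using t k by (auto simp: unit_partition_def)
 then have "a <= b" using unit_partition_less_iff[OF t' ab(1,2)] ab by simp
 moreover have "indicator (cell t k) y = (if a <= j & j < b then 1 else 0 :: real)"
  if "y : cell t' j" "j < m'" for y j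
  using cell_range_iff[OF t' that ab(1,2)] by (simp add: indicator_def cell_def[of t k] ab)
 ultimately show ?thesis using ab that[of a b] by blast
qed

lemma cell_right_end: "unit_partition m t ==> j < m ==> t (Suc j) : cell t j"
 using unit_partition_strict_mono[of m t j "Suc j"] by (auto simp: cell_def)

text \<open>A coarse indicator is constant on fine cells, and the right endpoint is a point sure to
  lie in the half-open cell. Evaluating there yields the coefficients of a refined step
  function.\<close>

lemma indicator_cell_right_end:
 assumes "unit_partition m t" "unit_partition m' t'" "t ` {..m} <= t' ` {..m'}" "k < m"
  "y : cell t' j" "j < m'"
 shows "indicator (cell t k) y = (indicator (cell t k) (t' (Suc j)) :: real)"
proof -
 obtain a b where "!!y j. y : cell t' j ==> j < m' ==> indicator (cell t k) y = (if a <= j & j < b then 1 else 0 :: real)"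
  by (rule indicator_cell_refine[OF assms(1-4)]) blast
 note * = this
 show ?thesis unfolding *[OF assms(5,6)] *[OF cell_right_end[OF assms(2,6)] assms(6)] ..
qed

lemma increment_refine:
 fixes b :: "real => real"
 assumes "unit_partition m t" "unit_partition m' t'" "t ` {..m} <= t' ` {..m'}" "k < m"
 shows "b (t (Suc k)) - b (t k) =
  (SUM j<m'. indicator (cell t k) (t' (Suc j)) * (b (t' (Suc j)) - b (t' j)))"
proof -
 obtain u v where uv: "u <= v" "v <= m'" "t k = t' u" "t (Suc k) = t' v"
  "!!y j. y : cell t' j ==> j < m' ==> indicator (cell t k) y = (if u <= j & j < v then 1 else 0 :: real)"
  by (rule indicator_cell_refine[OF assms]) blast
 have "(SUM j<m'. indicator (cell t k) (t' (Suc j)) * (b (t' (Suc j)) - b (t' j))) =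
   (SUM j<m'. if j : {u..<v} then b (t' (Suc j)) - b (t' j) else 0)"
  by (intro sum.cong refl) (auto simp: uv(5)[OF cell_right_end[OF assms(2)]])
 also have "... = (SUM j:{u..<v}. b (t' (Suc j)) - b (t' j))"
  using uv(2) by (subst sum.inter_restrict[symmetric]) (auto intro!: sum.cong)
 also have "... = b (t' v) - b (t' u)" using uv(1) by (rule sum_Suc_diff')
 finally show ?thesis by (simp add: uv)
qed

lemma step1_refine:
 fixes c
 assumes "unit_partition m t" "unit_partition m' t'" "t ` {..m} <= t' ` {..m'}"
 defines "c' \<equiv> %j. step1 m t c (t' (Suc j))"
 shows "x : {0..1} ==> step1 m t c x = step1 m' t' c' x"
  and "step1_integral B m t c ww = step1_integral B m' t' c' ww"
proof -
 assume x: "x : {0..1}"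
 show "step1 m t c x = step1 m' t' c' x"
 proof (cases rule: cell_cases[OF assms(2) x])
  case (2 j)
  have "step1 m t c x = c' j"
   unfolding c'_def step1_alt
   by (intro sum.cong refl arg_cong2[where f = times] indicator_cell_right_end[OF assms(1-3) _ 2(2,1)]) auto
  then show ?thesis by (simp add: step1_cell[OF assms(2) 2(2,1)])
 qed (simp add: step1_0[OF assms(1)] step1_0[OF assms(2)])
next
 have "step1_integral B m t c ww = (SUM k<m. SUM j<m'. c k * indicator (cell t k) (t' (Suc j)) * (B (t' (Suc j)) ww - B (t' j) ww))"
  unfolding step1_integral_def
  by (intro sum.cong refl)
   (simp only: increment_refine[OF assms(1-3), of _ "%s. B s ww"] sum_distrib_left mult.assoc lessThan_iff)
 also have "... = step1_integral B m' t' c' ww"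
  unfolding step1_integral_def c'_def step1_alt sum_distrib_right by (rule sum.swap)
 finally show "step1_integral B m t c ww = step1_integral B m' t' c' ww" .
qed

text \<open>Every fine diagonal block lies in a coarse diagonal block, where the function is 0, or
  outside all coarse off-diagonal ones. So the refined coefficients vanish on the diagonal, and the
  diagonal-free form loses nothing under refinement.\<close>

lemma step2_refine:
 fixes d
 assumes "unit_partition m t" "unit_partition m' t'" "t ` {..m} <= t' ` {..m'}"
 defines "d' \<equiv> %i j. step2 m t d (t' (Suc i)) (t' (Suc j))"
 shows "x : {0..1} ==> y : {0..1} ==> step2 m t d x y = step2 m' t' d' x y"
  and "step2_integral B m t d ww = step2_integral B m' t' d' ww"
proof -
 note ind = indicator_cell_right_end[OF assms(1-3)]
 have diag: "d' i i = 0" if "i < m'" for i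
 proof -
  have "t' (Suc i) : {0..1}" using unit_partition_range[OF assms(2), of "Suc i"] that by auto
  then show ?thesis unfolding d'_def
   by (cases rule: cell_cases[OF assms(1), of "t' (Suc i)"]) (auto simp: step2_0[OF assms(1)] step2_cell[OF assms(1)])
 qed
 assume x: "x : {0..1}" and y: "y : {0..1}"
 show "step2 m t d x y = step2 m' t' d' x y"
 proof (cases rule: cell_cases[OF assms(2) x])
  case (2 i)
  note i = this
  show ?thesis
  proof (cases rule: cell_cases[OF assms(2) y])
   case (2 j)
   have "step2 m t d x y = d' i j"
    unfolding d'_def step2_alt using ind[OF _ i(2,1)] ind[OF _ 2(2,1)]
    by (intro sum.cong refl) auto
   then show ?thesis using diag i(1) by (simp add: step2_cell[OF assms(2) i(2) 2(2) i(1) 2(1)])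
  qed (simp add: step2_0[OF assms(1)] step2_0[OF assms(2)])
 qed (simp add: step2_0[OF assms(1)] step2_0[OF assms(2)])
next
 let ?D = "%j. B (t' (Suc j)) ww - B (t' j) ww"
 let ?i = "%k j. indicator (cell t k) (t' (Suc j)) :: real"
 let ?S = "{(j, k). j < m & k < m & j ~= k}"
 have diag: "d' i i = 0" if "i < m'" for i
 proof -
  have "t' (Suc i) : {0..1}" using unit_partition_range[OF assms(2), of "Suc i"] that by auto
  then show ?thesis unfolding d'_def
   by (cases rule: cell_cases[OF assms(1), of "t' (Suc i)"]) (auto simp: step2_0[OF assms(1)] step2_cell[OF assms(1)])
 qed
 have "step2_integral B m t d ww =
   (SUM (j, k):?S. SUM i<m'. SUM l<m'. d j k * ?i j i * ?i k l * (?D i * ?D l))"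
  unfolding step2_integral_def
 proof (intro sum.cong refl, clarify)
  fix j k assume jk: "j < m" "k < m"
  show "d j k * (B (t (Suc j)) ww - B (t j) ww) * (B (t (Suc k)) ww - B (t k) ww) =
   (SUM i<m'. SUM l<m'. d j k * ?i j i * ?i k l * (?D i * ?D l))"
   unfolding increment_refine[OF assms(1-3) jk(1), of "%s. B s ww"]
    increment_refine[OF assms(1-3) jk(2), of "%s. B s ww"]
   unfolding mult.assoc sum_product unfolding sum_distrib_left
   by (intro sum.cong refl) (simp only: mult_ac)
 qed
 also have "... = (SUM i<m'. SUM l<m'. SUM (j, k):?S. d j k * ?i j i * ?i k l * (?D i * ?D l))"
  unfolding split_beta' by (subst sum.swap, intro sum.cong refl, subst sum.swap) simp
 also have "... = (SUM i<m'. SUM l<m'. d' i l * ?D i * ?D l)"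
  unfolding d'_def step2_alt split_beta' by (simp only: sum_distrib_right mult.assoc)
 also have "... = (SUM i<m'. SUM l<m'. if i ~= l then d' i l * ?D i * ?D l else 0)"
  by (intro sum.cong refl) (auto simp: diag)
 finally show "step2_integral B m t d ww = step2_integral B m' t' d' ww"
  unfolding step2_integral_def sum_off_diag .
qed

lemma common_refinement:
 assumes "unit_partition m1 t1" "unit_partition m2 t2"
 obtains m t where "unit_partition m t" "t1 ` {..m1} <= t ` {..m}" "t2 ` {..m2} <= t ` {..m}"
proof -
 let ?P = "t1 ` {..m1} \<union> t2 ` {..m2}"
 have "?P <= {0..1}" using unit_partition_range[OF assms(1)] unit_partition_range[OF assms(2)] by auto
 moreover have "0 : ?P" "1 : ?P"
  using assms(1) by (auto simp: unit_partition_def image_iff)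
 ultimately obtain m t where "unit_partition m t" "t ` {..m} = ?P"
  using exists_unit_partition[of ?P] by auto
 then show ?thesis using that[of m t] by auto
qed

lemma step1_linear:
 "step1 m t (%k. a * c k + b * c' k) x = a * step1 m t c x + b * step1 m t c' x"
 unfolding step1_alt distrib_right sum.distrib by (simp only: sum_distrib_left mult.assoc)

lemma step1_integral_linear:
 "step1_integral B m t (%k. a * c k + b * c' k) ww = a * step1_integral B m t c ww + b * step1_integral B m t c' ww"
 unfolding step1_integral_def distrib_right sum.distrib by (simp only: sum_distrib_left mult.assoc)

lemma step2_linear:
 "step2 m t (%j k. a * d j k + b * d' j k) x y = a * step2 m t d x y + b * step2 m t d' x y"
 unfolding step2_alt split_beta' distrib_right sum.distrib by (simp only: sum_distrib_left mult.assoc)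

lemma step2_integral_linear:
 "step2_integral B m t (%j k. a * d j k + b * d' j k) ww = a * step2_integral B m t d ww + b * step2_integral B m t d' ww"
 unfolding step2_integral_def split_beta' distrib_right sum.distrib by (simp only: sum_distrib_left mult.assoc)

text \<open>The same coefficients \<open>c\<close> represent the combination as a function and as a
  stochastic sum. Linearity of the integral across different partitions, and with it the isometry
  for differences, rests on this.\<close>

lemma step1_common:
 assumes "unit_partition m1 t1" "unit_partition m2 t2" "unit_partition m t"
  "t1 ` {..m1} <= t ` {..m}" "t2 ` {..m2} <= t ` {..m}"
 obtains c where "!!x. x : {0..1} ==> step1 m t c x = a * step1 m1 t1 c1 x + b * step1 m2 t2 c2 x"
  "!!ww. step1_integral B m t c ww = a * step1_integral B m1 t1 c1 ww + b * step1_integral B m2 t2 c2 ww"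
proof (rule that)
 let ?c = "%j. a * step1 m1 t1 c1 (t (Suc j)) + b * step1 m2 t2 c2 (t (Suc j))"
 show "step1 m t ?c x = a * step1 m1 t1 c1 x + b * step1 m2 t2 c2 x" if "x : {0..1}" for x
  unfolding step1_linear step1_refine(1)[OF assms(1,3,4) that] step1_refine(1)[OF assms(2,3,5) that] ..
 show "step1_integral B m t ?c ww = a * step1_integral B m1 t1 c1 ww + b * step1_integral B m2 t2 c2 ww" for ww
  unfolding step1_integral_linear step1_refine(2)[OF assms(1,3,4)] step1_refine(2)[OF assms(2,3,5)] ..
qed

lemma step2_common:
 assumes "unit_partition m1 t1" "unit_partition m2 t2" "unit_partition m t"
  "t1 ` {..m1} <= t ` {..m}" "t2 ` {..m2} <= t ` {..m}"
 obtains d where "!!x y. x : {0..1} ==> y : {0..1} ==> step2 m t d x y = a * step2 m1 t1 d1 x y + b * step2 m2 t2 d2 x y"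
  "!!ww. step2_integral B m t d ww = a * step2_integral B m1 t1 d1 ww + b * step2_integral B m2 t2 d2 ww"
proof (rule that)
 let ?d = "%i j. a * step2 m1 t1 d1 (t (Suc i)) (t (Suc j)) + b * step2 m2 t2 d2 (t (Suc i)) (t (Suc j))"
 show "step2 m t ?d x y = a * step2 m1 t1 d1 x y + b * step2 m2 t2 d2 x y" if "x : {0..1}" "y : {0..1}" for x y
  unfolding step2_linear step2_refine(1)[OF assms(1,3,4) that] step2_refine(1)[OF assms(2,3,5) that] ..
 show "step2_integral B m t ?d ww = a * step2_integral B m1 t1 d1 ww + b * step2_integral B m2 t2 d2 ww" for ww
  unfolding step2_integral_linear step2_refine(2)[OF assms(1,3,4)] step2_refine(2)[OF assms(2,3,5)] ..
qed

section \<open>Wiener integrals\<close>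

lemma abs_step1_le: "\<bar>step1 m t c x\<bar> <= (SUM k<m. \<bar>c k\<bar>)"
 unfolding step1_alt
 by (rule order_trans[OF sum_abs], rule sum_mono) (simp add: abs_mult indicator_def)

lemma refine_mesh:
 assumes t: "unit_partition m t" and n: "0 < n"
 obtains m' t' where "unit_partition m' t'" "t ` {..m} <= t' ` {..m'}"
  "!!k. k < m' ==> t' (Suc k) - t' k <= 1 / real n"
proof -
 let ?Q = "(%i. real i / real n) ` {..n}"
 let ?P = "t ` {..m} \<union> ?Q"
 have "?Q <= {0..1}" using n by (auto simp: divide_le_eq_1)
 then have "?P <= {0..1}" using unit_partition_range[OF t] by auto
 moreover have "0 : ?P" "1 : ?P"
  using t by (auto simp: unit_partition_def image_iff)
 ultimately obtain m' t' where t': "unit_partition m' t'" "t' ` {..m'} = ?P"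
  using exists_unit_partition[of ?P] by auto
 have "t' (Suc k) - t' k <= 1 / real n" if k: "k < m'" for k
 proof (rule ccontr)
  assume a: "\<not> t' (Suc k) - t' k <= 1 / real n"
  have r: "0 <= t' k" "t' (Suc k) <= 1" using unit_partition_range[OF t'(1)] k by auto
  \<comment> \<open>\<open>i / n\<close> is the least multiple of \<open>1 / n\<close> strictly
    above \<open>t' k\<close>. A gap longer than \<open>1 / n\<close> would contain it in its
    interior, although it is itself a partition point.\<close>
  define i where "i = nat (\<lfloor>real n * t' k\<rfloor> + 1)"
  have fl: "0 <= \<lfloor>real n * t' k\<rfloor>" using r(1) by simp
  have ri: "real i = of_int \<lfloor>real n * t' k\<rfloor> + 1" using fl by (simp add: i_def)
  have 1: "real n * t' k < real i" unfolding ri by linarith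
  have 2: "real i <= real n * t' k + 1" unfolding ri by linarith
  have "1 < real n * (t' (Suc k) - t' k)" using a n by (simp add: field_simps)
  with 2 have 3: "real i < real n * t' (Suc k)" by (simp add: right_diff_distrib)
  have l: "t' k < real i / real n" "real i / real n < t' (Suc k)" using 1 3 n by (simp_all add: field_simps)
  have "real n * t' (Suc k) <= real n * 1" using r(2) by (intro mult_left_mono) auto
  with 3 have "real i < real n" by linarith
  then have "real i / real n : ?P" by auto
  then obtain j where j: "j <= m'" "real i / real n = t' j" using t'(2) by (metis (no_types, lifting) atMost_iff imageE)
  have "k < j" "j < Suc k"
   using l k j unit_partition_less_iff[OF t'(1), of k j] unit_partition_less_iff[OF t'(1), of j "Suc k"] by auto
  then show False by simp
 qed
 then show ?thesis using that[OF t'(1)] t'(2) by auto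
qed

lemma prob_space_unit_square: "prob_space unit_square"
proof -
 interpret U: prob_space unit_unif by (rule prob_space_unit_unif)
 interpret P: pair_prob_space unit_unif unit_unif ..
 show ?thesis by unfold_locales
qed

lemma space_unit_square: "space unit_square = {0..1} \<times> {0..1}"
 by (simp add: space_pair_measure)

lemma sq_norm_tensor:
 assumes [measurable]: "u : borm unit_unif" "v : borm unit_unif"
 shows "sq_norm unit_square (%p. u (fst p) * v (snd p)) = sq_norm unit_unif u * sq_norm unit_unif v"
proof -
 interpret U: prob_space unit_unif by (rule prob_space_unit_unif)
 have "sq_norm unit_square (%p. u (fst p) * v (snd p)) =
   (\<integral>\<^sup>+x. \<integral>\<^sup>+y. ennreal ((u x)^2) * ennreal ((v y)^2) \<partial>unit_unif \<partial>unit_unif)"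
  unfolding sq_norm_def
  by (subst U.nn_integral_fst[symmetric]) (auto simp: power_mult_distrib ennreal_mult)
 then show ?thesis
  unfolding sq_norm_def by (simp add: nn_integral_cmult nn_integral_multc)
qed

text \<open>A product of two step functions is a step function of two variables except on the
  diagonal blocks, which the integral excludes. Their total area is at most the mesh, so on a mesh
  \<open>1 / n\<close> the squared error is at most \<open>K / n\<close>, where \<open>K\<close>
  bounds the squared product. This is why diagonal-free step functions are dense.\<close>

lemma sq_norm_tensor_step2_le:
 assumes t: "unit_partition m t" and e: "0 < e"
 obtains m' t' d where "unit_partition m' t'"
  "sq_norm unit_square (%p. step1 m t c (fst p) * step1 m t c' (snd p) - case_prod (step2 m' t' d) p) <= ennreal e"
proof -
 define K where "K = ((SUM k<m. \<bar>c k\<bar>) * (SUM k<m. \<bar>c' k\<bar>))^2"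
 have K: "0 <= K" by (simp add: K_def)
 obtain n0 where "K / e < real n0" using reals_Archimedean2 by blast
 then obtain n where n: "0 < n" "K / e < real n" using that[of "Suc n0"] by auto
 then have Kn: "K / real n <= e" using e by (simp add: field_simps)
 obtain m' t' where t': "unit_partition m' t'" "t ` {..m} <= t' ` {..m'}"
  and mesh: "!!k. k < m' ==> t' (Suc k) - t' k <= 1 / real n"
  using refine_mesh[OF t n(1)] by blast
 let ?a = "%i. step1 m t c (t' (Suc i))" and ?b = "%i. step1 m t c' (t' (Suc i))"
 let ?d = "%i j. ?a i * ?b j"
 let ?p = "%k. t' (Suc k) - t' k"
 let ?g = "%p. SUM k<m'. (?d k k)^2 * (indicator (cell t' k) (fst p) * indicator (cell t' k) (snd p))"
 have pw: "(step1 m t c x * step1 m t c' y - step2 m' t' ?d x y)^2 <= ?g (x, y)"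
  if x: "x : {0..1}" and y: "y : {0..1}" for x y
 proof (cases rule: cell_cases[OF t'(1) x])
  case 1
  then show ?thesis
   by (simp add: step1_0[OF t] step2_0[OF t'(1)] sum_nonneg del: sum_mult_indicator sum_indicator_mult)
 next
  case (2 i)
  note i = this
  show ?thesis
  proof (cases rule: cell_cases[OF t'(1) y])
   case 1
   then show ?thesis
    by (simp add: step1_0[OF t] step2_0[OF t'(1)] sum_nonneg del: sum_mult_indicator sum_indicator_mult)
  next
   case (2 j)
   have s: "step1 m t c x = ?a i" "step1 m t c' y = ?b j"
    unfolding step1_refine(1)[OF t t' x, of c] step1_refine(1)[OF t t' y, of c']
    using step1_cell[OF t'(1)] i 2 by simp_all
   have "?g (x, y) = (SUM k<m'. if k = i then (if i = j then (?d k k)^2 else 0) else 0)"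
    by (intro sum.cong refl)
     (simp add: indicator_cell[OF t'(1) i(2,1)] indicator_cell[OF t'(1) 2(2,1)])
   also have "... = (if i = j then (?d i i)^2 else 0)" using i(1) by simp
   finally show ?thesis
    unfolding s step2_cell[OF t'(1) i(2) 2(2) i(1) 2(1)] by (simp add: power2_eq_square)
  qed
 qed
 have int: "integrable unit_square (%p. indicator (cell t' k) (fst p) * indicator (cell t' k) (snd p) :: real)" for k
  by (rule bdm_integrable[OF prob_space.finite_measure[OF prob_space_unit_square] bdmI[where C = 1]],
    intro borel_measurable_times measurable_indicator_cell_fst measurable_indicator_cell_snd)
   (auto simp: indicator_def)
 have "sq_norm unit_square (%p. step1 m t c (fst p) * step1 m t c' (snd p) - case_prod (step2 m' t' ?d) p) <=
   (\<integral>\<^sup>+p. ennreal (?g p) \<partial>unit_square)"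
  unfolding sq_norm_def using pw
  by (intro nn_integral_mono ennreal_leI) (auto simp: space_unit_square split_beta' simp del: sum_mult_indicator sum_indicator_mult)
 also have "... = ennreal (LINT p|unit_square. ?g p)"
  using int by (intro nn_integral_eq_integral lintb_sum integrable_mult_right)
   (auto intro!: sum_nonneg AE_I2 simp del: sum_mult_indicator sum_indicator_mult)
 also have "(LINT p|unit_square. ?g p) = (SUM k<m'. (?d k k)^2 * (?p k * ?p k))"
  using int by (subst lint_sum)
   (auto intro!: sum.cong integrable_mult_right simp: integral_indicator_cell2[OF t'(1)])
 also have "... <= (SUM k<m'. K * (?p k * (1 / real n)))"
 proof (rule sum_mono)
  fix k assume "k : {..<m'}"
  then have k: "k < m'" by simp
  have p: "0 <= ?p k" using unit_partition_mono[OF t'(1), of k "Suc k"] k by simp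
  have "\<bar>?d k k\<bar> <= (SUM k<m. \<bar>c k\<bar>) * (SUM k<m. \<bar>c' k\<bar>)"
   unfolding abs_mult by (intro mult_mono abs_step1_le) (auto intro: sum_nonneg)
  then have "(?d k k)^2 <= K"
   unfolding K_def by (metis abs_ge_zero power2_abs power_mono)
  then show "(?d k k)^2 * (?p k * ?p k) <= K * (?p k * (1 / real n))"
   using p mesh[OF k] K by (intro mult_mono) auto
 qed
 also have "... = K / real n"
  using unit_partition_sum[OF t'(1)] by (simp add: sum_distrib_left[symmetric] sum_distrib_right[symmetric] sum_divide_distrib[symmetric])
 finally have "sq_norm unit_square (%p. step1 m t c (fst p) * step1 m t c' (snd p) - case_prod (step2 m' t' ?d) p) <= ennreal (K / real n)"
  by (simp add: ennreal_leI)
 then show ?thesis using that[OF t'(1)] Kn by (meson ennreal_leI order_trans)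
qed

section \<open>Density of step functions in L2\<close>

definition step1_approximable :: "(real => real) => bool" where
 "step1_approximable f \<longleftrightarrow> f : borm unit_unif &
   (\<forall>e>0. EX m t c. unit_partition m t & sq_norm unit_unif (%x. f x - step1 m t c x) <= ennreal e)"

definition step2_approximable :: "(real \<times> real => real) => bool" where
 "step2_approximable f \<longleftrightarrow> f : borm unit_square &
   (\<forall>e>0. EX m t d. unit_partition m t & sq_norm unit_square (%p. f p - case_prod (step2 m t d) p) <= ennreal e)"

lemma trivial_partition: "unit_partition 1 real"
 by (simp add: unit_partition_def)

lemma ennreal_bound_2:
 fixes u v :: ennreal
 assumes "u <= ennreal a" "v <= ennreal b" "0 <= a" "0 <= b"
 shows "2 * u + 2 * v <= ennreal (2 * a + 2 * b)"
proof -
 have "2 * u + 2 * v <= 2 * ennreal a + 2 * ennreal b"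
  by (intro add_mono mult_left_mono assms) auto
 also have "... = ennreal (2 * a + 2 * b)" using assms by (simp add: ennreal_mult)
 finally show ?thesis .
qed

lemma sq_norm_linear_le:
 assumes "f : borm M" "g : borm M"
  and f: "sq_norm M f <= ennreal e" and g: "sq_norm M g <= ennreal e" and e: "0 <= e"
 shows "sq_norm M (%x. a * f x + b * g x) <= ennreal (2 * (a^2 * e) + 2 * (b^2 * e))"
proof -
 have "ennreal (a^2) * sq_norm M f <= ennreal (a^2 * e)" "ennreal (b^2) * sq_norm M g <= ennreal (b^2 * e)"
  using mult_left_mono[OF f, of "ennreal (a^2)"] mult_left_mono[OF g, of "ennreal (b^2)"] e
  by (auto simp: ennreal_mult)
 then have "2 * sq_norm M (%x. a * f x) + 2 * sq_norm M (%x. b * g x) <= ennreal (2 * (a^2 * e) + 2 * (b^2 * e))"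
  using e assms(1,2) by (intro ennreal_bound_2) (auto simp: sq_norm_cmult)
 moreover have "sq_norm M (%x. a * f x + b * g x) <= 2 * sq_norm M (%x. a * f x) + 2 * sq_norm M (%x. b * g x)"
  using assms(1,2) by (intro sq_norm_add_le) auto
 ultimately show ?thesis by (rule order_trans[rotated])
qed

lemma small_eps: "0 < e ==> \<exists>\<delta>>0. 2 * (a^2 * \<delta>) + 2 * (b^2 * \<delta>) <= (e::real)"
proof -
 assume e: "0 < e"
 have p: "0 < 2 * a^2 + 2 * b^2 + 1" using zero_le_power2[of a] zero_le_power2[of b] by linarith
 let ?\<delta> = "e / (2 * a^2 + 2 * b^2 + 1)"
 have "2 * (a^2 * ?\<delta>) + 2 * (b^2 * ?\<delta>) = (2 * a^2 + 2 * b^2) * ?\<delta>" by (simp only: distrib_right mult.assoc)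
 also have "... <= (2 * a^2 + 2 * b^2 + 1) * ?\<delta>" using p e by (intro mult_right_mono) auto
 also have "... = e" using p by simp
 finally show ?thesis using p e by (intro exI[of _ ?\<delta>]) auto
qed

lemma step1_approximable_linear:
 assumes f: "step1_approximable f" and g: "step1_approximable g"
 shows "step1_approximable (%x. a * f x + b * g x)"
 unfolding step1_approximable_def
proof (intro conjI allI impI)
 have [measurable]: "f : borm unit_unif" "g : borm unit_unif"
  using f g by (auto simp: step1_approximable_def)
 show "(%x. a * f x + b * g x) : borm unit_unif" by measurable
 fix e :: real assume "0 < e"
 then obtain \<delta> where \<delta>: "0 < \<delta>" "2 * (a^2 * \<delta>) + 2 * (b^2 * \<delta>) <= e" using small_eps[of e a b] by blast
 obtain m1 t1 c1 where 1: "unit_partition m1 t1" "sq_norm unit_unif (%x. f x - step1 m1 t1 c1 x) <= ennreal \<delta>"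
  using f \<delta>(1) unfolding step1_approximable_def by blast
 obtain m2 t2 c2 where 2: "unit_partition m2 t2" "sq_norm unit_unif (%x. g x - step1 m2 t2 c2 x) <= ennreal \<delta>"
  using g \<delta>(1) unfolding step1_approximable_def by blast
 obtain m t where t: "unit_partition m t" "t1 ` {..m1} <= t ` {..m}" "t2 ` {..m2} <= t ` {..m}"
  using common_refinement[OF 1(1) 2(1)] by blast
 obtain c where c: "!!x. x : {0..1} ==> step1 m t c x = a * step1 m1 t1 c1 x + b * step1 m2 t2 c2 x"
  by (rule step1_common[OF 1(1) 2(1) t, of a c1 b c2]) blast
 have "sq_norm unit_unif (%x. a * f x + b * g x - step1 m t c x) =
   sq_norm unit_unif (%x. a * (f x - step1 m1 t1 c1 x) + b * (g x - step1 m2 t2 c2 x))"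
  by (rule sq_norm_cong) (simp add: c algebra_simps)
 also have "... <= ennreal (2 * (a^2 * \<delta>) + 2 * (b^2 * \<delta>))"
  using \<delta>(1) by (intro sq_norm_linear_le 1 2) auto
 also have "... <= ennreal e" using \<delta>(2) by (rule ennreal_leI)
 finally show "EX m t c. unit_partition m t & sq_norm unit_unif (%x. a * f x + b * g x - step1 m t c x) <= ennreal e"
  using t(1) by blast
qed

lemma step2_approximable_linear:
 assumes f: "step2_approximable f" and g: "step2_approximable g"
 shows "step2_approximable (%x. a * f x + b * g x)"
 unfolding step2_approximable_def
proof (intro conjI allI impI)
 have [measurable]: "f : borm unit_square" "g : borm unit_square"
  using f g by (auto simp: step2_approximable_def)
 show "(%x. a * f x + b * g x) : borm unit_square" by measurable
 fix e :: real assume "0 < e"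
 then obtain \<delta> where \<delta>: "0 < \<delta>" "2 * (a^2 * \<delta>) + 2 * (b^2 * \<delta>) <= e" using small_eps[of e a b] by blast
 obtain m1 t1 c1 where 1: "unit_partition m1 t1" "sq_norm unit_square (%p. f p - case_prod (step2 m1 t1 c1) p) <= ennreal \<delta>"
  using f \<delta>(1) unfolding step2_approximable_def by blast
 obtain m2 t2 c2 where 2: "unit_partition m2 t2" "sq_norm unit_square (%p. g p - case_prod (step2 m2 t2 c2) p) <= ennreal \<delta>"
  using g \<delta>(1) unfolding step2_approximable_def by blast
 obtain m t where t: "unit_partition m t" "t1 ` {..m1} <= t ` {..m}" "t2 ` {..m2} <= t ` {..m}"
  using common_refinement[OF 1(1) 2(1)] by blast
 obtain c where c: "!!x y. x : {0..1} ==> y : {0..1} ==> step2 m t c x y = a * step2 m1 t1 c1 x y + b * step2 m2 t2 c2 x y"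
  by (rule step2_common[OF 1(1) 2(1) t, of a c1 b c2]) blast
 have "sq_norm unit_square (%x. a * f x + b * g x - case_prod (step2 m t c) x) =
   sq_norm unit_square (%x. a * (f x - case_prod (step2 m1 t1 c1) x) + b * (g x - case_prod (step2 m2 t2 c2) x))"
  by (rule sq_norm_cong) (auto simp: space_unit_square c algebra_simps)
 also have "... <= ennreal (2 * (a^2 * \<delta>) + 2 * (b^2 * \<delta>))"
  using \<delta>(1) by (intro sq_norm_linear_le 1 2) auto
 also have "... <= ennreal e" using \<delta>(2) by (rule ennreal_leI)
 finally show "EX m t d. unit_partition m t & sq_norm unit_square (%x. a * f x + b * g x - case_prod (step2 m t d) x) <= ennreal e"
  using t(1) by blast
qed

lemma step1_approximable_limit:
 assumes f [measurable]: "f : borm unit_unif"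
  and lim: "!!e. 0 < e ==> EX g. g : borm unit_unif & step1_approximable g &
   sq_norm unit_unif (%x. f x - g x) <= ennreal e"
 shows "step1_approximable f"
 unfolding step1_approximable_def
proof (intro conjI allI impI f)
 fix e :: real assume e: "0 < e"
 obtain g where [measurable]: "g : borm unit_unif" and g: "step1_approximable g"
  "sq_norm unit_unif (%x. f x - g x) <= ennreal (e / 4)"
  using lim[of "e / 4"] e by auto
 obtain m t c where t: "unit_partition m t" "sq_norm unit_unif (%x. g x - step1 m t c x) <= ennreal (e / 4)"
  using g(1) e unfolding step1_approximable_def by (meson zero_less_divide_iff zero_less_numeral)
 have "sq_norm unit_unif (%x. f x - step1 m t c x) <=
   2 * sq_norm unit_unif (%x. f x - g x) + 2 * sq_norm unit_unif (%x. g x - step1 m t c x)"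
  by (rule sq_norm_triangle) measurable
 also have "... <= ennreal (2 * (e / 4) + 2 * (e / 4))" using e by (intro ennreal_bound_2 g t) auto
 finally show "EX m t c. unit_partition m t & sq_norm unit_unif (%x. f x - step1 m t c x) <= ennreal e"
  using t(1) by auto
qed

lemma step2_approximable_limit:
 assumes f [measurable]: "f : borm unit_square"
  and lim: "!!e. 0 < e ==> EX g. g : borm unit_square & step2_approximable g &
   sq_norm unit_square (%x. f x - g x) <= ennreal e"
 shows "step2_approximable f"
 unfolding step2_approximable_def
proof (intro conjI allI impI f)
 fix e :: real assume e: "0 < e"
 obtain g where [measurable]: "g : borm unit_square" and g: "step2_approximable g"
  "sq_norm unit_square (%x. f x - g x) <= ennreal (e / 4)"
  using lim[of "e / 4"] e by auto
 obtain m t d where t: "unit_partition m t" "sq_norm unit_square (%x. g x - case_prod (step2 m t d) x) <= ennreal (e / 4)"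
  using g(1) e unfolding step2_approximable_def by (meson zero_less_divide_iff zero_less_numeral)
 have "sq_norm unit_square (%x. f x - case_prod (step2 m t d) x) <=
   2 * sq_norm unit_square (%x. f x - g x) + 2 * sq_norm unit_square (%x. g x - case_prod (step2 m t d) x)"
  by (rule sq_norm_triangle) measurable
 also have "... <= ennreal (2 * (e / 4) + 2 * (e / 4))" using e by (intro ennreal_bound_2 g t) auto
 finally show "EX m t d. unit_partition m t & sq_norm unit_square (%x. f x - case_prod (step2 m t d) x) <= ennreal e"
  using t(1) by auto
qed

lemma AE_unit_unif_pos: "AE x in unit_unif. 0 < x"
proof -
 have "AE x in lborel. x ~= (0::real)" by (rule AE_lborel_singleton)
 then show ?thesis
  unfolding unit_unif_def by (subst AE_restrict_space_iff) (auto elim: eventually_mono)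
qed

lemma step1_approximable_one: "step1_approximable (%_. 1)"
proof -
 have "step1 1 real (%_. 1) x = 1" if "0 < x" "x : {0..1}" for x
  using that by (simp add: step1_def)
 then have "AE x in unit_unif. 1 - step1 1 real (%_. 1) x = 0"
  using AE_unit_unif_pos by (auto intro: AE_mp)
 then have "sq_norm unit_unif (%x. 1 - step1 1 real (%_. 1) x) = sq_norm unit_unif (%x. 0)"
  by (rule sq_norm_cong_AE)
 then have "sq_norm unit_unif (%x. 1 - step1 1 real (%_. 1) x) <= ennreal e" for e
  by (simp add: sq_norm_def)
 then show ?thesis
  unfolding step1_approximable_def using trivial_partition by (intro conjI) (simp, blast)
qed

lemma step1_approximable_atMost: "step1_approximable (indicator ({..a} Int {0..1}))"
 unfolding step1_approximable_def
proof (intro conjI allI impI)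
 have "{..a} Int {0..1} : sets unit_unif" by (auto simp: unit_unif_def sets_restrict_space)
 then show "indicator ({..a} Int {0..1}) : borm unit_unif" by simp
 fix e :: real assume "0 < e"
 have "EX m t c. unit_partition m t & (ALL x. 0 < x --> x <= 1 --> indicator ({..a} Int {0..1}) x = step1 m t c x)"
 proof (cases "0 < a & a < 1")
  case True
  let ?t = "%k::nat. if k = 0 then 0 else if k = 1 then a else 1"
  have "unit_partition 2 ?t" using True by (auto simp: unit_partition_def less_2_cases_iff)
  moreover have "indicator ({..a} Int {0..1}) x = step1 2 ?t (%k. if k = 0 then 1 else 0) x" if "0 < x" "x <= 1" for x
   using that by (simp add: step1_def numeral_2_eq_2 indicator_def)
  ultimately show ?thesis by blast
 next
  case False
  have "indicator ({..a} Int {0..1}) x = step1 1 real (%_. if 1 <= a then 1 else 0) x" if "0 < x" "x <= 1" for x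
   using that False by (auto simp: step1_def indicator_def)
  then show ?thesis using trivial_partition by blast
 qed
 then obtain m t c where t: "unit_partition m t" and
  eq: "!!x. 0 < x ==> x <= 1 ==> indicator ({..a} Int {0..1}) x = step1 m t c x" by blast
 have "AE x in unit_unif. indicator ({..a} Int {0..1}) x - step1 m t c x = 0"
  using AE_unit_unif_pos AE_space by eventually_elim (use eq in auto)
 then have "sq_norm unit_unif (%x. indicator ({..a} Int {0..1}) x - step1 m t c x) = sq_norm unit_unif (%x. 0)"
  by (rule sq_norm_cong_AE)
 then have "sq_norm unit_unif (%x. indicator ({..a} Int {0..1}) x - step1 m t c x) <= ennreal e"
  by (simp add: sq_norm_def)
 then show "EX m t c. unit_partition m t & sq_norm unit_unif (%x. indicator ({..a} Int {0..1}) x - step1 m t c x) <= ennreal e"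
  using t by blast
qed

text \<open>The generator consists of half-lines cut down to the unit interval; their indicators are
  step functions up to the null point 0.\<close>

lemma step1_approximable_bounded:
 assumes "bdm unit_unif f"
 shows "step1_approximable f"
proof (rule L2_induct[where P = step1_approximable and f = f and M = unit_unif and G = "(%a. {..a} Int {0..1}) ` UNIV"])
 have borel: "sets (borel :: real measure) = sigma_sets UNIV (range atMost)"
  by (subst borel_eq_atMost, rule sets_measure_of) simp
 have "sets unit_unif = (\<inter>) {0..1} ` sigma_sets UNIV (range atMost)"
  unfolding unit_unif_def sets_restrict_space by (simp only: sets_lborel borel)
 also have "... = sigma_sets {0..1} ((\<inter>) {0..1} ` range atMost)"
 proof (rule sigma_sets_Int)
  have "{0..1::real} : sets borel" by (rule borel_closed[OF closed_atLeastAtMost])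
  then show "{0..1::real} : sigma_sets UNIV (range atMost)" by (simp only: borel)
 qed simp
 also have "(\<inter>) {0..1} ` range atMost = (%a::real. {..a} Int {0..1}) ` UNIV"
  by (simp only: image_image Int_commute)
 finally show "sets unit_unif = sigma_sets (space unit_unif) ((%a. {..a} Int {0..1}) ` UNIV)" by (simp only: space_unit_unif)
 show "Int_stable (range (%a::real. {..a} Int {0..1}))"
 proof (rule Int_stableI)
  fix A B :: "real set" assume "A : range (%a. {..a} Int {0..1})" "B : range (%a. {..a} Int {0..1})"
  then obtain a b where "A = {..a} Int {0..1}" "B = {..b} Int {0..1}" by auto
  then have "A Int B = {..min a b} Int {0..1}" by auto
  then show "A Int B : range (%a. {..a} Int {0..1})" by (rule range_eqI)
 qed
 show "step1_approximable (indicator A)" if "A : range (%a. {..a} Int {0..1})" for A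
  using that step1_approximable_atMost by auto
 show "bdm unit_unif f" by fact
 show "prob_space unit_unif" by (rule prob_space_unit_unif)
 show "range (%a::real. {..a} Int {0..1}) <= Pow (space unit_unif)" by auto
qed (fact step1_approximable_one step1_approximable_linear step1_approximable_limit)+

lemma bdm_indicator: "A : sets M ==> bdm M (indicator A :: _ => real)"
 by (rule bdmI[where C = 1]) (auto simp: indicator_def)

text \<open>Both sides of the rectangle are approximated by step functions of one variable; their
  product is then approximated by diagonal-free step functions on a finer mesh.\<close>

lemma step2_approximable_rect:
 assumes A [measurable]: "A : sets unit_unif" and B [measurable]: "B : sets unit_unif"
 shows "step2_approximable (indicator (A \<times> B))"
proof (rule step2_approximable_limit)
 show "indicator (A \<times> B) : borm unit_square" by measurable
 fix e :: real assume e: "0 < e"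
 \<comment> \<open>For \<open>\<delta> <= 1\<close> the squared norm of the first approximant is at
   most 4, so the two errors add up to at most 2 \<delta> + 8 \<delta> = 10 \<delta>.\<close>
 define \<delta> where "\<delta> = min 1 (e / 10)"
 have \<delta>: "0 < \<delta>" "\<delta> <= 1" "10 * \<delta> <= e" using e by (auto simp: \<delta>_def)
 obtain m1 t1 c1 where 1: "unit_partition m1 t1" "sq_norm unit_unif (%x. indicator A x - step1 m1 t1 c1 x) <= ennreal \<delta>"
  using step1_approximable_bounded[OF bdm_indicator[OF A]] \<delta>(1) unfolding step1_approximable_def by blast
 obtain m2 t2 c2 where 2: "unit_partition m2 t2" "sq_norm unit_unif (%x. indicator B x - step1 m2 t2 c2 x) <= ennreal \<delta>"
  using step1_approximable_bounded[OF bdm_indicator[OF B]] \<delta>(1) unfolding step1_approximable_def by blast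
 let ?u = "step1 m1 t1 c1" and ?v = "step1 m2 t2 c2"
 have ind: "sq_norm unit_unif (indicator C) <= ennreal 1" for C :: "real set"
 proof -
  interpret U: prob_space unit_unif by (rule prob_space_unit_unif)
  have "sq_norm unit_unif (indicator C) <= (\<integral>\<^sup>+x. 1 \<partial>unit_unif)"
   unfolding sq_norm_def by (intro nn_integral_mono) (simp add: indicator_def)
  then show ?thesis using U.emeasure_space_1 by simp
 qed
 have "sq_norm unit_unif (%x. ?u x - indicator A x) <= ennreal \<delta>" using 1(2) by (subst sq_norm_commute)
 then have "2 * sq_norm unit_unif (%x. ?u x - indicator A x) + 2 * sq_norm unit_unif (indicator A) <= ennreal (2 * \<delta> + 2 * 1)"
  using \<delta>(1) by (intro ennreal_bound_2 ind) auto
 then have u: "sq_norm unit_unif ?u <= ennreal (2 * \<delta> + 2 * 1)"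
  using sq_norm_add_le[of "%x. ?u x - indicator A x" unit_unif "indicator A"] by (auto intro: order_trans)
 let ?g = "%p. ?u (fst p) * ?v (snd p)"
 have g: "?g : borm unit_square" by measurable
 have "step2_approximable ?g"
  unfolding step2_approximable_def
 proof (intro conjI allI impI g)
  fix e' :: real assume e': "0 < e'"
  obtain m t where t: "unit_partition m t" "t1 ` {..m1} <= t ` {..m}" "t2 ` {..m2} <= t ` {..m}"
   using common_refinement[OF 1(1) 2(1)] by blast
  let ?c = "%j. step1 m1 t1 c1 (t (Suc j))" and ?c' = "%j. step1 m2 t2 c2 (t (Suc j))"
  obtain m' t' d where t': "unit_partition m' t'"
   "sq_norm unit_square (%p. step1 m t ?c (fst p) * step1 m t ?c' (snd p) - case_prod (step2 m' t' d) p) <= ennreal e'"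
   by (rule sq_norm_tensor_step2_le[OF t(1) e', of ?c ?c'])
  have "sq_norm unit_square (%p. ?g p - case_prod (step2 m' t' d) p) =
    sq_norm unit_square (%p. step1 m t ?c (fst p) * step1 m t ?c' (snd p) - case_prod (step2 m' t' d) p)"
   by (rule sq_norm_cong)
    (auto simp: space_unit_square step1_refine(1)[OF 1(1) t(1,2), symmetric] step1_refine(1)[OF 2(1) t(1,3), symmetric])
  then have "sq_norm unit_square (%p. ?g p - case_prod (step2 m' t' d) p) <= ennreal e'"
   using t'(2) by (simp only:)
  then show "EX m t d. unit_partition m t & sq_norm unit_square (%p. ?g p - case_prod (step2 m t d) p) <= ennreal e'"
   using t'(1) by blast
 qed
 moreover have "sq_norm unit_square (%p. indicator (A \<times> B) p - ?g p) <= ennreal e"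
 proof -
  have "sq_norm unit_square (%p. indicator (A \<times> B) p - ?g p) =
    sq_norm unit_square (%p. (indicator A (fst p) - ?u (fst p)) * indicator B (snd p) +
     ?u (fst p) * (indicator B (snd p) - ?v (snd p)))"
   by (rule sq_norm_cong) (auto simp: indicator_times algebra_simps)
  also have "... <= 2 * sq_norm unit_square (%p. (indicator A (fst p) - ?u (fst p)) * indicator B (snd p)) +
    2 * sq_norm unit_square (%p. ?u (fst p) * (indicator B (snd p) - ?v (snd p)))"
   by (rule sq_norm_add_le) measurable
  also have "sq_norm unit_square (%p. (indicator A (fst p) - ?u (fst p)) * indicator B (snd p)) =
    sq_norm unit_unif (%x. indicator A x - ?u x) * sq_norm unit_unif (indicator B)"
   by (rule sq_norm_tensor) measurable
  also have "sq_norm unit_square (%p. ?u (fst p) * (indicator B (snd p) - ?v (snd p))) =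
    sq_norm unit_unif ?u * sq_norm unit_unif (%x. indicator B x - ?v x)"
   by (rule sq_norm_tensor) measurable
  also have "2 * (sq_norm unit_unif (%x. indicator A x - ?u x) * sq_norm unit_unif (indicator B)) +
    2 * (sq_norm unit_unif ?u * sq_norm unit_unif (%x. indicator B x - ?v x)) <=
    ennreal (2 * (\<delta> * 1) + 2 * ((2 * \<delta> + 2 * 1) * \<delta>))"
  proof (rule ennreal_bound_2)
   show "sq_norm unit_unif (%x. indicator A x - ?u x) * sq_norm unit_unif (indicator B) <= ennreal (\<delta> * 1)"
   proof -
    have "sq_norm unit_unif (%x. indicator A x - ?u x) * sq_norm unit_unif (indicator B) <= ennreal \<delta> * ennreal 1"
     by (intro mult_mono 1 ind) auto
    then show ?thesis by simp
   qed
   show "sq_norm unit_unif ?u * sq_norm unit_unif (%x. indicator B x - ?v x) <= ennreal ((2 * \<delta> + 2 * 1) * \<delta>)"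
   proof -
    have "sq_norm unit_unif ?u * sq_norm unit_unif (%x. indicator B x - ?v x) <= ennreal (2 * \<delta> + 2 * 1) * ennreal \<delta>"
     by (intro mult_mono u 2) auto
    then show ?thesis using \<delta>(1) by (simp only: ennreal_mult)
   qed
  qed (use \<delta> in auto)
  also have "... <= ennreal e"
  proof (rule ennreal_leI)
   have "(2 * \<delta> + 2 * 1) * \<delta> <= 4 * \<delta>" using \<delta> by (intro mult_right_mono) auto
   then show "2 * (\<delta> * 1) + 2 * ((2 * \<delta> + 2 * 1) * \<delta>) <= e" using \<delta> by linarith
  qed
  finally show ?thesis .
 qed
 ultimately show "EX g. g : borm unit_square & step2_approximable g &
   sq_norm unit_square (%x. indicator (A \<times> B) x - g x) <= ennreal e"
  using g by blast
qed

lemma step2_approximable_bounded: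
 assumes "bdm unit_square f"
 shows "step2_approximable f"
proof (rule L2_induct[where P = step2_approximable and f = f and M = unit_square and G = "{a \<times> b |a b. a : sets unit_unif & b : sets unit_unif}"])
 show "sets unit_square = sigma_sets (space unit_square) {a \<times> b |a b. a : sets unit_unif & b : sets unit_unif}"
  by (simp only: sets_pair_measure space_pair_measure)
 show "Int_stable {a \<times> b |a b. a : sets unit_unif & b : sets unit_unif}"
  by (rule Int_stable_pair_measure_generator)
 show "{a \<times> b |a b. a : sets unit_unif & b : sets unit_unif} <= Pow (space unit_square)"
  using sets.sets_into_space[of _ unit_unif] by (fastforce simp: space_pair_measure)
 show "step2_approximable (indicator A)" if "A : {a \<times> b |a b. a : sets unit_unif & b : sets unit_unif}" for A
  using that step2_approximable_rect by auto
 have "step2_approximable (indicator (space unit_unif \<times> space unit_unif))"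
  by (rule step2_approximable_rect[OF sets.top sets.top])
 note sq1 = this
 show "step2_approximable (%_. 1)"
 proof (rule step2_approximable_limit)
  fix e :: real
  note sq1
  moreover have "sq_norm unit_square (%x. 1 - indicator (space unit_unif \<times> space unit_unif) x) = sq_norm unit_square (%_. 0)"
   by (rule sq_norm_cong) (auto simp: space_pair_measure)
  ultimately show "EX g. g : borm unit_square & step2_approximable g & sq_norm unit_square (%x. 1 - g x) <= ennreal e"
   by (intro exI[of _ "indicator (space unit_unif \<times> space unit_unif)"]) (auto simp: sq_norm_def step2_approximable_def)
 qed simp
 show "bdm unit_square f" by fact
 show "prob_space unit_square" by (rule prob_space_unit_square)
qed (fact step2_approximable_linear step2_approximable_limit)+

section \<open>Counting copies by injective homomorphisms\<close>

definition inj_maps :: "'a set => 'b set => ('a => 'b) set" where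
 "inj_maps V A = {em : V \<rightarrow>\<^sub>E A. inj_on em V}"

lemma finite_inj_maps [simp]: "finite V ==> finite A ==> finite (inj_maps V A)"
 by (rule finite_subset[OF _ finite_PiE[of V "%_. A"]]) (auto simp: inj_maps_def)

lemma inj_mapsD:
 assumes "em : inj_maps V A"
 shows "inj_on em V" "!!a. a : V ==> em a : A" "em ` V <= A"
 using assms by (auto simp: inj_maps_def)

lemma card_inj_maps:
 assumes "finite V" "finite A"
 shows "real (card (inj_maps V A)) = falling_factorial (card A) (card V)"
proof -
 have c: "card (inj_maps V A) = (\<Prod>i<card V. card A - i)"
  using card_inj_on_subset_funcset[OF assms subset_refl] by (simp add: inj_maps_def atLeast0LessThan)
 show ?thesis
 proof (cases "card V <= card A")
  case True
  then show ?thesis unfolding c falling_factorial_def by (simp add: of_nat_prod of_nat_diff)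
 next
  case False
  \<comment> \<open>The index \<open>card A\<close> is below \<open>card V\<close> and gives a
    vanishing factor in both products.\<close>
  then have "(\<Prod>i<card V. card A - i) = 0" "falling_factorial (card A) (card V) = 0"
   unfolding falling_factorial_def by (auto intro!: bexI[of _ "card A"])
  then show ?thesis unfolding c by simp
 qed
qed

lemma card_inj_maps_fixed:
 assumes V: "finite V" "finite A" "C <= V" and c0: "inj_on c0 C" "c0 ` C <= A"
 shows "card {em : inj_maps V A. ALL a:C. em a = c0 a} = card (inj_maps (V - C) (A - c0 ` C))"
proof (rule bij_betw_same_card)
 let ?f = "%em. restrict em (V - C)" and ?g = "%\<psi>. \<lambda>a\<in>V. if a : C then c0 a else \<psi> a"
 show "bij_betw ?f {em : inj_maps V A. ALL a:C. em a = c0 a} (inj_maps (V - C) (A - c0 ` C))"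
 proof (rule bij_betw_byWitness[where f' = ?g])
  show "ALL em:{em : inj_maps V A. ALL a:C. em a = c0 a}. ?g (?f em) = em"
   using V(3) by (auto simp: inj_maps_def fun_eq_iff PiE_iff extensional_def)
  show "\<forall>\<psi>\<in>inj_maps (V - C) (A - c0 ` C). ?f (?g \<psi>) = \<psi>"
   by (auto simp: inj_maps_def fun_eq_iff PiE_iff extensional_def)
  show "?f ` {em : inj_maps V A. ALL a:C. em a = c0 a} <= inj_maps (V - C) (A - c0 ` C)"
  proof (intro image_subsetI)
   fix em assume p: "em : {em : inj_maps V A. ALL a:C. em a = c0 a}"
   then have i: "inj_on em V" "!!a. a : V ==> em a : A" "!!a. a : C ==> em a = c0 a"
    by (auto dest: inj_mapsD)
   have "em a ~: c0 ` C" if "a : V - C" for a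
   proof
    assume "em a : c0 ` C"
    then obtain b where "b : C" "em a = em b" using i(3) by auto
    then show False using inj_onD[OF i(1)] that V(3) by auto
   qed
   then show "?f em : inj_maps (V - C) (A - c0 ` C)"
    using i by (auto simp: inj_maps_def inj_on_def)
  qed
  show "?g ` inj_maps (V - C) (A - c0 ` C) <= {em : inj_maps V A. ALL a:C. em a = c0 a}"
  proof (intro image_subsetI)
   fix \<psi> assume p: "\<psi> : inj_maps (V - C) (A - c0 ` C)"
   then have i: "inj_on \<psi> (V - C)" "!!a. a : V - C ==> \<psi> a : A - c0 ` C"
    by (auto dest: inj_mapsD)
   have "inj_on (?g \<psi>) V"
   proof (rule inj_onI)
    fix a b assume ab: "a : V" "b : V" "?g \<psi> a = ?g \<psi> b"
    show "a = b"
    proof (cases "a : C"; cases "b : C")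
     assume "a : C" "b : C" then show ?thesis using ab inj_onD[OF c0(1)] by auto
    next
     assume "a : C" "b ~: C" then show ?thesis using ab i(2)[of b] imageI[of a C c0] by auto
    next
     assume "a ~: C" "b : C" then show ?thesis using ab i(2)[of a] imageI[of b C c0] by auto
    next
     assume "a ~: C" "b ~: C" then show ?thesis using ab inj_onD[OF i(1)] by auto
    qed
   qed
   moreover have "?g \<psi> : V \<rightarrow>\<^sub>E A" using i(2) c0(2) by (auto simp: image_subset_iff)
   ultimately show "?g \<psi> : {em : inj_maps V A. ALL a:C. em a = c0 a}"
    using V(3) by (auto simp: inj_maps_def)
  qed
 qed
qed

text \<open>Each position is taken by the vertex \<open>a\<close> in equally many embeddings. In
  this way sums of first-order projections become linear statistics; the version for two vertices
  produces the quadratic and noise statistics.\<close>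

lemma sum_inj_maps_1:
 fixes F :: "nat => real"
 assumes V: "finite V" "a : V"
 shows "(SUM em:inj_maps V {1..n}. F (em a)) = falling_factorial (n - 1) (card V - 1) * (SUM i:{1..n}. F i)"
proof -
 have "(SUM em:inj_maps V {1..n}. F (em a)) = (SUM i:{1..n}. SUM em:{em\<in>inj_maps V {1..n}. em a = i}. F (em a))"
  using V by (intro sum.group[symmetric]) (auto dest: inj_mapsD(2)[OF _ V(2)])
 also have "... = (SUM i:{1..n}. falling_factorial (n - 1) (card V - 1) * F i)"
 proof (rule sum.cong[OF refl])
  fix i assume i: "i : {1..n}"
  have "card {em\<in>inj_maps V {1..n}. em a = i} = card (inj_maps (V - {a}) ({1..n} - {i}))"
   using card_inj_maps_fixed[of V "{1..n}" "{a}" "%_. i"] V i by simp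
  then have "real (card {em\<in>inj_maps V {1..n}. em a = i}) = falling_factorial (n - 1) (card V - 1)"
   using card_inj_maps[of "V - {a}" "{1..n} - {i}"] V i by simp
  moreover have "(SUM em:{em\<in>inj_maps V {1..n}. em a = i}. F (em a)) = (SUM em:{em\<in>inj_maps V {1..n}. em a = i}. F i)"
   by (intro sum.cong) auto
  ultimately show "(SUM em:{em\<in>inj_maps V {1..n}. em a = i}. F (em a)) = falling_factorial (n - 1) (card V - 1) * F i"
   by simp
 qed
 finally show ?thesis by (simp add: sum_distrib_left)
qed

definition distinct_pairs :: "nat => (nat \<times> nat) set" where
 "distinct_pairs n = {(i, j). i : {1..n} & j : {1..n} & i ~= j}"

lemma finite_distinct_pairs [simp]: "finite (distinct_pairs n)"
 by (rule finite_subset[of _ "{1..n} \<times> {1..n}"]) (auto simp: distinct_pairs_def)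

lemma sum_inj_maps_2:
 fixes F :: "nat => nat => real"
 assumes V: "finite V" "a : V" "b : V" "a ~= b"
 shows "(SUM em:inj_maps V {1..n}. F (em a) (em b)) =
  falling_factorial (n - 2) (card V - 2) * (SUM (i, j):distinct_pairs n. F i j)"
proof -
 have im: "(%em. (em a, em b)) ` inj_maps V {1..n} <= distinct_pairs n"
 proof (intro image_subsetI)
  fix em assume p: "em : inj_maps V {1..n}"
  have "em a ~= em b" using inj_onD[OF inj_mapsD(1)[OF p] _ V(2,3)] V(4) by auto
  then show "(em a, em b) : distinct_pairs n"
   using inj_mapsD(2)[OF p V(2)] inj_mapsD(2)[OF p V(3)] by (simp add: distinct_pairs_def)
 qed
 have "(SUM em:inj_maps V {1..n}. F (em a) (em b)) =
   (SUM p:distinct_pairs n. SUM em:{em\<in>inj_maps V {1..n}. (em a, em b) = p}. F (em a) (em b))"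
  using V by (intro sum.group[symmetric] im) auto
 also have "... = (SUM p:distinct_pairs n. falling_factorial (n - 2) (card V - 2) * F (fst p) (snd p))"
 proof (rule sum.cong[OF refl])
  fix p assume p: "p : distinct_pairs n"
  obtain i j where ij: "p = (i, j)" "i : {1..n}" "j : {1..n}" "i ~= j"
   using p by (auto simp: distinct_pairs_def)
  let ?c = "%x. if x = a then i else j"
  have "{em\<in>inj_maps V {1..n}. (em a, em b) = p} = {em\<in>inj_maps V {1..n}. ALL x:{a, b}. em x = ?c x}"
   using V(4) ij by auto
  also have "card ... = card (inj_maps (V - {a, b}) ({1..n} - ?c ` {a, b}))"
   using V ij by (intro card_inj_maps_fixed) (auto simp: inj_on_def)
  also have "?c ` {a, b} = {i, j}" using V(4) by auto
  finally have "real (card {em\<in>inj_maps V {1..n}. (em a, em b) = p}) = falling_factorial (n - 2) (card V - 2)"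
   using card_inj_maps[of "V - {a, b}" "{1..n} - {i, j}"] V ij by (simp add: card_Diff_subset numeral_2_eq_2)
  moreover have "(SUM em:{em\<in>inj_maps V {1..n}. (em a, em b) = p}. F (em a) (em b)) =
    (SUM em:{em\<in>inj_maps V {1..n}. (em a, em b) = p}. F i j)"
   using ij by (intro sum.cong) auto
  ultimately show "(SUM em:{em\<in>inj_maps V {1..n}. (em a, em b) = p}. F (em a) (em b)) =
   falling_factorial (n - 2) (card V - 2) * F (fst p) (snd p)" using ij by (simp add: numeral_2_eq_2)
 qed
 finally show ?thesis by (simp add: sum_distrib_left split_beta')
qed

section \<open>Copies as images of injective homomorphisms\<close>

lemma simple_graph_edges_eq:
 "simple_graph S ==> edges S = {(x, y). x < y & (x, y) : ordered_edges S}"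
 by (auto simp: simple_graph_def ordered_edges_def)

lemma ordered_edges_sym: "(a, b) : ordered_edges G \<longleftrightarrow> (b, a) : ordered_edges G"
 by (auto simp: ordered_edges_def)

lemma ordered_edges_verts: "simple_graph G ==> (a, b) : ordered_edges G ==> a : verts G & b : verts G & a ~= b"
 by (auto simp: simple_graph_def ordered_edges_def)

lemma finite_edges: "simple_graph G ==> finite (edges G)"
 by (rule finite_subset[of _ "verts G \<times> verts G"]) (auto simp: simple_graph_def)

definition inj_homs :: "sgraph => sgraph => (nat => nat) set" where
 "inj_homs H G = {em : inj_maps (verts H) (verts G). ALL (a, b):edges H. (em a, em b) : ordered_edges G}"

text \<open>Edges are stored in increasing order, which an embedding need not respect. Therefore the
  image is taken of the ordered edges and sorted afterwards.\<close>

definition image_graph :: "sgraph => (nat => nat) => sgraph" where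
 "image_graph H em = \<lparr>verts = em ` verts H, edges = {(x, y). x < y & (x, y) : map_prod em em ` ordered_edges H}\<rparr>"

lemma ordered_edges_image_graph:
 assumes H: "simple_graph H" and i: "inj_on em (verts H)"
 shows "ordered_edges (image_graph H em) = map_prod em em ` ordered_edges H"
proof -
 define I where "I = map_prod em em ` ordered_edges H"
 have s: "(y, x) : I" if xy: "(x, y) : I" for x y
 proof -
  obtain a b where ab: "(a, b) : ordered_edges H" "x = em a" "y = em b" using xy by (auto simp: I_def)
  have "(b, a) : ordered_edges H" using ab(1) by (rule ordered_edges_sym[THEN iffD1])
  then show ?thesis unfolding I_def by (rule rev_image_eqI) (simp add: ab)
 qed
 have ne: "x ~= y" if "(x, y) : I" for x y
  using that ordered_edges_verts[OF H] inj_onD[OF i] by (auto simp: I_def)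
 have G: "edges (image_graph H em) = {(x, y). x < y & (x, y) : I}" by (simp add: image_graph_def I_def)
 have "(x, y) : ordered_edges (image_graph H em) \<longleftrightarrow> (x, y) : I" for x y
  using s[of x y] s[of y x] ne[of x y] unfolding ordered_edges_def G
  by (cases x y rule: linorder_cases) auto
 then show ?thesis unfolding I_def by auto
qed

lemma simple_graph_image_graph:
 assumes H: "simple_graph H"
 shows "simple_graph (image_graph H em)"
 using H ordered_edges_verts[OF H] by (auto simp: simple_graph_def image_graph_def)

lemma image_graph_eq_iff:
 assumes H: "simple_graph H" and S: "simple_graph S" "verts S <= verts G" "edges S <= edges G"
  and ext: "em : extensional (verts H)"
 shows "em : inj_homs H G & image_graph H em = S \<longleftrightarrow> graph_iso em H S"
proof
 assume a: "em : inj_homs H G & image_graph H em = S"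
 then have i: "inj_on em (verts H)" by (auto simp: inj_homs_def inj_maps_def)
 have "(a, b) : ordered_edges H \<longleftrightarrow> (em a, em b) : map_prod em em ` ordered_edges H"
  if "a : verts H" "b : verts H" for a b
 proof
  assume "(a, b) : ordered_edges H"
  then show "(em a, em b) : map_prod em em ` ordered_edges H" by (rule rev_image_eqI) simp
 next
  assume "(em a, em b) : map_prod em em ` ordered_edges H"
  then obtain a' b' where e: "(a', b') : ordered_edges H" "em a = em a'" "em b = em b'" by auto
  have "a' : verts H" "b' : verts H" using ordered_edges_verts[OF H e(1)] by auto
  then have "a = a'" "b = b'" using inj_onD[OF i] e that by auto
  then show "(a, b) : ordered_edges H" using e(1) by simp
 qed
 then have "ALL a:verts H. ALL b:verts H. (a, b) : ordered_edges H \<longleftrightarrow> (em a, em b) : ordered_edges (image_graph H em)"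
  by (simp add: ordered_edges_image_graph[OF H i])
 moreover have "bij_betw em (verts H) (verts (image_graph H em))"
  using i by (simp add: bij_betw_def image_graph_def)
 ultimately show "graph_iso em H S" using a by (auto simp: graph_iso_def)
next
 assume iso: "graph_iso em H S"
 then have i: "inj_on em (verts H)" and v: "em ` verts H = verts S" by (auto simp: graph_iso_def bij_betw_def)
 have e: "(a, b) : ordered_edges H \<longleftrightarrow> (em a, em b) : ordered_edges S" if "a : verts H" "b : verts H" for a b
  using iso that by (auto simp: graph_iso_def)
 have "(em a, em b) : ordered_edges G" if "(a, b) : edges H" for a b
 proof -
  have "(a, b) : ordered_edges H" "a : verts H" "b : verts H"
   using that H by (auto simp: simple_graph_def ordered_edges_def)
  then have "(em a, em b) : ordered_edges S" using e by simp
  then show ?thesis using S(3) by (auto simp: ordered_edges_def)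
 qed
 then have "em : inj_homs H G"
  using i v S(2) ext by (auto simp: inj_homs_def inj_maps_def PiE_iff)
 moreover have "map_prod em em ` ordered_edges H = ordered_edges S"
 proof (intro set_eqI iffI)
  fix p assume "p : map_prod em em ` ordered_edges H"
  then show "p : ordered_edges S" using e ordered_edges_verts[OF H] by auto
 next
  fix p assume p: "p : ordered_edges S"
  obtain x y where xy: "p = (x, y)" by (cases p)
  then have "x : em ` verts H" "y : em ` verts H" using p ordered_edges_verts[OF S(1)] v by auto
  then obtain a b where "a : verts H" "b : verts H" "x = em a" "y = em b" by auto
  then show "p : map_prod em em ` ordered_edges H" using p e xy by auto
 qed
 then have "image_graph H em = S"
  using simple_graph_edges_eq[OF S(1)] v by (intro sgraph.equality) (auto simp: image_graph_def)
 ultimately show "em : inj_homs H G & image_graph H em = S" by simp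
qed

lemma graph_iso_cong:
 assumes "!!a. a : verts H ==> f a = g a"
 shows "graph_iso f H S \<longleftrightarrow> graph_iso g H S"
 using assms bij_betw_cong[of "verts H" f g "verts S"] by (simp add: graph_iso_def)

text \<open>The isomorphisms onto \<open>S\<close> form a torsor of the automorphism group, with
  \<open>f\<close> as base point. Automorphisms are the identity off the vertex set while embeddings
  are \<open>undefined\<close> there; \<open>?F\<close> and \<open>?G\<close> translate between the
  two conventions.\<close>

lemma card_graph_isos:
 assumes iso: "graph_iso f H S"
 shows "card {em : extensional (verts H). graph_iso em H S} = card (Aut H)"
proof (rule sym, rule bij_betw_same_card)
 let ?V = "verts H"
 let ?F = "%\<sigma>. \<lambda>a\<in>?V. f (\<sigma> a)" and ?G = "%em a. if a : ?V then inv_into ?V f (em a) else a"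
 have f: "inj_on f ?V" "f ` ?V = verts S" using iso by (auto simp: graph_iso_def bij_betw_def)
 have fe: "(a, b) : ordered_edges H \<longleftrightarrow> (f a, f b) : ordered_edges S" if "a : ?V" "b : ?V" for a b
  using iso that by (auto simp: graph_iso_def)
 show "bij_betw ?F (Aut H) {em : extensional ?V. graph_iso em H S}"
 proof (rule bij_betw_byWitness[where f' = ?G])
  show "\<forall>\<sigma>\<in>Aut H. ?G (?F \<sigma>) = \<sigma>"
  proof (intro ballI ext)
   fix \<sigma> a assume s: "\<sigma> : Aut H"
   show "?G (?F \<sigma>) a = \<sigma> a"
   proof (cases "a : ?V")
    case True
    then have "\<sigma> a : ?V" using s by (simp add: Aut_def permutes_in_image)
    then show ?thesis using True by (simp add: inv_into_f_f[OF f(1)])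
   next
    case False
    then show ?thesis using s permutes_not_in[of \<sigma> ?V a] by (simp add: Aut_def)
   qed
  qed
  show "ALL em:{em : extensional ?V. graph_iso em H S}. ?F (?G em) = em"
  proof (intro ballI ext)
   fix em a assume p: "em : {em : extensional ?V. graph_iso em H S}"
   show "?F (?G em) a = em a"
   proof (cases "a : ?V")
    case True
    then have "em a : f ` ?V" using p f(2) by (auto simp: graph_iso_def bij_betw_def)
    then show ?thesis using True by (simp add: f_inv_into_f)
   next
    case False
    then show ?thesis using p by (simp add: extensional_def)
   qed
  qed
  show "?F ` Aut H <= {em : extensional ?V. graph_iso em H S}"
  proof (intro image_subsetI CollectI conjI)
   fix \<sigma> assume s: "\<sigma> : Aut H"
   then have b: "bij_betw \<sigma> ?V ?V" and e: "!!a b. a : ?V ==> b : ?V ==> (a, b) : ordered_edges H \<longleftrightarrow> (\<sigma> a, \<sigma> b) : ordered_edges H"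
    by (auto simp: Aut_def graph_iso_def)
   have "graph_iso (f \<circ> \<sigma>) H S"
    unfolding graph_iso_def
    using bij_betw_trans[OF b] iso e fe bij_betwE[OF b] by (auto simp: graph_iso_def)
   then show "graph_iso (?F \<sigma>) H S" by (subst graph_iso_cong[of H _ "f \<circ> \<sigma>"]) auto
  qed simp
  show "?G ` {em : extensional ?V. graph_iso em H S} <= Aut H"
  proof (intro image_subsetI)
   fix em assume p: "em : {em : extensional ?V. graph_iso em H S}"
   then have b: "bij_betw em ?V (verts S)" by (auto simp: graph_iso_def)
   have "bij_betw (inv_into ?V f \<circ> em) ?V ?V"
    by (rule bij_betw_trans[OF b bij_betw_inv_into]) (use f in \<open>simp add: bij_betw_def\<close>)
   then have bg: "bij_betw (?G em) ?V ?V" by (rule bij_betw_cong[THEN iffD1, rotated]) simp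
   then have "?G em permutes ?V" by (rule bij_imp_permutes) simp
   moreover have "(a, b) : ordered_edges H \<longleftrightarrow> (?G em a, ?G em b) : ordered_edges H" if ab: "a : ?V" "b : ?V" for a b
   proof -
    have "em a : f ` ?V" "em b : f ` ?V" using b ab f(2) by (auto simp: bij_betw_def)
    then have "f (?G em a) = em a" "f (?G em b) = em b" using ab by (auto simp: f_inv_into_f)
    moreover have "?G em a : ?V" "?G em b : ?V" using bij_betwE[OF bg] ab by blast+
    ultimately show ?thesis using fe[of "?G em a" "?G em b"] p ab by (auto simp: graph_iso_def)
   qed
   ultimately show "?G em : Aut H" using bg unfolding Aut_def graph_iso_def by blast
  qed
 qed
qed

lemma finite_Aut: "simple_graph H ==> finite (Aut H)"
 by (rule finite_subset[OF _ finite_permutations[of "verts H"]]) (auto simp: Aut_def simple_graph_def)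

lemma card_Aut_pos: "simple_graph H ==> 0 < card (Aut H)"
 using finite_Aut[of H] by (auto simp: card_gt_0_iff Aut_def graph_iso_def intro!: exI[of _ id])

lemma finite_copies:
 assumes "simple_graph G"
 shows "finite (copies H G)"
proof (rule finite_subset)
 show "copies H G <= (%(V, E). \<lparr>verts = V, edges = E\<rparr>) ` (Pow (verts G) \<times> Pow (edges G))"
 proof
  fix S assume "S : copies H G"
  then have "(verts S, edges S) : Pow (verts G) \<times> Pow (edges G)" by (auto simp: copies_def)
  then show "S : (%(V, E). \<lparr>verts = V, edges = E\<rparr>) ` (Pow (verts G) \<times> Pow (edges G))"
   by (rule rev_image_eqI) simp
 qed
 show "finite ((%(V, E). \<lparr>verts = V, edges = E :: (nat \<times> nat) set\<rparr>) ` (Pow (verts G) \<times> Pow (edges G)))"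
  using assms finite_edges[OF assms] by (intro finite_imageI finite_cartesian_product) (auto simp: simple_graph_def)
qed

text \<open>Sending an injective homomorphism to its image maps onto the copies, and each fibre
  consists of the isomorphisms onto one copy.\<close>

lemma card_inj_homs:
 assumes H: "simple_graph H" and G: "simple_graph G"
 shows "card (inj_homs H G) = card (Aut H) * subgraph_count H G"
proof -
 have fin: "finite (inj_homs H G)"
  using H G by (intro finite_subset[OF _ finite_inj_maps[of "verts H" "verts G"]])
   (auto simp: inj_homs_def simple_graph_def)
 have ext: "em : extensional (verts H)" if "em : inj_homs H G" for em
  using that by (auto simp: inj_homs_def inj_maps_def PiE_iff)
 have im: "image_graph H ` inj_homs H G <= copies H G"
 proof (intro image_subsetI)
  fix em assume p: "em : inj_homs H G"
  have i: "inj_on em (verts H)" "em ` verts H <= verts G" using p by (auto simp: inj_homs_def inj_maps_def)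
  have e: "edges (image_graph H em) <= edges G"
  proof
   fix q assume q: "q : edges (image_graph H em)"
   then obtain a b where ab: "q = (em a, em b)" "em a < em b" "(a, b) : ordered_edges H"
    by (auto simp: image_graph_def)
   then have "(a, b) : edges H \<or> (b, a) : edges H" by (auto simp: ordered_edges_def)
   then have "(em a, em b) : ordered_edges G" using p ordered_edges_sym by (auto simp: inj_homs_def)
   then show "q : edges G" using ab simple_graph_edges_eq[OF G] by auto
  qed
  have v: "verts (image_graph H em) <= verts G" using i by (simp add: image_graph_def)
  have "graph_iso em H (image_graph H em)"
   using image_graph_eq_iff[OF H simple_graph_image_graph[OF H] v e ext[OF p]] p by simp
  then show "image_graph H em : copies H G"
   using simple_graph_image_graph[OF H] v e by (auto simp: copies_def)
 qed
 have "card (inj_homs H G) = (SUM S:copies H G. SUM em:{em\<in>inj_homs H G. image_graph H em = S}. 1)"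
  using sum.group[OF fin finite_copies[OF G] im, of "%_. 1 :: nat"] by simp
 also have "... = (SUM S:copies H G. card (Aut H))"
 proof (rule sum.cong[OF refl])
  fix S assume S: "S : copies H G"
  then obtain f where f: "graph_iso f H S" by (auto simp: copies_def)
  have "{em\<in>inj_homs H G. image_graph H em = S} = {em : extensional (verts H). graph_iso em H S}"
   using image_graph_eq_iff[OF H, of S G] S ext by (auto simp: copies_def)
  then show "(SUM em:{em\<in>inj_homs H G. image_graph H em = S}. 1) = card (Aut H)"
   using card_graph_isos[OF f] by simp
 qed
 finally show ?thesis by (simp add: subgraph_count_def)
qed

section \<open>Brownian increments and existence of Wiener integrals\<close>

text \<open>Lets a product of selected increments be written as a monomial in all of them, so that
  one moment formula covers every case of coinciding indices.\<close>

lemma prod_power_single: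
 fixes x :: "nat => real"
 assumes "k < m"
 shows "(\<Prod>i<m. x i ^ (if i = k then 1 else 0)) = x k"
proof -
 have "(\<Prod>i<m. x i ^ (if i = k then 1 else 0)) = (\<Prod>i<m. if i = k then x i else 1)"
  by (intro prod.cong) auto
 then show ?thesis using assms by simp
qed

lemma integral_double_sum:
 fixes f :: "'i => 'j => 'a => real"
 assumes "!!k l. k : A ==> l : C ==> integrable M (f k l)"
 shows "(LINT x|M. (SUM k:A. SUM l:C. a k l * f k l x)) = (SUM k:A. SUM l:C. a k l * (LINT x|M. f k l x))"
proof -
 have "(LINT x|M. (SUM k:A. SUM l:C. a k l * f k l x)) = (SUM k:A. LINT x|M. (SUM l:C. a k l * f k l x))"
  by (intro lint_sum lintb_sum integrable_mult_right assms)
 also have "... = (SUM k:A. SUM l:C. LINT x|M. a k l * f k l x)"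
  by (intro sum.cong refl lint_sum integrable_mult_right assms)
 finally show ?thesis by simp
qed

locale brownian_space = prob_space N for N :: "'b measure" +
 fixes B :: "real => 'b => real"
 assumes brownian: "brownian_motion N B"
begin

abbreviation incr :: "(nat => real) => nat => 'b => real" where
 "incr t k ww \<equiv> B (t (Suc k)) ww - B (t k) ww"

lemma measurable_B: "s : {0..1} ==> B s : borm N"
 using brownian by (auto simp: brownian_motion_def)

lemma measurable_incr:
 assumes "unit_partition m t" "k < m"
 shows "incr t k : borm N"
 using unit_partition_range[OF assms(1)] assms(2) by (intro borel_measurable_diff measurable_B) auto

lemma incr_distributed:
 assumes "unit_partition m t" "k < m"
 shows "distributed N lborel (incr t k) (normal_density 0 (sqrt (t (Suc k) - t k)))"
proof -
 have "0 <= t k" "t k < t (Suc k)" "t (Suc k) <= 1"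
  using unit_partition_range[OF assms(1), of k] unit_partition_range[OF assms(1), of "Suc k"]
   unit_partition_strict_mono[OF assms(1), of k "Suc k"] assms(2) by auto
 then show ?thesis using brownian unfolding brownian_motion_def by blast
qed

lemma incr_indep:
 assumes "unit_partition m t"
 shows "indep_vars (%_. borel) (incr t) {..<m}"
proof -
 have "(\<forall>k<m. t k < t (Suc k)) & 0 <= t 0 & t m <= 1" using assms by (simp add: unit_partition_def)
 then show ?thesis using brownian unfolding brownian_motion_def by blast
qed

lemma incr_moments:
 assumes t: "unit_partition m t" and k: "k < m"
 shows "integrable N (incr t k)" "(LINT ww|N. incr t k ww) = 0"
  "integrable N (%ww. (incr t k ww)^2)" "(LINT ww|N. (incr t k ww)^2) = t (Suc k) - t k"
proof -
 let ?\<sigma> = "sqrt (t (Suc k) - t k)"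
 have p: "0 < t (Suc k) - t k" using unit_partition_strict_mono[OF t, of k "Suc k"] k by simp
 then have s: "0 < ?\<sigma>" by simp
 note d = incr_distributed[OF t k]
 show "integrable N (incr t k)"
  using distributed_integrable[OF d, of "%x. x"] integrable_normal_moment[OF s, of 0 1] by simp
 show "(LINT ww|N. incr t k ww) = 0" by (rule normal_distributed_expectation[OF s d])
 show "integrable N (%ww. (incr t k ww)^2)"
  using distributed_integrable[OF d, of "%x. x^2"] integrable_normal_moment[OF s, of 0 2] by simp
 have "variance (incr t k) = ?\<sigma>^2" by (rule normal_distributed_variance[OF s d])
 then show "(LINT ww|N. (incr t k ww)^2) = t (Suc k) - t k"
  using \<open>(LINT ww|N. incr t k ww) = 0\<close> p by simp
qed

text \<open>By independence the moment of a monomial factors. Degree 2 in each increment is enough,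
  since the two factors of an off-diagonal product are different increments; so only the mean and
  the variance of the increments enter.\<close>

lemma incr_prod:
 fixes e :: "nat => nat"
 assumes t: "unit_partition m t" and e: "!!i. i < m ==> e i <= 2"
 shows "integrable N (%ww. \<Prod>i<m. incr t i ww ^ e i)"
  "(LINT ww|N. (\<Prod>i<m. incr t i ww ^ e i)) = (\<Prod>i<m. if e i = 0 then 1 else if e i = 1 then 0 else t (Suc i) - t i)"
proof -
 have ind: "indep_vars (%_. borel) (%i ww. incr t i ww ^ e i) {..<m}"
  by (rule indep_vars_compose2[OF incr_indep[OF t]]) measurable
 have m: "integrable N (%ww. incr t i ww ^ e i) &
   (LINT ww|N. incr t i ww ^ e i) = (if e i = 0 then 1 else if e i = 1 then 0 else t (Suc i) - t i)" if i: "i < m" for i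
 proof -
  consider "e i = 0" | "e i = 1" | "e i = 2" using e[OF i] by linarith
  then show ?thesis by cases (simp_all add: incr_moments[OF t i] prob_space)
 qed
 show "integrable N (%ww. \<Prod>i<m. incr t i ww ^ e i)"
  by (rule indep_vars_integrable[OF _ ind]) (use m in auto)
 have "(LINT ww|N. (\<Prod>i<m. incr t i ww ^ e i)) = (\<Prod>i<m. LINT ww|N. incr t i ww ^ e i)"
  by (rule indep_vars_lebesgue_integral[OF _ ind]) (use m in auto)
 also have "... = (\<Prod>i<m. if e i = 0 then 1 else if e i = 1 then 0 else t (Suc i) - t i)"
  by (intro prod.cong refl) (use m in auto)
 finally show "(LINT ww|N. (\<Prod>i<m. incr t i ww ^ e i)) = (\<Prod>i<m. if e i = 0 then 1 else if e i = 1 then 0 else t (Suc i) - t i)" .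
qed

lemma incr_pair:
 assumes t: "unit_partition m t" and kl: "k < m" "l < m"
 shows "integrable N (%ww. incr t k ww * incr t l ww)"
  "(LINT ww|N. incr t k ww * incr t l ww) = (if k = l then t (Suc k) - t k else 0)"
proof -
 let ?e = "%i. (if i = k then 1 else 0) + (if i = l then 1 else 0) :: nat"
 have eq: "incr t k ww * incr t l ww = (\<Prod>i<m. incr t i ww ^ ?e i)" for ww
  unfolding power_add prod.distrib using kl by (simp only: prod_power_single)
 have e: "?e i <= 2" for i by simp
 show "integrable N (%ww. incr t k ww * incr t l ww)" unfolding eq by (rule incr_prod(1)[OF t e])
 have "(LINT ww|N. incr t k ww * incr t l ww) = (\<Prod>i<m. if ?e i = 0 then 1 else if ?e i = 1 then 0 else t (Suc i) - t i)"
  unfolding eq by (rule incr_prod(2)[OF t e])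
 also have "... = (if k = l then t (Suc k) - t k else 0)"
 proof (cases "k = l")
  case True
  then have "(\<Prod>i<m. if ?e i = 0 then 1 else if ?e i = 1 then 0 else t (Suc i) - t i) =
    (\<Prod>i<m. if i = k then t (Suc i) - t i else 1)" by (intro prod.cong) auto
  then show ?thesis using True kl by simp
 next
  case False
  then show ?thesis using kl by (subst prod_zero) (auto intro!: bexI[of _ k])
 qed
 finally show "(LINT ww|N. incr t k ww * incr t l ww) = (if k = l then t (Suc k) - t k else 0)" .
qed

lemma incr_quad:
 assumes t: "unit_partition m t" and jk: "j < m" "k < m" "j ~= k" and jk': "j' < m" "k' < m" "j' ~= k'"
 shows "integrable N (%ww. (incr t j ww * incr t k ww) * (incr t j' ww * incr t k' ww))"
  "(LINT ww|N. (incr t j ww * incr t k ww) * (incr t j' ww * incr t k' ww)) =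
   (if (j', k') = (j, k) \<or> (j', k') = (k, j) then (t (Suc j) - t j) * (t (Suc k) - t k) else 0)"
proof -
 let ?e = "%i. ((if i = j then 1 else 0) + (if i = k then 1 else 0)) + ((if i = j' then 1 else 0) + (if i = k' then 1 else 0)) :: nat"
 have eq: "(incr t j ww * incr t k ww) * (incr t j' ww * incr t k' ww) = (\<Prod>i<m. incr t i ww ^ ?e i)" for ww
  unfolding power_add prod.distrib using jk jk' by (simp only: prod_power_single)
 have e: "?e i <= 2" for i using jk(3) jk'(3) by simp
 show "integrable N (%ww. (incr t j ww * incr t k ww) * (incr t j' ww * incr t k' ww))"
  unfolding eq by (rule incr_prod(1)[OF t e])
 have "(LINT ww|N. (incr t j ww * incr t k ww) * (incr t j' ww * incr t k' ww)) =
   (\<Prod>i<m. if ?e i = 0 then 1 else if ?e i = 1 then 0 else t (Suc i) - t i)"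
  unfolding eq by (rule incr_prod(2)[OF t e])
 also have "... = (if (j', k') = (j, k) \<or> (j', k') = (k, j) then (t (Suc j) - t j) * (t (Suc k) - t k) else 0)"
 proof (cases "(j', k') = (j, k) \<or> (j', k') = (k, j)")
  case True
  then have e2: "?e i = (if i = j then 2 else 0) + (if i = k then 2 else 0)" for i by (elim disjE) simp_all
  have "(\<Prod>i<m. if ?e i = 0 then 1 else if ?e i = 1 then 0 else t (Suc i) - t i) =
    (\<Prod>i<m. (if i = j then t (Suc i) - t i else 1) * (if i = k then t (Suc i) - t i else 1))"
   unfolding e2 by (intro prod.cong refl) (use jk(3) in simp)
  also have "... = (t (Suc j) - t j) * (t (Suc k) - t k)" unfolding prod.distrib using jk by simp
  finally show ?thesis using True by simp
 next
  case False
  \<comment> \<open>Unless the two pairs agree up to order, some increment occurs exactly once in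
    the monomial, and its mean is 0.\<close>
  have "EX i:{j, k}. ?e i = 1"
  proof (cases "j = j' \<or> j = k'")
   case True
   then have "k ~= j'" "k ~= k'" using False jk by auto
   then show ?thesis using jk(3) by (intro bexI[of _ k]) simp_all
  next
   case False
   then show ?thesis using jk(3) by (intro bexI[of _ j]) simp_all
  qed
  then obtain i where i: "i < m" "?e i = 1" using jk(1,2) by (elim bexE) blast
  have "(\<Prod>i<m. if ?e i = 0 then 1 else if ?e i = 1 then 0 else t (Suc i) - t i) = 0"
   by (rule prod_zero[OF finite_lessThan], rule bexI[of _ i]) (use i in \<open>simp_all only: one_neq_zero if_True if_False refl lessThan_iff\<close>)
  then show ?thesis by (simp only: False if_False)
 qed
 finally show "(LINT ww|N. (incr t j ww * incr t k ww) * (incr t j' ww * incr t k' ww)) =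
   (if (j', k') = (j, k) \<or> (j', k') = (k, j) then (t (Suc j) - t j) * (t (Suc k) - t k) else 0)" .
qed

lemma measurable_step1_integral:
 "unit_partition m t ==> step1_integral B m t c : borm N"
 unfolding step1_integral_def[abs_def]
 by (intro borel_measurable_sum borel_measurable_times borel_measurable_const measurable_incr) auto

lemma measurable_step2_integral:
 assumes "unit_partition m t"
 shows "step2_integral B m t d : borm N"
 unfolding step2_integral_def[abs_def] split_beta'
 by (intro borel_measurable_sum borel_measurable_times borel_measurable_const measurable_incr[OF assms]) auto

lemma step1_integral_sq:
 assumes t: "unit_partition m t"
 shows "integrable N (%ww. (step1_integral B m t c ww)^2)"
  "(LINT ww|N. (step1_integral B m t c ww)^2) = (SUM k<m. (c k)^2 * (t (Suc k) - t k))"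
proof -
 have eq: "(step1_integral B m t c ww)^2 = (SUM k<m. SUM l<m. (c k * c l) * (incr t k ww * incr t l ww))" for ww
  unfolding step1_integral_def power2_eq_square sum_product by (intro sum.cong refl) (simp only: mult_ac)
 show "integrable N (%ww. (step1_integral B m t c ww)^2)"
  unfolding eq by (intro lintb_sum integrable_mult_right incr_pair(1)[OF t]) auto
 have "(LINT ww|N. (step1_integral B m t c ww)^2) =
   (SUM k<m. SUM l<m. (c k * c l) * (LINT ww|N. incr t k ww * incr t l ww))"
  unfolding eq by (rule integral_double_sum) (auto intro: incr_pair(1)[OF t])
 also have "... = (SUM k<m. SUM l<m. if l = k then (c k)^2 * (t (Suc k) - t k) else 0)"
  by (intro sum.cong refl) (auto simp: incr_pair(2)[OF t] power2_eq_square)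
 finally show "(LINT ww|N. (step1_integral B m t c ww)^2) = (SUM k<m. (c k)^2 * (t (Suc k) - t k))" by simp
qed

text \<open>Only a pair and its transpose are correlated. The coefficients may be asymmetric, so the
  mixed products are estimated by half the sum of squares, which gives the factor 2 in place of an
  isometry.\<close>

lemma step2_integral_sq:
 assumes t: "unit_partition m t"
 shows "integrable N (%ww. (step2_integral B m t d ww)^2)"
  "(LINT ww|N. (step2_integral B m t d ww)^2) <=
   2 * (SUM (j, k):{(j, k). j < m & k < m & j ~= k}. (d j k)^2 * (t (Suc j) - t j) * (t (Suc k) - t k))"
proof -
 let ?S = "{(j, k). j < m & k < m & j ~= k}"
 let ?p = "%q. (t (Suc (fst q)) - t (fst q)) * (t (Suc (snd q)) - t (snd q))"
 let ?D = "%q ww. incr t (fst q) ww * incr t (snd q) ww"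
 let ?d = "%q. d (fst q) (snd q)"
 have eq: "(step2_integral B m t d ww)^2 = (SUM q:?S. SUM q':?S. (?d q * ?d q') * (?D q ww * ?D q' ww))" for ww
  unfolding step2_integral_def power2_eq_square sum_product split_beta'
  by (intro sum.cong refl) (simp only: mult_ac)
 have int: "integrable N (%ww. ?D q ww * ?D q' ww)" if "q : ?S" "q' : ?S" for q q'
  using that by (intro incr_quad(1)[OF t]) auto
 show "integrable N (%ww. (step2_integral B m t d ww)^2)"
  unfolding eq by (intro lintb_sum integrable_mult_right int)
 have "(LINT ww|N. (step2_integral B m t d ww)^2) =
   (SUM q:?S. SUM q':?S. (?d q * ?d q') * (LINT ww|N. ?D q ww * ?D q' ww))"
  unfolding eq by (rule integral_double_sum) (rule int)
 also have "... = (SUM q:?S. SUM q':?S. (if q' = q then (?d q)^2 * ?p q else 0) + (if q' = prod.swap q then ?d q * ?d (prod.swap q) * ?p q else 0))"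
 proof (intro sum.cong refl)
  fix q q' assume q: "q : ?S" "q' : ?S"
  obtain j k where 1: "q = (j, k)" by (cases q)
  obtain j' k' where 2: "q' = (j', k')" by (cases q')
  show "(?d q * ?d q') * (LINT ww|N. ?D q ww * ?D q' ww) =
   (if q' = q then (?d q)^2 * ?p q else 0) + (if q' = prod.swap q then ?d q * ?d (prod.swap q) * ?p q else 0)"
   using q incr_quad(2)[OF t, of j k j' k'] by (auto simp: 1 2 power2_eq_square)
 qed
 also have "... = (SUM q:?S. (?d q)^2 * ?p q + ?d q * ?d (prod.swap q) * ?p q)"
 proof (intro sum.cong refl)
  fix q assume q: "q : ?S"
  then have "prod.swap q : ?S" by auto
  with q show "(SUM q':?S. (if q' = q then (?d q)^2 * ?p q else 0) + (if q' = prod.swap q then ?d q * ?d (prod.swap q) * ?p q else 0)) =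
   (?d q)^2 * ?p q + ?d q * ?d (prod.swap q) * ?p q"
   unfolding sum.distrib by (simp only: sum.delta finite_off_diag if_True)
 qed
 also have "... <= (SUM q:?S. (?d q)^2 * ?p q + ((?d q)^2 * ?p q + (?d (prod.swap q))^2 * ?p q) / 2)"
 proof (rule sum_mono)
  fix q assume "q : ?S"
  then have "0 <= ?p q"
   using unit_partition_mono[OF t, of "fst q" "Suc (fst q)"] unit_partition_mono[OF t, of "snd q" "Suc (snd q)"]
   by (intro mult_nonneg_nonneg) auto
  moreover have "?d q * ?d (prod.swap q) <= ((?d q)^2 + (?d (prod.swap q))^2) / 2"
   using sum_squares_bound[of "?d q" "?d (prod.swap q)"] by simp
  ultimately have "?d q * ?d (prod.swap q) * ?p q <= ((?d q)^2 + (?d (prod.swap q))^2) / 2 * ?p q"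
   by (intro mult_right_mono)
  also have "((?d q)^2 + (?d (prod.swap q))^2) / 2 * ?p q = ((?d q)^2 * ?p q + (?d (prod.swap q))^2 * ?p q) / 2"
   by (simp only: distrib_right times_divide_eq_left)
  finally show "(?d q)^2 * ?p q + ?d q * ?d (prod.swap q) * ?p q <=
    (?d q)^2 * ?p q + ((?d q)^2 * ?p q + (?d (prod.swap q))^2 * ?p q) / 2"
   by (rule add_left_mono)
 qed
 also have "... = (SUM q:?S. (?d q)^2 * ?p q) + ((SUM q:?S. (?d q)^2 * ?p q) + (SUM q:?S. (?d (prod.swap q))^2 * ?p q)) / 2"
  by (simp only: sum.distrib sum_divide_distrib[symmetric])
 also have "(SUM q:?S. (?d (prod.swap q))^2 * ?p q) = (SUM q:?S. (?d q)^2 * ?p q)"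
  by (rule sum.reindex_bij_witness[where i = prod.swap and j = prod.swap]) (auto simp: mult_ac)
 finally show "(LINT ww|N. (step2_integral B m t d ww)^2) <=
   2 * (SUM (j, k):?S. (d j k)^2 * (t (Suc j) - t j) * (t (Suc k) - t k))"
  by (simp add: split_beta' mult.assoc)
qed

lemma sq_norm_step1_integral:
 "unit_partition m t ==> sq_norm N (step1_integral B m t c) = sq_norm unit_unif (step1 m t c)"
 by (simp add: sq_norm_eq_integral step1_integral_sq sq_norm_step1)

lemma sq_norm_step2_integral:
 assumes t: "unit_partition m t"
 shows "sq_norm N (step2_integral B m t d) <= 2 * sq_norm unit_square (case_prod (step2 m t d))"
proof -
 have "0 <= (SUM (j, k):{(j, k). j < m & k < m & j ~= k}. (d j k)^2 * (t (Suc j) - t j) * (t (Suc k) - t k))"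
  using unit_partition_mono[OF t] by (intro sum_nonneg) auto
 then show ?thesis
  unfolding sq_norm_eq_integral[OF step2_integral_sq(1)[OF t]] sq_norm_step2[OF t]
  using ennreal_leI[OF step2_integral_sq(2)[OF t, of d]] by (simp add: ennreal_mult)
qed

lemma char_incr:
 assumes t: "unit_partition m t" and k: "k < m"
 shows "(CLINT ww|N. iexp (a * incr t k ww)) = exp (- (a^2 * (t (Suc k) - t k)) / 2)"
proof -
 let ?\<sigma> = "sqrt (t (Suc k) - t k)"
 have p: "0 < t (Suc k) - t k" using unit_partition_strict_mono[OF t, of k "Suc k"] k by simp
 then have s: "0 < ?\<sigma>" by simp
 have "distributed N lborel (%x. (incr t k x - 0) / ?\<sigma>) std_normal_density"
  by (rule normal_standard_normal_convert[OF s, THEN iffD1, OF incr_distributed[OF t k]])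
 then have d: "distributed N lborel (%x. incr t k x / ?\<sigma>) std_normal_density" by simp
 have "(CLINT ww|N. iexp (a * incr t k ww)) = (CLINT ww|N. iexp ((a * ?\<sigma>) * (incr t k ww / ?\<sigma>)))"
  using p by simp
 also have "... = (CLINT x|distr N lborel (%x. incr t k x / ?\<sigma>). iexp ((a * ?\<sigma>) * x))"
  using measurable_incr[OF t k] by (subst integral_distr) auto
 also have "distr N lborel (%x. incr t k x / ?\<sigma>) = std_normal_distribution"
  using distributed_distr_eq_density[OF d] .
 also have "(CLINT x|std_normal_distribution. iexp ((a * ?\<sigma>) * x)) = char std_normal_distribution (a * ?\<sigma>)"
  by (simp add: char_def)
 also have "... = exp (- (a^2 * (t (Suc k) - t k)) / 2)"
  using p by (simp add: char_std_normal_distribution power_mult_distrib)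
 finally show ?thesis .
qed

lemma char_step1_integral:
 assumes t: "unit_partition m t"
 shows "(CLINT ww|N. iexp (step1_integral B m t c ww)) = exp (- (SUM k<m. (c k)^2 * (t (Suc k) - t k)) / 2)"
proof -
 have ind: "indep_vars (%_. borel) (%k ww. iexp (c k * incr t k ww)) {..<m}"
  by (rule indep_vars_compose2[OF incr_indep[OF t], of "%k x. iexp (c k * x)"]) measurable
 have int: "integrable N (%ww. iexp (c k * incr t k ww))" if "k < m" for k
  using measurable_incr[OF t that]
  by (intro bdm_integrable[OF finite_measure_axioms] bdm_iexp) auto
 have "(CLINT ww|N. iexp (step1_integral B m t c ww)) = (CLINT ww|N. (\<Prod>k<m. iexp (c k * incr t k ww)))"
  by (simp only: step1_integral_def of_real_sum sum_distrib_left exp_sum finite_lessThan)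
 also have "... = (\<Prod>k<m. CLINT ww|N. iexp (c k * incr t k ww))"
  by (rule indep_vars_lebesgue_integral[OF _ ind]) (use int in auto)
 also have "... = (\<Prod>k<m. complex_of_real (exp (- ((c k)^2 * (t (Suc k) - t k)) / 2)))"
  by (intro prod.cong refl char_incr[OF t]) auto
 also have "... = complex_of_real (exp (SUM k<m. - ((c k)^2 * (t (Suc k) - t k)) / 2))"
  by (simp only: of_real_prod[symmetric] exp_sum[symmetric] finite_lessThan)
 finally show ?thesis by (simp add: sum_negf sum_divide_distrib)
qed

section \<open>Existence of the Wiener integrals\<close>

lemma wiener1_cauchy:
 assumes 1: "unit_partition m1 t1" and 2: "unit_partition m2 t2"
 shows "sq_norm N (%ww. step1_integral B m1 t1 c1 ww - step1_integral B m2 t2 c2 ww) =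
  sq_norm unit_unif (%x. step1 m1 t1 c1 x - step1 m2 t2 c2 x)"
proof -
 obtain m t where t: "unit_partition m t" "t1 ` {..m1} <= t ` {..m}" "t2 ` {..m2} <= t ` {..m}"
  using common_refinement[OF 1 2] by blast
 obtain c where c: "!!x. x : {0..1} ==> step1 m t c x = 1 * step1 m1 t1 c1 x + (-1) * step1 m2 t2 c2 x"
  "!!ww. step1_integral B m t c ww = 1 * step1_integral B m1 t1 c1 ww + (-1) * step1_integral B m2 t2 c2 ww"
  by (rule step1_common[OF 1 2 t, of 1 c1 "-1" c2 B]) blast
 have "sq_norm N (%ww. step1_integral B m1 t1 c1 ww - step1_integral B m2 t2 c2 ww) = sq_norm N (step1_integral B m t c)"
  by (rule sq_norm_cong) (simp add: c)
 also have "... = sq_norm unit_unif (step1 m t c)" by (rule sq_norm_step1_integral[OF t(1)])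
 also have "... = sq_norm unit_unif (%x. step1 m1 t1 c1 x - step1 m2 t2 c2 x)"
  by (rule sq_norm_cong) (simp add: c)
 finally show ?thesis .
qed

lemma wiener2_cauchy:
 assumes 1: "unit_partition m1 t1" and 2: "unit_partition m2 t2"
 shows "sq_norm N (%ww. step2_integral B m1 t1 c1 ww - step2_integral B m2 t2 c2 ww) <=
  2 * sq_norm unit_square (%x. case_prod (step2 m1 t1 c1) x - case_prod (step2 m2 t2 c2) x)"
proof -
 obtain m t where t: "unit_partition m t" "t1 ` {..m1} <= t ` {..m}" "t2 ` {..m2} <= t ` {..m}"
  using common_refinement[OF 1 2] by blast
 obtain c where c: "!!x y. x : {0..1} ==> y : {0..1} ==> step2 m t c x y = 1 * step2 m1 t1 c1 x y + (-1) * step2 m2 t2 c2 x y"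
  "!!ww. step2_integral B m t c ww = 1 * step2_integral B m1 t1 c1 ww + (-1) * step2_integral B m2 t2 c2 ww"
  by (rule step2_common[OF 1 2 t, of 1 c1 "-1" c2 B]) blast
 have "sq_norm N (%ww. step2_integral B m1 t1 c1 ww - step2_integral B m2 t2 c2 ww) = sq_norm N (step2_integral B m t c)"
  by (rule sq_norm_cong) (simp add: c)
 also have "... <= 2 * sq_norm unit_square (case_prod (step2 m t c))" by (rule sq_norm_step2_integral[OF t(1)])
 also have "sq_norm unit_square (case_prod (step2 m t c)) =
   sq_norm unit_square (%x. case_prod (step2 m1 t1 c1) x - case_prod (step2 m2 t2 c2) x)"
  by (rule sq_norm_cong) (auto simp: space_unit_square c)
 finally show ?thesis .
qed

lemma L2_limit_exists:
 fixes s :: "nat => 'c => real"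
 assumes f: "f : borm S" and s: "!!n. s n : borm S"
  and Y: "!!n. Y n : borm N"
  and err: "!!n. sq_norm S (%x. f x - s n x) <= ennreal ((1 / 4) ^ n)"
  and iso: "!!n k. sq_norm N (%ww. Y k ww - Y n ww) <= 2 * sq_norm S (%x. s k x - s n x)"
 shows "EX X. X : borm N & (%n. sq_norm N (%x. X x - Y n x)) \<longlonglongrightarrow> 0"
proof (rule L2_complete[OF prob_space_axioms Y, of 3])
 fix n k :: nat assume nk: "n <= k"
 have "sq_norm S (%x. s k x - s n x) <= 2 * sq_norm S (%x. s k x - f x) + 2 * sq_norm S (%x. f x - s n x)"
  by (rule sq_norm_triangle[OF s f s])
 also have "... <= ennreal (2 * (1 / 4) ^ n + 2 * (1 / 4) ^ n)"
 proof (rule ennreal_bound_2)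
  have "sq_norm S (%x. s k x - f x) <= ennreal ((1 / 4) ^ k)" using err[of k] by (subst sq_norm_commute)
  also have "... <= ennreal ((1 / 4) ^ n)" using nk by (intro ennreal_leI power_decreasing) auto
  finally show "sq_norm S (%x. s k x - f x) <= ennreal ((1 / 4) ^ n)" .
 qed (use err[of n] in auto)
 finally have "2 * sq_norm S (%x. s k x - s n x) <= 2 * ennreal (4 * (1 / 4) ^ n)"
  by (intro mult_left_mono) auto
 also have "... = ennreal (8 * (1 / 4) ^ n)" by (simp add: ennreal_mult)
 \<comment> \<open>The origin of the constant 3 and of the rate \<open>(1 / 4) ^ n\<close>: one has
   \<open>8 <= 3^2\<close>, and \<open>(1 / 4) ^ n\<close> is the square of
   \<open>(1 / 2) ^ n\<close>, the rate demanded for completeness.\<close>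
 also have "... <= ennreal ((3 * (1 / 2) ^ n)^2)"
 proof (rule ennreal_leI)
  have "((1 / 2 :: real) ^ n)^2 = ((1 / 2)^2) ^ n" by (simp only: power_mult[symmetric] mult.commute)
  also have "(1 / 2 :: real)^2 = 1 / 4" by (simp add: power2_eq_square)
  finally show "8 * (1 / 4) ^ n <= (3 * (1 / 2) ^ n :: real)^2" by (simp add: power_mult_distrib)
 qed
 finally show "sq_norm N (%x. Y k x - Y n x) <= ennreal ((3 * (1 / 2) ^ n)^2)"
  using iso[of k n] by (rule order_trans[rotated])
qed simp

lemma tendsto_quarter_powers: "(!!n. u n <= ennreal ((1 / 4) ^ n)) ==> u \<longlonglongrightarrow> 0"
proof (rule tendsto_sandwich[OF _ _ tendsto_const])
 have "(%n. ennreal ((1 / 4) ^ n)) \<longlonglongrightarrow> ennreal 0"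
  by (intro tendsto_ennrealI LIMSEQ_power_zero) auto
 then show "(%n. ennreal ((1 / 4) ^ n)) \<longlonglongrightarrow> 0" by simp
qed (auto intro: always_eventually)

text \<open>The integral is an arbitrary choice among its versions, so nothing is known about it
  until one version exists. Fast step approximations of the integrand give a Cauchy sequence of
  stochastic sums.\<close>

lemma has_wiener1_exists:
 assumes "bdm unit_unif f"
 shows "has_wiener1 N B f (wiener1 N B f)"
proof -
 have a: "step1_approximable f" using assms by (rule step1_approximable_bounded)
 then have f: "f : borm unit_unif" by (simp add: step1_approximable_def)
 have "EX q. unit_partition (fst q) (fst (snd q)) &
   sq_norm unit_unif (%x. f x - step1 (fst q) (fst (snd q)) (snd (snd q)) x) <= ennreal ((1 / 4) ^ n)" for n :: nat
 proof -
  have "(0::real) < (1 / 4) ^ n" by simp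
  then obtain m t c where "unit_partition m t" "sq_norm unit_unif (%x. f x - step1 m t c x) <= ennreal ((1 / 4) ^ n)"
   using a unfolding step1_approximable_def by blast
  then show ?thesis by (intro exI[of _ "(m, t, c)"]) simp
 qed
 then have "ALL n. EX q. unit_partition (fst q) (fst (snd q)) &
   sq_norm unit_unif (%x. f x - step1 (fst q) (fst (snd q)) (snd (snd q)) x) <= ennreal ((1 / 4) ^ n)" ..
 from choice[OF this] obtain q where q: "ALL n. unit_partition (fst (q n)) (fst (snd (q n))) &
   sq_norm unit_unif (%x. f x - step1 (fst (q n)) (fst (snd (q n))) (snd (snd (q n))) x) <= ennreal ((1 / 4) ^ n)" ..
 define m t c where "m n = fst (q n)" and "t n = fst (snd (q n))" and "c n = snd (snd (q n))" for n
 have t: "unit_partition (m n) (t n)" and e: "sq_norm unit_unif (%x. f x - step1 (m n) (t n) (c n) x) <= ennreal ((1 / 4) ^ n)" for n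
  using q by (simp_all add: m_def t_def c_def)
 have "EX X. X : borm N & (%n. sq_norm N (%x. X x - step1_integral B (m n) (t n) (c n) x)) \<longlonglongrightarrow> 0"
 proof (rule L2_limit_exists[OF f measurable_step1 measurable_step1_integral[OF t] e])
  show "sq_norm N (%ww. step1_integral B (m k) (t k) (c k) ww - step1_integral B (m n) (t n) (c n) ww) <=
   2 * sq_norm unit_unif (%x. step1 (m k) (t k) (c k) x - step1 (m n) (t n) (c n) x)" for n k
   unfolding wiener1_cauchy[OF t t] using mult_right_mono[of 1 "2::ennreal"] by simp
 qed
 then obtain X where X: "X : borm N" "(%n. sq_norm N (%x. X x - step1_integral B (m n) (t n) (c n) x)) \<longlonglongrightarrow> 0"
  by (elim exE conjE)
 have "has_wiener1 N B f X"
  unfolding has_wiener1_def sq_norm_def[symmetric]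
  using f X t tendsto_quarter_powers[OF e] by blast
 then show ?thesis unfolding wiener1_def by (rule someI[of "has_wiener1 N B f"])
qed

lemma has_wiener2_exists:
 assumes "bdm unit_square (case_prod f)"
 shows "has_wiener2 N B f (wiener2 N B f)"
proof -
 have a: "step2_approximable (case_prod f)" using assms by (rule step2_approximable_bounded)
 then have f: "case_prod f : borm unit_square" by (simp add: step2_approximable_def)
 have "EX q. unit_partition (fst q) (fst (snd q)) &
   sq_norm unit_square (%x. case_prod f x - case_prod (step2 (fst q) (fst (snd q)) (snd (snd q))) x) <= ennreal ((1 / 4) ^ n)" for n :: nat
 proof -
  have "(0::real) < (1 / 4) ^ n" by simp
  then obtain m t c where "unit_partition m t" "sq_norm unit_square (%x. case_prod f x - case_prod (step2 m t c) x) <= ennreal ((1 / 4) ^ n)"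
   using a unfolding step2_approximable_def by blast
  then show ?thesis by (intro exI[of _ "(m, t, c)"]) simp
 qed
 then have "ALL n. EX q. unit_partition (fst q) (fst (snd q)) &
   sq_norm unit_square (%x. case_prod f x - case_prod (step2 (fst q) (fst (snd q)) (snd (snd q))) x) <= ennreal ((1 / 4) ^ n)" ..
 from choice[OF this] obtain q where q: "ALL n. unit_partition (fst (q n)) (fst (snd (q n))) &
   sq_norm unit_square (%x. case_prod f x - case_prod (step2 (fst (q n)) (fst (snd (q n))) (snd (snd (q n)))) x) <= ennreal ((1 / 4) ^ n)" ..
 define m t c where "m n = fst (q n)" and "t n = fst (snd (q n))" and "c n = snd (snd (q n))" for n
 have t: "unit_partition (m n) (t n)" and e: "sq_norm unit_square (%x. case_prod f x - case_prod (step2 (m n) (t n) (c n)) x) <= ennreal ((1 / 4) ^ n)" for n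
  using q by (simp_all add: m_def t_def c_def)
 have "EX X. X : borm N & (%n. sq_norm N (%x. X x - step2_integral B (m n) (t n) (c n) x)) \<longlonglongrightarrow> 0"
  by (rule L2_limit_exists[OF f measurable_step2 measurable_step2_integral[OF t] e wiener2_cauchy[OF t t]])
 then obtain X where X: "X : borm N" "(%n. sq_norm N (%x. X x - step2_integral B (m n) (t n) (c n) x)) \<longlonglongrightarrow> 0"
  by (elim exE conjE)
 have e': "(%n. \<integral>\<^sup>+(x, y). ennreal ((f x y - step2 (m n) (t n) (c n) x y)^2) \<partial>unit_square) \<longlonglongrightarrow> 0"
  using tendsto_quarter_powers[OF e] by (simp add: sq_norm_def split_beta')
 have "has_wiener2 N B f X"
  unfolding has_wiener2_def sq_norm_def[symmetric]
  using f X t e' by blast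
 then show ?thesis unfolding wiener2_def by (rule someI[of "has_wiener2 N B f"])
qed

text \<open>The pair \<open>(f, K)\<close> of kernels and the sum \<open>X\<close> of their one- and two-fold integrals are
 approximated by step kernels over one partition.\<close>

definition chaos_approx :: "(real => real) => (real \<times> real => real) => ('b => real) => bool" where
 "chaos_approx f K X \<longleftrightarrow> f : borm unit_unif & K : borm unit_square & X : borm N &
   (\<forall>e>0. EX m t c d. unit_partition m t &
    sq_norm unit_unif (%x. f x - step1 m t c x) <= ennreal e &
    sq_norm unit_square (%p. K p - case_prod (step2 m t d) p) <= ennreal e &
    sq_norm N (%ww. X ww - (step1_integral B m t c ww + step2_integral B m t d ww)) <= ennreal e)"

lemma eventually_le_ennreal:
 fixes u :: "nat => ennreal"
 assumes "u \<longlonglongrightarrow> 0" "0 < e"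
 shows "\<forall>\<^sub>F n in sequentially. u n <= ennreal e"
proof -
 have "\<forall>\<^sub>F n in sequentially. u n < ennreal e"
  using assms by (intro order_tendstoD(2)[OF assms(1)]) auto
 then show ?thesis by eventually_elim auto
qed

lemma chaos_approx_wiener1:
 assumes "has_wiener1 N B f X"
 shows "chaos_approx f (%_. 0) X"
proof -
 obtain m t c where f: "f : borm unit_unif" "X : borm N"
  and t: "ALL n. unit_partition (m n) (t n)"
  and l1: "(%n. sq_norm unit_unif (%x. f x - step1 (m n) (t n) (c n) x)) \<longlonglongrightarrow> 0"
  and l2: "(%n. sq_norm N (%x. X x - step1_integral B (m n) (t n) (c n) x)) \<longlonglongrightarrow> 0"
  using assms unfolding has_wiener1_def sq_norm_def[symmetric] by (elim exE conjE) 
 show ?thesis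
  unfolding chaos_approx_def
 proof (intro conjI allI impI f)
  fix e :: real assume e: "0 < e"
  have "\<forall>\<^sub>F n in sequentially. sq_norm unit_unif (%x. f x - step1 (m n) (t n) (c n) x) <= ennreal e &
    sq_norm N (%x. X x - step1_integral B (m n) (t n) (c n) x) <= ennreal e"
   by (intro eventually_conj eventually_le_ennreal[OF l1 e] eventually_le_ennreal[OF l2 e])
  then obtain n where n: "sq_norm unit_unif (%x. f x - step1 (m n) (t n) (c n) x) <= ennreal e"
    "sq_norm N (%x. X x - step1_integral B (m n) (t n) (c n) x) <= ennreal e"
   by (auto simp: eventually_sequentially)
  have z: "step2 (m n) (t n) (%_ _. 0) = (%_ _. 0)" "step2_integral B (m n) (t n) (%_ _. 0) = (%_. 0)"
   by (auto simp: step2_def step2_integral_def fun_eq_iff)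
  show "EX m t c d. unit_partition m t &
    sq_norm unit_unif (%x. f x - step1 m t c x) <= ennreal e &
    sq_norm unit_square (%p. 0 - case_prod (step2 m t d) p) <= ennreal e &
    sq_norm N (%ww. X ww - (step1_integral B m t c ww + step2_integral B m t d ww)) <= ennreal e"
   using n t by (intro exI[of _ "m n"] exI[of _ "t n"] exI[of _ "c n"] exI[of _ "%_ _. 0"])
    (simp add: z sq_norm_def split_beta')
 qed simp
qed

lemma chaos_approx_wiener2:
 assumes "has_wiener2 N B f X"
 shows "chaos_approx (%_. 0) (case_prod f) X"
proof -
 obtain m t c where f: "case_prod f : borm unit_square" "X : borm N"
  and t: "ALL n. unit_partition (m n) (t n)"
  and l1': "(%n. \<integral>\<^sup>+(x, y). ennreal ((f x y - step2 (m n) (t n) (c n) x y)^2) \<partial>unit_square) \<longlonglongrightarrow> 0"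
  and l2: "(%n. sq_norm N (%x. X x - step2_integral B (m n) (t n) (c n) x)) \<longlonglongrightarrow> 0"
  using assms unfolding has_wiener2_def sq_norm_def[symmetric] by (elim exE conjE) 
 have l1: "(%n. sq_norm unit_square (%p. case_prod f p - case_prod (step2 (m n) (t n) (c n)) p)) \<longlonglongrightarrow> 0"
  using l1' by (simp add: sq_norm_def split_beta')
 show ?thesis
  unfolding chaos_approx_def
 proof (intro conjI allI impI f)
  fix e :: real assume e: "0 < e"
  have "\<forall>\<^sub>F n in sequentially. sq_norm unit_square (%x. case_prod f x - case_prod (step2 (m n) (t n) (c n)) x) <= ennreal e &
    sq_norm N (%x. X x - step2_integral B (m n) (t n) (c n) x) <= ennreal e"
   by (intro eventually_conj eventually_le_ennreal[OF l1 e] eventually_le_ennreal[OF l2 e])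
  then obtain n where n: "sq_norm unit_square (%x. case_prod f x - case_prod (step2 (m n) (t n) (c n)) x) <= ennreal e"
    "sq_norm N (%x. X x - step2_integral B (m n) (t n) (c n) x) <= ennreal e"
   by (auto simp: eventually_sequentially)
  have z: "step1 (m n) (t n) (%_. 0) = (%_. 0)" "step1_integral B (m n) (t n) (%_. 0) = (%_. 0)"
   by (auto simp: step1_def step1_integral_def fun_eq_iff)
  show "EX m t c d. unit_partition m t &
    sq_norm unit_unif (%x. 0 - step1 m t c x) <= ennreal e &
    sq_norm unit_square (%p. case_prod f p - case_prod (step2 m t d) p) <= ennreal e &
    sq_norm N (%ww. X ww - (step1_integral B m t c ww + step2_integral B m t d ww)) <= ennreal e"
   using n t by (intro exI[of _ "m n"] exI[of _ "t n"] exI[of _ "%_. 0"] exI[of _ "c n"])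
    (simp add: z sq_norm_def)
 qed simp
qed

lemma chaos_approx_linear:
 assumes 1: "chaos_approx f1 K1 X1" and 2: "chaos_approx f2 K2 X2"
 shows "chaos_approx (%x. a * f1 x + b * f2 x) (%p. a * K1 p + b * K2 p) (%ww. a * X1 ww + b * X2 ww)"
proof -
 have [measurable]: "f1 : borm unit_unif" "K1 : borm unit_square" "X1 : borm N"
  "f2 : borm unit_unif" "K2 : borm unit_square" "X2 : borm N"
  using 1 2 by (auto simp: chaos_approx_def)
 show ?thesis
  unfolding chaos_approx_def
 proof (intro conjI allI impI)
  fix e :: real assume "0 < e"
  then obtain \<delta> where \<delta>: "0 < \<delta>" "2 * (a^2 * \<delta>) + 2 * (b^2 * \<delta>) <= e" using small_eps[of e a b] by blast
  obtain m1 t1 c1 d1 where t1: "unit_partition m1 t1"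
   and a1: "sq_norm unit_unif (%x. f1 x - step1 m1 t1 c1 x) <= ennreal \<delta>"
    "sq_norm unit_square (%p. K1 p - case_prod (step2 m1 t1 d1) p) <= ennreal \<delta>"
    "sq_norm N (%ww. X1 ww - (step1_integral B m1 t1 c1 ww + step2_integral B m1 t1 d1 ww)) <= ennreal \<delta>"
   using 1 \<delta>(1) unfolding chaos_approx_def by blast
  obtain m2 t2 c2 d2 where t2: "unit_partition m2 t2"
   and a2: "sq_norm unit_unif (%x. f2 x - step1 m2 t2 c2 x) <= ennreal \<delta>"
    "sq_norm unit_square (%p. K2 p - case_prod (step2 m2 t2 d2) p) <= ennreal \<delta>"
    "sq_norm N (%ww. X2 ww - (step1_integral B m2 t2 c2 ww + step2_integral B m2 t2 d2 ww)) <= ennreal \<delta>"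
   using 2 \<delta>(1) unfolding chaos_approx_def by blast
  note [measurable] = measurable_step1_integral[OF t1] measurable_step1_integral[OF t2]
   measurable_step2_integral[OF t1] measurable_step2_integral[OF t2]
  obtain m t where t: "unit_partition m t" "t1 ` {..m1} <= t ` {..m}" "t2 ` {..m2} <= t ` {..m}"
   using common_refinement[OF t1 t2] by blast
  obtain c where c: "!!x. x : {0..1} ==> step1 m t c x = a * step1 m1 t1 c1 x + b * step1 m2 t2 c2 x"
   "!!ww. step1_integral B m t c ww = a * step1_integral B m1 t1 c1 ww + b * step1_integral B m2 t2 c2 ww"
   by (rule step1_common[OF t1 t2 t, of a c1 b c2 B]) blast
  obtain d where d: "!!x y. x : {0..1} ==> y : {0..1} ==> step2 m t d x y = a * step2 m1 t1 d1 x y + b * step2 m2 t2 d2 x y"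
   "!!ww. step2_integral B m t d ww = a * step2_integral B m1 t1 d1 ww + b * step2_integral B m2 t2 d2 ww"
   by (rule step2_common[OF t1 t2 t, of a d1 b d2 B]) blast
  have le: "ennreal (2 * (a^2 * \<delta>) + 2 * (b^2 * \<delta>)) <= ennreal e" using \<delta>(2) by (rule ennreal_leI)
  have "sq_norm unit_unif (%x. a * f1 x + b * f2 x - step1 m t c x) =
    sq_norm unit_unif (%x. a * (f1 x - step1 m1 t1 c1 x) + b * (f2 x - step1 m2 t2 c2 x))"
   by (rule sq_norm_cong) (simp add: c algebra_simps)
  also have "... <= ennreal (2 * (a^2 * \<delta>) + 2 * (b^2 * \<delta>))"
   using \<delta>(1) by (intro sq_norm_linear_le a1 a2) auto
  finally have r1: "sq_norm unit_unif (%x. a * f1 x + b * f2 x - step1 m t c x) <= ennreal e" using le by (rule order_trans)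
  have "sq_norm unit_square (%p. a * K1 p + b * K2 p - case_prod (step2 m t d) p) =
    sq_norm unit_square (%p. a * (K1 p - case_prod (step2 m1 t1 d1) p) + b * (K2 p - case_prod (step2 m2 t2 d2) p))"
   by (rule sq_norm_cong) (auto simp: space_unit_square d algebra_simps)
  also have "... <= ennreal (2 * (a^2 * \<delta>) + 2 * (b^2 * \<delta>))"
   using \<delta>(1) by (intro sq_norm_linear_le a1 a2) auto
  finally have r2: "sq_norm unit_square (%p. a * K1 p + b * K2 p - case_prod (step2 m t d) p) <= ennreal e" using le by (rule order_trans)
  have "sq_norm N (%ww. a * X1 ww + b * X2 ww - (step1_integral B m t c ww + step2_integral B m t d ww)) =
    sq_norm N (%ww. a * (X1 ww - (step1_integral B m1 t1 c1 ww + step2_integral B m1 t1 d1 ww)) +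
     b * (X2 ww - (step1_integral B m2 t2 c2 ww + step2_integral B m2 t2 d2 ww)))"
   by (rule sq_norm_cong) (simp add: c d algebra_simps)
  also have "... <= ennreal (2 * (a^2 * \<delta>) + 2 * (b^2 * \<delta>))"
   using \<delta>(1) by (intro sq_norm_linear_le a1 a2) auto
  finally have r3: "sq_norm N (%ww. a * X1 ww + b * X2 ww - (step1_integral B m t c ww + step2_integral B m t d ww)) <= ennreal e"
   using le by (rule order_trans)
  show "EX m t c d. unit_partition m t &
    sq_norm unit_unif (%x. a * f1 x + b * f2 x - step1 m t c x) <= ennreal e &
    sq_norm unit_square (%p. a * K1 p + b * K2 p - case_prod (step2 m t d) p) <= ennreal e &
    sq_norm N (%ww. a * X1 ww + b * X2 ww - (step1_integral B m t c ww + step2_integral B m t d ww)) <= ennreal e"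
   using t(1) r1 r2 r3 by blast
 qed measurable
qed

lemma chaos_approx_zero: "chaos_approx (%_. 0) (%_. 0) (%_. 0)"
proof -
 have z: "step1 1 real (%_. 0) = (%_. 0)" "step1_integral B 1 real (%_. 0) = (%_. 0)"
  "step2 1 real (%_ _. 0) = (%_ _. 0)" "step2_integral B 1 real (%_ _. 0) = (%_. 0)"
  by (auto simp: step1_def step1_integral_def step2_def step2_integral_def fun_eq_iff)
 have "EX m t c d. unit_partition m t &
    sq_norm unit_unif (%x. 0 - step1 m t c x) <= ennreal e &
    sq_norm unit_square (%p. 0 - case_prod (step2 m t d) p) <= ennreal e &
    sq_norm N (%ww. 0 - (step1_integral B m t c ww + step2_integral B m t d ww)) <= ennreal e" for e
  using trivial_partition
  by (intro exI[of _ 1] exI[of _ real] exI[of _ "%_. 0"] exI[of _ "%_ _. 0"]) (simp add: z[unfolded One_nat_def] sq_norm_def split_beta')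
 then show ?thesis unfolding chaos_approx_def by simp
qed

lemma chaos_approx_sum:
 assumes "finite I" "!!i. i : I ==> chaos_approx (f i) (K i) (X i)"
 shows "chaos_approx (%x. SUM i:I. a i * f i x) (%p. SUM i:I. a i * K i p) (%ww. SUM i:I. a i * X i ww)"
 using assms
proof (induction I)
 case empty
 show ?case using chaos_approx_zero by simp
next
 case (insert i I)
 then have "chaos_approx (%x. a i * f i x + 1 * (SUM i:I. a i * f i x)) (%p. a i * K i p + 1 * (SUM i:I. a i * K i p))
   (%ww. a i * X i ww + 1 * (SUM i:I. a i * X i ww))"
  by (intro chaos_approx_linear) auto
 with insert.hyps show ?case by simp
qed

end

section \<open>Second moments of incomplete Hoeffding expansions\<close>

text \<open>Fix the \<open>s\<close> vertices that are sent into \<open>P\<close>, in at most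
  \<open>2 ^ card V\<close> ways; they have \<open>card V\<close> possible images each and the
  remaining vertices n each. The quotient of powers avoids a truncated exponent.\<close>

lemma card_inj_maps_meeting_le:
 assumes V: "finite V" and P: "finite P" "card P = card V" and n: "1 <= n"
 shows "real (card {\<psi> : inj_maps V {1..n}. s <= card (P Int \<psi> ` V)}) <= 2 ^ card V * card V ^ s * (real n ^ card V / real n ^ s)"
proof -
 let ?T = "%A. \<Pi>\<^sub>E a\<in>V. if a : A then P else {1..n}"
 let ?F = "{A. A <= V & card A = s}"
 have finF: "finite ?F" using V by simp
 have cardF: "card ?F <= 2 ^ card V"
 proof -
  have "card ?F <= card (Pow V)" using V by (intro card_mono) auto
  then show ?thesis using V by (simp add: card_Pow)
 qed
 have sub: "{\<psi> : inj_maps V {1..n}. s <= card (P Int \<psi> ` V)} <= (\<Union>A\<in>?F. ?T A)"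
 proof
  fix \<psi> assume "\<psi> : {\<psi> : inj_maps V {1..n}. s <= card (P Int \<psi> ` V)}"
  then have p: "\<psi> : V \<rightarrow>\<^sub>E {1..n}" "inj_on \<psi> V" "s <= card (P Int \<psi> ` V)" by (auto simp: inj_maps_def)
  let ?A = "{a : V. \<psi> a : P}"
  have "P Int \<psi> ` V = \<psi> ` ?A" by auto
  moreover have "card (\<psi> ` ?A) = card ?A" by (rule card_image) (rule inj_on_subset[OF p(2)], auto)
  ultimately have "s <= card ?A" using p(3) by simp
  then obtain A where A: "A <= ?A" "card A = s" by (rule obtain_subset_with_card_n)
  then have "A : ?F" by auto
  moreover have "\<psi> : ?T A" using p(1) A(1) by (auto simp: PiE_iff)
  ultimately show "\<psi> : (\<Union>A\<in>?F. ?T A)" by blast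
 qed
 have cT: "real (card (?T A)) = card V ^ s * (real n ^ card V / real n ^ s)" if A: "A : ?F" for A
 proof -
  have fA: "finite A" "A <= V" "card A = s" using A V finite_subset by auto
  then have le: "s <= card V" using V card_mono by blast
  have "card (?T A) = (\<Prod>a\<in>V. card (if a : A then P else {1..n}))" using V by (rule card_PiE)
  also have "... = (\<Prod>a\<in>V. if a : A then card V else n)" using P by (intro prod.cong refl) auto
  also have "... = card V ^ card A * n ^ card (V - A)"
   using V fA by (simp add: prod.If_cases Int_absorb1 Diff_eq)
  finally have "card (?T A) = card V ^ s * n ^ (card V - s)" using fA V by (simp add: card_Diff_subset)
  then have "real (card (?T A)) = card V ^ s * real n ^ (card V - s)" by simp
  also have "real n ^ (card V - s) = real n ^ card V / real n ^ s" using n le by (simp add: power_diff)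
  finally show ?thesis .
 qed
 have "card {\<psi> : inj_maps V {1..n}. s <= card (P Int \<psi> ` V)} <= card (\<Union>A\<in>?F. ?T A)"
  using V P finF by (intro card_mono[OF _ sub]) (auto intro!: finite_PiE)
 also have "... <= (SUM A:?F. card (?T A))" by (rule card_UN_le[OF finF])
 finally have "real (card {\<psi> : inj_maps V {1..n}. s <= card (P Int \<psi> ` V)}) <= real (SUM A:?F. card (?T A))"
  by (rule of_nat_mono)
 also have "real (SUM A:?F. card (?T A)) = (SUM A:?F. real (card (?T A)))" by (rule of_nat_sum)
 also have "(SUM A:?F. real (card (?T A))) = real (card ?F) * (card V ^ s * (real n ^ card V / real n ^ s))" using cT by simp
 also have "... <= 2 ^ card V * (card V ^ s * (real n ^ card V / real n ^ s))"
 proof (rule mult_right_mono)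
  show "real (card ?F) <= 2 ^ card V" using of_nat_mono[OF cardF, where 'a = real] by simp
 qed simp
 finally show ?thesis by (simp add: mult.assoc)
qed

lemma card_inj_maps_le:
 assumes "finite V"
 shows "real (card (inj_maps V {1..n})) <= real n ^ card V"
proof -
 have "card (inj_maps V {1..n}) <= card (V \<rightarrow>\<^sub>E {1..n})"
  using assms by (intro card_mono finite_PiE) (auto simp: inj_maps_def)
 also have "... = n ^ card V" using assms by (simp add: card_funcsetE)
 finally have "real (card (inj_maps V {1..n})) <= real (n ^ card V)" by (rule of_nat_mono)
 then show ?thesis by simp
qed

text \<open>Only pairs of embeddings sharing at least \<open>s\<close> vertices contribute to the second moment.\<close>

lemma second_moment_sum_inj_maps:
 fixes R :: "('v => nat) => (nat \<times> nat => real) => real"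
 assumes V: "finite V" and n: "1 <= n" and Bd: "0 <= Bd"
  and bm: "!!em. em : inj_maps V {1..n} ==> bdm cube (R em)"
  and dep: "!!em. em : inj_maps V {1..n} ==> depends_on (em ` V \<times> em ` V) (R em)"
  and sq: "!!em. em : inj_maps V {1..n} ==> (LINT w|cube. (R em w)^2) <= Bd"
  and deg: "!!em S. em : inj_maps V {1..n} ==> S <= em ` V ==> card S < s ==>
   AE w in cube. cond_mean (S \<times> S) (R em) w = 0"
 shows "(LINT w|cube. (SUM em:inj_maps V {1..n}. R em w)^2) <=
  Bd * (2 ^ card V * card V ^ s) * (real n ^ card V * (real n ^ card V / real n ^ s))"
proof -
 let ?I = "inj_maps V {1..n}"
 let ?c = "2 ^ card V * card V ^ s * (real n ^ card V / real n ^ s)"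
 have eq: "(SUM em:?I. R em w)^2 = (SUM em:?I. \<Sum>\<psi>\<in>?I. 1 * (R em w * R \<psi> w))" for w
  by (simp add: power2_eq_square sum_product)
 have "(LINT w|cube. (SUM em:?I. R em w)^2) = (SUM em:?I. \<Sum>\<psi>\<in>?I. 1 * (LINT w|cube. R em w * R \<psi> w))"
  unfolding eq by (rule integral_double_sum) (intro integrable_cube bdm_mult bm)
 also have "... <= (SUM em:?I. \<Sum>\<psi>\<in>?I. if s <= card (em ` V Int \<psi> ` V) then Bd else 0)"
 proof (intro sum_mono)
  fix em \<psi> assume p: "em : ?I" "\<psi> : ?I"
  show "1 * (LINT w|cube. R em w * R \<psi> w) <= (if s <= card (em ` V Int \<psi> ` V) then Bd else 0)"
  proof (cases "s <= card (em ` V Int \<psi> ` V)")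
   case True
   have "(LINT w|cube. R em w * R \<psi> w) <= (LINT w|cube. ((R em w)^2 + (R \<psi> w)^2) / 2)"
   proof (rule integral_mono)
    show "integrable cube (%w. R em w * R \<psi> w)" by (intro integrable_cube bdm_mult bm p)
    show "integrable cube (%w. ((R em w)^2 + (R \<psi> w)^2) / 2)"
     by (intro integrable_divide integrable_cube bdm_add bdm_power bm p)
    show "R em w * R \<psi> w <= ((R em w)^2 + (R \<psi> w)^2) / 2" for w
     using sum_squares_bound[of "R em w" "R \<psi> w"] by simp
   qed
   also have "... = ((LINT w|cube. (R em w)^2) + (LINT w|cube. (R \<psi> w)^2)) / 2"
    using p by (simp add: integrable_cube bdm_power bm)
   also have "... <= Bd" using sq[OF p(1)] sq[OF p(2)] by simp
   finally show ?thesis using True by simp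
  next
   case False
   let ?S = "\<psi> ` V Int em ` V"
   have c: "card ?S < s" using False by (simp add: Int_commute)
   have D: "(\<psi> ` V \<times> \<psi> ` V) Int (em ` V \<times> em ` V) = ?S \<times> ?S" by auto
   have z: "AE w in cube. cond_mean (?S \<times> ?S) (R em) w = 0" by (rule deg[OF p(1) _ c]) auto
   \<comment> \<open>The second factor reads only coordinates over its own vertices, so the first
     may be replaced by its projection to the shared ones, and with fewer than \<open>s\<close> of
     them this projection vanishes.\<close>
   have "(LINT w|cube. R em w * R \<psi> w) = (LINT w|cube. cond_mean (\<psi> ` V \<times> \<psi> ` V) (R em) w * R \<psi> w)"
    by (rule integral_mult_cond_mean[OF bm[OF p(1)] bm[OF p(2)] dep[OF p(2)]])
   also have "... = (LINT w|cube. cond_mean (?S \<times> ?S) (R em) w * R \<psi> w)"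
   proof (intro lint_cong refl arg_cong2[where f = times])
    fix w :: "nat \<times> nat => real" assume w: "w : space cube"
    show "cond_mean (\<psi> ` V \<times> \<psi> ` V) (R em) w = cond_mean (?S \<times> ?S) (R em) w"
     using cond_mean_depends_Int[OF bm[OF p(1)] dep[OF p(1)] w, of "\<psi> ` V \<times> \<psi> ` V"] unfolding D .
   qed
   also have "... = 0"
    by (rule integral_eq_zero_AE) (use z in eventually_elim, simp)
   finally show ?thesis using False by simp
  qed
 qed
 also have "... = (SUM em:?I. Bd * real (card {\<psi> : ?I. s <= card (em ` V Int \<psi> ` V)}))"
 proof (rule sum.cong[OF refl])
  fix em assume "em : ?I"
  have "(\<Sum>\<psi>\<in>?I. if s <= card (em ` V Int \<psi> ` V) then Bd else 0) = (\<Sum>\<psi>\<in>{\<psi> : ?I. s <= card (em ` V Int \<psi> ` V)}. Bd)"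
   using V by (intro sum.inter_filter[symmetric]) auto
  then show "(\<Sum>\<psi>\<in>?I. if s <= card (em ` V Int \<psi> ` V) then Bd else 0) = Bd * real (card {\<psi> : ?I. s <= card (em ` V Int \<psi> ` V)})"
   by (simp add: mult.commute)
 qed
 also have "... <= (SUM em:?I. Bd * ?c)"
 proof (intro sum_mono mult_left_mono Bd)
  fix em assume p: "em : ?I"
  show "real (card {\<psi> : ?I. s <= card (em ` V Int \<psi> ` V)}) <= ?c"
   using V n inj_mapsD(1)[OF p] by (intro card_inj_maps_meeting_le) (auto simp: card_image)
 qed
 also have "... = real (card ?I) * (Bd * ?c)" by simp
 also have "... <= real n ^ card V * (Bd * ?c)"
  using Bd by (intro mult_right_mono card_inj_maps_le V) auto
 finally show ?thesis by (simp add: mult_ac)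
qed

section \<open>Linear and quadratic statistics of the vertex variables\<close>

definition lin_stat :: "nat => (real => real) => (nat \<times> nat => real) => real" where
 "lin_stat n h w = (SUM i:{1..n}. h (w (i, i)))"

definition quad_stat :: "nat => (real \<times> real => real) => (nat \<times> nat => real) => real" where
 "quad_stat n A w = (SUM (i, j):distinct_pairs n. A (w (i, i), w (j, j)))"

lemma falling_factorial_0 [simp]: "falling_factorial n 0 = 1"
 by (simp add: falling_factorial_def)

lemma bdm_vertex:
 "bdm unit_unif h ==> bdm cube (%w. h (w i))"
 by (rule bdm_compose[OF _ measurable_cube_component])

lemma bdm_vertex2:
 "bdm unit_square A ==> bdm cube (%w. A (w i, w j))"
 by (rule bdm_compose[OF _ measurable_Pair[OF measurable_cube_component measurable_cube_component]])

lemma depends_on_vertex: "i : K ==> depends_on K (%w. h (w i))"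
 by (simp add: depends_on_def)

lemma depends_on_vertex2: "i : K ==> j : K ==> depends_on K (%w. h (w i) (w j))"
 by (simp add: depends_on_def)

text \<open>The general bound for embeddings of a single vertex, with \<open>s = 1\<close>; the
  constant 2 is \<open>2 ^ card V\<close>.\<close>

lemma lin_stat_sq_le:
 assumes h: "bdm unit_unif h" and z: "(LINT x|unit_unif. h x) = 0"
  and Bd: "(LINT x|unit_unif. (h x)^2) <= Bd" and n: "1 <= n"
 shows "(LINT w|cube. (lin_stat n h w)^2) <= 2 * Bd * real n"
proof -
 let ?V = "{1::nat}"
 have "0 <= (LINT x|unit_unif. (h x)^2)" by simp
 with Bd have Bd0: "0 <= Bd" by linarith
 have hm: "h : borm unit_unif" by (rule bdm_measurable[OF h])
 have eq: "lin_stat n h w = (SUM em:inj_maps ?V {1..n}. h (w (em 1, em 1)))" for w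
  using sum_inj_maps_1[of ?V 1 "%i. h (w (i, i))" n] by (simp add: lin_stat_def)
 have "(LINT w|cube. (SUM em:inj_maps ?V {1..n}. h (w (em 1, em 1)))^2) <=
   Bd * (2 ^ card ?V * card ?V ^ 1) * (real n ^ card ?V * (real n ^ card ?V / real n ^ 1))"
 proof (rule second_moment_sum_inj_maps)
  fix em :: "nat => nat" assume p: "em : inj_maps ?V {1..n}"
  show "bdm cube (%w. h (w (em 1, em 1)))" by (rule bdm_vertex[OF h])
  show "depends_on (em ` ?V \<times> em ` ?V) (%w. h (w (em 1, em 1)))" by (rule depends_on_vertex) simp
  show "(LINT w|cube. (h (w (em 1, em 1)))^2) <= Bd"
   using integral_cube_component[of "%x. (h x)^2" "(em 1, em 1)"] hm Bd by simp
  fix S assume "S <= em ` ?V" "card S < 1"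
  then have "S = {}" using finite_subset[of S] by auto
  then show "AE w in cube. cond_mean (S \<times> S) (%w. h (w (em 1, em 1))) w = 0"
   using integral_cube_component[OF hm, of "(em 1, em 1)"] z by (simp add: cond_mean_empty)
 qed (use n Bd0 in auto)
 then show ?thesis unfolding eq using n by simp
qed

lemma cond_mean_vertex2:
 assumes A: "A : borm unit_square" and ij: "i ~= j" and w: "w : space cube"
 shows "i : K ==> j ~: K ==> cond_mean K (%w. A (w i, w j)) w = (LINT y|unit_unif. A (w i, y))"
  "i ~: K ==> j : K ==> cond_mean K (%w. A (w i, w j)) w = (LINT x|unit_unif. A (x, w j))"
  "i ~: K ==> j ~: K ==> cond_mean K (%w. A (w i, w j)) w = (LINT p|unit_square. A p)"
proof -
 have r: "w k : space unit_unif" for k using w by (simp add: space_cube)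
 show "cond_mean K (%w. A (w i, w j)) w = (LINT y|unit_unif. A (w i, y))" if "i : K" "j ~: K"
  using that integral_cube_component[of "%y. A (w i, y)" j] measurable_compose[OF measurable_Pair1'[OF r] A]
  by (simp add: cond_mean_def override_on_def)
 show "cond_mean K (%w. A (w i, w j)) w = (LINT x|unit_unif. A (x, w j))" if "i ~: K" "j : K"
  using that integral_cube_component[of "%x. A (x, w j)" i] measurable_compose[OF measurable_Pair2'[OF r] A]
  by (simp add: cond_mean_def override_on_def)
 show "cond_mean K (%w. A (w i, w j)) w = (LINT p|unit_square. A p)" if "i ~: K" "j ~: K"
  using that integral_cube_pair[OF ij A] by (simp add: cond_mean_def override_on_def)
qed

lemma quad_stat_inj_maps:
 "quad_stat n A w = (SUM em:inj_maps {1::nat, 2} {1..n}. A (w (em 1, em 1), w (em 2, em 2)))"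
 using sum_inj_maps_2[of "{1::nat, 2}" 1 2 "%i j. A (w (i, i), w (j, j))" n]
 by (simp add: quad_stat_def)

text \<open>Here \<open>s\<close> is the order of degeneracy: a merely centred kernel gives a second
  moment of order n^3, a kernel with vanishing marginals one of order n^2. The constant 16 covers
  \<open>4 * 2 ^ s\<close> in both cases.\<close>

lemma quad_stat_sq_le:
 assumes A: "bdm unit_square A" and Bd: "(LINT p|unit_square. (A p)^2) <= Bd" and n: "1 <= n"
  and s: "s = 1 \<or> s = 2" and z: "(LINT p|unit_square. A p) = 0"
  and d: "s = 2 ==> AE x in unit_unif. (LINT y|unit_unif. A (x, y)) = 0"
   "s = 2 ==> AE y in unit_unif. (LINT x|unit_unif. A (x, y)) = 0"
 shows "(LINT w|cube. (quad_stat n A w)^2) <= 16 * Bd * (real n ^ 4 / real n ^ s)"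
proof -
 let ?V = "{1::nat, 2}"
 have "0 <= (LINT x|unit_square. (A x)^2)" by simp
 with Bd have Bd0: "0 <= Bd" by linarith
 have Am: "A : borm unit_square" by (rule bdm_measurable[OF A])
 have "(LINT w|cube. (SUM em:inj_maps ?V {1..n}. A (w (em 1, em 1), w (em 2, em 2)))^2) <=
   Bd * (2 ^ card ?V * card ?V ^ s) * (real n ^ card ?V * (real n ^ card ?V / real n ^ s))"
 proof (rule second_moment_sum_inj_maps)
  fix em :: "nat => nat" assume p: "em : inj_maps ?V {1..n}"
  let ?i = "em 1" and ?j = "em 2"
  have ij: "?i ~= ?j" using inj_onD[OF inj_mapsD(1)[OF p], of 1 2] by auto
  show "bdm cube (%w. A (w (?i, ?i), w (?j, ?j)))" by (rule bdm_vertex2[OF A])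
  show "depends_on (em ` ?V \<times> em ` ?V) (%w. A (w (?i, ?i), w (?j, ?j)))"
   by (rule depends_on_vertex2[where h = "%x y. A (x, y)"]) auto
  show "(LINT w|cube. (A (w (?i, ?i), w (?j, ?j)))^2) <= Bd"
   using integral_cube_pair[of "(?i, ?i)" "(?j, ?j)" "%p. (A p)^2"] ij Am Bd by simp
  fix S assume S: "S <= em ` ?V" "card S < s"
  have fS: "finite S" using S(1) by (rule finite_subset) simp
  consider "?i ~: S" "?j ~: S" | "s = 2" "?i : S" "?j ~: S" | "s = 2" "?i ~: S" "?j : S"
  proof (cases "?i : S"; cases "?j : S")
   assume "?i : S" "?j : S"
   then have "card {?i, ?j} <= card S" using fS by (intro card_mono) auto
   then show thesis using S(2) s ij by auto
  next
   assume a: "?i : S" "?j ~: S"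
   have "1 <= card S" using a fS by (metis One_nat_def Suc_leI card_gt_0_iff empty_iff)
   then show thesis using that(2) a S(2) s by auto
  next
   assume a: "?i ~: S" "?j : S"
   have "1 <= card S" using a fS by (metis One_nat_def Suc_leI card_gt_0_iff empty_iff)
   then show thesis using that(3) a S(2) s by auto
  qed (use that in auto)
  then show "AE w in cube. cond_mean (S \<times> S) (%w. A (w (?i, ?i), w (?j, ?j))) w = 0"
  proof cases
   case 1
   show ?thesis
    by (rule AE_I2) (use cond_mean_vertex2(3)[OF Am, of "(?i, ?i)" "(?j, ?j)" _ "S \<times> S"] 1 ij z in auto)
  next
   case 2
   have "AE w in cube. (LINT y|unit_unif. A (w (?i, ?i), y)) = 0" using d(1)[OF 2(1)] by (rule AE_cube_component)
   then show ?thesis using AE_space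
    by eventually_elim (use cond_mean_vertex2(1)[OF Am, of "(?i, ?i)" "(?j, ?j)" _ "S \<times> S"] 2 ij in auto)
  next
   case 3
   have "AE w in cube. (LINT x|unit_unif. A (x, w (?j, ?j))) = 0" using d(2)[OF 3(1)] by (rule AE_cube_component)
   then show ?thesis using AE_space
    by eventually_elim (use cond_mean_vertex2(2)[OF Am, of "(?i, ?i)" "(?j, ?j)" _ "S \<times> S"] 3 ij in auto)
  qed
 qed (use n Bd0 in auto)
 also have "real n ^ card ?V * (real n ^ card ?V / real n ^ s) = real n ^ 4 / real n ^ s"
  by (simp add: power4_eq_xxxx power2_eq_square)
 also have "Bd * (2 ^ card ?V * card ?V ^ s) = Bd * (4 * 2 ^ s)" by simp
 also have "Bd * (4 * 2 ^ s) * (real n ^ 4 / real n ^ s) <= Bd * 16 * (real n ^ 4 / real n ^ s)"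
  using s Bd0 by (intro mult_right_mono mult_left_mono) auto
 finally show ?thesis unfolding quad_stat_inj_maps by (simp add: mult_ac)
qed

lemma bdm_lin_stat: "bdm unit_unif h ==> bdm cube (lin_stat n h)"
 unfolding lin_stat_def[abs_def] by (intro bdm_sum bdm_vertex)

lemma bdm_quad_stat: "bdm unit_square A ==> bdm cube (quad_stat n A)"
 unfolding quad_stat_inj_maps[abs_def] by (intro bdm_sum bdm_vertex2)

section \<open>The random graph on the cube and its conditional densities\<close>

text \<open>The coordinate \<open>(i, i)\<close> of the cube carries \<open>U\<^sub>i\<close> and the coordinate \<open>(i, j)\<close>, \<open>i < j\<close>, carries \<open>Y\<^sub>i\<^sub>j\<close>.\<close>

definition cube_graph :: "nat => (real => real => real) => (nat \<times> nat => real) => sgraph" where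
 "cube_graph n W w = threshold_graph n W (\<lambda>i\<in>{1..n}. w (i, i), \<lambda>e\<in>vertex_pairs n. w e)"

lemma distr_cube_vertices_pairs:
 "distr cube ((\<Pi>\<^sub>M i\<in>{1..n}. unit_unif) \<Otimes>\<^sub>M (\<Pi>\<^sub>M e\<in>vertex_pairs n. unit_unif))
   (%w. (\<lambda>i\<in>{1..n}. w (i, i), \<lambda>e\<in>vertex_pairs n. w e)) =
  (\<Pi>\<^sub>M i\<in>{1..n}. unit_unif) \<Otimes>\<^sub>M (\<Pi>\<^sub>M e\<in>vertex_pairs n. unit_unif)"
  (is "distr cube (?P \<Otimes>\<^sub>M ?Q) ?T = _")
proof -
 let ?r1 = "%w. \<lambda>i\<in>{1..n}. w (i, i) :: real" and ?r2 = "%w. \<lambda>e\<in>vertex_pairs n. w e :: real"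
 let ?K = "range (%i::nat. (i, i))"
 have r1: "?r1 : cube \<rightarrow>\<^sub>M ?P" by (rule measurable_restrict) measurable
 have r2: "?r2 : cube \<rightarrow>\<^sub>M ?Q" by (rule measurable_restrict) measurable
 have T: "?T : cube \<rightarrow>\<^sub>M ?P \<Otimes>\<^sub>M ?Q" using r1 r2 by (rule measurable_Pair)
 have d1: "distr cube ?P ?r1 = ?P" by (rule distr_cube_PiM[of "%i. (i, i)"]) (auto simp: inj_on_def)
 have d2: "distr cube ?Q ?r2 = ?Q" by (rule distr_cube_PiM[of "%e. e"]) auto
 have sf: "sigma_finite_measure (distr cube ?Q ?r2)"
  unfolding d2 by (intro prob_space_imp_sigma_finite prob_space_PiM prob_space_unit_unif)
 \<comment> \<open>The diagonal coordinates may be drawn from one sample and the others from an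
   independent one, which displays the joint law as a product.\<close>
 have "distr cube (?P \<Otimes>\<^sub>M ?Q) ?T = distr (distr (cube \<Otimes>\<^sub>M cube) cube (%(w, w'). override_on w' w ?K)) (?P \<Otimes>\<^sub>M ?Q) ?T"
  by (simp only: distr_cube_override_on)
 also have "... = distr (cube \<Otimes>\<^sub>M cube) (?P \<Otimes>\<^sub>M ?Q) (?T \<circ> (%(w, w'). override_on w' w ?K))"
  by (rule distr_distr[OF T measurable_override_on])
 also have "... = distr (cube \<Otimes>\<^sub>M cube) (?P \<Otimes>\<^sub>M ?Q) (%(w, w'). (?r1 w, ?r2 w'))"
 proof (rule distr_cong[OF refl refl])
  fix p :: "(nat \<times> nat => real) \<times> (nat \<times> nat => real)"
  show "(?T \<circ> (%(w, w'). override_on w' w ?K)) p = (%(w, w'). (?r1 w, ?r2 w')) p"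
   by (cases p) (auto simp: override_on_def fun_eq_iff vertex_pairs_def restrict_def)
 qed
 also have "... = distr cube ?P ?r1 \<Otimes>\<^sub>M distr cube ?Q ?r2"
  by (rule pair_measure_distr[OF r1 r2 sf, symmetric])
 finally show ?thesis by (simp only: d1 d2)
qed

lemma measurable_cube_graph:
 assumes "graphon W"
 shows "cube_graph n W : cube \<rightarrow>\<^sub>M count_space (graphs_on n)"
proof -
 have "(%w. (\<lambda>i\<in>{1..n}. w (i, i), \<lambda>e\<in>vertex_pairs n. w e)) :
   cube \<rightarrow>\<^sub>M (\<Pi>\<^sub>M i\<in>{1..n}. unit_unif) \<Otimes>\<^sub>M (\<Pi>\<^sub>M e\<in>vertex_pairs n. unit_unif)"
  by (intro measurable_Pair measurable_restrict) measurable
 from measurable_compose[OF this measurable_threshold_graph[OF assms]] show ?thesis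
  unfolding cube_graph_def[abs_def] .
qed

lemma distr_cube_graph:
 assumes W: "graphon W"
 shows "distr cube (count_space (graphs_on n)) (cube_graph n W) = graphon_random_graph n W"
proof -
 have m: "(%w. (\<lambda>i\<in>{1..n}. w (i, i), \<lambda>e\<in>vertex_pairs n. w e)) :
   cube \<rightarrow>\<^sub>M (\<Pi>\<^sub>M i\<in>{1..n}. unit_unif) \<Otimes>\<^sub>M (\<Pi>\<^sub>M e\<in>vertex_pairs n. unit_unif)"
  by (intro measurable_Pair measurable_restrict) measurable
 let ?T = "%w. (\<lambda>i\<in>{1..n}. w (i, i), \<lambda>e\<in>vertex_pairs n. w e :: real)"
 let ?PQ = "(\<Pi>\<^sub>M i\<in>{1..n}. unit_unif) \<Otimes>\<^sub>M (\<Pi>\<^sub>M e\<in>vertex_pairs n. unit_unif)"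
 have "graphon_random_graph n W = distr (distr cube ?PQ ?T) (count_space (graphs_on n)) (threshold_graph n W)"
  by (simp only: graphon_random_graph_def distr_cube_vertices_pairs)
 also have "... = distr cube (count_space (graphs_on n)) (threshold_graph n W \<circ> ?T)"
  by (rule distr_distr[OF measurable_threshold_graph[OF W] m])
 also have "threshold_graph n W \<circ> ?T = cube_graph n W" by (simp only: fun_eq_iff o_apply cube_graph_def simp_thms)
 finally show ?thesis ..
qed

lemma integral_graphon_random_graph:
 fixes F :: "sgraph => 'b::{banach, second_countable_topology}"
 assumes "graphon W"
 shows "(\<integral>G. F G \<partial>graphon_random_graph n W) = (LINT w|cube. F (cube_graph n W w))"
 unfolding distr_cube_graph[OF assms, symmetric]
 by (rule integral_distr[OF measurable_cube_graph[OF assms]]) simp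

section \<open>Edge indicators and their conditional means\<close>

definition edge_ind :: "(real => real => real) => nat => nat => (nat \<times> nat => real) => real" where
 "edge_ind W i j w = (if w (min i j, max i j) <= W (w (i, i)) (w (j, j)) then 1 else 0)"

definition hom_ind :: "(real => real => real) => sgraph => (nat => nat) => (nat \<times> nat => real) => real" where
 "hom_ind W H em w = (\<Prod>(a, b)\<in>edges H. edge_ind W (em a) (em b) w)"

lemma graphon_range: "graphon W ==> x : {0..1} ==> y : {0..1} ==> 0 <= W x y & W x y <= 1"
 by (auto simp: graphon_def)

lemma graphon_sym: "graphon W ==> x : {0..1} ==> y : {0..1} ==> W x y = W y x"
 by (auto simp: graphon_def)

lemma cube_range: "w : space cube ==> w i : {0..1}"
 by (simp add: space_cube)

lemma edge_ind_sym:
 assumes "graphon W" "w : space cube"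
 shows "edge_ind W i j w = edge_ind W j i w"
 using graphon_sym[OF assms(1) cube_range[OF assms(2)] cube_range[OF assms(2)]]
 by (simp add: edge_ind_def min.commute max.commute)

lemma bdm_edge_ind:
 assumes W: "graphon W"
 shows "bdm cube (edge_ind W i j)"
proof (rule bdmI[where C = 1])
 have [measurable]: "(%w. W (w (i, i)) (w (j, j))) : borm cube"
  by (rule measurable_graphon[OF W]) measurable
 have [measurable]: "(%w. w (min i j, max i j)) : borm cube"
  by (rule measurable_compose[OF measurable_cube_component measurable_unit_unif_borel])
 show "edge_ind W i j : borm cube" unfolding edge_ind_def[abs_def] by measurable
qed (simp add: edge_ind_def)

lemma bdm_hom_ind: "graphon W ==> bdm cube (hom_ind W H em)"
 unfolding hom_ind_def[abs_def] split_beta' by (intro bdm_prod bdm_edge_ind)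

lemma hom_ind_range: "0 <= hom_ind W H em w" "hom_ind W H em w <= 1"
 unfolding hom_ind_def by (auto intro!: prod_nonneg prod_le_1 simp: edge_ind_def split_beta')

lemma depends_on_edge_ind:
 assumes "i : S" "j : S"
 shows "depends_on (S \<times> S) (edge_ind W i j)"
proof -
 have "(min i j, max i j) : S \<times> S" using assms by (auto simp: min_def max_def)
 then show ?thesis using assms unfolding depends_on_def edge_ind_def by auto
qed

lemma depends_on_hom_ind:
 assumes "simple_graph H"
 shows "depends_on (em ` verts H \<times> em ` verts H) (hom_ind W H em)"
 unfolding hom_ind_def[abs_def] split_beta'
 by (intro depends_on_prod depends_on_edge_ind) (use assms in \<open>auto simp: simple_graph_def\<close>)

lemma ordered_edges_cube_graph:
 assumes W: "graphon W" and w: "w : space cube" and ij: "i : {1..n}" "j : {1..n}" "i ~= j"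
 shows "(i, j) : ordered_edges (cube_graph n W w) \<longleftrightarrow> edge_ind W i j w = 1"
proof -
 have e: "(i, j) : ordered_edges (cube_graph n W w) \<longleftrightarrow> edge_ind W i j w = 1"
  if "i < j" "i : {1..n}" "j : {1..n}" for i j
  using that by (auto simp: ordered_edges_def cube_graph_def threshold_graph_def vertex_pairs_def edge_ind_def)
 show ?thesis
 proof (cases "i < j")
  case True
  then show ?thesis using e ij by simp
 next
  case False
  then show ?thesis using e[of j i] ij ordered_edges_sym[of i j] edge_ind_sym[OF W w, of i j] by simp
 qed
qed

lemma simple_graph_cube_graph: "simple_graph (cube_graph n W w)"
 by (auto simp: simple_graph_def cube_graph_def threshold_graph_def vertex_pairs_def)

lemma verts_cube_graph [simp]: "verts (cube_graph n W w) = {1..n}"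
 by (simp add: cube_graph_def threshold_graph_def)

lemma subgraph_count_cube_graph:
 assumes W: "graphon W" and H: "simple_graph H" and w: "w : space cube"
 shows "real (card (Aut H)) * real (subgraph_count H (cube_graph n W w)) = (SUM em:inj_maps (verts H) {1..n}. hom_ind W H em w)"
proof -
 let ?G = "cube_graph n W w"
 have fin: "finite (verts H)" using H by (simp add: simple_graph_def)
 have h: "hom_ind W H em w = (if em : inj_homs H ?G then 1 else 0)" if p: "em : inj_maps (verts H) {1..n}" for em
 proof -
  have e: "(em a, em b) : ordered_edges ?G \<longleftrightarrow> edge_ind W (em a) (em b) w = 1" if ab: "(a, b) : edges H" for a b
  proof -
   have v: "a : verts H" "b : verts H" "a ~= b" using H ab by (auto simp: simple_graph_def)
   then have "em a ~= em b" using inj_onD[OF inj_mapsD(1)[OF p]] by auto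
   then show ?thesis using ordered_edges_cube_graph[OF W w] inj_mapsD(2)[OF p] v by simp
  qed
  show ?thesis
  proof (cases "em : inj_homs H ?G")
   case True
   then have "edge_ind W (em a) (em b) w = 1" if "(a, b) : edges H" for a b
    using that e by (auto simp: inj_homs_def)
   then have "hom_ind W H em w = 1" unfolding hom_ind_def by (intro prod.neutral) auto
   then show ?thesis using True by simp
  next
   case False
   then obtain a b where ab: "(a, b) : edges H" "(em a, em b) ~: ordered_edges ?G"
    using p by (auto simp: inj_homs_def)
   then have "edge_ind W (em a) (em b) w = 0" using e[OF ab(1)] by (auto simp: edge_ind_def split: if_splits)
   then have "hom_ind W H em w = 0"
    unfolding hom_ind_def by (intro prod_zero finite_edges[OF H] bexI[OF _ ab(1)]) simp
   then show ?thesis using False by simp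
  qed
 qed
 have "(SUM em:inj_maps (verts H) {1..n}. hom_ind W H em w) =
   (SUM em:inj_maps (verts H) {1..n}. if em : inj_homs H ?G then 1 else 0)"
  by (intro sum.cong refl h)
 also have "... = (SUM em:inj_maps (verts H) {1..n} Int inj_homs H ?G. 1)"
  using fin by (subst sum.inter_restrict) auto
 also have "inj_maps (verts H) {1..n} Int inj_homs H ?G = inj_homs H ?G" by (auto simp: inj_homs_def)
 finally show ?thesis using card_inj_homs[OF H simple_graph_cube_graph, of n W w] by simp
qed

text \<open>General enough for the density of \<open>H\<close> and its versions with one or two
  positions fixed. The edge set is a separate argument so that edges among the fixed vertices can be
  left out.\<close>

definition partial_density ::
 "(real => real => real) => ('v \<times> 'v) set => 'v set => 'v set => ('v => real) => real" where
 "partial_density W E V C u =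
   (LINT z|(\<Pi>\<^sub>M c\<in>V - C. unit_unif). (\<Prod>(a, b)\<in>E. W (override_on z u C a) (override_on z u C b)))"

lemma partial_density_cong:
 assumes "!!c. c : C ==> u c = v c"
 shows "partial_density W E V C u = partial_density W E V C v"
proof -
 have "override_on z u C = override_on z v C" for z using assms by (auto simp: override_on_def fun_eq_iff)
 then show ?thesis by (simp add: partial_density_def)
qed

lemma measurable_override_component:
 assumes "c : V" "!!c. c : C ==> u c : {0..1}"
 shows "(%z. override_on z u C c) : (\<Pi>\<^sub>M c\<in>V - C. unit_unif) \<rightarrow>\<^sub>M unit_unif"
 using assms by (cases "c : C") (auto simp: override_on_def intro!: measurable_component_singleton)

text \<open>The link between resampling on the cube and the densities of the statement. The map
  \<rho> names the coordinate that carries a vertex, and of the kept set \<open>K\<close> only its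
  trace on these coordinates matters.\<close>

lemma cond_mean_prod_graphon:
 assumes W: "graphon W" and \<rho>: "inj_on \<rho> V" and E: "E <= V \<times> V" and C: "C <= V"
  and K: "!!c. c : V ==> \<rho> c : K \<longleftrightarrow> c : C" and w: "w : space cube"
 shows "cond_mean K (%w. \<Prod>(a, b)\<in>E. W (w (\<rho> a)) (w (\<rho> b))) w = partial_density W E V C (%c. w (\<rho> c))"
proof -
 let ?u = "%c. w (\<rho> c)"
 let ?F = "%z. \<Prod>(a, b)\<in>E. W (override_on z ?u C a) (override_on z ?u C b)"
 have F: "?F : borm (\<Pi>\<^sub>M c\<in>V - C. unit_unif)"
  unfolding split_beta'
 proof (intro borel_measurable_prod measurable_graphon[OF W] measurable_override_component)
  fix e assume "e : E"
  then show "fst e : V" "snd e : V" using E by auto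
 qed (use cube_range[OF w] in auto)
 have "partial_density W E V C ?u = (LINT w'|cube. ?F (\<lambda>c\<in>V - C. w' (\<rho> c)))"
  unfolding partial_density_def
  by (rule integral_PiM_cube[OF _ F]) (rule inj_on_subset[OF \<rho>], auto)
 also have "... = cond_mean K (%w. \<Prod>(a, b)\<in>E. W (w (\<rho> a)) (w (\<rho> b))) w"
  unfolding cond_mean_def
 proof (intro lint_cong refl prod.cong)
  fix w' :: "'b => real" and e assume e: "e : E"
  obtain a b where ab: "e = (a, b)" by (cases e)
  have "override_on (\<lambda>c\<in>V - C. w' (\<rho> c)) ?u C c = override_on w' w K (\<rho> c)" if "c : V" for c
   using that K[OF that] by (simp add: override_on_def)
  moreover have "a : V" "b : V" using e E ab by auto
  ultimately show "(case e of (a, b) => W (override_on (\<lambda>c\<in>V - C. w' (\<rho> c)) ?u C a) (override_on (\<lambda>c\<in>V - C. w' (\<rho> c)) ?u C b)) =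
   (case e of (a, b) => W (override_on w' w K (\<rho> a)) (override_on w' w K (\<rho> b)))"
   by (simp add: ab)
 qed
 finally show ?thesis ..
qed

lemma integral_le_indicator:
 assumes "c : {0..1}"
 shows "(LINT w|cube. (if w i <= c then 1 else 0 :: real)) = c"
proof -
 have A: "{..c} Int {0..1} : sets unit_unif" by (auto simp: unit_unif_def sets_restrict_space)
 have "(LINT w|cube. (if w i <= c then 1 else 0 :: real)) = (LINT w|cube. indicator ({..c} Int {0..1}) (w i))"
 proof (intro lint_cong refl)
  fix w :: "'a => real" assume "w : space cube"
  then show "(if w i <= c then 1 else 0) = (indicator ({..c} Int {0..1}) (w i) :: real)"
   using cube_range[of w i] by (simp add: indicator_def)
 qed
 also have "... = (LINT x|unit_unif. indicator ({..c} Int {0..1}) x)"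
  by (rule integral_cube_component) (use A in simp)
 also have "... = measure unit_unif ({..c} Int {0..1})" by simp
 also have "... = measure lborel ({..c} Int {0..1})"
  unfolding unit_unif_def by (intro measure_restrict_space) auto
 also have "{..c} Int {0..1} = {0..c}" using assms by auto
 finally show ?thesis using assms by simp
qed

text \<open>All vertex coordinates are kept, so only edge coordinates are averaged. Distinct edges
  of \<open>H\<close> use distinct coordinates, because the embedding is injective; hence the
  average factors, and each edge not inside \<open>S\<close> is replaced by its conditional
  probability.\<close>

lemma cond_mean_diag_hom_ind:
 assumes W: "graphon W" and H: "simple_graph H" and i: "inj_on em (verts H)" and w: "w : space cube"
 shows "cond_mean (S \<times> S \<union> range (%i. (i, i))) (hom_ind W H em) w =
  (\<Prod>(a, b)\<in>edges H. if em a : S & em b : S then edge_ind W (em a) (em b) w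
    else W (w (em a, em a)) (w (em b, em b)))"
proof -
 interpret Cb: prob_space "cube :: (nat \<times> nat => real) measure" by (rule prob_space_cube)
 let ?K = "S \<times> S \<union> range (%i. (i, i))"
 let ?p = "%e. (min (em (fst e)) (em (snd e)), max (em (fst e)) (em (snd e)))"
 let ?W = "%e. W (w (em (fst e), em (fst e))) (w (em (snd e), em (snd e)))"
 let ?g = "%e w'. if override_on w' w ?K (?p e) <= ?W e then 1 else 0 :: real"
 have v: "fst e : verts H" "snd e : verts H" "fst e < snd e" if "e : edges H" for e
  using H that by (auto simp: simple_graph_def)
 have pinj: "?p e ~= ?p e'" if e: "e : edges H" "e' : edges H" "e ~= e'" for e e'
 proof
  assume "?p e = ?p e'"
  then have "{em (fst e), em (snd e)} = {em (fst e'), em (snd e')}"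
   by (auto simp: min_def max_def split: if_splits)
  then have "em ` {fst e, snd e} = em ` {fst e', snd e'}" by simp
  then have "{fst e, snd e} = {fst e', snd e'}"
   using inj_on_image_eq_iff[OF i, of "{fst e, snd e}" "{fst e', snd e'}"] v[OF e(1)] v[OF e(2)] by simp
  then have "fst e = fst e' & snd e = snd e'" using v(3)[OF e(1)] v(3)[OF e(2)] by (auto simp: doubleton_eq_iff)
  then show False using e(3) by (simp add: prod_eq_iff)
 qed
 have gm: "bdm cube (?g e)" for e
 proof (rule bdmI[where C = 1])
  have "(%w'. override_on w' w ?K (?p e)) : borm cube"
   by (rule measurable_compose[OF measurable_compose[OF measurable_override_on2[OF w] measurable_cube_component] measurable_unit_unif_borel])
  then show "?g e : borm cube" by measurable
 qed simp
 have gd: "depends_on {?p e} (?g e)" for e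
  unfolding depends_on_def by (auto simp: override_on_def)
 have "cond_mean ?K (hom_ind W H em) w = (LINT w'|cube. (\<Prod>e\<in>edges H. ?g e w'))"
  unfolding cond_mean_def hom_ind_def split_beta' edge_ind_def
  by (intro lint_cong refl prod.cong) (simp add: override_on_def)
 also have "... = (\<Prod>e\<in>edges H. LINT w'|cube. ?g e w')"
  by (rule integral_prod_depends_on[OF finite_edges[OF H] gm gd]) (use pinj in \<open>simp add: disjoint_family_on_def\<close>)
 also have "... = (\<Prod>e\<in>edges H. if em (fst e) : S & em (snd e) : S then edge_ind W (em (fst e)) (em (snd e)) w else ?W e)"
 proof (rule prod.cong[OF refl])
  fix e assume e: "e : edges H"
  have ne: "em (fst e) ~= em (snd e)" using inj_onD[OF i] v[OF e] by fastforce
  show "(LINT w'|cube. ?g e w') = (if em (fst e) : S & em (snd e) : S then edge_ind W (em (fst e)) (em (snd e)) w else ?W e)"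
  proof (cases "em (fst e) : S & em (snd e) : S")
   case True
   then have "?p e : ?K" by (auto simp: min_def max_def)
   then have "?g e w' = edge_ind W (em (fst e)) (em (snd e)) w" for w'
    by (simp only: override_on_def edge_ind_def if_True)
   then show ?thesis using True by (simp add: Cb.prob_space)
  next
   case False
   then have "?p e ~: ?K" using ne by (auto simp: min_def max_def split: if_splits)
   then have "override_on w' w ?K (?p e) = w' (?p e)" for w' by (simp only: override_on_def if_False)
   then have "(LINT w'|cube. ?g e w') = (LINT w'|cube. (if w' (?p e) <= ?W e then 1 else 0 :: real))"
    by (simp only:)
   also have "... = ?W e"
    using graphon_range[OF W cube_range[OF w] cube_range[OF w]] by (intro integral_le_indicator) simp
   finally show ?thesis by (simp only: False if_False)
  qed
 qed
 finally show ?thesis by (simp add: split_beta')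
qed

lemma prod_split_set:
 fixes f g :: "'a => real"
 assumes "finite E"
 shows "(\<Prod>e\<in>E. if P e then f e else g e) = (\<Prod>e\<in>{e\<in>E. P e}. f e) * (\<Prod>e\<in>{e\<in>E. \<not> P e}. g e)"
proof -
 have "{e. P e} Int E = {e\<in>E. P e}" "E Int - {e. P e} = {e\<in>E. \<not> P e}" "E Int {e. P e} = {e\<in>E. P e}" by auto
 then show ?thesis using prod.If_cases[OF assms, of P f g] by simp
qed

text \<open>Averaging in two stages through the tower property: with all vertices kept, the edges
  outside \<open>C\<close> turn into values of the graphon while those inside remain indicators;
  then the vertices outside \<open>C\<close> are integrated out.\<close>

lemma cond_mean_hom_ind:
 assumes W: "graphon W" and H: "simple_graph H" and i: "inj_on em (verts H)" and C: "C <= verts H"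
  and w: "w : space cube"
 shows "cond_mean (em ` C \<times> em ` C) (hom_ind W H em) w =
  (\<Prod>(a, b)\<in>{(a, b)\<in>edges H. a : C & b : C}. edge_ind W (em a) (em b) w) *
  partial_density W {(a, b)\<in>edges H. \<not> (a : C & b : C)} (verts H) C (%c. w (em c, em c))"
proof -
 let ?S = "em ` C"
 let ?K = "?S \<times> ?S \<union> range (%i. (i, i))"
 let ?E1 = "{(a, b)\<in>edges H. a : C & b : C}" and ?E2 = "{(a, b)\<in>edges H. \<not> (a : C & b : C)}"
 let ?f1 = "%w. \<Prod>(a, b)\<in>?E1. edge_ind W (em a) (em b) w" and ?f2 = "%w. \<Prod>(a, b)\<in>?E2. W (w (em a, em a)) (w (em b, em b))"
 have v: "fst e : verts H" "snd e : verts H" if "e : edges H" for e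
  using H that by (auto simp: simple_graph_def)
 have iS: "em a : ?S \<longleftrightarrow> a : C" if "a : verts H" for a
  using inj_on_image_mem_iff[OF i that C] .
 have "cond_mean (?S \<times> ?S) (hom_ind W H em) w = cond_mean (?S \<times> ?S) (cond_mean ?K (hom_ind W H em)) w"
  using cond_mean_cond_mean[OF bdm_hom_ind[OF W] w, of "?S \<times> ?S" ?K H em] by (simp add: Int_absorb2)
 also have "... = cond_mean (?S \<times> ?S) (%w. ?f2 w * ?f1 w) w"
 proof (rule cond_mean_cong[OF _ w])
  fix w :: "nat \<times> nat => real" assume w: "w : space cube"
  have "cond_mean ?K (hom_ind W H em) w = (\<Prod>(a, b)\<in>edges H. if em a : ?S & em b : ?S then edge_ind W (em a) (em b) w
    else W (w (em a, em a)) (w (em b, em b)))"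
   by (rule cond_mean_diag_hom_ind[OF W H i w])
  also have "... = (\<Prod>e\<in>edges H. if fst e : C & snd e : C then edge_ind W (em (fst e)) (em (snd e)) w
    else W (w (em (fst e), em (fst e))) (w (em (snd e), em (snd e))))"
   by (intro prod.cong refl) (use iS v in \<open>simp add: split_beta'\<close>)
  also have "... = ?f1 w * ?f2 w"
   by (simp add: prod_split_set[OF finite_edges[OF H]] split_beta')
  finally show "cond_mean ?K (hom_ind W H em) w = ?f2 w * ?f1 w" by (simp only: mult.commute)
 qed
 also have "... = cond_mean (?S \<times> ?S) ?f2 w * ?f1 w"
 proof (rule cond_mean_mult[OF _ w])
  show "depends_on (?S \<times> ?S) ?f1"
   unfolding split_beta' by (intro depends_on_prod depends_on_edge_ind) auto
 qed
 also have "cond_mean (?S \<times> ?S) ?f2 w = partial_density W ?E2 (verts H) C (%c. w (em c, em c))"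
 proof (rule cond_mean_prod_graphon[OF W _ _ C _ w, where \<rho> = "%c. (em c, em c)"])
  show "inj_on (%c. (em c, em c)) (verts H)" using i by (auto simp: inj_on_def)
  show "?E2 <= verts H \<times> verts H" using H by (auto simp: simple_graph_def)
  show "(em c, em c) : ?S \<times> ?S \<longleftrightarrow> c : C" if "c : verts H" for c using iS[OF that] by simp
 qed
 finally show ?thesis by (simp only: mult.commute)
qed

lemma edge_weight_to_multigraph:
 "edge_weight W (to_multigraph H) x = (\<Prod>(a, b)\<in>edges H. W (x a) (x b))"
 by (simp add: edge_weight_def to_multigraph_def prod_unfold_prod_mset)

lemma tdens_partial: "tdens H W = partial_density W (edges H) (verts H) {} u"
 by (simp add: hom_density_def partial_density_def edge_weight_to_multigraph[unfolded to_multigraph_def] to_multigraph_def)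

lemma tdens1_partial: "tdens1 a (u a) H W = partial_density W (edges H) (verts H) {a} u"
proof -
 have "override_on z u {a} = z(a := u a)" for z by (auto simp: override_on_def fun_eq_iff)
 then show ?thesis by (simp add: tdens1_def partial_density_def edge_weight_to_multigraph)
qed

lemma tdens2_partial: "a ~= b ==> tdens2 a b (u a) (u b) H W = partial_density W (edges H) (verts H) {a, b} u"
proof -
 assume "a ~= b"
 then have "override_on z u {a, b} = z(a := u a, b := u b)" for z by (auto simp: override_on_def fun_eq_iff)
 then show ?thesis by (simp add: tdens2_def partial_density_def edge_weight_to_multigraph)
qed

section \<open>First and second order approximation of the counts\<close>

text \<open>The integrand of the one-fold integral in the limit and, up to normalisation, the
  symmetrised first-order Hoeffding projection. It vanishes almost everywhere exactly when
  \<open>W\<close> is regular for a pattern \<open>H\<close>.\<close>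

definition irr_kernel :: "sgraph => (real => real => real) => real => real" where
 "irr_kernel H W x = (1 / real (card (Aut H))) * (SUM a:verts H. tdens1 a x H W)
    - real (card (verts H)) / real (card (Aut H)) * tdens H W"

definition reg_kernel :: "sgraph => (real => real => real) => real => real => real" where
 "reg_kernel H W x y = two_point_kernel H W x y
    - real (card (verts H)) * (real (card (verts H)) - 1) / (2 * real (card (Aut H))) * tdens H W"

text \<open>The coefficient of the indicator of the edge between \<open>a\<close> and
  \<open>b\<close>: the conditional density of \<open>H\<close> with that edge deleted. Deleting
  instead of dividing by \<open>W x y\<close> keeps it meaningful where the graphon
  vanishes.\<close>

definition tdens_minus :: "nat => nat => real => real => sgraph => (real => real => real) => real" where
 "tdens_minus a b x y H W =
   partial_density W {(c, d)\<in>edges H. \<not> (c : {a, b} & d : {a, b})} (verts H) {a, b} (%c. if c = a then x else y)"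

definition noise_kernel :: "sgraph => (real => real => real) => real => real => real" where
 "noise_kernel H W x y = (1 / real (card (Aut H))) * (SUM (a, b):ordered_edges H. tdens_minus a b x y H W)"

text \<open>The sum runs over ordered pairs, so for a symmetric \<open>g\<close> each edge indicator
  occurs twice; half of the statistic, which is what appears below, is the sum over unordered
  pairs.\<close>

definition noise_stat :: "nat => (real => real => real) => (real \<times> real => real) => (nat \<times> nat => real) => real" where
 "noise_stat n W g w = (SUM (i, j):distinct_pairs n.
   (edge_ind W i j w - W (w (i, i)) (w (j, j))) * g (w (i, i), w (j, j)))"

definition off_pairs :: "'a set => ('a \<times> 'a) set" where
 "off_pairs V = {(a, b). a : V & b : V & a ~= b}"

lemma finite_off_pairs: "finite V ==> finite (off_pairs V)"
 by (rule finite_subset[of _ "V \<times> V"]) (auto simp: off_pairs_def)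

lemma sum_off_pairs:
 assumes "finite V"
 shows "(SUM (a, b):off_pairs V. F a b) = (SUM a:V. SUM b:V - {a}. F a b)"
proof -
 have "off_pairs V = Sigma V (%a. V - {a})" by (auto simp: off_pairs_def)
 then show ?thesis using assms by (simp add: sum.Sigma)
qed

lemma sum_off_pairs_fst:
 fixes F :: "'a => real"
 assumes "finite V"
 shows "(SUM (a, b):off_pairs V. F a) = (real (card V) - 1) * (SUM a:V. F a)"
proof -
 have "(SUM a:V. SUM b:V - {a}. F a) = (SUM a:V. (real (card V) - 1) * F a)"
 proof (rule sum.cong[OF refl])
  fix a assume a: "a : V"
  then have "1 <= card V" using assms by (metis One_nat_def Suc_leI card_gt_0_iff empty_iff)
  then show "(SUM b:V - {a}. F a) = (real (card V) - 1) * F a"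
   using a assms by (simp add: of_nat_diff)
 qed
 then show ?thesis unfolding sum_off_pairs[OF assms] by (simp add: sum_distrib_left)
qed

lemma sum_off_pairs_swap: "(SUM (a, b):off_pairs V. F a b) = (SUM (a, b):off_pairs V. F b a)"
 by (rule sum.reindex_bij_witness[where i = prod.swap and j = prod.swap]) (auto simp: off_pairs_def)

lemma sum_off_pairs_snd:
 fixes F :: "'a => real"
 assumes "finite V"
 shows "(SUM (a, b):off_pairs V. F b) = (real (card V) - 1) * (SUM a:V. F a)"
 using sum_off_pairs_swap[of "%a b. F b" V] sum_off_pairs_fst[OF assms, of F] by simp

lemma bdm_partial_density:
 assumes W: "graphon W" and E: "E <= V \<times> V" and u: "!!c. c : C ==> (%x. u x c) : M \<rightarrow>\<^sub>M unit_unif"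
 shows "bdm M (%x. partial_density W E V C (u x))"
proof -
 let ?P = "\<Pi>\<^sub>M c\<in>V - C. unit_unif"
 let ?o = "%q. override_on (snd q) (u (fst q)) C"
 have m: "(%q. ?o q c) : M \<Otimes>\<^sub>M ?P \<rightarrow>\<^sub>M unit_unif" if c: "c : V" for c
 proof (cases "c : C")
  case True
  then show ?thesis using measurable_compose[OF measurable_fst u[OF True], of ?P] by (simp add: override_on_def)
 next
  case False
  then have "(%q. snd q c) : M \<Otimes>\<^sub>M ?P \<rightarrow>\<^sub>M unit_unif"
   using c by (intro measurable_compose[OF measurable_snd measurable_component_singleton]) auto
  then show ?thesis using False by (simp add: override_on_def)
 qed
 have e: "fst e : V" "snd e : V" if "e : E" for e using that E by auto
 have "bdm (M \<Otimes>\<^sub>M ?P) (%q. \<Prod>e\<in>E. W (?o q (fst e)) (?o q (snd e)))"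
 proof (rule bdm_prod)
  fix e assume "e : E"
  note e = e[OF this]
  show "bdm (M \<Otimes>\<^sub>M ?P) (%q. W (?o q (fst e)) (?o q (snd e)))"
  proof (rule bdmI[where C = 1])
   show "(%q. W (?o q (fst e)) (?o q (snd e))) : borm (M \<Otimes>\<^sub>M ?P)"
    by (intro measurable_graphon[OF W] m e)
   fix q assume q: "q : space (M \<Otimes>\<^sub>M ?P)"
   have "?o q (fst e) : {0..1}" "?o q (snd e) : {0..1}"
    using measurable_space[OF m[OF e(1)] q] measurable_space[OF m[OF e(2)] q] by simp_all
   from graphon_range[OF W this] show "norm (W (?o q (fst e)) (?o q (snd e))) <= 1" by simp
  qed
 qed
 from bdm_integral[OF prob_space_PiM this]
 have "bdm M (%x. LINT z|?P. (\<Prod>e\<in>E. W (?o (x, z) (fst e)) (?o (x, z) (snd e))))"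
  using prob_space_unit_unif by blast
 then show ?thesis by (simp add: partial_density_def split_beta')
qed

lemma simple_graph_edges_subset: "simple_graph H ==> edges H <= verts H \<times> verts H"
 by (auto simp: simple_graph_def)

lemma bdm_tdens1:
 assumes "graphon W" "simple_graph H"
 shows "bdm unit_unif (%x. tdens1 a x H W)"
proof -
 have "bdm unit_unif (%x. partial_density W (edges H) (verts H) {a} (%_. x))"
  by (rule bdm_partial_density[OF assms(1) simple_graph_edges_subset[OF assms(2)]]) simp
 then show ?thesis using tdens1_partial[of a "%_. x" H W for x] by simp
qed

lemma measurable_pair_choice: "(%p. if c = a then fst p else snd p) : unit_square \<rightarrow>\<^sub>M unit_unif"
 by (cases "c = a") simp_all

lemma bdm_tdens2:
 assumes "graphon W" "simple_graph H" "a ~= b"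
 shows "bdm unit_square (%p. tdens2 a b (fst p) (snd p) H W)"
proof -
 have "bdm unit_square (%p. partial_density W (edges H) (verts H) {a, b} (%c. if c = a then fst p else snd p))"
  by (rule bdm_partial_density[OF assms(1) simple_graph_edges_subset[OF assms(2)] measurable_pair_choice])
 then show ?thesis using tdens2_partial[OF assms(3), of "%c. if c = a then fst p else snd p" H W for p] assms(3) by simp
qed

lemma bdm_tdens_minus:
 assumes "graphon W" "simple_graph H"
 shows "bdm unit_square (%p. tdens_minus a b (fst p) (snd p) H W)"
 unfolding tdens_minus_def
 by (rule bdm_partial_density[OF assms(1) _ measurable_pair_choice])
  (use simple_graph_edges_subset[OF assms(2)] in auto)

lemma bdm_irr_kernel:
 "graphon W ==> simple_graph H ==> bdm unit_unif (irr_kernel H W)"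
 unfolding irr_kernel_def[abs_def]
 by (intro bdm_diff bdm_mult bdm_const bdm_sum bdm_tdens1)

lemma two_point_kernel_off_pairs:
 "two_point_kernel H W x y = (1 / (2 * real (card (Aut H)))) * (SUM e:off_pairs (verts H). tdens2 (fst e) (snd e) x y H W)"
 by (simp add: two_point_kernel_def off_pairs_def split_beta')

lemma bdm_reg_kernel:
 "graphon W ==> simple_graph H ==> bdm unit_square (case_prod (reg_kernel H W))"
 unfolding reg_kernel_def[abs_def] split_beta' two_point_kernel_off_pairs
 by (intro bdm_diff bdm_mult bdm_const bdm_sum bdm_tdens2)
  (auto simp: off_pairs_def)

lemma bdm_noise_kernel:
 "graphon W ==> simple_graph H ==> bdm unit_square (case_prod (noise_kernel H W))"
 unfolding noise_kernel_def[abs_def] split_beta'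
 by (intro bdm_mult bdm_const bdm_sum bdm_tdens_minus)

lemma bdm_graphon_prod:
 fixes \<rho> :: "'v => 'i"
 assumes W: "graphon W"
 shows "bdm cube (%w. \<Prod>(a, b)\<in>E. W (w (\<rho> a)) (w (\<rho> b)))"
 unfolding split_beta'
proof (rule bdm_prod)
 fix e
 show "bdm cube (%w. W (w (\<rho> (fst e))) (w (\<rho> (snd e))))"
 proof (rule bdmI[where C = 1])
  show "(%w. W (w (\<rho> (fst e))) (w (\<rho> (snd e)))) : borm cube"
   by (intro measurable_graphon[OF W] measurable_cube_component)
  fix w :: "'i => real" assume w: "w : space cube"
  show "norm (W (w (\<rho> (fst e))) (w (\<rho> (snd e)))) <= 1"
   using graphon_range[OF W cube_range[OF w, of "\<rho> (fst e)"] cube_range[OF w, of "\<rho> (snd e)"]] by simp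
 qed
qed

text \<open>All three are the tower property: on the cube, \<open>tdens1\<close> and
  \<open>tdens2\<close> are conditional means of the same product of graphon values.\<close>

lemma
 assumes W: "graphon W" and H: "simple_graph H"
 shows integral_tdens1: "a : verts H ==> (LINT x|unit_unif. tdens1 a x H W) = tdens H W"
  and integral_tdens2_snd: "a : verts H ==> b : verts H ==> a ~= b ==> x : {0..1} ==>
   (LINT y|unit_unif. tdens2 a b x y H W) = tdens1 a x H W"
  and integral_tdens2_fst: "a : verts H ==> b : verts H ==> a ~= b ==> x : {0..1} ==>
   (LINT y|unit_unif. tdens2 a b y x H W) = tdens1 b x H W"
proof -
 let ?P = "%w :: nat => real. \<Prod>(a, b)\<in>edges H. W (w a) (w b)"
 have P: "bdm cube ?P" using bdm_graphon_prod[OF W, where \<rho> = "%a. a"] .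
 have pd: "cond_mean C ?P w = partial_density W (edges H) (verts H) C w" if "C <= verts H" "w : space cube" for C w
  using cond_mean_prod_graphon[OF W, of "%a. a" "verts H" "edges H" C C w] simple_graph_edges_subset[OF H] that by simp
 have t1: "cond_mean {a} ?P w = tdens1 a (w a) H W" if "a : verts H" "w : space cube" for a w
  using pd[of "{a}" w] that tdens1_partial[of a w H W] by simp
 have t2: "cond_mean {a, b} ?P w = tdens2 a b (w a) (w b) H W" if "a : verts H" "b : verts H" "a ~= b" "w : space cube" for a b w
  using pd[of "{a, b}" w] that tdens2_partial[of a b w H W] by simp
 show "(LINT x|unit_unif. tdens1 a x H W) = tdens H W" if a: "a : verts H"
 proof -
  have "(LINT x|unit_unif. tdens1 a x H W) = (LINT w|cube. tdens1 a (w a) H W)"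
   by (rule integral_cube_component[symmetric]) (rule bdm_measurable[OF bdm_tdens1[OF W H]])
  also have "... = (LINT w|cube. cond_mean {a} ?P w)"
   by (intro lint_cong refl) (simp add: t1 a)
  also have "... = (LINT w|cube. ?P w)" by (rule integral_cond_mean[OF P])
  also have "... = cond_mean {} ?P (%_. 0)" by (simp add: cond_mean_empty)
  also have "... = tdens H W" using pd[of "{}" "%_. 0"] tdens_partial[of H W "%_. 0"] by (simp add: space_cube)
  finally show ?thesis .
 qed
 have m2: "(%p. tdens2 a b (fst p) (snd p) H W) : borm unit_square" if "a ~= b" for a b
  by (rule bdm_measurable[OF bdm_tdens2[OF W H that]])
 {
  fix a b x assume ab: "a : verts H" "b : verts H" "a ~= b" and x: "x : {0..1::real}"
  let ?w = "%_::nat. x"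
  have w: "?w : space cube" using x by (simp add: space_cube)
  have c: "cond_mean {c} (%w. tdens2 a b (w a) (w b) H W) ?w = cond_mean {c} ?P ?w" if "c = a \<or> c = b" for c
  proof -
   have "cond_mean {c} (%w. tdens2 a b (w a) (w b) H W) ?w = cond_mean {c} (cond_mean {a, b} ?P) ?w"
    by (rule cond_mean_cong[OF _ w]) (simp add: t2 ab)
   also have "... = cond_mean ({c} Int {a, b}) ?P ?w" by (rule cond_mean_cond_mean[OF P w])
   finally show ?thesis using that by simp
  qed
  show "(LINT y|unit_unif. tdens2 a b x y H W) = tdens1 a x H W"
   using c[of a] t1[OF ab(1) w] cond_mean_vertex2(1)[OF m2[OF ab(3)] ab(3) w, of "{a}"] ab(3) by simp
  show "(LINT y|unit_unif. tdens2 a b y x H W) = tdens1 b x H W"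
   using c[of b] t1[OF ab(2) w] cond_mean_vertex2(2)[OF m2[OF ab(3)] ab(3) w, of "{b}"] ab(3) by simp
 }
qed

lemma pattern_graphD:
 assumes "pattern_graph H"
 shows "simple_graph H" "finite (verts H)" "2 <= card (verts H)" "0 < card (Aut H)"
 using assms card_Aut_pos[of H] by (auto simp: pattern_graph_def simple_graph_def)

lemma measure_unit_unif: "measure unit_unif {0..1} = 1"
 using prob_space.prob_space[OF prob_space_unit_unif] by simp

lemma integral_irr_kernel:
 assumes W: "graphon W" and H: "pattern_graph H"
 shows "(LINT x|unit_unif. irr_kernel H W x) = 0"
proof -
 note H' = pattern_graphD[OF H]
 interpret U: prob_space unit_unif by (rule prob_space_unit_unif)
 have i: "integrable unit_unif (%x. tdens1 a x H W)" for a
  by (rule bdm_integrable[OF finite_measure_unit_unif bdm_tdens1[OF W H'(1)]])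
 have "(LINT x|unit_unif. irr_kernel H W x) =
   (1 / real (card (Aut H))) * (SUM a:verts H. LINT x|unit_unif. tdens1 a x H W) - real (card (verts H)) / real (card (Aut H)) * tdens H W"
  unfolding irr_kernel_def using i by (simp add: lint_diff measure_unit_unif)
 also have "(SUM a:verts H. LINT x|unit_unif. tdens1 a x H W) = (SUM a:verts H. tdens H W)"
  by (intro sum.cong refl integral_tdens1[OF W H'(1)])
 finally show ?thesis by simp
qed

text \<open>The marginals of the second-order kernel are multiples of the first-order kernel. Hence
  regularity makes the second-order kernel degenerate, and this is what justifies the scale
  \<open>1 / n\<close>.\<close>

lemma integral_reg_kernel:
 assumes W: "graphon W" and H: "pattern_graph H" and x: "x : {0..1}"
 shows "(LINT y|unit_unif. reg_kernel H W x y) = (real (card (verts H)) - 1) / 2 * irr_kernel H W x"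
  and "(LINT y|unit_unif. reg_kernel H W y x) = (real (card (verts H)) - 1) / 2 * irr_kernel H W x"
proof -
 note H' = pattern_graphD[OF H]
 interpret U: prob_space unit_unif by (rule prob_space_unit_unif)
 let ?V = "verts H" and ?k = "real (card (verts H))" and ?A = "real (card (Aut H))"
 have xs: "x : space unit_unif" using x by simp
 have i: "integrable unit_unif (%y. tdens2 a b x y H W)" "integrable unit_unif (%y. tdens2 a b y x H W)" if "a ~= b" for a b
  using bdm_compose[OF bdm_tdens2[OF W H'(1) that] measurable_Pair1'[OF xs]]
   bdm_compose[OF bdm_tdens2[OF W H'(1) that] measurable_Pair2'[OF xs]]
  by (auto intro: bdm_integrable[OF finite_measure_unit_unif])
 have ne: "fst e : ?V" "snd e : ?V" "fst e ~= snd e" if "e : off_pairs ?V" for e using that by (auto simp: off_pairs_def)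
 have e: "(1 / (2 * ?A)) * ((?k - 1) * (SUM a:?V. tdens1 a x H W)) - ?k * (?k - 1) / (2 * ?A) * tdens H W =
   (?k - 1) / 2 * irr_kernel H W x"
  unfolding irr_kernel_def using H'(4) by (simp add: field_simps)
 have "(LINT y|unit_unif. reg_kernel H W x y) = (1 / (2 * ?A)) * (SUM e:off_pairs ?V. LINT y|unit_unif. tdens2 (fst e) (snd e) x y H W)
   - ?k * (?k - 1) / (2 * ?A) * tdens H W"
  unfolding reg_kernel_def two_point_kernel_off_pairs
  using i[OF ne(3)] by (subst lint_diff) (auto intro!: integrable_mult_right simp: measure_unit_unif)
 also have "(SUM e:off_pairs ?V. LINT y|unit_unif. tdens2 (fst e) (snd e) x y H W) = (SUM (a, b):off_pairs ?V. tdens1 a x H W)"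
  unfolding split_beta' by (intro sum.cong refl integral_tdens2_snd[OF W H'(1)] ne x)
 also have "... = (?k - 1) * (SUM a:?V. tdens1 a x H W)" by (rule sum_off_pairs_fst[OF H'(2)])
 finally show "(LINT y|unit_unif. reg_kernel H W x y) = (?k - 1) / 2 * irr_kernel H W x" using e by simp
 have "(LINT y|unit_unif. reg_kernel H W y x) = (1 / (2 * ?A)) * (SUM e:off_pairs ?V. LINT y|unit_unif. tdens2 (fst e) (snd e) y x H W)
   - ?k * (?k - 1) / (2 * ?A) * tdens H W"
  unfolding reg_kernel_def two_point_kernel_off_pairs
  using i[OF ne(3)] by (subst lint_diff) (auto intro!: integrable_mult_right simp: measure_unit_unif)
 also have "(SUM e:off_pairs ?V. LINT y|unit_unif. tdens2 (fst e) (snd e) y x H W) = (SUM (a, b):off_pairs ?V. tdens1 b x H W)"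
  unfolding split_beta' by (intro sum.cong refl integral_tdens2_fst[OF W H'(1)] ne x)
 also have "... = (?k - 1) * (SUM a:?V. tdens1 a x H W)" by (rule sum_off_pairs_snd[OF H'(2)])
 finally show "(LINT y|unit_unif. reg_kernel H W y x) = (?k - 1) / 2 * irr_kernel H W x" using e by simp
qed

lemma H_regular_irr_kernel:
 assumes "pattern_graph H" "H_regular H W"
 shows "AE x in unit_unif. irr_kernel H W x = 0"
 using assms(2) unfolding H_regular_def
proof eventually_elim
 case (elim x)
 have "0 < real (card (verts H))" using pattern_graphD[OF assms(1)] by simp
 with elim have "(SUM a:verts H. tdens1 a x H W) = real (card (verts H)) * tdens H W" by (simp add: field_simps)
 then show ?case by (simp add: irr_kernel_def)
qed

section \<open>Hoeffding projections for a single embedding\<close>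

context
 fixes W :: "real => real => real" and H :: sgraph and em :: "nat => nat"
 assumes W: "graphon W" and H: "simple_graph H" and em: "inj_on em (verts H)"
begin

text \<open>The square over the image of \<open>C\<close> contains both the vertex variables of
  these vertices, on its diagonal, and the edge variables among them. So the decomposition is
  indexed by sets of vertices although edges are random as well.\<close>

definition hproj :: "nat set => (nat \<times> nat => real) => real" where
 "hproj C = cond_mean (em ` C \<times> em ` C) (hom_ind W H em)"

definition resid1 :: "(nat \<times> nat => real) => real" where
 "resid1 w = hom_ind W H em w - hproj {} w - (SUM a:verts H. hproj {a} w - hproj {} w)"

text \<open>The alternating sum isolates the part that genuinely needs both vertices; every pair is
  listed in both orders, hence the factor \<open>1 / 2\<close>.\<close>

definition resid2 :: "(nat \<times> nat => real) => real" where
 "resid2 w = resid1 w - (1 / 2) * (SUM (a, b):off_pairs (verts H). hproj {a, b} w - hproj {a} w - hproj {b} w + hproj {} w)"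

lemma bdm_proj: "bdm cube (hproj C)"
 unfolding hproj_def by (rule bdm_cond_mean[OF bdm_hom_ind[OF W]])

lemma depends_on_proj: "C <= verts H ==> depends_on (em ` verts H \<times> em ` verts H) (hproj C)"
 unfolding hproj_def by (rule depends_on_mono[OF depends_on_cond_mean]) auto

lemma proj_range:
 assumes "w : space cube"
 shows "0 <= hproj C w" "hproj C w <= 1"
proof -
 interpret Cb: prob_space "cube :: (nat \<times> nat => real) measure" by (rule prob_space_cube)
 let ?f = "%w'. hom_ind W H em (override_on w' w (em ` C \<times> em ` C))"
 have i: "integrable cube ?f"
  by (rule integrable_cube[OF bdm_override_on2[OF bdm_hom_ind[OF W] assms]])
 show "0 <= hproj C w" unfolding hproj_def cond_mean_def by (intro Bochner_Integration.integral_nonneg hom_ind_range)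
 show "hproj C w <= 1" unfolding hproj_def cond_mean_def by (intro Cb.integral_le_const[OF i] AE_I2 hom_ind_range)
qed

lemma cond_mean_proj:
 assumes "C <= verts H" "C' <= verts H" "w : space cube"
 shows "cond_mean (em ` C' \<times> em ` C') (hproj C) w = hproj (C' Int C) w"
proof -
 have "(em ` C' \<times> em ` C') Int (em ` C \<times> em ` C) = em ` (C' Int C) \<times> em ` (C' Int C)"
  using inj_on_image_Int[OF em assms(2,1)] by auto
 then show ?thesis
  using cond_mean_cond_mean[OF bdm_hom_ind[OF W] assms(3), of "em ` C' \<times> em ` C'" "em ` C \<times> em ` C" H em]
  by (simp add: hproj_def)
qed

lemma bdm_resid1: "bdm cube resid1"
 unfolding resid1_def[abs_def]
 by (intro bdm_diff bdm_sum bdm_proj bdm_hom_ind[OF W])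

lemma bdm_pair_term: "bdm cube (%w. hproj {a, b} w - hproj {a} w - hproj {b} w + hproj {} w)"
 by (intro bdm_diff bdm_add bdm_proj)

lemma bdm_resid2: "bdm cube resid2"
 unfolding resid2_def[abs_def] split_beta'
 by (intro bdm_diff bdm_mult bdm_const bdm_sum bdm_resid1 bdm_pair_term)

lemma depends_on_resid1: "depends_on (em ` verts H \<times> em ` verts H) resid1"
 unfolding depends_on_def resid1_def
proof (intro ballI impI arg_cong2[where f = "(-)"] sum.cong refl)
 let ?D = "em ` verts H \<times> em ` verts H"
 fix w w' :: "nat \<times> nat => real"
 assume w: "w : space cube" "w' : space cube" "ALL i:?D. w i = w' i"
 show "hom_ind W H em w = hom_ind W H em w'"
  using depends_on_hom_ind[OF H, of em W] w unfolding depends_on_def by blast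
 show "hproj {} w = hproj {} w'" using depends_on_proj[of "{}"] w unfolding depends_on_def by blast
 then show "hproj {} w = hproj {} w'" .
 show "hproj {a} w = hproj {a} w'" if "a : verts H" for a
  using depends_on_proj[of "{a}"] w that unfolding depends_on_def by blast
qed

lemma depends_on_resid2: "depends_on (em ` verts H \<times> em ` verts H) resid2"
 unfolding depends_on_def resid2_def split_beta'
proof (intro ballI impI arg_cong2[where f = "(-)"] arg_cong2[where f = "(+)"] arg_cong2[where f = times] sum.cong refl)
 let ?D = "em ` verts H \<times> em ` verts H"
 fix w w' :: "nat \<times> nat => real"
 assume w: "w : space cube" "w' : space cube" "ALL i:?D. w i = w' i"
 have p: "hproj C w = hproj C w'" if "C <= verts H" for C
  using depends_on_proj[OF that] w unfolding depends_on_def by blast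
 show "resid1 w = resid1 w'" using depends_on_resid1 w unfolding depends_on_def by blast
 fix e assume "e : off_pairs (verts H)"
 then have e: "fst e : verts H" "snd e : verts H" by (auto simp: off_pairs_def)
 show "hproj {fst e, snd e} w = hproj {fst e, snd e} w'" "hproj {fst e} w = hproj {fst e} w'"
  "hproj {snd e} w = hproj {snd e} w'" "hproj {} w = hproj {} w'" by (rule p, use e in simp)+
qed

lemma finite_verts: "finite (verts H)"
 using H by (simp add: simple_graph_def)

lemma cond_mean_resid1:
 assumes C: "C <= verts H" and w: "w : space cube"
 shows "cond_mean (em ` C \<times> em ` C) resid1 w = hproj C w - hproj {} w - (SUM a:verts H. hproj (C Int {a}) w - hproj {} w)"
proof -
 let ?c = "cond_mean (em ` C \<times> em ` C)"
 have "?c resid1 w = ?c (%w. hom_ind W H em w - hproj {} w) w - ?c (%w. SUM a:verts H. hproj {a} w - hproj {} w) w"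
  unfolding resid1_def[abs_def]
  by (intro cond_mean_diff w bdm_diff bdm_sum bdm_proj bdm_hom_ind[OF W])
 also have "?c (%w. hom_ind W H em w - hproj {} w) w = ?c (hom_ind W H em) w - ?c (hproj {}) w"
  by (intro cond_mean_diff w bdm_proj bdm_hom_ind[OF W])
 also have "?c (%w. SUM a:verts H. hproj {a} w - hproj {} w) w = (SUM a:verts H. ?c (%w. hproj {a} w - hproj {} w) w)"
  by (intro cond_mean_sum w bdm_diff bdm_proj)
 also have "... = (SUM a:verts H. ?c (hproj {a}) w - ?c (hproj {}) w)"
  by (intro sum.cong refl cond_mean_diff w bdm_proj)
 also have "... = (SUM a:verts H. hproj (C Int {a}) w - hproj {} w)"
  by (intro sum.cong refl) (simp add: cond_mean_proj[OF _ C w])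
 also have "?c (hproj {}) w = hproj {} w" using cond_mean_proj[OF _ C w, of "{}"] by simp
 finally show ?thesis by (simp add: hproj_def)
qed

lemma cond_mean_resid2:
 assumes C: "C <= verts H" and w: "w : space cube"
 shows "cond_mean (em ` C \<times> em ` C) resid2 w = cond_mean (em ` C \<times> em ` C) resid1 w -
  (1 / 2) * (SUM (a, b):off_pairs (verts H). hproj (C Int {a, b}) w - hproj (C Int {a}) w - hproj (C Int {b}) w + hproj {} w)"
proof -
 let ?c = "cond_mean (em ` C \<times> em ` C)"
 let ?t = "%e w. hproj {fst e, snd e} w - hproj {fst e} w - hproj {snd e} w + hproj {} w"
 have t: "?c (?t e) w = hproj (C Int {fst e, snd e}) w - hproj (C Int {fst e}) w - hproj (C Int {snd e}) w + hproj {} w"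
  if e: "e : off_pairs (verts H)" for e
 proof -
  have v: "fst e : verts H" "snd e : verts H" using e by (auto simp: off_pairs_def)
  have "?c (?t e) w = ?c (%w. hproj {fst e, snd e} w - hproj {fst e} w - hproj {snd e} w) w + ?c (hproj {}) w"
   by (intro cond_mean_add w bdm_diff bdm_proj)
  also have "?c (%w. hproj {fst e, snd e} w - hproj {fst e} w - hproj {snd e} w) w =
    ?c (%w. hproj {fst e, snd e} w - hproj {fst e} w) w - ?c (hproj {snd e}) w"
   by (intro cond_mean_diff w bdm_diff bdm_proj)
  also have "?c (%w. hproj {fst e, snd e} w - hproj {fst e} w) w = ?c (hproj {fst e, snd e}) w - ?c (hproj {fst e}) w"
   by (intro cond_mean_diff w bdm_proj)
  finally show ?thesis using v by (simp add: cond_mean_proj[OF _ C w])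
 qed
 have "?c resid2 w = ?c resid1 w - ?c (%w. (1 / 2) * (SUM e:off_pairs (verts H). ?t e w)) w"
  unfolding resid2_def[abs_def] split_beta'
  by (intro cond_mean_diff w bdm_mult bdm_const bdm_sum bdm_resid1 bdm_pair_term)
 also have "?c (%w. (1 / 2) * (SUM e:off_pairs (verts H). ?t e w)) w = (1 / 2) * ?c (%w. SUM e:off_pairs (verts H). ?t e w) w"
  by (rule cond_mean_cmult)
 also have "?c (%w. SUM e:off_pairs (verts H). ?t e w) w = (SUM e:off_pairs (verts H). ?c (?t e) w)"
  by (intro cond_mean_sum w bdm_pair_term)
 also have "... = (SUM e:off_pairs (verts H). hproj (C Int {fst e, snd e}) w - hproj (C Int {fst e}) w - hproj (C Int {snd e}) w + hproj {} w)"
  by (intro sum.cong refl t)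
 finally show ?thesis by (simp add: split_beta')
qed

lemma preimage_subset:
 assumes "S <= em ` verts H"
 obtains C where "C <= verts H" "S = em ` C" "card C = card S"
proof -
 obtain C where C: "C <= verts H" "S = em ` C" using assms by (auto simp: subset_image_iff)
 moreover have "card C = card S" using C card_image[OF inj_on_subset[OF em C(1)]] by simp
 ultimately show ?thesis by (rule that)
qed

lemma resid1_orthogonal_1:
 assumes C: "C <= verts H" "C = {} \<or> C = {b}" and w: "w : space cube"
 shows "cond_mean (em ` C \<times> em ` C) resid1 w = 0"
 using C(2)
proof
 assume "C = {}"
 then show ?thesis using cond_mean_resid1[OF C(1) w] by simp
next
 assume b: "C = {b}"
 have "(SUM a:verts H. hproj (C Int {a}) w - hproj {} w) = (SUM a:verts H. if a = b then hproj {b} w - hproj {} w else 0)"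
  using b by (intro sum.cong refl) auto
 also have "... = hproj {b} w - hproj {} w" using b C(1) finite_verts by simp
 finally show ?thesis using cond_mean_resid1[OF C(1) w] b by simp
qed

lemma resid1_orthogonal:
 assumes S: "S <= em ` verts H" "card S < 2"
 shows "AE w in cube. cond_mean (S \<times> S) resid1 w = 0"
proof (rule AE_I2)
 fix w :: "nat \<times> nat => real" assume w: "w : space cube"
 obtain C where C: "C <= verts H" "S = em ` C" "card C = card S" by (rule preimage_subset[OF S(1)])
 have "finite C" using C(1) finite_verts by (rule finite_subset)
 then have "C = {} \<or> (EX b. C = {b})" using S(2) C(3) by (auto simp: less_2_cases_iff card_1_singleton_iff)
 then show "cond_mean (S \<times> S) resid1 w = 0" using resid1_orthogonal_1[OF C(1) _ w] C(2) by blast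
qed

text \<open>After projection to \<open>C\<close> a pair term survives only if both of its vertices
  lie in \<open>C\<close>. For two vertices exactly the two orders of one pair survive, and half
  their sum equals the projection of \<open>resid1\<close>; for fewer vertices already
  \<open>resid1\<close> projects to 0.\<close>

lemma resid2_orthogonal:
 assumes S: "S <= em ` verts H" "card S < 3"
 shows "AE w in cube. cond_mean (S \<times> S) resid2 w = 0"
proof (rule AE_I2)
 fix w :: "nat \<times> nat => real" assume w: "w : space cube"
 obtain C where C: "C <= verts H" "S = em ` C" "card C = card S" by (rule preimage_subset[OF S(1)])
 have fC: "finite C" using C(1) finite_verts by (rule finite_subset)
 let ?t = "%e. hproj (C Int {fst e, snd e}) w - hproj (C Int {fst e}) w - hproj (C Int {snd e}) w + hproj {} w"
 have t0: "?t e = 0" if "\<not> (fst e : C & snd e : C)" for e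
 proof (cases "fst e : C")
  case True
  then have "C Int {fst e, snd e} = C Int {fst e}" "C Int {snd e} = {}" using that by auto
  then show ?thesis by simp
 next
  case False
  then have "C Int {fst e, snd e} = C Int {snd e}" "C Int {fst e} = {}" by auto
  then show ?thesis by simp
 qed
 show "cond_mean (S \<times> S) resid2 w = 0"
 proof (cases "card C = 2")
  case False
  then have c: "C = {} \<or> (EX b. C = {b})" using S(2) C(3) fC by (auto simp: card_1_singleton_iff less_Suc_eq numeral_3_eq_3 numeral_2_eq_2)
  have "(SUM e:off_pairs (verts H). ?t e) = 0"
   by (intro sum.neutral ballI t0) (use c in \<open>auto simp: off_pairs_def\<close>)
  moreover have "cond_mean (em ` C \<times> em ` C) resid1 w = 0" using resid1_orthogonal_1[OF C(1) _ w] c by blast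
  ultimately show ?thesis using cond_mean_resid2[OF C(1) w] C(2) by (simp add: split_beta')
 next
  case True
  then obtain c d where cd: "C = {c, d}" "c ~= d" by (auto simp: card_2_iff)
  have v: "c : verts H" "d : verts H" using C(1) cd by auto
  let ?T = "hproj C w - hproj {c} w - hproj {d} w + hproj {} w"
  have "(SUM e:off_pairs (verts H). ?t e) = (SUM e:{(c, d), (d, c)}. ?t e)"
  proof (rule sum.mono_neutral_right[OF finite_off_pairs[OF finite_verts]])
   show "{(c, d), (d, c)} <= off_pairs (verts H)" using v cd by (auto simp: off_pairs_def)
   show "ALL e:off_pairs (verts H) - {(c, d), (d, c)}. ?t e = 0"
   proof
    fix e assume "e : off_pairs (verts H) - {(c, d), (d, c)}"
    then have "\<not> (fst e : C & snd e : C)" using cd by (cases e) (auto simp: off_pairs_def)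
    then show "?t e = 0" by (rule t0)
   qed
  qed
  also have "... = 2 * ?T"
  proof -
   have "C Int {c} = {c}" "C Int {d} = {d}" "C Int {c, d} = C" "C Int {d, c} = C" using cd by auto
   then show ?thesis using cd(2) by simp
  qed
  finally have 1: "(SUM e:off_pairs (verts H). ?t e) = 2 * ?T" .
  have "(SUM a:verts H. hproj (C Int {a}) w - hproj {} w) = (SUM a:{c, d}. hproj (C Int {a}) w - hproj {} w)"
   by (rule sum.mono_neutral_right[OF finite_verts]) (use v cd in auto)
  also have "... = (hproj {c} w - hproj {} w) + (hproj {d} w - hproj {} w)" using cd by simp
  finally have "cond_mean (em ` C \<times> em ` C) resid1 w = ?T" using cond_mean_resid1[OF C(1) w] by simp
  then show ?thesis using cond_mean_resid2[OF C(1) w] 1 C(2) by (simp add: split_beta')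
 qed
qed

lemma resid1_bound: "w : space cube ==> \<bar>resid1 w\<bar> <= 2 + real (card (verts H))"
proof -
 assume w: "w : space cube"
 have "\<bar>SUM a:verts H. hproj {a} w - hproj {} w\<bar> <= (SUM a:verts H. 1)"
 proof (rule order_trans[OF sum_abs], rule sum_mono)
  show "\<bar>hproj {a} w - hproj {} w\<bar> <= 1" for a
   using proj_range[OF w, of "{a}"] proj_range[OF w, of "{}"] unfolding abs_le_iff by linarith
 qed
 then show ?thesis
  using hom_ind_range[of W H em w] proj_range[OF w, of "{}"] unfolding resid1_def by (simp add: abs_le_iff)
qed

lemma resid2_bound: "w : space cube ==> \<bar>resid2 w\<bar> <= 2 + real (card (verts H)) + real (card (off_pairs (verts H)))"
proof -
 assume w: "w : space cube"
 let ?t = "%e. hproj {fst e, snd e} w - hproj {fst e} w - hproj {snd e} w + hproj {} w"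
 have "\<bar>?t e\<bar> <= 2" for e
  using proj_range[OF w, of "{fst e, snd e}"] proj_range[OF w, of "{fst e}"] proj_range[OF w, of "{snd e}"] proj_range[OF w, of "{}"]
  unfolding abs_le_iff by linarith
 then have "\<bar>SUM e:off_pairs (verts H). ?t e\<bar> <= (SUM e:off_pairs (verts H). 2)"
  by (intro order_trans[OF sum_abs] sum_mono)
 then show ?thesis
  using resid1_bound[OF w] unfolding resid2_def split_beta' by (simp add: abs_le_iff)
qed

end

lemma hproj_empty:
 assumes "graphon W" "simple_graph H" "inj_on em (verts H)" "w : space cube"
 shows "hproj W H em {} w = tdens H W"
 unfolding hproj_def[OF assms(1-3)]
 using cond_mean_hom_ind[OF assms(1-3) empty_subsetI assms(4)] tdens_partial[of H W "%c. w (em c, em c)"] by simp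

lemma hproj_single:
 assumes "graphon W" and H: "simple_graph H" and em: "inj_on em (verts H)" and w: "w : space cube" and a: "a : verts H"
 shows "hproj W H em {a} w = tdens1 a (w (em a, em a)) H W"
proof -
 have "{(c, d)\<in>edges H. c : {a} & d : {a}} = {}" "{(c, d)\<in>edges H. \<not> (c : {a} & d : {a})} = edges H"
  using H by (auto simp: simple_graph_def)
 moreover have "{a} <= verts H" using a by simp
 ultimately show ?thesis
  unfolding hproj_def[OF assms(1-3)]
  using cond_mean_hom_ind[OF assms(1-3) _ w, of "{a}"] tdens1_partial[of a "%c. w (em c, em c)" H W]
  by (simp only: prod.empty mult_1_left)
qed

lemma edges_between:
 assumes H: "simple_graph H" and ab: "(a, b) : ordered_edges H"
 shows "{(c, d)\<in>edges H. c : {a, b} & d : {a, b}} = {(a, b)} \<or> {(c, d)\<in>edges H. c : {a, b} & d : {a, b}} = {(b, a)}"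
proof -
 have less: "c < d" if "(c, d) : edges H" for c d using H that by (auto simp: simple_graph_def)
 have "(a, b) : edges H \<or> (b, a) : edges H" using ab by (simp add: ordered_edges_def)
 then show ?thesis
 proof
  assume "(a, b) : edges H"
  then have "{(c, d)\<in>edges H. c : {a, b} & d : {a, b}} = {(a, b)}"
   using less[of a a] less[of b b] less[of a b] less[of b a] by auto
  then show ?thesis ..
 next
  assume "(b, a) : edges H"
  then have "{(c, d)\<in>edges H. c : {a, b} & d : {a, b}} = {(b, a)}"
   using less[of a a] less[of b b] less[of a b] less[of b a] by auto
  then show ?thesis ..
 qed
qed

lemma tdens2_split:
 assumes W: "graphon W" and H: "simple_graph H" and ab: "(a, b) : ordered_edges H" and xy: "x : {0..1}" "y : {0..1}"
 shows "tdens2 a b x y H W = W x y * tdens_minus a b x y H W"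
proof -
 have ne: "a ~= b" using ordered_edges_verts[OF H ab] by simp
 let ?u = "%c. if c = a then x else y"
 let ?E1 = "{(c, d)\<in>edges H. c : {a, b} & d : {a, b}}" and ?E2 = "{(c, d)\<in>edges H. \<not> (c : {a, b} & d : {a, b})}"
 have E: "edges H = ?E1 \<union> ?E2" "?E1 Int ?E2 = {}" by auto
 have fin: "finite ?E1" "finite ?E2" using finite_edges[OF H] by (auto intro: finite_subset[rotated])
 have "?E1 = {(a, b)} \<or> ?E1 = {(b, a)}"
  by (rule edges_between[OF H ab])
 then have E1: "(\<Prod>(c, d)\<in>?E1. W (override_on z ?u {a, b} c) (override_on z ?u {a, b} d)) = W x y" for z
  using ne graphon_sym[OF W xy] by (elim disjE) (simp_all add: override_on_def)
 have "tdens2 a b x y H W = partial_density W (edges H) (verts H) {a, b} ?u"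
  using tdens2_partial[OF ne, of ?u H W] ne by simp
 also have "... = (LINT z|(\<Pi>\<^sub>M c\<in>verts H - {a, b}. unit_unif). W x y * (\<Prod>(c, d)\<in>?E2. W (override_on z ?u {a, b} c) (override_on z ?u {a, b} d)))"
  unfolding partial_density_def
 proof (intro lint_cong refl)
  fix z
  show "(\<Prod>(c, d)\<in>edges H. W (override_on z ?u {a, b} c) (override_on z ?u {a, b} d)) =
    W x y * (\<Prod>(c, d)\<in>?E2. W (override_on z ?u {a, b} c) (override_on z ?u {a, b} d))"
   using prod.union_disjoint[OF fin E(2), of "%(c, d). W (override_on z ?u {a, b} c) (override_on z ?u {a, b} d)"]
   unfolding E1 E(1)[symmetric] .
 qed
 also have "... = W x y * tdens_minus a b x y H W"
  unfolding tdens_minus_def partial_density_def by (rule integral_mult_right_zero)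
 finally show ?thesis .
qed

text \<open>If the pair is an edge of \<open>H\<close>, its indicator remains in the projection.
  Splitting it into the graphon value and a conditionally centred remainder separates the function
  of the vertices from the noise; this remainder is the origin of the Gaussian part of the
  limit.\<close>

lemma hproj_pair:
 assumes W: "graphon W" and H: "simple_graph H" and em: "inj_on em (verts H)" and w: "w : space cube"
  and ab: "a : verts H" "b : verts H" "a ~= b"
 shows "hproj W H em {a, b} w = tdens2 a b (w (em a, em a)) (w (em b, em b)) H W +
  (if (a, b) : ordered_edges H then (edge_ind W (em a) (em b) w - W (w (em a, em a)) (w (em b, em b))) *
    tdens_minus a b (w (em a, em a)) (w (em b, em b)) H W else 0)"
proof -
 let ?x = "w (em a, em a)" and ?y = "w (em b, em b)"
 let ?E1 = "{(c, d)\<in>edges H. c : {a, b} & d : {a, b}}" and ?E2 = "{(c, d)\<in>edges H. \<not> (c : {a, b} & d : {a, b})}"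
 have "{a, b} <= verts H" using ab by simp
 from cond_mean_hom_ind[OF W H em this w]
 have 1: "hproj W H em {a, b} w = (\<Prod>(c, d)\<in>?E1. edge_ind W (em c) (em d) w) * partial_density W ?E2 (verts H) {a, b} (%c. w (em c, em c))"
  by (simp only: hproj_def[OF W H em])
 show ?thesis
 proof (cases "(a, b) : ordered_edges H")
  case True
  have "?E1 = {(a, b)} \<or> ?E1 = {(b, a)}"
   by (rule edges_between[OF H True])
  then have "(\<Prod>(c, d)\<in>?E1. edge_ind W (em c) (em d) w) = edge_ind W (em a) (em b) w"
   using edge_ind_sym[OF W w, of "em a" "em b"] by (elim disjE) simp_all
  moreover have "partial_density W ?E2 (verts H) {a, b} (%c. w (em c, em c)) = tdens_minus a b ?x ?y H W"
   unfolding tdens_minus_def by (rule partial_density_cong) (use ab(3) in auto)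
  moreover have "tdens2 a b ?x ?y H W = W ?x ?y * tdens_minus a b ?x ?y H W"
   by (rule tdens2_split[OF W H True cube_range[OF w] cube_range[OF w]])
  ultimately show ?thesis using True 1 by (simp add: left_diff_distrib)
 next
  case False
  have E: "?E1 = {}" "?E2 = edges H"
   using False H by (auto simp: ordered_edges_def simple_graph_def)
  show ?thesis
   using 1 tdens2_partial[OF ab(3), of "%c. w (em c, em c)" H W] False unfolding E by simp
 qed
qed

section \<open>Approximation of the normalised counts\<close>

lemma falling_factorial_ratio: "(%n. falling_factorial (n - c) m / real n ^ m) \<longlonglongrightarrow> 1"
proof -
 have "(%n. \<Prod>i<m. 1 - real (c + i) / real n) \<longlonglongrightarrow> (\<Prod>i<m. 1 - 0)"
  by (intro tendsto_prod tendsto_diff tendsto_const tendsto_divide_0[OF tendsto_const] filterlim_real_at_infinity_sequentially)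
 moreover have "\<forall>\<^sub>F n in sequentially. (\<Prod>i<m. 1 - real (c + i) / real n) = falling_factorial (n - c) m / real n ^ m"
  using eventually_ge_at_top[of "Suc c"]
 proof eventually_elim
  case (elim n)
  have "(\<Prod>i<m. 1 - real (c + i) / real n) = (\<Prod>i<m. (real (n - c) - real i) / real n)"
   using elim by (intro prod.cong refl) (simp add: of_nat_diff field_simps)
  then show ?case by (simp add: falling_factorial_def prod_dividef)
 qed
 ultimately show ?thesis by (simp add: Lim_transform_eventually)
qed

lemma integral_square_add_le:
 fixes f g :: "('i => real) => real"
 assumes "bdm cube f" "bdm cube g"
 shows "(LINT w|cube. (f w + g w)^2) <= 2 * (LINT w|cube. (f w)^2) + 2 * (LINT w|cube. (g w)^2)"
proof -
 have i: "integrable cube (%w. (f w)^2)" "integrable cube (%w. (g w)^2)" "integrable cube (%w. (f w + g w)^2)"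
  by (intro integrable_cube bdm_power bdm_add assms)+
 have "(LINT w|cube. (f w + g w)^2) <= (LINT w|cube. 2 * (f w)^2 + 2 * (g w)^2)"
 proof (rule integral_mono[OF i(3)])
  show "integrable cube (%w. 2 * (f w)^2 + 2 * (g w)^2)" using i by simp
  show "(f w + g w)^2 <= 2 * (f w)^2 + 2 * (g w)^2" for w
   using sum_squares_bound[of "f w" "g w"] by (simp add: power2_sum)
 qed
 then show ?thesis using i by simp
qed

lemma bdm_of_graph:
 fixes F :: "sgraph => real"
 assumes W: "graphon W"
 shows "bdm cube (%w. F (cube_graph n W w))"
proof (rule bdmI[where C = "SUM G:graphs_on n. \<bar>F G\<bar>"])
 show "(%w. F (cube_graph n W w)) : borm cube"
  by (rule measurable_compose[OF measurable_cube_graph[OF W]]) simp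
 fix w :: "nat \<times> nat => real" assume "w : space cube"
 then have "cube_graph n W w : graphs_on n" using measurable_space[OF measurable_cube_graph[OF W]] by simp
 then show "norm (F (cube_graph n W w)) <= (SUM G:graphs_on n. \<bar>F G\<bar>)"
  using member_le_sum[of _ "graphs_on n" "%G. \<bar>F G\<bar>"] finite_graphs_on[of n] by simp
qed

lemma Z_stat_cube_graph:
 assumes W: "graphon W" and H: "pattern_graph H" and w: "w : space cube" and n: "1 <= n"
 shows "Z_stat n H W (cube_graph n W w) =
  real n powr (if H_regular H W then 1 else 1 / 2) / real n ^ card (verts H) / real (card (Aut H)) *
   (SUM em:inj_maps (verts H) {1..n}. hom_ind W H em w - tdens H W)"
proof -
 note H' = pattern_graphD[OF H]
 let ?k = "card (verts H)" and ?A = "real (card (Aut H))" and ?e = "if H_regular H W then 1 else 1 / 2 :: real"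
 have p: "real n powr (- real ?k + e) = real n powr e / real n ^ ?k" for e
  unfolding powr_add powr_minus using n by (simp add: powr_realpow divide_inverse)
 have "(SUM em:inj_maps (verts H) {1..n}. hom_ind W H em w - tdens H W) =
   ?A * real (subgraph_count H (cube_graph n W w)) - falling_factorial n ?k * tdens H W"
  using card_inj_maps[OF H'(2), of "{1..n}"] subgraph_count_cube_graph[OF W H'(1) w, of n]
  by (simp add: sum_subtractf)
 then have "real (subgraph_count H (cube_graph n W w)) - falling_factorial n ?k * tdens H W / ?A =
   (SUM em:inj_maps (verts H) {1..n}. hom_ind W H em w - tdens H W) / ?A"
  using H'(4) by (simp add: field_simps)
 then show ?thesis unfolding Z_stat_def Let_def p by simp
qed

lemma sum_tdens1_inj_maps:
 assumes W: "graphon W" and H: "pattern_graph H"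
 shows "(SUM em:inj_maps (verts H) {1..n}. SUM a:verts H. tdens1 a (w (em a, em a)) H W - tdens H W) =
  falling_factorial (n - 1) (card (verts H) - 1) * (real (card (Aut H)) * lin_stat n (irr_kernel H W) w)"
proof -
 note H' = pattern_graphD[OF H]
 let ?c = "falling_factorial (n - 1) (card (verts H) - 1)"
 have "(SUM em:inj_maps (verts H) {1..n}. SUM a:verts H. tdens1 a (w (em a, em a)) H W - tdens H W) =
   (SUM a:verts H. SUM em:inj_maps (verts H) {1..n}. tdens1 a (w (em a, em a)) H W - tdens H W)" by (rule sum.swap)
 also have "... = (SUM a:verts H. ?c * (SUM i:{1..n}. tdens1 a (w (i, i)) H W - tdens H W))"
  by (intro sum.cong refl sum_inj_maps_1[OF H'(2)])
 also have "... = ?c * (SUM i:{1..n}. SUM a:verts H. tdens1 a (w (i, i)) H W - tdens H W)"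
  unfolding sum_distrib_left[symmetric] by (subst sum.swap) simp
 also have "(SUM i:{1..n}. SUM a:verts H. tdens1 a (w (i, i)) H W - tdens H W) = real (card (Aut H)) * lin_stat n (irr_kernel H W) w"
  unfolding lin_stat_def sum_distrib_left using H'(4)
  by (intro sum.cong refl) (simp add: irr_kernel_def sum_subtractf field_simps)
 finally show ?thesis .
qed

lemma second_moment_resid:
 assumes W: "graphon W" and H: "pattern_graph H" and n: "1 <= n"
 defines "k \<equiv> card (verts H)"
 shows "(LINT w|cube. (SUM em:inj_maps (verts H) {1..n}. resid1 W H em w)^2) <=
   (2 + real k)^2 * (2 ^ k * real k ^ 2) * (real n ^ k * (real n ^ k / real n ^ 2))"
  and "(LINT w|cube. (SUM em:inj_maps (verts H) {1..n}. resid2 W H em w)^2) <=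
   (2 + real k + real (card (off_pairs (verts H))))^2 * (2 ^ k * real k ^ 3) * (real n ^ k * (real n ^ k / real n ^ 3))"
proof -
 note H' = pattern_graphD[OF H]
 interpret Cb: prob_space "cube :: (nat \<times> nat => real) measure" by (rule prob_space_cube)
 have sq: "(LINT w|cube. (R w)^2) <= c^2" if R: "bdm cube R" "!!w. w : space cube ==> \<bar>R w\<bar> <= c"
  for R :: "(nat \<times> nat => real) => real" and c
 proof (rule Cb.integral_le_const[OF integrable_cube[OF bdm_power[OF R(1)]] AE_I2])
  fix w :: "nat \<times> nat => real" assume "w : space cube"
  then have "\<bar>R w\<bar>^2 <= c^2" using R(2) by (intro power_mono) auto
  then show "(R w)^2 <= c^2" by simp
 qed
 have "(LINT w|cube. (SUM em:inj_maps (verts H) {1..n}. resid1 W H em w)^2) <=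
   (2 + real k)^2 * (2 ^ k * k ^ 2) * (real n ^ k * (real n ^ k / real n ^ 2))"
  unfolding k_def
 proof (rule second_moment_sum_inj_maps[OF H'(2) n])
  fix em assume "em : inj_maps (verts H) {1..n}"
  then have i: "inj_on em (verts H)" by (rule inj_mapsD)
  show "bdm cube (resid1 W H em)" by (rule bdm_resid1[OF W H'(1) i])
  then show "(LINT w|cube. (resid1 W H em w)^2) <= (2 + real (card (verts H)))^2"
   by (rule sq) (rule resid1_bound[OF W H'(1) i])
  show "depends_on (em ` verts H \<times> em ` verts H) (resid1 W H em)" by (rule depends_on_resid1[OF W H'(1) i])
  show "AE w in cube. cond_mean (S \<times> S) (resid1 W H em) w = 0" if "S <= em ` verts H" "card S < 2" for S
   by (rule resid1_orthogonal[OF W H'(1) i that])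
 qed simp
 then show "(LINT w|cube. (SUM em:inj_maps (verts H) {1..n}. resid1 W H em w)^2) <=
   (2 + real k)^2 * (2 ^ k * real k ^ 2) * (real n ^ k * (real n ^ k / real n ^ 2))" by simp
 have "(LINT w|cube. (SUM em:inj_maps (verts H) {1..n}. resid2 W H em w)^2) <=
   (2 + real k + real (card (off_pairs (verts H))))^2 * (2 ^ k * k ^ 3) * (real n ^ k * (real n ^ k / real n ^ 3))"
  unfolding k_def
 proof (rule second_moment_sum_inj_maps[OF H'(2) n])
  fix em assume "em : inj_maps (verts H) {1..n}"
  then have i: "inj_on em (verts H)" by (rule inj_mapsD)
  show "bdm cube (resid2 W H em)" by (rule bdm_resid2[OF W H'(1) i])
  then show "(LINT w|cube. (resid2 W H em w)^2) <= (2 + real (card (verts H)) + real (card (off_pairs (verts H))))^2"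
   by (rule sq) (rule resid2_bound[OF W H'(1) i])
  show "depends_on (em ` verts H \<times> em ` verts H) (resid2 W H em)" by (rule depends_on_resid2[OF W H'(1) i])
  show "AE w in cube. cond_mean (S \<times> S) (resid2 W H em) w = 0" if "S <= em ` verts H" "card S < 3" for S
   by (rule resid2_orthogonal[OF W H'(1) i that])
 qed simp
 then show "(LINT w|cube. (SUM em:inj_maps (verts H) {1..n}. resid2 W H em w)^2) <=
   (2 + real k + real (card (off_pairs (verts H))))^2 * (2 ^ k * real k ^ 3) * (real n ^ k * (real n ^ k / real n ^ 3))" by simp
qed

lemma bdm_sum_resid:
 assumes W: "graphon W" and H: "simple_graph H"
 shows "bdm cube (%w. SUM em:inj_maps (verts H) {1..n}. resid1 W H em w)"
  and "bdm cube (%w. SUM em:inj_maps (verts H) {1..n}. resid2 W H em w)"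
 by (intro bdm_sum bdm_resid1[OF W H] bdm_resid2[OF W H] inj_mapsD(1), assumption)+

text \<open>The remainder after first order has a second moment of order n^(2k-2), where k is the
  number of vertices, and the squared normalisation n^(1-2k) leaves \<open>1 / n\<close>. The edge
  noise is of second order and disappears with it. The other error comes from comparing a falling
  factorial with a power, expressed by \<open>r\<close>.\<close>

theorem Z_stat_irregular_approx:
 assumes W: "graphon W" and H: "pattern_graph H" and irr: "\<not> H_regular H W"
 shows "(%n. LINT w|cube. (Z_stat n H W (cube_graph n W w) - lin_stat n (irr_kernel H W) w / sqrt (real n))^2) \<longlonglongrightarrow> 0"
proof -
 note H' = pattern_graphD[OF H]
 let ?V = "verts H" and ?k = "card (verts H)" and ?A = "real (card (Aut H))"
 let ?R = "%n w. SUM em:inj_maps ?V {1..n}. resid1 W H em w"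
 let ?L = "%n. lin_stat n (irr_kernel H W)"
 define r where "r n = falling_factorial (n - 1) (?k - 1) / real n ^ (?k - 1)" for n
 define C where "C = (2 + real ?k)^2 * (2 ^ ?k * real ?k ^ 2)"
 define D where "D = (LINT x|unit_unif. (irr_kernel H W x)^2)"
 note bf = bdm_irr_kernel[OF W H'(1)]
 have decomp: "Z_stat n H W (cube_graph n W w) - ?L n w / sqrt (real n) =
   sqrt (real n) / real n ^ ?k / ?A * ?R n w + (r n - 1) / sqrt (real n) * ?L n w"
  if n: "1 <= n" and w: "w : space cube" for n w
 proof -
  have "(SUM em:inj_maps ?V {1..n}. hom_ind W H em w - tdens H W) =
    (SUM em:inj_maps ?V {1..n}. resid1 W H em w + (SUM a:?V. tdens1 a (w (em a, em a)) H W - tdens H W))"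
  proof (rule sum.cong[OF refl])
   fix em assume "em : inj_maps ?V {1..n}"
   then have i: "inj_on em ?V" by (rule inj_mapsD)
   have "(SUM a:?V. hproj W H em {a} w - hproj W H em {} w) = (SUM a:?V. tdens1 a (w (em a, em a)) H W - tdens H W)"
    by (intro sum.cong refl) (simp add: hproj_single[OF W H'(1) i w] hproj_empty[OF W H'(1) i w])
   then show "hom_ind W H em w - tdens H W = resid1 W H em w + (SUM a:?V. tdens1 a (w (em a, em a)) H W - tdens H W)"
    unfolding resid1_def[OF W H'(1) i] by (simp add: hproj_empty[OF W H'(1) i w])
  qed
  then have s: "(SUM em:inj_maps ?V {1..n}. hom_ind W H em w - tdens H W) =
    ?R n w + falling_factorial (n - 1) (?k - 1) * (?A * ?L n w)"
   unfolding sum.distrib sum_tdens1_inj_maps[OF W H] .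
  have nk: "real n ^ ?k = real n * real n ^ (?k - 1)" using H'(3) by (cases ?k) auto
  have sn: "sqrt (real n) * sqrt (real n) = real n" by simp
  have "sqrt (real n) / real n ^ ?k * (falling_factorial (n - 1) (?k - 1) * ?L n w) = r n / sqrt (real n) * ?L n w"
   unfolding r_def nk using n by (simp add: field_simps)
  then show ?thesis
   unfolding Z_stat_cube_graph[OF W H w n] s using irr H'(4)
   by (simp add: powr_half_sqrt distrib_left diff_divide_distrib left_diff_distrib field_simps)
 qed
 have le: "(LINT w|cube. (Z_stat n H W (cube_graph n W w) - ?L n w / sqrt (real n))^2) <=
   2 * (C / ?A^2) * (1 / real n) + 4 * D * (r n - 1)^2" if n: "1 <= n" for n
 proof -
  let ?a = "sqrt (real n) / real n ^ ?k / ?A" and ?b = "(r n - 1) / sqrt (real n)"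
  have "(LINT w|cube. (Z_stat n H W (cube_graph n W w) - ?L n w / sqrt (real n))^2) = (LINT w|cube. (?a * ?R n w + ?b * ?L n w)^2)"
   by (intro lint_cong refl) (simp only: decomp[OF n])
  also have "... <= 2 * (LINT w|cube. (?a * ?R n w)^2) + 2 * (LINT w|cube. (?b * ?L n w)^2)"
   by (intro integral_square_add_le bdm_mult bdm_const bdm_sum_resid[OF W H'(1)] bdm_lin_stat bf)
  also have "... = 2 * (?a^2 * (LINT w|cube. (?R n w)^2)) + 2 * (?b^2 * (LINT w|cube. (?L n w)^2))"
   by (simp only: power_mult_distrib integral_mult_right_zero)
  also have "... <= 2 * (?a^2 * (C * (real n ^ ?k * (real n ^ ?k / real n ^ 2)))) + 2 * (?b^2 * (2 * D * real n))"
   unfolding C_def D_def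
   by (intro add_mono mult_left_mono second_moment_resid(1)[OF W H n] lin_stat_sq_le[OF bf integral_irr_kernel[OF W H] _ n]) auto
  also have "... = 2 * (C / ?A^2) * (1 / real n) + 4 * D * (r n - 1)^2"
   using n H'(4) by (simp add: power_mult_distrib power_divide field_simps power2_eq_square)
  finally show ?thesis .
 qed
 have r1: "r \<longlonglongrightarrow> 1" unfolding r_def[abs_def] by (rule falling_factorial_ratio)
 have "(%n. 2 * (C / ?A^2) * (1 / real n) + 4 * D * (r n - 1)^2) \<longlonglongrightarrow> 2 * (C / ?A^2) * 0 + 4 * D * (1 - 1)^2"
  by (intro tendsto_intros r1 lim_1_over_n)
 then have lim: "(%n. 2 * (C / ?A^2) * (1 / real n) + 4 * D * (r n - 1)^2) \<longlonglongrightarrow> 0" by simp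
 show ?thesis
 proof (rule tendsto_sandwich[OF _ _ tendsto_const lim])
  show "\<forall>\<^sub>F n in sequentially. 0 <= (LINT w|cube. (Z_stat n H W (cube_graph n W w) - ?L n w / sqrt (real n))^2)" by simp
  show "\<forall>\<^sub>F n in sequentially. (LINT w|cube. (Z_stat n H W (cube_graph n W w) - ?L n w / sqrt (real n))^2) <=
    2 * (C / ?A^2) * (1 / real n) + 4 * D * (r n - 1)^2"
   using le by (rule eventually_sequentiallyI)
 qed
qed

lemma cond_mean_edge_ind:
 assumes W: "graphon W" and w: "w : space cube" and K: "(i, i) : K" "(j, j) : K" "(min i j, max i j) ~: K"
 shows "cond_mean K (edge_ind W i j) w = W (w (i, i)) (w (j, j))"
proof -
 have "cond_mean K (edge_ind W i j) w = (LINT w'|cube. (if w' (min i j, max i j) <= W (w (i, i)) (w (j, j)) then 1 else 0))"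
  unfolding cond_mean_def edge_ind_def override_on_def by (simp only: K if_True if_False)
 also have "... = W (w (i, i)) (w (j, j))"
  using graphon_range[OF W cube_range[OF w] cube_range[OF w]] by (intro integral_le_indicator) simp
 finally show ?thesis .
qed

lemma bdm_graphon_vertices:
 assumes "graphon W"
 shows "bdm cube (%w. W (w i) (w j))"
 using bdm_graphon_prod[OF assms, where E = "{(i, j)}" and \<rho> = "%x. x"] by simp

lemma noise_stat_inj_maps:
 "noise_stat n W g w = (SUM em:inj_maps {1::nat, 2} {1..n}.
   (edge_ind W (em 1) (em 2) w - W (w (em 1, em 1)) (w (em 2, em 2))) * g (w (em 1, em 1), w (em 2, em 2)))"
 using sum_inj_maps_2[of "{1::nat, 2}" 1 2 "%i j. (edge_ind W i j w - W (w (i, i)) (w (j, j))) * g (w (i, i), w (j, j))" n]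
 by (simp add: noise_stat_def)

lemma bdm_noise_term:
 "graphon W ==> bdm unit_square g ==>
  bdm cube (%w. (edge_ind W i j w - W (w (i, i)) (w (j, j))) * g (w (i, i), w (j, j)))"
 by (intro bdm_mult bdm_diff bdm_edge_ind bdm_graphon_vertices bdm_vertex2)

lemma bdm_noise_stat:
 "graphon W ==> bdm unit_square g ==> bdm cube (noise_stat n W g)"
 unfolding noise_stat_inj_maps[abs_def] by (intro bdm_sum bdm_noise_term)

text \<open>Given the vertices each noise term is centred, so its projection to fewer than two
  vertices is 0. The noise is thus degenerate of order 2 for every kernel \<open>g\<close>, even one
  whose marginals do not vanish.\<close>

lemma noise_stat_sq_le:
 assumes W: "graphon W" and g: "bdm unit_square g" and n: "1 <= n"
 shows "(LINT w|cube. (noise_stat n W g w)^2) <= 16 * (LINT p|unit_square. (g p)^2) * (real n)^2"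
proof -
 let ?V = "{1::nat, 2}" and ?Bd = "LINT p|unit_square. (g p)^2"
 let ?R = "%i j w. (edge_ind W i j w - W (w (i, i)) (w (j, j))) * g (w (i, i), w (j, j))"
 have gm: "g : borm unit_square" by (rule bdm_measurable[OF g])
 have "(LINT w|cube. (SUM em:inj_maps ?V {1..n}. ?R (em 1) (em 2) w)^2) <=
   ?Bd * (2 ^ card ?V * card ?V ^ 2) * (real n ^ card ?V * (real n ^ card ?V / real n ^ 2))"
 proof (rule second_moment_sum_inj_maps)
  fix em :: "nat => nat" assume p: "em : inj_maps ?V {1..n}"
  let ?i = "em 1" and ?j = "em 2"
  have ij: "?i ~= ?j"
  proof
   assume "?i = ?j"
   from inj_onD[OF inj_mapsD(1)[OF p] this] show False by simp
  qed
  show bm: "bdm cube (?R ?i ?j)" by (rule bdm_noise_term[OF W g])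
  have d: "depends_on ({i, j} \<times> {i, j}) (?R i j)" for i j
   unfolding depends_on_def
  proof (intro ballI impI)
   fix w w' :: "nat \<times> nat => real"
   assume ww: "w : space cube" "w' : space cube" and eq: "ALL e:{i, j} \<times> {i, j}. w e = w' e"
   have "edge_ind W i j w = edge_ind W i j w'"
    by (rule depends_onD[OF depends_on_edge_ind[OF insertI1 insertI2[OF singletonI]] ww]) (rule bspec[OF eq])
   moreover have "w (i, i) = w' (i, i)" "w (j, j) = w' (j, j)" using eq by simp_all
   ultimately show "?R i j w = ?R i j w'" by (simp only:)
  qed
  have "em ` ?V = {?i, ?j}" by simp
  then show "depends_on (em ` ?V \<times> em ` ?V) (?R ?i ?j)" using d by (simp only:)
  have "(LINT w|cube. (?R ?i ?j w)^2) <= (LINT w|cube. (g (w (?i, ?i), w (?j, ?j)))^2)"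
  proof (rule integral_mono)
   show "integrable cube (%w. (?R ?i ?j w)^2)" by (rule integrable_cube[OF bdm_power[OF bm]])
   show "integrable cube (%w. (g (w (?i, ?i), w (?j, ?j)))^2)" by (rule integrable_cube[OF bdm_power[OF bdm_vertex2[OF g]]])
   fix w :: "nat \<times> nat => real" assume w: "w : space cube"
   have "\<bar>edge_ind W ?i ?j w - W (w (?i, ?i)) (w (?j, ?j))\<bar> <= 1"
    using graphon_range[OF W cube_range[OF w, of "(?i, ?i)"] cube_range[OF w, of "(?j, ?j)"]] by (auto simp: edge_ind_def)
   then have "\<bar>edge_ind W ?i ?j w - W (w (?i, ?i)) (w (?j, ?j))\<bar>^2 <= 1^2" by (intro power_mono) auto
   then have "(edge_ind W ?i ?j w - W (w (?i, ?i)) (w (?j, ?j)))^2 * (g (w (?i, ?i), w (?j, ?j)))^2 <= 1 * (g (w (?i, ?i), w (?j, ?j)))^2"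
    by (intro mult_right_mono) auto
   then show "(?R ?i ?j w)^2 <= (g (w (?i, ?i), w (?j, ?j)))^2" by (simp add: power_mult_distrib)
  qed
  also have "... = ?Bd" using integral_cube_pair[of "(?i, ?i)" "(?j, ?j)" "%p. (g p)^2"] ij gm by simp
  finally show "(LINT w|cube. (?R ?i ?j w)^2) <= ?Bd" .
  fix S assume S: "S <= em ` ?V" "card S < 2"
  have fS: "finite S" using S(1) by (rule finite_subset) simp
  have nS: "\<not> (?i : S & ?j : S)"
  proof
   assume "?i : S & ?j : S"
   then have "card {?i, ?j} <= card S" using fS by (intro card_mono) auto
   then show False using S(2) ij by simp
  qed
  \<comment> \<open>Keeping in addition all vertex coordinates still misses the coordinate of this
    edge, since its endpoints are not both in \<open>S\<close>; so the mean over the edge coordinate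
    can be taken first.\<close>
  let ?K = "S \<times> S \<union> range (%i. (i, i))"
  have K: "(?i, ?i) : ?K" "(?j, ?j) : ?K" by auto
  have K': "(min ?i ?j, max ?i ?j) ~: ?K" using nS ij by (auto simp: min_def max_def split: if_splits)
  have z: "cond_mean ?K (?R ?i ?j) w = 0" if w: "w : space cube" for w
  proof -
   have "cond_mean ?K (?R ?i ?j) w = cond_mean ?K (%w. edge_ind W ?i ?j w - W (w (?i, ?i)) (w (?j, ?j))) w * g (w (?i, ?i), w (?j, ?j))"
    by (rule cond_mean_mult[OF depends_on_vertex2[OF K, of "%x y. g (x, y)"] w])
   also have "cond_mean ?K (%w. edge_ind W ?i ?j w - W (w (?i, ?i)) (w (?j, ?j))) w =
     cond_mean ?K (edge_ind W ?i ?j) w - cond_mean ?K (%w. W (w (?i, ?i)) (w (?j, ?j))) w"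
    by (rule cond_mean_diff[OF bdm_edge_ind[OF W] bdm_graphon_vertices[OF W] w])
   also have "cond_mean ?K (%w. W (w (?i, ?i)) (w (?j, ?j))) w = W (w (?i, ?i)) (w (?j, ?j))"
    by (rule cond_mean_depends[OF depends_on_vertex2[OF K] w])
   also have "cond_mean ?K (edge_ind W ?i ?j) w = W (w (?i, ?i)) (w (?j, ?j))" by (rule cond_mean_edge_ind[OF W w K K'])
   finally show ?thesis by simp
  qed
  show "AE w in cube. cond_mean (S \<times> S) (?R ?i ?j) w = 0"
  proof (rule AE_I2)
   fix w :: "nat \<times> nat => real" assume w: "w : space cube"
   have "cond_mean (S \<times> S) (?R ?i ?j) w = cond_mean (S \<times> S) (cond_mean ?K (?R ?i ?j)) w"
    using cond_mean_cond_mean[OF bm w, of "S \<times> S" ?K] by (simp add: Int_absorb2)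
   also have "... = cond_mean (S \<times> S) (%_. 0) w" by (rule cond_mean_cong[OF z w])
   finally show "cond_mean (S \<times> S) (?R ?i ?j) w = 0" by (simp add: cond_mean_def)
  qed
 next
  show "finite ?V" by simp
  show "0 <= ?Bd" by simp
 qed (rule n)
 also have "real n ^ card ?V * (real n ^ card ?V / real n ^ 2) = (real n)^2"
 proof -
  have "card ?V = 2" by simp
  then show ?thesis using n by (simp only:) simp
 qed
 also have "?Bd * real (2 ^ card ?V * card ?V ^ 2) = 16 * ?Bd"
 proof -
  have "card ?V = 2" by simp
  then show ?thesis by (simp only:) simp
 qed
 finally show ?thesis unfolding noise_stat_inj_maps .
qed

lemma sum_off_pairs_ordered_edges:
 fixes F :: "nat \<times> nat => real"
 assumes "simple_graph H"
 shows "(SUM e:off_pairs (verts H). if e : ordered_edges H then F e else 0) = (SUM e:ordered_edges H. F e)"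
proof -
 have "ordered_edges H <= off_pairs (verts H)"
  using ordered_edges_verts[OF assms] by (auto simp: off_pairs_def)
 moreover have "finite (off_pairs (verts H))" using assms by (intro finite_off_pairs) (simp add: simple_graph_def)
 ultimately show ?thesis by (intro sum.mono_neutral_cong_right) auto
qed

text \<open>Collects the second-order projections of all embeddings. The factor
  \<open>2 * card (Aut H)\<close> undoes the normalisation of \<open>reg_kernel\<close>;
  \<open>noise_kernel\<close> is normalised without the 2, hence the halved noise.\<close>

lemma sum_hproj_pairs_inj_maps:
 assumes W: "graphon W" and H: "pattern_graph H" and w: "w : space cube"
 shows "(SUM em:inj_maps (verts H) {1..n}. SUM e:off_pairs (verts H). hproj W H em {fst e, snd e} w - tdens H W) =
  falling_factorial (n - 2) (card (verts H) - 2) * (2 * real (card (Aut H)) *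
   (quad_stat n (case_prod (reg_kernel H W)) w + noise_stat n W (case_prod (noise_kernel H W)) w / 2))"
proof -
 note H' = pattern_graphD[OF H]
 let ?V = "verts H" and ?A = "real (card (Aut H))" and ?k = "real (card (verts H))"
 let ?c = "falling_factorial (n - 2) (card (verts H) - 2)"
 let ?x = "%i. w (i, i)"
 define F where "F e i j = tdens2 (fst e) (snd e) (?x i) (?x j) H W - tdens H W +
  (if e : ordered_edges H then (edge_ind W i j w - W (?x i) (?x j)) * tdens_minus (fst e) (snd e) (?x i) (?x j) H W else 0)" for e i j
 have v: "fst e : ?V" "snd e : ?V" "fst e ~= snd e" if "e : off_pairs ?V" for e using that by (auto simp: off_pairs_def)
 have "(SUM em:inj_maps ?V {1..n}. SUM e:off_pairs ?V. hproj W H em {fst e, snd e} w - tdens H W) =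
   (SUM em:inj_maps ?V {1..n}. SUM e:off_pairs ?V. F e (em (fst e)) (em (snd e)))"
 proof (intro sum.cong refl)
  fix em e assume p: "em : inj_maps ?V {1..n}" and e: "e : off_pairs ?V"
  show "hproj W H em {fst e, snd e} w - tdens H W = F e (em (fst e)) (em (snd e))"
   unfolding F_def hproj_pair[OF W H'(1) inj_mapsD(1)[OF p] w v[OF e]] by simp
 qed
 also have "... = (SUM e:off_pairs ?V. SUM em:inj_maps ?V {1..n}. F e (em (fst e)) (em (snd e)))" by (rule sum.swap)
 also have "... = (SUM e:off_pairs ?V. ?c * (SUM (i, j):distinct_pairs n. F e i j))"
  by (intro sum.cong refl sum_inj_maps_2[OF H'(2)] v)
 also have "... = ?c * (SUM (i, j):distinct_pairs n. SUM e:off_pairs ?V. F e i j)"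
  unfolding sum_distrib_left[symmetric] split_beta' by (subst sum.swap) simp
 also have "(SUM (i, j):distinct_pairs n. SUM e:off_pairs ?V. F e i j) =
   (SUM (i, j):distinct_pairs n. 2 * ?A * (reg_kernel H W (?x i) (?x j) + (edge_ind W i j w - W (?x i) (?x j)) * noise_kernel H W (?x i) (?x j) / 2))"
 proof (intro sum.cong refl, clarify)
  fix i j
  have c: "real (card (off_pairs ?V)) = ?k * (?k - 1)"
   using sum_off_pairs_fst[OF H'(2), of "%_. 1"] by (simp add: split_beta' mult.commute)
  have "(SUM e:off_pairs ?V. F e i j) = (SUM e:off_pairs ?V. tdens2 (fst e) (snd e) (?x i) (?x j) H W) - ?k * (?k - 1) * tdens H W +
    (SUM e:ordered_edges H. (edge_ind W i j w - W (?x i) (?x j)) * tdens_minus (fst e) (snd e) (?x i) (?x j) H W)"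
   unfolding F_def sum.distrib sum_subtractf sum_off_pairs_ordered_edges[OF H'(1)] using c by simp
  also have "... = 2 * ?A * reg_kernel H W (?x i) (?x j) + (edge_ind W i j w - W (?x i) (?x j)) * (?A * noise_kernel H W (?x i) (?x j))"
   unfolding reg_kernel_def two_point_kernel_off_pairs noise_kernel_def sum_distrib_left[symmetric] split_beta'
   using H'(4) by (simp add: right_diff_distrib)
  finally show "(SUM e:off_pairs ?V. F e i j) = 2 * ?A * (reg_kernel H W (?x i) (?x j) + (edge_ind W i j w - W (?x i) (?x j)) * noise_kernel H W (?x i) (?x j) / 2)"
   by (simp add: distrib_left)
 qed
 also have "... = 2 * ?A * (quad_stat n (case_prod (reg_kernel H W)) w + noise_stat n W (case_prod (noise_kernel H W)) w / 2)"
  unfolding quad_stat_def noise_stat_def split_beta' sum_distrib_left[symmetric] sum.distrib sum_divide_distrib by simp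
 finally show ?thesis .
qed

text \<open>The first-order part vanishes almost surely, so the expansion starts at order two. Its
  remainder has a second moment of order n^(2k-3), where k is the number of vertices, against the
  squared normalisation n^(2-2k), which again leaves \<open>1 / n\<close>.\<close>

theorem Z_stat_regular_approx:
 assumes W: "graphon W" and H: "pattern_graph H" and reg: "H_regular H W"
 shows "(%n. LINT w|cube. (Z_stat n H W (cube_graph n W w) -
   (quad_stat n (case_prod (reg_kernel H W)) w + noise_stat n W (case_prod (noise_kernel H W)) w / 2) / real n)^2) \<longlonglongrightarrow> 0"
proof -
 note H' = pattern_graphD[OF H]
 let ?V = "verts H" and ?k = "card (verts H)" and ?A = "real (card (Aut H))"
 let ?R = "%n w. SUM em:inj_maps ?V {1..n}. resid2 W H em w"
 let ?K = "case_prod (reg_kernel H W)" and ?g = "case_prod (noise_kernel H W)"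
 let ?L = "%n w. quad_stat n ?K w + noise_stat n W ?g w / 2"
 define r where "r n = falling_factorial (n - 2) (?k - 2) / real n ^ (?k - 2)" for n
 define C where "C = (2 + real ?k + real (card (off_pairs ?V)))^2 * (2 ^ ?k * real ?k ^ 3)"
 define D where "D = 32 * (LINT p|unit_square. (?K p)^2) + 8 * (LINT p|unit_square. (?g p)^2)"
 note bK = bdm_reg_kernel[OF W H'(1)] and bg = bdm_noise_kernel[OF W H'(1)]
 have "AE x in unit_unif. irr_kernel H W x = 0" by (rule H_regular_irr_kernel[OF H reg])
 then have AE0: "AE w in cube. irr_kernel H W (w (i, i)) = 0" for i :: nat by (rule AE_cube_component)
 \<comment> \<open>One null set serves all vertices at once, because there are countably
   many.\<close>
 have AEall: "AE w in cube. \<forall>i::nat. irr_kernel H W (w (i, i)) = 0"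
  using AE0 by (simp add: AE_all_countable)
 have decomp: "Z_stat n H W (cube_graph n W w) - ?L n w / real n =
   real n / real n ^ ?k / ?A * ?R n w + (r n - 1) / real n * ?L n w"
  if n: "1 <= n" and w: "w : space cube" and z: "\<forall>i::nat. irr_kernel H W (w (i, i)) = 0" for n w
 proof -
  let ?t = "tdens H W"
  let ?T = "%em. SUM a:?V. tdens1 a (w (em a, em a)) H W - ?t"
  have lz: "lin_stat n (irr_kernel H W) w = 0" using z by (simp add: lin_stat_def)
  have T0: "(SUM em:inj_maps ?V {1..n}. ?T em) = 0" unfolding sum_tdens1_inj_maps[OF W H] lz by simp
  \<comment> \<open>The first-order sum enters with coefficient 1 and is subtracted
    \<open>k - 1\<close> times by the pair terms, each vertex having \<open>k - 1\<close> partners;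
    this explains \<open>2 - k\<close>. Its total over all embeddings is 0 here.\<close>
  have "(SUM em:inj_maps ?V {1..n}. hom_ind W H em w - ?t) =
    (SUM em:inj_maps ?V {1..n}. resid2 W H em w + (2 - real ?k) * ?T em + (1 / 2) * (SUM e:off_pairs ?V. hproj W H em {fst e, snd e} w - ?t))"
  proof (rule sum.cong[OF refl])
   fix em assume "em : inj_maps ?V {1..n}"
   then have i: "inj_on em ?V" by (rule inj_mapsD)
   let ?p = "%a. hproj W H em {a} w"
   have e0: "hproj W H em {} w = ?t" by (rule hproj_empty[OF W H'(1) i w])
   have T: "?T em = (SUM a:?V. ?p a - ?t)"
    by (intro sum.cong refl) (simp add: hproj_single[OF W H'(1) i w])
   have f: "(SUM e:off_pairs ?V. ?p (fst e) - ?t) = (real ?k - 1) * ?T em"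
    using sum_off_pairs_fst[OF H'(2), of "%a. ?p a - ?t"] unfolding T split_beta' .
   have s: "(SUM e:off_pairs ?V. ?p (snd e) - ?t) = (real ?k - 1) * ?T em"
    using sum_off_pairs_snd[OF H'(2), of "%a. ?p a - ?t"] unfolding T split_beta' .
   have "(SUM e:off_pairs ?V. hproj W H em {fst e, snd e} w - ?p (fst e) - ?p (snd e) + ?t) =
     (SUM e:off_pairs ?V. (hproj W H em {fst e, snd e} w - ?t) - (?p (fst e) - ?t) - (?p (snd e) - ?t))"
    by (intro sum.cong refl) simp
   also have "... = (SUM e:off_pairs ?V. hproj W H em {fst e, snd e} w - ?t) - 2 * ((real ?k - 1) * ?T em)"
    unfolding sum_subtractf[where f = "%e. (hproj W H em {fst e, snd e} w - ?t) - (?p (fst e) - ?t)"]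
     sum_subtractf[where f = "%e. hproj W H em {fst e, snd e} w - ?t"] f s by simp
   finally have q: "(SUM e:off_pairs ?V. hproj W H em {fst e, snd e} w - ?p (fst e) - ?p (snd e) + ?t) =
     (SUM e:off_pairs ?V. hproj W H em {fst e, snd e} w - ?t) - 2 * ((real ?k - 1) * ?T em)" .
   have "resid2 W H em w = hom_ind W H em w - ?t - ?T em -
     (1 / 2) * ((SUM e:off_pairs ?V. hproj W H em {fst e, snd e} w - ?t) - 2 * ((real ?k - 1) * ?T em))"
    unfolding resid2_def[OF W H'(1) i] resid1_def[OF W H'(1) i] e0 split_beta' q T ..
   then show "hom_ind W H em w - ?t = resid2 W H em w + (2 - real ?k) * ?T em + (1 / 2) * (SUM e:off_pairs ?V. hproj W H em {fst e, snd e} w - ?t)"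
    by (simp add: algebra_simps)
  qed
  also have "... = ?R n w + (2 - real ?k) * (SUM em:inj_maps ?V {1..n}. ?T em) +
    (1 / 2) * (SUM em:inj_maps ?V {1..n}. SUM e:off_pairs ?V. hproj W H em {fst e, snd e} w - ?t)"
   by (simp only: sum.distrib sum_distrib_left)
  finally have s: "(SUM em:inj_maps ?V {1..n}. hom_ind W H em w - ?t) = ?R n w + falling_factorial (n - 2) (?k - 2) * (?A * ?L n w)"
   unfolding T0 sum_hproj_pairs_inj_maps[OF W H w] by simp
  have nk: "real n ^ ?k = real n * (real n * real n ^ (?k - 2))"
  proof -
   obtain k' where "?k = Suc (Suc k')" using H'(3) by (metis add_2_eq_Suc le_Suc_ex)
   then show ?thesis by simp
  qed
  have "real n / real n ^ ?k * (falling_factorial (n - 2) (?k - 2) * ?L n w) = r n / real n * ?L n w"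
   unfolding r_def nk using n by simp
  then have e: "real n / real n ^ ?k / ?A * (falling_factorial (n - 2) (?k - 2) * (?A * ?L n w)) = r n / real n * ?L n w"
   using H'(4) by (simp add: mult.left_commute mult.commute)
  have "Z_stat n H W (cube_graph n W w) = real n / real n ^ ?k / ?A * (?R n w + falling_factorial (n - 2) (?k - 2) * (?A * ?L n w))"
   unfolding Z_stat_cube_graph[OF W H w n] s using reg n by (simp only: if_True powr_one)
  also have "... = real n / real n ^ ?k / ?A * ?R n w + r n / real n * ?L n w"
   unfolding e[symmetric] by (rule distrib_left)
  finally have z: "Z_stat n H W (cube_graph n W w) = real n / real n ^ ?k / ?A * ?R n w + r n / real n * ?L n w" .
  have "a + r / m * L - L / m = a + (r - 1) / m * L" for a r m L :: real
   by (simp add: diff_divide_distrib left_diff_distrib)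
  then show ?thesis unfolding z .
 qed
 have Lsq: "(LINT w|cube. (?L n w)^2) <= D * (real n)^2" if n: "1 <= n" for n
 proof -
  have z: "AE x in unit_unif. (LINT y|unit_unif. ?K (x, y)) = 0" "AE y in unit_unif. (LINT x|unit_unif. ?K (x, y)) = 0"
   using H_regular_irr_kernel[OF H reg] AE_space by (eventually_elim, simp add: integral_reg_kernel[OF W H])+
  have z0: "(LINT p|unit_square. ?K p) = 0"
  proof -
   interpret U: prob_space unit_unif by (rule prob_space_unit_unif)
   interpret P: pair_prob_space unit_unif unit_unif ..
   have "(LINT p|unit_square. ?K p) = (LINT x|unit_unif. LINT y|unit_unif. ?K (x, y))"
    by (rule P.integral_fst'[symmetric]) (rule bdm_integrable[OF P.finite_measure_axioms bK])
   also have "... = 0" by (rule integral_eq_zero_AE[OF z(1)])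
   finally show ?thesis .
  qed
  have "(LINT w|cube. (quad_stat n ?K w)^2) <= 16 * (LINT p|unit_square. (?K p)^2) * (real n ^ 4 / real n ^ 2)"
   by (rule quad_stat_sq_le[OF bK order_refl n _ z0 z]) simp
  also have "real n ^ 4 / real n ^ 2 = (real n)^2" using n by (simp add: power4_eq_xxxx power2_eq_square)
  finally have q: "(LINT w|cube. (quad_stat n ?K w)^2) <= 16 * (LINT p|unit_square. (?K p)^2) * (real n)^2" .
  have "(LINT w|cube. (?L n w)^2) <= 2 * (LINT w|cube. (quad_stat n ?K w)^2) + 2 * (LINT w|cube. ((1 / 2) * noise_stat n W ?g w)^2)"
   using integral_square_add_le[OF bdm_quad_stat[OF bK] bdm_mult[OF bdm_const bdm_noise_stat[OF W bg]], of n "1 / 2" n] by simp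
  also have "(LINT w|cube. ((1 / 2) * noise_stat n W ?g w)^2) = (1 / 4) * (LINT w|cube. (noise_stat n W ?g w)^2)"
   by (simp add: power_mult_distrib power2_eq_square)
  also have "2 * (LINT w|cube. (quad_stat n ?K w)^2) + 2 * ((1 / 4) * (LINT w|cube. (noise_stat n W ?g w)^2)) <=
    2 * (16 * (LINT p|unit_square. (?K p)^2) * (real n)^2) + 2 * ((1 / 4) * (16 * (LINT p|unit_square. (?g p)^2) * (real n)^2))"
   by (intro add_mono mult_left_mono q noise_stat_sq_le[OF W bg n]) auto
  also have "... = D * (real n)^2" by (simp add: D_def algebra_simps)
  finally show ?thesis .
 qed
 have bL: "bdm cube (?L n)" for n
  using bdm_add[OF bdm_quad_stat[OF bK] bdm_mult[OF bdm_const bdm_noise_stat[OF W bg]], of n "1 / 2" n] by simp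
 have le: "(LINT w|cube. (Z_stat n H W (cube_graph n W w) - ?L n w / real n)^2) <=
   2 * (C / ?A^2) * (1 / real n) + 2 * D * (r n - 1)^2" if n: "1 <= n" for n
 proof -
  let ?a = "real n / real n ^ ?k / ?A" and ?b = "(r n - 1) / real n"
  have b1: "bdm cube (%w. ?a * ?R n w)" "bdm cube (%w. ?b * ?L n w)"
   by (intro bdm_mult bdm_const bdm_sum_resid[OF W H'(1)] bL)+
  have "(1 / real n) * x = x / real n" for x by simp
  then have b2: "bdm cube (%w. Z_stat n H W (cube_graph n W w) - ?L n w / real n)"
   using bdm_diff[OF bdm_of_graph[OF W, of "Z_stat n H W" n] bdm_mult[OF bdm_const bL, of "1 / real n" n]]
   by (simp only:)
  have "(LINT w|cube. (Z_stat n H W (cube_graph n W w) - ?L n w / real n)^2) = (LINT w|cube. (?a * ?R n w + ?b * ?L n w)^2)"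
  proof (rule integral_cong_AE)
   show "(%w. (Z_stat n H W (cube_graph n W w) - ?L n w / real n)^2) : borm cube"
    using bdm_measurable[OF bdm_power[OF b2]] .
   show "(%w. (?a * ?R n w + ?b * ?L n w)^2) : borm cube"
    by (rule bdm_measurable[OF bdm_power[OF bdm_add[OF b1]]])
   show "AE w in cube. (Z_stat n H W (cube_graph n W w) - ?L n w / real n)^2 = (?a * ?R n w + ?b * ?L n w)^2"
    using AEall AE_space by eventually_elim (rule arg_cong[where f = "%x. x^2"], rule decomp[OF n])
  qed
  also have "... <= 2 * (LINT w|cube. (?a * ?R n w)^2) + 2 * (LINT w|cube. (?b * ?L n w)^2)"
   by (rule integral_square_add_le[OF b1])
  also have "... = 2 * (?a^2 * (LINT w|cube. (?R n w)^2)) + 2 * (?b^2 * (LINT w|cube. (?L n w)^2))"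
   by (simp only: power_mult_distrib integral_mult_right_zero)
  also have "... <= 2 * (?a^2 * (C * (real n ^ ?k * (real n ^ ?k / real n ^ 3)))) + 2 * (?b^2 * (D * (real n)^2))"
   unfolding C_def
   by (intro add_mono mult_left_mono second_moment_resid(2)[OF W H n] Lsq[OF n]) auto
  also have "... = 2 * (C / ?A^2) * (1 / real n) + 2 * D * (r n - 1)^2"
  proof -
   have "2 * ((m / P / A)^2 * (C * (P * (P / m ^ 3)))) + 2 * (((q - 1) / m)^2 * (D * m^2)) =
     2 * (C / A^2) * (1 / m) + 2 * D * (q - 1)^2" if "m ~= 0" "P ~= 0" "A ~= 0" for m P A q :: real
    using that by (simp add: power_divide power2_eq_square power3_eq_cube)
   from this[of "real n" "real n ^ ?k" ?A "r n"] show ?thesis using n H'(4) by simp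
  qed
  finally show ?thesis .
 qed
 have r1: "r \<longlonglongrightarrow> 1" unfolding r_def[abs_def] by (rule falling_factorial_ratio)
 have "(%n. 2 * (C / ?A^2) * (1 / real n) + 2 * D * (r n - 1)^2) \<longlonglongrightarrow> 2 * (C / ?A^2) * 0 + 2 * D * (1 - 1)^2"
  by (intro tendsto_intros r1 lim_1_over_n)
 then have lim: "(%n. 2 * (C / ?A^2) * (1 / real n) + 2 * D * (r n - 1)^2) \<longlonglongrightarrow> 0" by simp
 show ?thesis
 proof (rule tendsto_sandwich[OF _ _ tendsto_const lim])
  show "\<forall>\<^sub>F n in sequentially. 0 <= (LINT w|cube. (Z_stat n H W (cube_graph n W w) - ?L n w / real n)^2)" by simp
  show "\<forall>\<^sub>F n in sequentially. (LINT w|cube. (Z_stat n H W (cube_graph n W w) - ?L n w / real n)^2) <=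
    2 * (C / ?A^2) * (1 / real n) + 2 * D * (r n - 1)^2"
   using le by (rule eventually_sequentiallyI)
 qed
qed

section \<open>Removing the edge noise\<close>

lemma norm_iexp_diff_le: "norm (iexp a - iexp b) <= \<bar>a - b\<bar>"
proof -
 have "iexp a - iexp b = iexp b * (iexp (a - b) - 1)"
  by (simp add: right_diff_distrib exp_add[symmetric])
 then have "norm (iexp a - iexp b) = norm (iexp (a - b) - 1)" by (simp add: norm_mult)
 also have "... <= \<bar>a - b\<bar>" using iexp_approx1[of "a - b" 0] by simp
 finally show ?thesis .
qed

lemma exp_minus_quadratic:
 fixes u :: real
 assumes "0 <= u"
 shows "\<bar>exp (- u) - (1 - u)\<bar> <= u^2"
proof -
 have "exp (- u) <= 1 / (1 + u)"
  using exp_ge_add_one_self[of u] assms by (simp add: exp_minus field_simps)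
 also have "1 / (1 + u) <= 1 - u + u^2"
 proof -
  have "1 <= (1 - u + u^2) * (1 + u)" using assms by (simp add: algebra_simps power2_eq_square)
  then show ?thesis using assms by (simp add: pos_divide_le_eq)
 qed
 finally show ?thesis using exp_ge_add_one_self[of "- u"] by simp
qed

lemma norm_diff_triangle_ineq': "norm (x - z) <= norm (x - y) + norm (y - z)"
 for x y z :: "'a::real_normed_vector"
 using norm_triangle_ineq[of "x - y" "y - z"] by simp

text \<open>Both characteristic functions are compared with \<open>1 - v / 2\<close>, where
  \<open>v\<close> is the variance: the Taylor remainder costs \<open>c ^ 3 / 6\<close>, and the
  exponential at most \<open>c ^ 4 / 4\<close>, which is at most \<open>c ^ 3 / 4\<close> since
  \<open>c <= 1\<close>.\<close>

lemma char_gaussian_approx: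
 fixes X :: "'a => real"
 assumes M: "prob_space M" and X: "X : borm M" and c: "!!x. x : space M ==> \<bar>X x\<bar> <= c" "c <= 1"
  and z: "(LINT x|M. X x) = 0"
 shows "norm ((CLINT x|M. iexp (X x)) - of_real (exp (- (LINT x|M. (X x)^2) / 2))) <= c ^ 3"
proof -
 interpret prob_space M by fact
 define v where "v = (LINT x|M. (X x)^2)"
 obtain x0 where "x0 : space M" using not_empty by auto
 then have c0: "0 <= c" using c(1)[of x0] by simp
 have b: "bdm M X" by (rule bdmI[OF X, where C = c]) (simp only: real_norm_def c(1))
 have bi: "bdm M (%x. iexp (X x))" by (rule bdm_iexp[OF X])
 note int = bdm_integrable[OF finite_measure_axioms]
 have v0: "0 <= v" unfolding v_def by simp
 have v: "v <= c^2" unfolding v_def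
 proof (rule integral_le_const[OF int[OF bdm_power[OF b]] AE_I2])
  fix x assume "x : space M"
  then have "\<bar>X x\<bar>^2 <= c^2" using c(1) by (intro power_mono) auto
  then show "(X x)^2 <= c^2" by simp
 qed
 let ?q = "%x. 1 + \<i> * complex_of_real (X x) - complex_of_real ((X x)^2) / 2"
 have iq: "integrable M (%x. complex_of_real (X x))" "integrable M (%x. complex_of_real ((X x)^2))"
  using int[OF b] int[OF bdm_power[OF b, of 2]] by (simp_all only: integrable_of_real)
 have iq': "integrable M ?q" using iq by simp
 have "(LINT x|M. ?q x) = 1 - of_real v / 2"
  using iq z by (simp add: v_def prob_space del: of_real_power)
 then have "norm ((CLINT x|M. iexp (X x)) - (1 - of_real v / 2)) = norm (CLINT x|M. iexp (X x) - ?q x)"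
  using lint_diff[OF int[OF bi] iq'] by (simp only:)
 also have "... <= (LINT x|M. norm (iexp (X x) - ?q x))" by (rule integral_norm_bound)
 also have "... <= c ^ 3 / 6"
 proof (rule integral_le_const[OF _ AE_I2])
  show "integrable M (%x. norm (iexp (X x) - ?q x))" by (rule integrable_norm[OF lintb_diff[OF int[OF bi] iq']])
  fix x assume "x : space M"
  then have "\<bar>X x\<bar> ^ 3 <= c ^ 3" using c(1) by (intro power_mono) auto
  moreover have "norm (iexp (X x) - ?q x) <= \<bar>X x\<bar> ^ 3 / 6"
   using iexp_approx1[of "X x" 2] by (simp add: numeral_2_eq_2 numeral_3_eq_3 power_mult_distrib fact_numeral algebra_simps)
  ultimately show "norm (iexp (X x) - ?q x) <= c ^ 3 / 6" by simp
 qed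
 finally have 1: "norm ((CLINT x|M. iexp (X x)) - (1 - of_real v / 2)) <= c ^ 3 / 6" .
 have "norm ((1 - of_real v / 2) - complex_of_real (exp (- v / 2))) = \<bar>(1 - v / 2) - exp (- v / 2)\<bar>"
 proof -
  have "(1 - of_real v / 2) - complex_of_real (exp (- v / 2)) = of_real ((1 - v / 2) - exp (- v / 2))" by simp
  then show ?thesis by (simp only: norm_of_real)
 qed
 also have "... <= (v / 2)^2" using exp_minus_quadratic[of "v / 2"] v0 by (simp add: abs_minus_commute)
 also have "... <= (c^2 / 2)^2" using v v0 by (intro power_mono) auto
 also have "... = c ^ 3 * c / 4" by (simp add: power2_eq_square power3_eq_cube)
 also have "... <= c ^ 3 * 1 / 4" using c(2) c0 by (intro divide_right_mono mult_left_mono) auto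
 finally have 2: "norm ((1 - of_real v / 2) - complex_of_real (exp (- v / 2))) <= c ^ 3 / 4" by simp
 have "0 <= c ^ 3" using c0 by simp
 then have "c ^ 3 / 6 + c ^ 3 / 4 <= c ^ 3" by simp
 then show ?thesis unfolding v_def[symmetric]
  using norm_diff_triangle_ineq'[of "CLINT x|M. iexp (X x)" "complex_of_real (exp (- v / 2))" "1 - of_real v / 2"] 1 2 by linarith
qed

text \<open>The variance of the absolute value is nonnegative.\<close>

lemma integral_abs_le_sqrt:
 fixes Y :: "'a => real"
 assumes M: "prob_space M" and Y: "bdm M Y"
 shows "(LINT x|M. \<bar>Y x\<bar>) <= sqrt (LINT x|M. (Y x)^2)"
proof -
 interpret prob_space M by fact
 note int = bdm_integrable[OF finite_measure_axioms]
 let ?a = "LINT x|M. \<bar>Y x\<bar>"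
 have i: "integrable M (%x. \<bar>Y x\<bar>)" "integrable M (%x. (Y x)^2)"
  using int[OF Y] int[OF bdm_power[OF Y]] by simp_all
 have "0 <= (LINT x|M. (\<bar>Y x\<bar> - ?a)^2)" by simp
 also have "... = (LINT x|M. (Y x)^2 - 2 * ?a * \<bar>Y x\<bar> + ?a^2)"
  by (intro lint_cong refl) (simp add: power2_diff)
 also have "... = (LINT x|M. (Y x)^2) - 2 * ?a * ?a + ?a^2" using i by (simp add: prob_space)
 finally have "?a^2 <= (LINT x|M. (Y x)^2)" by (simp add: power2_eq_square)
 then show ?thesis by (rule real_le_rsqrt)
qed

lemma sum_distinct_pairs_symmetric:
 fixes F :: "nat => nat => real"
 assumes "!!i j. F i j = F j i"
 shows "(SUM (i, j):distinct_pairs n. F i j) = 2 * (SUM (i, j):vertex_pairs n. F i j)"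
proof -
 have fin: "finite (vertex_pairs n)" by (rule finite_subset[of _ "{1..n} \<times> {1..n}"]) (auto simp: vertex_pairs_def)
 have "distinct_pairs n = vertex_pairs n \<union> prod.swap ` vertex_pairs n"
  by (auto simp: distinct_pairs_def vertex_pairs_def image_iff)
 moreover have "vertex_pairs n Int prod.swap ` vertex_pairs n = {}" by (auto simp: vertex_pairs_def)
 ultimately have "(SUM (i, j):distinct_pairs n. F i j) = (SUM (i, j):vertex_pairs n. F i j) + (SUM (i, j):prod.swap ` vertex_pairs n. F i j)"
  using fin by (simp add: sum.union_disjoint)
 also have "(SUM (i, j):prod.swap ` vertex_pairs n. F i j) = (SUM (i, j):vertex_pairs n. F j i)"
  by (subst sum.reindex) (auto simp: inj_on_def split_beta')
 also have "... = (SUM (i, j):vertex_pairs n. F i j)" by (subst assms) (rule refl)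
 finally show ?thesis by simp
qed

lemma finite_vertex_pairs: "finite (vertex_pairs n)"
 by (rule finite_subset[of _ "{1..n} \<times> {1..n}"]) (auto simp: vertex_pairs_def)

lemma card_vertex_pairs_le: "real (card (vertex_pairs n)) <= (real n)^2"
proof -
 have "card (vertex_pairs n) <= card ({1..n} \<times> {1..n})" by (intro card_mono) (auto simp: vertex_pairs_def)
 then have "card (vertex_pairs n) <= n^2" by (simp add: power2_eq_square)
 then show ?thesis by (metis of_nat_le_iff of_nat_power)
qed

lemma card_distinct_pairs: "1 <= n ==> real (card (distinct_pairs n)) = real n * (real n - 1)"
proof -
 assume n: "1 <= n"
 have "distinct_pairs n = off_pairs {1..n}" by (auto simp: distinct_pairs_def off_pairs_def)
 then show ?thesis using sum_off_pairs_fst[of "{1..n}" "%_. 1"] by (simp add: split_beta' mult.commute)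
qed

text \<open>The conditional variance of one noise term given its two vertices: the variance of a
  Bernoulli indicator with mean W, times the squared weight.\<close>

definition noise_var :: "(real => real => real) => (real \<times> real => real) => real \<times> real => real" where
 "noise_var W g p = W (fst p) (snd p) * (1 - W (fst p) (snd p)) * (g p)^2"

lemma bdm_graphon: "graphon W ==> bdm unit_square (%p. W (fst p) (snd p))"
 by (rule bdmI[where C = 1], intro measurable_graphon measurable_fst measurable_snd, assumption)
  (auto simp: space_pair_measure dest: graphon_range)

lemma bdm_noise_var:
 "graphon W ==> bdm unit_square g ==> bdm unit_square (noise_var W g)"
 unfolding noise_var_def[abs_def]
 by (intro bdm_mult bdm_diff bdm_const bdm_power bdm_graphon)

text \<open>Given the vertices, half the noise is a sum over unordered pairs of independent centred
  terms of size at most \<open>C / n\<close>. Exchanging one characteristic function for the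
  Gaussian one costs \<open>(C / n) ^ 3\<close>, and there are at most n^2 of them. The 4 combines
  the 2 of the Gaussian exponent with the 2 between ordered and unordered pairs.\<close>

lemma cond_mean_noise:
 assumes W: "graphon W" and gC: "!!p. p : space unit_square ==> \<bar>g p\<bar> <= C"
  and sym: "!!x y. x : {0..1} ==> y : {0..1} ==> g (x, y) = g (y, x)"
  and n: "1 <= n" "C <= real n" and w: "w : space cube"
 shows "norm (cond_mean (range (%i. (i, i))) (%w. iexp (noise_stat n W g w / 2 / real n)) w -
  of_real (exp (- quad_stat n (noise_var W g) w / (4 * (real n)^2)))) <= C ^ 3 / real n"
proof -
 let ?D = "range (%i::nat. (i, i))"
 let ?W = "%e. W (w (fst e, fst e)) (w (snd e, snd e))" and ?g = "%e. g (w (fst e, fst e), w (snd e, snd e))"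
 let ?X = "%e w' :: nat \<times> nat => real. ((if w' e <= ?W e then 1 else 0) - ?W e) * ?g e / real n"
 let ?V = "%e. noise_var W g (w (fst e, fst e), w (snd e, snd e))"
 interpret Cb: prob_space "cube :: (nat \<times> nat => real) measure" by (rule prob_space_cube)
 have r: "0 <= ?W e" "?W e <= 1" for e
  using graphon_range[OF W cube_range[OF w] cube_range[OF w], of "(fst e, fst e)" "(snd e, snd e)"] by auto
 have gb: "\<bar>?g e\<bar> <= C" for e using cube_range[OF w] by (intro gC) (simp add: space_pair_measure)
 then have C0: "0 <= C" by (meson abs_ge_zero order_trans)
 have bind: "bdm cube (%w' :: nat \<times> nat => real. if w' e <= c then 1 else 0 :: real)" for e c
  by (rule bdmI[where C = 1]) (auto intro!: borel_measurable_le measurable_If)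
 have bX: "bdm cube (?X e)" for e
  using bdm_mult[OF bdm_diff[OF bind bdm_const] bdm_const, of e "?W e" "?W e" "?g e / real n"] by simp
 have Xle: "\<bar>?X e w'\<bar> <= C / real n" for e w'
 proof -
  have "\<bar>(if w' e <= ?W e then 1 else 0) - ?W e\<bar> <= 1" using r[of e] by simp
  from mult_mono[OF this gb[of e]] show ?thesis using n C0 by (simp add: abs_mult divide_right_mono)
 qed
 have ind: "(LINT w'|cube. (if w' e <= ?W e then 1 else 0 :: real)) = ?W e" for e :: "nat \<times> nat"
  by (rule integral_le_indicator) (use r[of e] in simp)
 have X0: "(LINT w'|cube. ?X e w') = 0" for e
 proof -
  have "(LINT w'|cube. ?X e w') = (LINT w'|cube. (?g e / real n) * ((if w' e <= ?W e then 1 else 0) - ?W e))"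
   by (intro lint_cong refl) simp
  also have "... = (?g e / real n) * (?W e - ?W e)"
   unfolding integral_mult_right_zero using integrable_cube[OF bind] ind[of e] by (simp add: Cb.prob_space)
  finally show ?thesis by simp
 qed
 have X2: "(LINT w'|cube. (?X e w')^2) = ?V e / (real n)^2" for e
 proof -
  have "(LINT w'|cube. (?X e w')^2) = (LINT w'|cube. (?g e / real n)^2 * ((1 - 2 * ?W e) * (if w' e <= ?W e then 1 else 0) + (?W e)^2))"
  proof (intro lint_cong refl)
   have *: "((b - p) * h / m)^2 = (h / m)^2 * ((1 - 2 * p) * b + p^2)" if "b = 0 \<or> b = 1" for b p h m :: real
   proof -
    have "(b - p)^2 = (1 - 2 * p) * b + p^2" using that by (elim disjE) (simp_all add: power2_diff)
    then show ?thesis by (simp add: power_mult_distrib power_divide)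
   qed
   show "(?X e w')^2 = (?g e / real n)^2 * ((1 - 2 * ?W e) * (if w' e <= ?W e then 1 else 0) + (?W e)^2)" for w'
    by (rule *) simp
  qed
  also have "... = (?g e / real n)^2 * ((1 - 2 * ?W e) * ?W e + (?W e)^2)"
   unfolding integral_mult_right_zero using integrable_cube[OF bind] ind[of e] by (simp add: Cb.prob_space)
  also have "... = ?V e / (real n)^2" by (simp add: noise_var_def power_divide power2_eq_square algebra_simps add_divide_distrib[symmetric] diff_divide_distrib[symmetric])
  finally show ?thesis .
 qed
 have T: "noise_stat n W g (override_on w' w ?D) / 2 / real n = (SUM e:vertex_pairs n. ?X e w')" if w': "w' : space cube" for w'
 proof -
  let ?o = "override_on w' w ?D"
  have o: "?o : space cube" by (rule override_on_cube[OF w w'])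
  have d: "?o (i, i) = w (i, i)" for i by (simp add: override_on_def)
  have "noise_stat n W g ?o = 2 * (SUM (i, j):vertex_pairs n. (edge_ind W i j ?o - W (?o (i, i)) (?o (j, j))) * g (?o (i, i), ?o (j, j)))"
   unfolding noise_stat_def
  proof (rule sum_distinct_pairs_symmetric)
   fix i j
   show "(edge_ind W i j ?o - W (?o (i, i)) (?o (j, j))) * g (?o (i, i), ?o (j, j)) =
     (edge_ind W j i ?o - W (?o (j, j)) (?o (i, i))) * g (?o (j, j), ?o (i, i))"
    using edge_ind_sym[OF W o, of i j] graphon_sym[OF W cube_range[OF o] cube_range[OF o], of "(i, i)" "(j, j)"]
     sym[OF cube_range[OF o] cube_range[OF o], of "(i, i)" "(j, j)"] by simp
  qed
  then have "noise_stat n W g ?o / 2 / real n =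
    (SUM e:vertex_pairs n. (edge_ind W (fst e) (snd e) ?o - ?W e) * ?g e / real n)"
   unfolding d by (simp add: split_beta' sum_divide_distrib)
  also have "... = (SUM e:vertex_pairs n. ?X e w')"
  proof (intro sum.cong refl)
   fix e assume "e : vertex_pairs n"
   then have e: "min (fst e) (snd e) = fst e" "max (fst e) (snd e) = snd e" "e ~: ?D" by (auto simp: vertex_pairs_def)
   have "?o (fst e, snd e) = w' e" using e(3) by (simp add: override_on_def)
   then have "edge_ind W (fst e) (snd e) ?o = (if w' e <= ?W e then 1 else 0)"
    unfolding edge_ind_def e d by simp
   then show "(edge_ind W (fst e) (snd e) ?o - ?W e) * ?g e / real n = ?X e w'" by simp
  qed
  finally show ?thesis .
 qed
 have "cond_mean ?D (%w. iexp (noise_stat n W g w / 2 / real n)) w = (CLINT w'|cube. (\<Prod>e\<in>vertex_pairs n. iexp (?X e w')))"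
  unfolding cond_mean_def
 proof (intro lint_cong refl)
  fix w' :: "nat \<times> nat => real" assume "w' : space cube"
  show "iexp (noise_stat n W g (override_on w' w ?D) / 2 / real n) = (\<Prod>e\<in>vertex_pairs n. iexp (?X e w'))"
   unfolding T[OF \<open>w' : space cube\<close>] exp_sum[OF finite_vertex_pairs, symmetric] of_real_sum sum_distrib_left ..
 qed
 also have "... = (\<Prod>e\<in>vertex_pairs n. CLINT w'|cube. iexp (?X e w'))"
 proof (rule integral_prod_depends_on[OF finite_vertex_pairs, where A = "%e. {e}"])
  show "bdm cube (%w'. iexp (?X e w'))" for e by (rule bdm_iexp[OF bdm_measurable[OF bX]])
  show "depends_on {e} (%w'. iexp (?X e w'))" for e unfolding depends_on_def by simp
  show "disjoint_family_on (%e. {e}) (vertex_pairs n)" by (simp add: disjoint_family_on_def)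
 qed
 finally have cm: "cond_mean ?D (%w. iexp (noise_stat n W g w / 2 / real n)) w = (\<Prod>e\<in>vertex_pairs n. CLINT w'|cube. iexp (?X e w'))" .
 have Vs: "quad_stat n (noise_var W g) w = 2 * (SUM e:vertex_pairs n. ?V e)"
 proof -
  have "noise_var W g (w (i, i), w (j, j)) = noise_var W g (w (j, j), w (i, i))" for i j
   using graphon_sym[OF W cube_range[OF w] cube_range[OF w], of "(i, i)" "(j, j)"]
     sym[OF cube_range[OF w] cube_range[OF w], of "(i, i)" "(j, j)"] by (simp add: noise_var_def)
  from sum_distinct_pairs_symmetric[of "%i j. noise_var W g (w (i, i), w (j, j))", OF this]
  show ?thesis unfolding quad_stat_def by (simp add: split_beta')
 qed
 have ex: "complex_of_real (exp (- quad_stat n (noise_var W g) w / (4 * (real n)^2))) = (\<Prod>e\<in>vertex_pairs n. of_real (exp (- (?V e / (real n)^2) / 2)))"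
  unfolding of_real_prod[symmetric] exp_sum[OF finite_vertex_pairs, symmetric] Vs
  by (simp add: sum_negf sum_divide_distrib mult.commute[of 2])
 have V0: "0 <= ?V e" for e unfolding noise_var_def using r[of e] by simp
 have "norm ((\<Prod>e\<in>vertex_pairs n. CLINT w'|cube. iexp (?X e w')) - (\<Prod>e\<in>vertex_pairs n. of_real (exp (- (?V e / (real n)^2) / 2)))) <=
   (SUM e:vertex_pairs n. norm ((CLINT w'|cube. iexp (?X e w')) - of_real (exp (- (?V e / (real n)^2) / 2))))"
 proof (rule norm_prod_diff)
  fix e
  have "norm (CLINT w'|cube. iexp (?X e w')) <= (LINT w'|cube. norm (iexp (?X e w')))" by (rule integral_norm_bound)
  then show "norm (CLINT w'|cube. iexp (?X e w')) <= 1" by (simp add: Cb.prob_space)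
  show "norm (complex_of_real (exp (- (?V e / (real n)^2) / 2))) <= 1" using V0[of e] by simp
 qed
 also have "... <= (SUM e:vertex_pairs n. (C / real n) ^ 3)"
 proof (rule sum_mono)
  fix e
  show "norm ((CLINT w'|cube. iexp (?X e w')) - of_real (exp (- (?V e / (real n)^2) / 2))) <= (C / real n) ^ 3"
   unfolding X2[symmetric]
   by (rule char_gaussian_approx[OF prob_space_cube bdm_measurable[OF bX] Xle _ X0]) (use n in simp)
 qed
 also have "... <= (real n)^2 * (C / real n) ^ 3"
  using card_vertex_pairs_le[of n] C0 by (simp add: mult_right_mono)
 also have "... = C ^ 3 / real n" using n by (simp add: power2_eq_square power3_eq_cube)
 finally show ?thesis unfolding cm ex .
qed

text \<open>Conditioned on the vertices the noise has a characteristic function that depends on them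
  only through a quadratic statistic divided by n^2, and such a statistic concentrates at its mean.
  The factor becomes constant in the limit and leaves the integral, whatever function of the
  vertices is added; this is the asymptotic independence of the noise from the rest.\<close>

proposition noise_removal:
 assumes W: "graphon W" and g: "bdm unit_square g"
  and sym: "!!x y. x : {0..1} ==> y : {0..1} ==> g (x, y) = g (y, x)"
  and L: "!!n. bdm cube (L n)" and dep: "!!n. depends_on (range (%i. (i, i))) (L n)"
 shows "(%n. (CLINT w|cube. iexp (L n w + noise_stat n W g w / 2 / real n)) -
  of_real (exp (- (LINT p|unit_square. noise_var W g p) / 4)) * (CLINT w|cube. iexp (L n w))) \<longlonglongrightarrow> 0"
proof -
 let ?A = "noise_var W g" and ?D = "range (%i::nat. (i, i))"
 define a where "a = (LINT p|unit_square. ?A p)"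
 define Bd where "Bd = (LINT p|unit_square. (?A p - a)^2)"
 interpret Cb: prob_space "cube :: (nat \<times> nat => real) measure" by (rule prob_space_cube)
 interpret Sq: prob_space unit_square by (rule prob_space_unit_square)
 obtain C where C: "0 <= C" "!!p. p : space unit_square ==> \<bar>g p\<bar> <= C" using bdmE[OF g] by auto
 have bA: "bdm unit_square ?A" by (rule bdm_noise_var[OF W g])
 have bA': "bdm unit_square (%p. ?A p - a)" by (intro bdm_diff bA bdm_const)
 have A0: "0 <= ?A p" if "p : space unit_square" for p
  using that graphon_range[OF W, of "fst p" "snd p"] by (auto simp: noise_var_def space_pair_measure)
 have a0: "0 <= a" unfolding a_def by (rule integral_nonneg_AE[OF AE_I2[OF A0]])
 have zero: "(LINT p|unit_square. ?A p - a) = 0"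
  using bdm_integrable[OF Sq.finite_measure_axioms bA] by (simp add: a_def Sq.prob_space)
 let ?T = "%n w. noise_stat n W g w / 2 / real n"
 have bT: "bdm cube (?T n)" for n
  using bdm_mult[OF bdm_noise_stat[OF W g] bdm_const, of n "1 / 2 / real n"] by simp
 have bt: "bdm cube (%w. iexp (?T n w))" "bdm cube (%w. iexp (L n w))" for n
  by (intro bdm_iexp bdm_measurable[OF bT] bdm_measurable[OF L])+
 let ?c = "%n. cond_mean ?D (%w. iexp (?T n w))" and ?e = "complex_of_real (exp (- a / 4))"
 let ?q = "%n w. quad_stat n ?A w / (4 * (real n)^2)"
 \<comment> \<open>The three errors: Gaussian replacement, fluctuation of the conditional variance
   about its mean, and \<open>n * (n - 1)\<close> pairs in place of n^2.\<close>
 let ?r = "%n. C ^ 3 * (1 / real n) + (1 / 4) * sqrt (16 * Bd * (1 / real n)) + a / 4 * (1 / real n)"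
 have le: "norm ((CLINT w|cube. iexp (L n w + ?T n w)) - ?e * (CLINT w|cube. iexp (L n w))) <= ?r n"
  if n: "1 <= n" "C <= real n" for n
 proof -
  have "(CLINT w|cube. iexp (L n w + ?T n w)) = (CLINT w|cube. iexp (?T n w) * iexp (L n w))"
   by (intro lint_cong refl) (simp add: exp_add[symmetric] distrib_left add.commute)
  also have "... = (CLINT w|cube. ?c n w * iexp (L n w))"
  proof (rule integral_mult_cond_mean[OF bt])
   show "depends_on ?D (%w. iexp (L n w))" unfolding depends_on_def
   proof (intro ballI impI)
    fix w w' :: "nat \<times> nat => real"
    assume ww: "w : space cube" "w' : space cube" and eq: "ALL i:?D. w i = w' i"
    have "L n w = L n w'" by (rule depends_onD[OF dep ww]) (rule bspec[OF eq])
    then show "iexp (L n w) = iexp (L n w')" by (simp only:)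
   qed
  qed
  finally have "(CLINT w|cube. iexp (L n w + ?T n w)) - ?e * (CLINT w|cube. iexp (L n w)) =
    (CLINT w|cube. ?c n w * iexp (L n w)) - (CLINT w|cube. ?e * iexp (L n w))" by simp
  also have "... = (CLINT w|cube. ?c n w * iexp (L n w) - ?e * iexp (L n w))"
   by (intro lint_diff[symmetric] integrable_cube bdm_mult bdm_cond_mean bt bdm_const)
  finally have "norm ((CLINT w|cube. iexp (L n w + ?T n w)) - ?e * (CLINT w|cube. iexp (L n w))) <=
    (LINT w|cube. norm (?c n w * iexp (L n w) - ?e * iexp (L n w)))"
   by (simp only:) (rule integral_norm_bound)
  also have "... <= (LINT w|cube. C ^ 3 / real n + (\<bar>quad_stat n (%p. ?A p - a) w\<bar> / (4 * (real n)^2) + a / (4 * real n)))"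
  proof (rule integral_mono)
   show "integrable cube (%w. norm (?c n w * iexp (L n w) - ?e * iexp (L n w)))"
    by (intro integrable_norm integrable_cube bdm_diff bdm_mult bdm_cond_mean bt bdm_const)
   show "integrable cube (%w. C ^ 3 / real n + (\<bar>quad_stat n (%p. ?A p - a) w\<bar> / (4 * (real n)^2) + a / (4 * real n)))"
    using integrable_cube[OF bdm_quad_stat[OF bA', of n]] by simp
   fix w :: "nat \<times> nat => real" assume w: "w : space cube"
   have q: "quad_stat n ?A w = quad_stat n (%p. ?A p - a) w + real n * (real n - 1) * a"
    unfolding quad_stat_def split_beta' sum_subtractf using card_distinct_pairs[OF n(1)] by simp
   have q0: "0 <= quad_stat n ?A w" unfolding quad_stat_def
    using cube_range[OF w] by (intro sum_nonneg) (auto simp: space_pair_measure intro!: A0)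
   have "norm (?c n w * iexp (L n w) - ?e * iexp (L n w)) = norm (?c n w - ?e)"
    unfolding left_diff_distrib[symmetric] by (simp add: norm_mult)
   also have "... <= norm (?c n w - of_real (exp (- quad_stat n ?A w / (4 * (real n)^2)))) + norm (of_real (exp (- quad_stat n ?A w / (4 * (real n)^2))) - ?e)"
    by (rule norm_diff_triangle_ineq')
   also have "... <= C ^ 3 / real n + \<bar>?q n w - a / 4\<bar>"
   proof (rule add_mono)
    show "norm (?c n w - of_real (exp (- quad_stat n ?A w / (4 * (real n)^2)))) <= C ^ 3 / real n"
     by (rule cond_mean_noise[where W = W and g = g, OF W C(2) sym n w])
    have e: "\<bar>exp (- x) - exp (- y)\<bar> <= \<bar>x - y\<bar>" if "0 <= x" "0 <= y" for x y :: real
     using that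
    proof (induction x y rule: linorder_wlog)
     case (le x y)
     have l: "1 - exp (x - y) <= y - x" using exp_ge_add_one_self[of "x - y"] by linarith
     have "exp (- x) - exp (- y) = exp (- x) * (1 - exp (x - y))" by (simp add: right_diff_distrib exp_add[symmetric])
     also have "... <= 1 * (y - x)" using le by (intro mult_mono l) auto
     finally show ?case using le by simp
    next
     case (sym x y)
     then show ?case by (simp add: abs_minus_commute)
    qed
    show "norm (complex_of_real (exp (- quad_stat n ?A w / (4 * (real n)^2))) - ?e) <= \<bar>?q n w - a / 4\<bar>"
     using e[of "?q n w" "a / 4"] q0 a0 unfolding of_real_diff[symmetric] norm_of_real by simp
   qed
   also have "?q n w - a / 4 = quad_stat n (%p. ?A p - a) w / (4 * (real n)^2) - a / (4 * real n)"
    unfolding q using n by (simp add: field_simps power2_eq_square)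
   finally show "norm (?c n w * iexp (L n w) - ?e * iexp (L n w)) <=
     C ^ 3 / real n + (\<bar>quad_stat n (%p. ?A p - a) w\<bar> / (4 * (real n)^2) + a / (4 * real n))"
    using abs_triangle_ineq4[of "quad_stat n (%p. ?A p - a) w / (4 * (real n)^2)" "a / (4 * real n)"] a0 n by simp
  qed
  also have "... = C ^ 3 / real n + ((LINT w|cube. \<bar>quad_stat n (%p. ?A p - a) w\<bar>) / (4 * (real n)^2) + a / (4 * real n))"
   using integrable_cube[OF bdm_quad_stat[OF bA', of n]] by (simp add: Cb.prob_space)
  also have "... <= C ^ 3 / real n + (sqrt (16 * Bd * (real n ^ 4 / real n ^ 1)) / (4 * (real n)^2) + a / (4 * real n))"
  proof (intro add_mono order_refl divide_right_mono)
   have "(LINT w|cube. \<bar>quad_stat n (%p. ?A p - a) w\<bar>) <= sqrt (LINT w|cube. (quad_stat n (%p. ?A p - a) w)^2)"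
    by (rule integral_abs_le_sqrt[OF prob_space_cube bdm_quad_stat[OF bA']])
   also have "... <= sqrt (16 * Bd * (real n ^ 4 / real n ^ 1))"
    by (intro real_sqrt_le_mono quad_stat_sq_le[OF bA' _ n(1) _ zero]) (simp_all add: Bd_def)
   finally show "(LINT w|cube. \<bar>quad_stat n (%p. ?A p - a) w\<bar>) <= sqrt (16 * Bd * (real n ^ 4 / real n ^ 1))" .
  qed simp
  also have "sqrt (16 * Bd * (real n ^ 4 / real n ^ 1)) / (4 * (real n)^2) = (1 / 4) * sqrt (16 * Bd * (1 / real n))"
  proof -
   have "16 * Bd * (real n ^ 4 / real n ^ 1) = 16 * Bd * (1 / real n) * ((real n)^2)^2"
    using n by (simp add: field_simps power2_eq_square power4_eq_xxxx)
   then show ?thesis using n by (simp only: real_sqrt_mult real_sqrt_abs abs_power2) simp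
  qed
  finally show ?thesis by simp
 qed
 have "?r \<longlonglongrightarrow> C ^ 3 * 0 + (1 / 4) * sqrt (16 * Bd * 0) + a / 4 * 0" by (intro tendsto_intros lim_1_over_n)
 then have lim: "?r \<longlonglongrightarrow> 0" by simp
 have "\<forall>\<^sub>F n in sequentially. 1 <= n & C <= real n"
  using eventually_conj[OF eventually_ge_at_top filterlim_real_sequentially[THEN filterlim_at_top[THEN iffD1], rule_format]] .
 then have "\<forall>\<^sub>F n in sequentially. norm ((CLINT w|cube. iexp (L n w + ?T n w)) - ?e * (CLINT w|cube. iexp (L n w))) <= ?r n"
  by eventually_elim (use le in simp)
 then show ?thesis unfolding a_def[symmetric] by (rule Lim_null_comparison[OF _ lim])
qed

section \<open>The limit of the linear and quadratic statistics\<close>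

text \<open>Characteristic functions are Lipschitz for the L1 distance of random variables.
  Approximations by simpler statistics and by step kernels pass to the limit through this
  estimate.\<close>

lemma iexp_integral_diff_le:
 fixes A B :: "'a => real"
 assumes M: "prob_space M" and A: "A : borm M" and B: "B : borm M"
  and int: "integrable M (%x. A x - B x)"
 shows "norm ((CLINT x|M. iexp (A x)) - (CLINT x|M. iexp (B x))) <= (LINT x|M. \<bar>A x - B x\<bar>)"
proof -
 interpret prob_space M by fact
 have i: "integrable M (%x. iexp (A x))" "integrable M (%x. iexp (B x))"
  by (rule bdm_integrable[OF finite_measure_axioms bdm_iexp], fact)+
 have "norm ((CLINT x|M. iexp (A x)) - (CLINT x|M. iexp (B x))) = norm (CLINT x|M. iexp (A x) - iexp (B x))"
  using lint_diff[OF i] by (simp only:)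
 also have "... <= (LINT x|M. norm (iexp (A x) - iexp (B x)))" by (rule integral_norm_bound)
 also have "... <= (LINT x|M. \<bar>A x - B x\<bar>)"
 proof (rule integral_mono)
  show "integrable M (%x. norm (iexp (A x) - iexp (B x)))" by (rule integrable_norm[OF lintb_diff[OF i]])
  show "integrable M (%x. \<bar>A x - B x\<bar>)" by (rule integrable_abs[OF int])
 qed (rule norm_iexp_diff_le)
 finally show ?thesis .
qed

lemma iexp_integral_diff_le_sq_norm:
 fixes A B :: "'a => real"
 assumes M: "prob_space M" and A: "A : borm M" and B: "B : borm M"
  and sq: "sq_norm M (%x. A x - B x) <= ennreal (s^2)" and s: "0 < s"
 shows "norm ((CLINT x|M. iexp (A x)) - (CLINT x|M. iexp (B x))) <= s"
proof -
 have nn: "(\<integral>\<^sup>+x. ennreal \<bar>A x - B x\<bar> \<partial>M) <= ennreal s"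
  by (rule nn_integral_abs_le_sq_norm[OF M borel_measurable_diff[OF A B] sq s])
 then have "(\<integral>\<^sup>+x. ennreal (norm (A x - B x)) \<partial>M) < \<infinity>" by (simp add: le_less_trans)
 then have i: "integrable M (%x. A x - B x)" by (rule integrableI_bounded[OF borel_measurable_diff[OF A B]])
 have "ennreal (LINT x|M. \<bar>A x - B x\<bar>) <= ennreal s"
  using nn nn_integral_eq_integral[OF integrable_abs[OF i]] by simp
 then have "(LINT x|M. \<bar>A x - B x\<bar>) <= s" using s by simp
 with iexp_integral_diff_le[OF M A B i] show ?thesis by linarith
qed

text \<open>The n vertices contribute equal factors, each within \<open>(C / sqrt n) ^ 3\<close> of
  a Gaussian one, so the total error is of order \<open>1 / sqrt n\<close>.\<close>

lemma lin_stat_clt: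
 assumes h: "bdm unit_unif h" and z: "(LINT x|unit_unif. h x) = 0"
 shows "(%n. CLINT w|cube. iexp (lin_stat n h w / sqrt (real n))) \<longlonglongrightarrow> of_real (exp (- (LINT x|unit_unif. (h x)^2) / 2))"
proof -
 obtain C where C: "0 <= C" "!!x. x : space unit_unif ==> \<bar>h x\<bar> <= C" using bdmE[OF h] by auto
 define v where "v = (LINT x|unit_unif. (h x)^2)"
 have v0: "0 <= v" unfolding v_def by simp
 have hm: "h : borm unit_unif" by (rule bdm_measurable[OF h])
 have le: "norm ((CLINT w|cube. iexp (lin_stat n h w / sqrt (real n))) - of_real (exp (- v / 2))) <= C ^ 3 * sqrt (1 / real n)"
  if n: "1 <= n" "C^2 <= real n" for n
 proof -
  let ?h = "%x. h x / sqrt (real n)"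
  define ph where "ph = (CLINT x|unit_unif. iexp (?h x))"
  have bm: "bdm unit_unif (%x. iexp (?h x))" by (rule bdm_iexp) (use hm in simp)
  have sn: "0 < sqrt (real n)" "sqrt (real n) ^ 2 = real n" "C <= sqrt (real n)" using n real_le_rsqrt by simp_all
  have "(CLINT w|cube. iexp (lin_stat n h w / sqrt (real n))) = (CLINT w|cube. (\<Prod>i\<in>{1..n}. iexp (?h (w (i, i)))))"
   unfolding lin_stat_def sum_divide_distrib of_real_sum sum_distrib_left by (subst exp_sum) simp_all
  also have "... = (\<Prod>i\<in>{1..n}. CLINT w|cube. iexp (?h (w (i, i))))"
  proof (rule integral_prod_depends_on[where A = "%i. {(i, i)}"])
   show "bdm cube (%w. iexp (?h (w (i, i))))" for i
    by (rule bdm_compose[OF bm measurable_cube_component])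
   show "depends_on {(i, i)} (%w. iexp (?h (w (i, i))))" for i by (rule depends_on_vertex) simp
   show "disjoint_family_on (%i. {(i, i)}) {1..n}" by (simp add: disjoint_family_on_def)
  qed simp
  also have "... = ph ^ n"
   unfolding ph_def integral_cube_component[OF bdm_measurable[OF bm]] by simp
  finally have 1: "(CLINT w|cube. iexp (lin_stat n h w / sqrt (real n))) = ph ^ n" .
  define ex where "ex = exp (- (v / real n) / 2)"
  have "ex ^ n = exp (- v / 2)" unfolding ex_def exp_of_nat_mult[symmetric] using n by simp
  then have 2: "complex_of_real (exp (- v / 2)) = of_real ex ^ n" by (simp only: of_real_power[symmetric])
  have "norm ph <= (LINT x|unit_unif. norm (iexp (?h x)))" unfolding ph_def by (rule integral_norm_bound)
  then have nph: "norm ph <= 1" by (simp add: measure_unit_unif)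
  have nex: "norm (complex_of_real ex) <= 1" unfolding ex_def using v0 by simp
  have b: "norm (ph - of_real ex) <= (C / sqrt (real n)) ^ 3"
  proof -
   have "(LINT x|unit_unif. (?h x)^2) = v / real n" unfolding v_def power_divide sn by simp
   moreover have "norm ((CLINT x|unit_unif. iexp (?h x)) - of_real (exp (- (LINT x|unit_unif. (?h x)^2) / 2))) <= (C / sqrt (real n)) ^ 3"
   proof (rule char_gaussian_approx[OF prob_space_unit_unif])
    show "?h : borm unit_unif" using hm by simp
    show "\<bar>?h x\<bar> <= C / sqrt (real n)" if "x : space unit_unif" for x
     using C(2)[OF that] sn(1) by (simp add: divide_right_mono)
    show "C / sqrt (real n) <= 1" using sn by simp
    show "(LINT x|unit_unif. ?h x) = 0" using z by simp
   qed
   ultimately show ?thesis unfolding ph_def ex_def by (simp only:)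
  qed
  have "norm (ph ^ n - of_real ex ^ n) <= real n * norm (ph - of_real ex)"
   by (rule norm_power_diff[OF nph nex])
  also have "... <= real n * (C / sqrt (real n)) ^ 3" by (rule mult_left_mono[OF b]) simp
  also have "real n * (C / sqrt (real n)) ^ 3 = C ^ 3 * sqrt (1 / real n)"
  proof -
   have "real n * (C / r) ^ 3 = C ^ 3 * (1 / r)" if "r ^ 2 = real n" "0 < r" for r
    unfolding that(1)[symmetric] using that(2) by (simp add: power_divide power2_eq_square power3_eq_cube)
   from this[OF sn(2,1)] show ?thesis by (simp add: real_sqrt_divide)
  qed
  finally show ?thesis unfolding 1 2 by simp
 qed
 have "(%n. C ^ 3 * sqrt (1 / real n)) \<longlonglongrightarrow> C ^ 3 * sqrt 0" by (intro tendsto_intros lim_1_over_n)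
 then have lim: "(%n. C ^ 3 * sqrt (1 / real n)) \<longlonglongrightarrow> 0" by simp
 have "\<forall>\<^sub>F n in sequentially. 1 <= n & C^2 <= real n"
  using eventually_conj[OF eventually_ge_at_top filterlim_real_sequentially[THEN filterlim_at_top[THEN iffD1], rule_format]] .
 then have "\<forall>\<^sub>F n in sequentially. norm ((CLINT w|cube. iexp (lin_stat n h w / sqrt (real n))) - of_real (exp (- v / 2))) <= C ^ 3 * sqrt (1 / real n)"
  by eventually_elim (use le in simp)
 from Lim_null_comparison[OF this lim] show ?thesis unfolding v_def[symmetric] by (rule LIM_zero_cancel)
qed

lemma integral_square_ge:
 fixes Y :: "'a => real"
 assumes M: "prob_space M" and Y: "bdm M Y"
 shows "(LINT x|M. Y x)^2 <= (LINT x|M. (Y x)^2)"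
proof -
 have "\<bar>\<integral>x. Y x \<partial>M\<bar> <= (LINT x|M. \<bar>Y x\<bar>)" by (rule integral_abs_bound)
 also note integral_abs_le_sqrt[OF M Y]
 finally have "\<bar>\<integral>x. Y x \<partial>M\<bar>^2 <= (sqrt (LINT x|M. (Y x)^2))^2" by (intro power_mono) auto
 then show ?thesis by simp
qed

lemma bdm_section:
 assumes "bdm unit_square G" "x : {0..1}"
 shows "bdm unit_unif (%y. G (x, y))" "bdm unit_unif (%y. G (y, x))"
 using assms(2) by (auto intro!: bdm_compose[OF assms(1)])

lemma integral_unit_square:
 fixes G :: "real \<times> real => real"
 assumes G: "bdm unit_square G"
 shows "(LINT p|unit_square. G p) = (LINT x|unit_unif. LINT y|unit_unif. G (x, y))"
  "(LINT p|unit_square. G (snd p, fst p)) = (LINT p|unit_square. G p)"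
proof -
 interpret U: prob_space unit_unif by (rule prob_space_unit_unif)
 interpret P: pair_prob_space unit_unif unit_unif ..
 show "(LINT p|unit_square. G p) = (LINT x|unit_unif. LINT y|unit_unif. G (x, y))"
  by (rule P.integral_fst'[symmetric]) (rule bdm_integrable[OF P.finite_measure_axioms G])
 have m: "G : borm unit_square" by (rule bdm_measurable[OF G])
 have "(%p. G (snd p, fst p)) : borm unit_square"
  by (rule measurable_compose[OF measurable_Pair[OF measurable_snd measurable_fst] m])
 from integral_cube_pair[of "0::nat" 1, OF _ this] integral_cube_pair[of "1::nat" 0, OF _ m]
 show "(LINT p|unit_square. G (snd p, fst p)) = (LINT p|unit_square. G p)" by simp
qed

lemma integral_marginal_sq_le:
 fixes G :: "real \<times> real => real"
 assumes G: "bdm unit_square G"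
 shows "(LINT x|unit_unif. (LINT y|unit_unif. G (x, y))^2) <= (LINT p|unit_square. (G p)^2)"
  "(LINT y|unit_unif. (LINT x|unit_unif. G (x, y))^2) <= (LINT p|unit_square. (G p)^2)"
proof -
 have *: "(LINT x|unit_unif. (LINT y|unit_unif. G (x, y))^2) <= (LINT p|unit_square. (G p)^2)" if G: "bdm unit_square G"
  for G :: "real \<times> real => real"
  unfolding integral_unit_square(1)[OF bdm_power[OF G]]
 proof (rule integral_mono)
  show "integrable unit_unif (%x. (LINT y|unit_unif. G (x, y))^2)"
   by (rule bdm_integrable[OF finite_measure_unit_unif bdm_power[OF bdm_integral[OF prob_space_unit_unif G]]])
  show "integrable unit_unif (%x. LINT y|unit_unif. (G (x, y))^2)"
   by (rule bdm_integrable[OF finite_measure_unit_unif bdm_integral[OF prob_space_unit_unif bdm_power[OF G]]])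
  fix x assume "x : space unit_unif"
  then show "(LINT y|unit_unif. G (x, y))^2 <= (LINT y|unit_unif. (G (x, y))^2)"
   by (intro integral_square_ge prob_space_unit_unif bdm_section[OF G]) simp
 qed
 show "(LINT x|unit_unif. (LINT y|unit_unif. G (x, y))^2) <= (LINT p|unit_square. (G p)^2)" by (rule *[OF G])
 have "bdm unit_square (%p. G (snd p, fst p))"
  by (rule bdm_compose[OF G measurable_Pair[OF measurable_snd measurable_fst]])
 from *[OF this] show "(LINT y|unit_unif. (LINT x|unit_unif. G (x, y))^2) <= (LINT p|unit_square. (G p)^2)"
  using integral_unit_square(2)[OF bdm_power[OF G, of 2]] by simp
qed

text \<open>Needed for two centrings: of cell indicators by their means, and of Brownian increments
  by their share of the total displacement.\<close>

lemma bilinear_centre: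
 fixes D :: "nat => nat => real"
 shows "(SUM j:J. SUM k:J. D j k * ((a j - p j) * (b k - q k))) =
  (SUM j:J. SUM k:J. D j k * (a j * b k)) - (SUM j:J. (SUM k:J. D j k * q k) * a j)
  - (SUM k:J. (SUM j:J. D j k * p j) * b k) + (SUM j:J. SUM k:J. D j k * (p j * q k))"
proof -
 have "(SUM j:J. SUM k:J. D j k * ((a j - p j) * (b k - q k))) =
   (SUM j:J. SUM k:J. D j k * (a j * b k) - D j k * q k * a j - D j k * p j * b k + D j k * (p j * q k))"
  by (intro sum.cong refl) (simp add: algebra_simps)
 also have "(SUM k:J. (SUM j:J. D j k * p j) * b k) = (SUM j:J. SUM k:J. D j k * p j * b k)"
  unfolding sum_distrib_right by (rule sum.swap)
 ultimately show ?thesis by (simp add: sum.distrib sum_subtractf sum_distrib_right)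
qed

lemma lin_stat_mult:
 "lin_stat n h w * lin_stat n h' w = quad_stat n (%p. h (fst p) * h' (snd p)) w + lin_stat n (%x. h x * h' x) w"
proof -
 have s: "{1..n} \<times> {1..n} = distinct_pairs n \<union> (%i. (i, i)) ` {1..n}" by (auto simp: distinct_pairs_def)
 have "lin_stat n h w * lin_stat n h' w = (SUM (i, j):{1..n} \<times> {1..n}. h (w (i, i)) * h' (w (j, j)))"
  unfolding lin_stat_def sum_product sum.cartesian_product ..
 also have "... = (SUM (i, j):distinct_pairs n. h (w (i, i)) * h' (w (j, j))) + (SUM (i, j):(%i. (i, i)) ` {1..n}. h (w (i, i)) * h' (w (j, j)))"
  unfolding s by (rule sum.union_disjoint) (auto simp: distinct_pairs_def[of n, symmetric], simp add: distinct_pairs_def)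
 also have "(SUM (i, j):(%i. (i, i)) ` {1..n}. h (w (i, i)) * h' (w (j, j))) = lin_stat n (%x. h x * h' x) w"
  unfolding lin_stat_def by (subst sum.reindex) (simp_all add: inj_on_def)
 finally show ?thesis unfolding quad_stat_def by simp
qed


section \<open>Step kernels as polynomials in the cell counts\<close>

locale step_kernels =
 fixes m :: nat and t c :: "nat => real" and d :: "nat => nat => real"
 assumes part: "unit_partition m t"
begin

text \<open>Writing the excluded diagonal into the coefficients lets all double sums run over a full
  square, where they can be factored and exchanged.\<close>

definition D :: "nat => nat => real" where "D j k = (if j ~= k then d j k else 0)"
definition mesh :: "nat => real" where "mesh k = t (Suc k) - t k"
definition ctr :: "nat => real => real" where "ctr k x = indicator (cell t k) x - mesh k"
text \<open>\<open>rw\<close> and \<open>cl\<close> hold the coefficients of the two marginals of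
  the step kernel, \<open>dl\<close> is its integral and \<open>cb\<close> the integral of the
  one-variable step function. They are small when the step functions approximate centred and
  degenerate kernels.\<close>

definition rw :: "nat => real" where "rw j = (SUM k<m. D j k * mesh k)"
definition cl :: "nat => real" where "cl k = (SUM j<m. D j k * mesh j)"
definition dl :: real where "dl = (SUM j<m. SUM k<m. D j k * (mesh j * mesh k))"
definition cb :: real where "cb = (SUM k<m. c k * mesh k)"
text \<open>The common polynomial of both sides: at the cell counts it is close to the statistics of
  the graph, at the bridge increments close to the sum of the two step integrals. The constant
  \<open>dl\<close> compensates the pairs of equal vertices in the products of counts.\<close>

definition chaos :: "(nat => real) => real" where
 "chaos x = (SUM k<m. c k * x k) + (SUM j<m. SUM k<m. D j k * (x j * x k)) + dl"

lemma sum_mesh: "(SUM k<m. mesh k) = 1"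
 unfolding mesh_def by (rule unit_partition_sum[OF part])

lemma sum_off_diag_D: "(SUM (j, k):{(j, k). j < m & k < m & j ~= k}. d j k * a j * b k) = (SUM j<m. SUM k<m. D j k * (a j * b k))"
 unfolding sum_off_diag by (intro sum.cong refl) (simp add: D_def)

lemma step2_D: "step2 m t d x y = (SUM j<m. SUM k<m. D j k * (indicator (cell t j) x * indicator (cell t k) y))"
 unfolding step2_alt by (rule sum_off_diag_D)

lemma step2_integral_D: "step2_integral B m t d ww =
  (SUM j<m. SUM k<m. D j k * ((B (t (Suc j)) ww - B (t j) ww) * (B (t (Suc k)) ww - B (t k) ww)))"
 unfolding step2_integral_def by (rule sum_off_diag_D)

lemma sum_rw: "(SUM j<m. rw j * mesh j) = dl" and sum_cl: "(SUM k<m. cl k * mesh k) = dl"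
proof -
 show "(SUM j<m. rw j * mesh j) = dl"
  unfolding rw_def dl_def sum_distrib_right by (intro sum.cong refl) simp
 have "(SUM k<m. cl k * mesh k) = (SUM k<m. SUM j<m. D j k * (mesh j * mesh k))"
  unfolding cl_def sum_distrib_right by (intro sum.cong refl) simp
 also have "... = dl" unfolding dl_def by (rule sum.swap)
 finally show "(SUM k<m. cl k * mesh k) = dl" .
qed

lemma integral_steps:
 "(LINT x|unit_unif. step1 m t c x) = cb" "(LINT x|unit_unif. step1 m t rw x) = dl" "(LINT x|unit_unif. step1 m t cl x) = dl"
 unfolding integral_step1[OF part] mesh_def[symmetric] sum_rw sum_cl cb_def by (rule refl)+

lemma integral_step2_section:
 "(LINT y|unit_unif. step2 m t d x y) = step1 m t rw x" "(LINT x|unit_unif. step2 m t d x y) = step1 m t cl y"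
proof -
 have i: "(LINT x|unit_unif. (SUM j<m. SUM k<m. a j k * (indicator (cell t (h j k)) x :: real))) = (SUM j<m. SUM k<m. a j k * mesh (h j k))"
  if "!!j k. j < m ==> k < m ==> h j k < m" for a :: "nat => nat => real" and h
 proof -
  have "(LINT x|unit_unif. (SUM j<m. SUM k<m. a j k * (indicator (cell t (h j k)) x :: real))) =
    (SUM j<m. SUM k<m. a j k * (LINT x|unit_unif. indicator (cell t (h j k)) x))"
   by (rule integral_double_sum) (rule integrable_indicator_cell)
  also have "... = (SUM j<m. SUM k<m. a j k * mesh (h j k))"
   unfolding mesh_def using that by (intro sum.cong refl arg_cong2[where f = "(*)"] integral_indicator_cell[OF part]) simp
  finally show ?thesis .
 qed
 have "(LINT y|unit_unif. step2 m t d x y) = (LINT y|unit_unif. (SUM j<m. SUM k<m. (D j k * indicator (cell t j) x) * (indicator (cell t k) y :: real)))"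
  unfolding step2_D by (intro lint_cong sum.cong refl) (simp only: ac_simps)
 also have "... = (SUM j<m. SUM k<m. (D j k * indicator (cell t j) x) * mesh k)" by (rule i[where h = "%j k. k"])
 also have "... = step1 m t rw x"
  unfolding step1_alt rw_def sum_distrib_right by (intro sum.cong refl) simp
 finally show "(LINT y|unit_unif. step2 m t d x y) = step1 m t rw x" .
 have "(LINT x|unit_unif. step2 m t d x y) = (LINT x|unit_unif. (SUM j<m. SUM k<m. (D j k * indicator (cell t k) y) * (indicator (cell t j) x :: real)))"
  unfolding step2_D by (intro lint_cong sum.cong refl) (simp only: ac_simps)
 also have "... = (SUM j<m. SUM k<m. (D j k * indicator (cell t k) y) * mesh j)" by (rule i[where h = "%j k. j"])
 also have "... = (SUM k<m. SUM j<m. (D j k * indicator (cell t k) y) * mesh j)" by (rule sum.swap)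
 also have "... = step1 m t cl y"
  unfolding step1_alt cl_def sum_distrib_right by (intro sum.cong refl) simp
 finally show "(LINT x|unit_unif. step2 m t d x y) = step1 m t cl y" .
qed

lemma sum_ctr: "(SUM k<m. a k * ctr k x) = step1 m t a x - (SUM k<m. a k * mesh k)"
 unfolding ctr_def step1_alt by (simp add: right_diff_distrib sum_subtractf)

lemma sum_ctr2: "(SUM j<m. SUM k<m. D j k * (ctr j x * ctr k y)) = step2 m t d x y - step1 m t rw x - step1 m t cl y + dl"
 unfolding ctr_def bilinear_centre step2_D step1_alt rw_def[symmetric] cl_def[symmetric] dl_def[symmetric] ..

lemma step2_diag: "x : {0..1} ==> step2 m t d x x = 0"
 by (erule cell_cases[OF part]) (simp_all add: step2_0[OF part] step2_cell[OF part])

lemma bdm_ctr: "bdm unit_unif (ctr k)"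
 unfolding ctr_def[abs_def]
 by (intro bdm_diff bdm_const bdmI[where C = 1] measurable_indicator_cell) (simp add: indicator_def)

lemma integral_ctr: "k < m ==> (LINT x|unit_unif. ctr k x) = 0"
proof -
 assume k: "k < m"
 have "(LINT x|unit_unif. ctr k x) = (LINT x|unit_unif. indicator (cell t k) x) - (LINT x|unit_unif. mesh k)"
  unfolding ctr_def
  by (rule lint_diff[OF integrable_indicator_cell bdm_integrable[OF finite_measure_unit_unif bdm_const]])
 also have "... = 0" unfolding integral_indicator_cell[OF part k] by (simp add: measure_unit_unif mesh_def)
 finally show ?thesis .
qed

definition cells :: "nat => (nat \<times> nat => real) => nat => real" where
 "cells n w k = lin_stat n (ctr k) w / sqrt (real n)"

lemma bdm_cells: "bdm cube (%w. cells n w k)"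
 using bdm_mult[OF bdm_lin_stat[OF bdm_ctr] bdm_const, of n k "1 / sqrt (real n)"]
 unfolding cells_def by simp

lemma sum_cells: "(SUM k<m. a k * cells n w k) = lin_stat n (%x. SUM k<m. a k * ctr k x) w / sqrt (real n)"
proof -
 have "(SUM k<m. a k * lin_stat n (ctr k) w) = lin_stat n (%x. SUM k<m. a k * ctr k x) w"
  unfolding lin_stat_def sum_distrib_left by (rule sum.swap)
 then show ?thesis unfolding cells_def by (simp add: sum_divide_distrib[symmetric])
qed

text \<open>The diagonal of the squared sums contributes \<open>n\<^sup>-\<^sup>1 \<Sum>\<^sub>i D(U\<^sub>i, U\<^sub>i)\<close>, which concentrates at \<open>- dl\<close>.\<close>

lemma chaos_cells:
 assumes n: "1 <= n" and w: "w : space cube"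
 shows "chaos (cells n w) = lin_stat n (%x. step1 m t c x - cb) w / sqrt (real n) +
  quad_stat n (%p. step2 m t d (fst p) (snd p) - step1 m t rw (fst p) - step1 m t cl (snd p) + dl) w / real n +
  lin_stat n (%x. 2 * dl - step1 m t rw x - step1 m t cl x) w / real n"
proof -
 let ?l = "%k. lin_stat n (ctr k) w"
 have 1: "(SUM k<m. c k * cells n w k) = lin_stat n (%x. step1 m t c x - cb) w / sqrt (real n)"
  unfolding sum_cells sum_ctr cb_def ..
 have q: "(SUM j<m. SUM k<m. D j k * quad_stat n (%p. ctr j (fst p) * ctr k (snd p)) w) =
   quad_stat n (%p. SUM j<m. SUM k<m. D j k * (ctr j (fst p) * ctr k (snd p))) w"
  unfolding quad_stat_def split_beta' sum_distrib_left
  by (subst sum.swap, subst (2) sum.swap) simp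
 have l: "(SUM j<m. SUM k<m. D j k * lin_stat n (%x. ctr j x * ctr k x) w) =
   lin_stat n (%x. SUM j<m. SUM k<m. D j k * (ctr j x * ctr k x)) w"
  unfolding lin_stat_def sum_distrib_left
  by (subst sum.swap, subst (2) sum.swap) simp
 have ld: "lin_stat n (%x. SUM j<m. SUM k<m. D j k * (ctr j x * ctr k x)) w + real n * dl =
   lin_stat n (%x. 2 * dl - step1 m t rw x - step1 m t cl x) w"
 proof -
  have "lin_stat n (%x. SUM j<m. SUM k<m. D j k * (ctr j x * ctr k x)) w + real n * dl =
    (SUM i:{1..n}. (SUM j<m. SUM k<m. D j k * (ctr j (w (i, i)) * ctr k (w (i, i)))) + dl)"
   unfolding lin_stat_def sum.distrib by simp
  also have "... = lin_stat n (%x. 2 * dl - step1 m t rw x - step1 m t cl x) w"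
   unfolding lin_stat_def sum_ctr2 by (intro sum.cong refl) (simp add: step2_diag[OF cube_range[OF w]])
  finally show ?thesis .
 qed
 have "(SUM j<m. SUM k<m. D j k * (cells n w j * cells n w k)) = (SUM j<m. SUM k<m. D j k * (?l j * ?l k)) / real n"
  unfolding cells_def sum_divide_distrib by (intro sum.cong refl) simp
 also have "(SUM j<m. SUM k<m. D j k * (?l j * ?l k)) =
   (SUM j<m. SUM k<m. D j k * quad_stat n (%p. ctr j (fst p) * ctr k (snd p)) w) + (SUM j<m. SUM k<m. D j k * lin_stat n (%x. ctr j x * ctr k x) w)"
  unfolding lin_stat_mult distrib_left sum.distrib ..
 finally have 2: "(SUM j<m. SUM k<m. D j k * (cells n w j * cells n w k)) =
   (quad_stat n (%p. step2 m t d (fst p) (snd p) - step1 m t rw (fst p) - step1 m t cl (snd p) + dl) w +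
    lin_stat n (%x. SUM j<m. SUM k<m. D j k * (ctr j x * ctr k x)) w) / real n"
  unfolding q l sum_ctr2 .
 show ?thesis unfolding chaos_def 1 2 ld[symmetric] using n by (simp add: add_divide_distrib)
qed


lemma integral_step1_sq: "(LINT x|unit_unif. (step1 m t a x)^2) = (SUM k<m. (a k)^2 * mesh k)"
proof -
 have "ennreal (LINT x|unit_unif. (step1 m t a x)^2) = ennreal (SUM k<m. (a k)^2 * mesh k)"
  unfolding mesh_def sq_norm_step1[OF part, symmetric]
  by (rule sq_norm_eq_integral[symmetric, OF bdm_integrable[OF finite_measure_unit_unif bdm_power[OF bdm_step1]]])
 moreover have "0 <= (SUM k<m. (a k)^2 * mesh k)"
  using unit_partition_mono[OF part] by (intro sum_nonneg mult_nonneg_nonneg) (simp_all add: mesh_def)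
 ultimately show ?thesis by (subst (asm) ennreal_inj) simp_all
qed

lemma integral_ctr_sum_sq:
 "(LINT x|unit_unif. (SUM k<m. a k * ctr k x)^2) = (SUM k<m. (a k - (SUM l<m. a l * mesh l))^2 * mesh k)"
proof -
 let ?a = "SUM l<m. a l * mesh l"
 have "(LINT x|unit_unif. (SUM k<m. a k * ctr k x)^2) = (LINT x|unit_unif. (step1 m t (%k. a k - ?a) x)^2)"
 proof (rule integral_cong_AE)
  show "(%x. (SUM k<m. a k * ctr k x)^2) : borm unit_unif"
   by (intro bdm_measurable bdm_power bdm_sum bdm_mult bdm_const bdm_ctr)
  show "(%x. (step1 m t (%k. a k - ?a) x)^2) : borm unit_unif"
   by (rule bdm_measurable[OF bdm_power[OF bdm_step1]])
  \<comment> \<open>Equality may fail at 0: there all indicators vanish, so the centred sum is minus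
    its mean while the step function is 0.\<close>
  show "AE x in unit_unif. (SUM k<m. a k * ctr k x)^2 = (step1 m t (%k. a k - ?a) x)^2"
   using AE_unit_unif_pos AE_space
  proof eventually_elim
   case (elim x)
   then have "x : {0..1}" by simp
   then obtain j where j: "j < m" "x : cell t j" using cell_cases[OF part] elim by (metis less_irrefl)
   show ?case unfolding sum_ctr step1_cell[OF part j(2,1)] ..
  qed
 qed
 then show ?thesis unfolding integral_step1_sq .
qed

text \<open>Since the true kernel has vanishing marginals, the marginals of the step kernel are, up
  to sign, those of the approximation error; integrating out a variable does not increase the L2
  norm, so they are at most \<open>s\<close>. The centring of \<open>f\<close> bounds
  \<open>cb\<close> in the same way.\<close>

lemma chaos_approx_bounds:
 assumes f: "bdm unit_unif f" "(LINT x|unit_unif. f x) = 0" and K: "bdm unit_square K"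
  and z: "AE x in unit_unif. (LINT y|unit_unif. K (x, y)) = 0" "AE y in unit_unif. (LINT x|unit_unif. K (x, y)) = 0"
  and s: "0 < s" and e1: "sq_norm unit_unif (%x. f x - step1 m t c x) <= ennreal (s^2)"
  and e2: "sq_norm unit_square (%p. K p - case_prod (step2 m t d) p) <= ennreal (s^2)"
 shows "\<bar>cb\<bar> <= s" "(SUM j<m. (rw j)^2 * mesh j) <= s^2" "(SUM k<m. (cl k)^2 * mesh k) <= s^2" "\<bar>dl\<bar> <= s"
  "EX Z. \<forall>n\<ge>1. norm ((CLINT w|cube. iexp (lin_stat n f w / sqrt (real n) + quad_stat n K w / real n)) - (CLINT w|cube. iexp (chaos (cells n w)))) <=
   19 * s + sqrt (Z * (1 / real n))"
proof -
 interpret U: prob_space unit_unif by (rule prob_space_unit_unif)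
 interpret S: prob_space unit_square by (rule prob_space_unit_square)
 note iU = bdm_integrable[OF finite_measure_unit_unif] and iS = bdm_integrable[OF S.finite_measure_axioms]
 note one = measure_unit_unif
 let ?F = "%x. f x - step1 m t c x" and ?G = "%p. K p - case_prod (step2 m t d) p"
 let ?r = "step1 m t rw" and ?l = "step1 m t cl"
 have bF: "bdm unit_unif ?F" by (rule bdm_diff[OF f(1) bdm_step1])
 have bG: "bdm unit_square ?G" by (rule bdm_diff[OF K bdm_step2])
 have F2: "(LINT x|unit_unif. (?F x)^2) <= s^2"
  using e1 unfolding sq_norm_eq_integral[OF iU[OF bdm_power[OF bF]]] by simp
 have G2: "(LINT p|unit_square. (?G p)^2) <= s^2"
  using e2 unfolding sq_norm_eq_integral[OF iS[OF bdm_power[OF bG]]] by simp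
 have abs_le: "\<bar>a\<bar> <= s" if "a^2 <= s^2" for a :: real using that s by (simp add: abs_le_square_iff[symmetric])
 have F1: "(LINT x|unit_unif. ?F x) = - cb"
  using lint_diff[OF iU[OF f(1)] iU[OF bdm_step1[of m t c]]] unfolding f(2) integral_steps by simp
 have "(- cb)^2 <= s^2"
  using integral_square_ge[OF prob_space_unit_unif bF] F2 unfolding F1 by linarith
 then have cb: "\<bar>cb\<bar> <= s" by (intro abs_le) simp
 then show "\<bar>cb\<bar> <= s" .
 have Gx: "(LINT y|unit_unif. ?G (x, y)) = (LINT y|unit_unif. K (x, y)) - ?r x" if x: "x : {0..1}" for x
  using lint_diff[OF iU[OF bdm_section(1)[OF K x]] iU[OF bdm_section(1)[OF bdm_step2[of m t d] x]]]
  by (simp add: integral_step2_section)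
 have Gy: "(LINT x|unit_unif. ?G (x, y)) = (LINT x|unit_unif. K (x, y)) - ?l y" if y: "y : {0..1}" for y
  using lint_diff[OF iU[OF bdm_section(2)[OF K y]] iU[OF bdm_section(2)[OF bdm_step2[of m t d] y]]]
  by (simp add: integral_step2_section)
 note m1 = bdm_measurable[OF bdm_power[OF bdm_step1]]
 have bG': "bdm unit_square (%p. ?G (snd p, fst p))"
  by (rule bdm_compose[OF bG measurable_Pair[OF measurable_snd measurable_fst]])
 have gm: "(%x. (LINT y|unit_unif. ?G (x, y))^2) : borm unit_unif" "(%y. (LINT x|unit_unif. ?G (x, y))^2) : borm unit_unif"
  using bdm_measurable[OF bdm_power[OF bdm_integral[OF prob_space_unit_unif bG], of 2]]
   bdm_measurable[OF bdm_power[OF bdm_integral[OF prob_space_unit_unif bG'], of 2]] by simp_all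
 have "(LINT x|unit_unif. (?r x)^2) = (LINT x|unit_unif. (LINT y|unit_unif. ?G (x, y))^2)"
 proof (rule integral_cong_AE[OF m1 gm(1)])
  show "AE x in unit_unif. (?r x)^2 = (LINT y|unit_unif. ?G (x, y))^2"
   using z(1) AE_space
  proof eventually_elim
   case (elim x)
   then have x: "x : {0..1}" by simp
   show ?case unfolding Gx[OF x] using elim by simp
  qed
 qed
 also note integral_marginal_sq_le(1)[OF bG]
 finally have r2: "(LINT x|unit_unif. (?r x)^2) <= s^2" using G2 by linarith
 then show "(SUM j<m. (rw j)^2 * mesh j) <= s^2" unfolding integral_step1_sq .
 have "(LINT x|unit_unif. (?l x)^2) = (LINT y|unit_unif. (LINT x|unit_unif. ?G (x, y))^2)"
 proof (rule integral_cong_AE[OF m1 gm(2)])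
  show "AE y in unit_unif. (?l y)^2 = (LINT x|unit_unif. ?G (x, y))^2"
   using z(2) AE_space
  proof eventually_elim
   case (elim y)
   then have x: "y : {0..1}" by simp
   show ?case unfolding Gy[OF x] using elim by simp
  qed
 qed
 also note integral_marginal_sq_le(2)[OF bG]
 finally have l2: "(LINT x|unit_unif. (?l x)^2) <= s^2" using G2 by linarith
 then show "(SUM k<m. (cl k)^2 * mesh k) <= s^2" unfolding integral_step1_sq .
 have dl2: "dl^2 <= s^2"
  using integral_square_ge[OF prob_space_unit_unif bdm_step1[of m t rw]] r2 unfolding integral_steps by linarith
 then show "\<bar>dl\<bar> <= s" by (rule abs_le)
 \<comment> \<open>\<open>u\<close> and \<open>V\<close> are the approximation errors relative to
   the recentred step kernels. Only after recentring is \<open>u\<close> centred and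
   \<open>V\<close> degenerate, so that the second moments have the orders matching the scales
   \<open>sqrt n\<close> and n. \<open>zz\<close> is the diagonal contribution together with
   \<open>dl\<close>, centred, and negligible after division by n.\<close>
 define u where "u x = f x - (step1 m t c x - cb)" for x
 define V where "V p = K p - (step2 m t d (fst p) (snd p) - ?r (fst p) - ?l (snd p) + dl)" for p
 define zz where "zz x = 2 * dl - ?r x - ?l x" for x
 have bu: "bdm unit_unif u" unfolding u_def[abs_def] by (intro bdm_diff bdm_const bdm_step1 f)
 have bz: "bdm unit_unif zz" unfolding zz_def[abs_def] by (intro bdm_diff bdm_const bdm_step1)
 have bV: "bdm unit_square V" unfolding V_def[abs_def]
  using bdm_step2[of m t d]
  by (intro bdm_diff bdm_add bdm_const K bdm_compose[OF bdm_step1 measurable_fst]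
    bdm_compose[OF bdm_step1 measurable_snd]) (simp add: split_beta')
 have u0: "(LINT x|unit_unif. u x) = 0"
 proof -
  have "(LINT x|unit_unif. u x) = (LINT x|unit_unif. ?F x + cb)" unfolding u_def by (intro lint_cong refl) simp
  also have "... = (LINT x|unit_unif. ?F x) + (LINT x|unit_unif. cb)" by (rule lint_add[OF iU[OF bF] iU[OF bdm_const]])
  finally show ?thesis unfolding F1 by (simp add: one)
 qed
 have u2: "(LINT x|unit_unif. (u x)^2) <= 4 * s^2"
 proof -
  have "(LINT x|unit_unif. (u x)^2) <= (LINT x|unit_unif. 2 * (?F x)^2 + 2 * cb^2)"
  proof (rule integral_mono[OF iU[OF bdm_power[OF bu]] iU])
   show "bdm unit_unif (%x. 2 * (?F x)^2 + 2 * cb^2)" by (intro bdm_add bdm_mult bdm_const bdm_power bF)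
   have *: "(a - (b - e))^2 <= 2 * (a - b)^2 + 2 * e^2" for a b e :: real
   proof -
    have "2 * (a - b)^2 + 2 * e^2 - (a - (b - e))^2 = (a - b - e)^2" by (simp add: power2_eq_square algebra_simps)
    moreover have "0 <= (a - b - e)^2" by simp
    ultimately show ?thesis by linarith
   qed
   show "(u x)^2 <= 2 * (?F x)^2 + 2 * cb^2" for x unfolding u_def by (rule *)
  qed
  also have "... = 2 * (LINT x|unit_unif. (?F x)^2) + 2 * cb^2"
   using iU[OF bdm_power[OF bF, of 2]] by (simp add: one)
  also have "cb^2 <= s^2" using power_mono[OF cb, of 2] by simp
  finally show ?thesis using F2 by linarith
 qed
 have z0: "(LINT x|unit_unif. zz x) = 0"
  unfolding zz_def using iU[OF bdm_step1[of m t rw]] iU[OF bdm_step1[of m t cl]] by (simp add: integral_steps one)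
 have Vx: "AE x in unit_unif. (LINT y|unit_unif. V (x, y)) = 0"
  using z(1) AE_space
 proof eventually_elim
  case (elim x)
  then have x: "x : {0..1}" by simp
  have "(LINT y|unit_unif. V (x, y)) = (LINT y|unit_unif. ?G (x, y) + (?r x - dl + ?l y))"
   unfolding V_def by (intro lint_cong refl) simp
  also have "... = (LINT y|unit_unif. ?G (x, y)) + (LINT y|unit_unif. ?r x - dl + ?l y)"
   by (intro lint_add iU bdm_section(1)[OF bG x] bdm_add bdm_const bdm_step1)
  also have "(LINT y|unit_unif. ?r x - dl + ?l y) = ?r x"
   using iU[OF bdm_step1[of m t cl]] by (simp add: integral_steps one)
  finally show ?case unfolding Gx[OF x] using elim by simp
 qed
 have Vy: "AE y in unit_unif. (LINT x|unit_unif. V (x, y)) = 0"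
  using z(2) AE_space
 proof eventually_elim
  case (elim y)
  then have y: "y : {0..1}" by simp
  have "(LINT x|unit_unif. V (x, y)) = (LINT x|unit_unif. ?G (x, y) + (?l y - dl + ?r x))"
   unfolding V_def by (intro lint_cong refl) simp
  also have "... = (LINT x|unit_unif. ?G (x, y)) + (LINT x|unit_unif. ?l y - dl + ?r x)"
   by (intro lint_add iU bdm_section(2)[OF bG y] bdm_add bdm_const bdm_step1)
  also have "(LINT x|unit_unif. ?l y - dl + ?r x) = ?l y"
   using iU[OF bdm_step1[of m t rw]] by (simp add: integral_steps one)
  finally show ?case unfolding Gy[OF y] using elim by simp
 qed
 have V0: "(LINT p|unit_square. V p) = 0"
  unfolding integral_unit_square(1)[OF bV] by (rule integral_eq_zero_AE[OF Vx])
 have V2: "(LINT p|unit_square. (V p)^2) <= 16 * s^2"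
 proof -
  have br: "bdm unit_square (%p. (?r (fst p))^2)" by (rule bdm_power[OF bdm_compose[OF bdm_step1 measurable_fst]])
  have bl: "bdm unit_square (%p. (?l (snd p))^2)" by (rule bdm_power[OF bdm_compose[OF bdm_step1 measurable_snd]])
  have r': "(LINT p|unit_square. (?r (fst p))^2) <= s^2" unfolding integral_unit_square(1)[OF br] using r2 by (simp add: one)
  have l': "(LINT p|unit_square. (?l (snd p))^2) <= s^2" unfolding integral_unit_square(1)[OF bl] using l2 by (simp add: one)
  have "(LINT p|unit_square. (V p)^2) <= (LINT p|unit_square. 4 * (?G p)^2 + (4 * (?r (fst p))^2 + (4 * (?l (snd p))^2 + 4 * dl^2)))"
  proof (rule integral_mono[OF iS[OF bdm_power[OF bV]] iS])
   show "bdm unit_square (%p. 4 * (?G p)^2 + (4 * (?r (fst p))^2 + (4 * (?l (snd p))^2 + 4 * dl^2)))"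
    by (intro bdm_add bdm_mult bdm_const bdm_power[OF bG] br bl)
   fix p
   \<comment> \<open>\<open>V\<close> consists of the error, its two marginals and a constant. Each
     has squared norm at most s^2, and the square of four terms is at most 4 times the sum of
     squares, which yields \<open>16 * s^2\<close>.\<close>
   have *: "(a + b + c - e)^2 <= 4 * a^2 + (4 * b^2 + (4 * c^2 + 4 * e^2))" for a b c e :: real
   proof -
    have "4 * a^2 + (4 * b^2 + (4 * c^2 + 4 * e^2)) - (a + b + c - e)^2 =
      (a - b)^2 + (a - c)^2 + (a + e)^2 + (b - c)^2 + (b + e)^2 + (c + e)^2"
     by (simp add: power2_eq_square algebra_simps)
    moreover have "0 <= (a - b)^2 + (a - c)^2 + (a + e)^2 + (b - c)^2 + (b + e)^2 + (c + e)^2" by simp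
    ultimately show ?thesis by linarith
   qed
   have "V p = ?G p + ?r (fst p) + ?l (snd p) - dl" unfolding V_def by (simp add: split_beta')
   then show "(V p)^2 <= 4 * (?G p)^2 + (4 * (?r (fst p))^2 + (4 * (?l (snd p))^2 + 4 * dl^2))" by (simp only: *)
  qed
  also have "... = 4 * (LINT p|unit_square. (?G p)^2) + (4 * (LINT p|unit_square. (?r (fst p))^2) + (4 * (LINT p|unit_square. (?l (snd p))^2) + 4 * dl^2))"
   using iS[OF bdm_power[OF bG, of 2]] iS[OF br] iS[OF bl] by (simp add: S.prob_space)
  finally show ?thesis using G2 r' l' dl2 by linarith
 qed
 let ?Z = "2 * (LINT x|unit_unif. (zz x)^2)"
 show "EX Z. \<forall>n\<ge>1. norm ((CLINT w|cube. iexp (lin_stat n f w / sqrt (real n) + quad_stat n K w / real n)) - (CLINT w|cube. iexp (chaos (cells n w)))) <=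
   19 * s + sqrt (Z * (1 / real n))"
 proof (intro exI[of _ ?Z] allI impI)
  fix n :: nat assume n: "1 <= n"
  let ?A = "%w. lin_stat n f w / sqrt (real n) + quad_stat n K w / real n"
  let ?E = "%w. \<bar>lin_stat n u w\<bar> / sqrt (real n) + (\<bar>quad_stat n V w\<bar> / real n + \<bar>lin_stat n zz w\<bar> / real n)"
  have bA: "bdm cube ?A"
   using bdm_add[OF bdm_mult[OF bdm_lin_stat[OF f(1)] bdm_const] bdm_mult[OF bdm_quad_stat[OF K] bdm_const], of n "1 / sqrt (real n)" n "1 / real n"] by simp
  have bC: "bdm cube (%w. chaos (cells n w))" unfolding chaos_def
   by (intro bdm_add bdm_sum bdm_mult bdm_const bdm_cells)
  note iC = integrable_cube[OF bdm_lin_stat[OF bu], of n] integrable_cube[OF bdm_quad_stat[OF bV], of n] integrable_cube[OF bdm_lin_stat[OF bz], of n]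
  have "norm ((CLINT w|cube. iexp (?A w)) - (CLINT w|cube. iexp (chaos (cells n w)))) <= (LINT w|cube. \<bar>?A w - chaos (cells n w)\<bar>)"
   by (rule iexp_integral_diff_le[OF prob_space_cube bdm_measurable[OF bA] bdm_measurable[OF bC] integrable_cube[OF bdm_diff[OF bA bC]]])
  also have "... <= (LINT w|cube. ?E w)"
  proof (rule integral_mono[OF integrable_abs[OF integrable_cube[OF bdm_diff[OF bA bC]]]])
   show "integrable cube ?E" using iC by simp
   fix w :: "nat \<times> nat => real" assume w: "w : space cube"
   have 1: "lin_stat n f w - lin_stat n (%x. step1 m t c x - cb) w = lin_stat n u w"
    unfolding lin_stat_def u_def sum_subtractf[symmetric] ..
   have 2: "quad_stat n K w - quad_stat n (%p. step2 m t d (fst p) (snd p) - ?r (fst p) - ?l (snd p) + dl) w = quad_stat n V w"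
    unfolding quad_stat_def V_def split_beta' sum_subtractf[symmetric] ..
   have *: "\<bar>a / x + b / y - (a' / x + b' / y + e / y)\<bar> <= \<bar>a - a'\<bar> / x + (\<bar>b - b'\<bar> / y + \<bar>e\<bar> / y)" if "0 < x" "0 < y" for a b a' b' e x y :: real
   proof -
    have "a / x + b / y - (a' / x + b' / y + e / y) = (a - a') / x + ((b - b') / y - e / y)" by (simp add: diff_divide_distrib)
    also have "\<bar>...\<bar> <= \<bar>(a - a') / x\<bar> + (\<bar>(b - b') / y\<bar> + \<bar>e / y\<bar>)" by linarith
    finally show ?thesis using that by (simp only: abs_divide abs_of_pos)
   qed
   show "\<bar>?A w - chaos (cells n w)\<bar> <= ?E w"
    unfolding chaos_cells[OF n w] zz_def[symmetric] 1[symmetric] 2[symmetric] by (rule *) (use n in simp_all)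
  qed
  also have "... = (LINT w|cube. \<bar>lin_stat n u w\<bar>) / sqrt (real n) + ((LINT w|cube. \<bar>quad_stat n V w\<bar>) / real n + (LINT w|cube. \<bar>lin_stat n zz w\<bar>) / real n)"
   using iC by simp
  also have "... <= sqrt (2 * (4 * s^2) * real n) / sqrt (real n) + (sqrt (16 * (16 * s^2) * (real n ^ 4 / real n ^ 2)) / real n + sqrt (?Z * real n) / real n)"
   by (intro add_mono divide_right_mono order_trans[OF integral_abs_le_sqrt[OF prob_space_cube]] real_sqrt_le_mono
     bdm_lin_stat bdm_quad_stat bu bz bV lin_stat_sq_le[OF bu u0 u2 n] lin_stat_sq_le[OF bz z0 order_refl n]
     quad_stat_sq_le[OF bV V2 n _ V0 Vx Vy]) simp_all
  also have "... = sqrt 8 * s + (16 * s + sqrt (?Z * (1 / real n)))"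
  proof -
   have a: "sqrt (2 * (4 * s^2) * real n) / sqrt (real n) = sqrt 8 * s"
    using n s by (simp add: real_sqrt_mult)
   have "16 * (16 * s^2) * (real n ^ 4 / real n ^ 2) = (16 * s * real n)^2"
    using n by (simp add: power2_eq_square power4_eq_xxxx)
   then have b: "sqrt (16 * (16 * s^2) * (real n ^ 4 / real n ^ 2)) / real n = 16 * s" using n s by simp
   have e: "?Z * real n = (?Z * (1 / real n)) * (real n)^2" using n by (simp add: power2_eq_square)
   have "sqrt (x * (real n)^2) = sqrt x * real n" for x by (simp add: real_sqrt_mult)
   then have "sqrt (?Z * real n) = sqrt (?Z * (1 / real n)) * real n" unfolding e .
   then show ?thesis unfolding a b using n by simp
  qed
  \<comment> \<open>The linear error contributes \<open>sqrt 8 <= 3\<close> and the quadratic one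
    16.\<close>
  also have "... <= 19 * s + sqrt (?Z * (1 / real n))"
  proof -
   have "sqrt 8 <= 3" by (rule real_le_lsqrt) simp_all
   then have "sqrt 8 * s <= 3 * s" using s by (intro mult_right_mono) auto
   then show ?thesis by linarith
  qed
  finally show "norm ((CLINT w|cube. iexp (?A w)) - (CLINT w|cube. iexp (chaos (cells n w)))) <= 19 * s + sqrt (?Z * (1 / real n))" .
 qed
qed

end


section \<open>From the bridge to Brownian motion\<close>

locale brownian_steps = brownian_space N B + step_kernels m t c d
 for N :: "'b measure" and B m t c d
begin

definition bsum :: "'b => real" where "bsum ww = (SUM l<m. incr t l ww)"
text \<open>Increments of a Brownian bridge. The centred cell counts add up to 0 almost surely,
  which their limit must reproduce and the increments of the motion do not.\<close>

definition bridge :: "'b => nat => real" where "bridge ww k = incr t k ww - mesh k * bsum ww"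

lemma sum_bridge: "(SUM k<m. a k * bridge ww k) = (SUM k<m. a k * incr t k ww) - (SUM l<m. a l * mesh l) * bsum ww"
 unfolding bridge_def by (simp only: right_diff_distrib sum_subtractf sum_distrib_right mult.assoc)

lemma sum_bridge_step1_integral:
 "(SUM k<m. a k * bridge ww k) = step1_integral B m t (%k. a k - (SUM l<m. a l * mesh l)) ww"
proof -
 have "(SUM k<m. (a k - A) * x k) = (SUM k<m. a k * x k) - A * (SUM k<m. x k)" for A and x :: "nat => real"
  by (simp add: left_diff_distrib sum_subtractf sum_distrib_left)
 then show ?thesis unfolding sum_bridge step1_integral_def bsum_def by (simp only:)
qed

lemma measurable_bridge: "k < m ==> (%ww. bridge ww k) : borm N"
 unfolding bridge_def bsum_def
 by (intro borel_measurable_diff borel_measurable_times borel_measurable_const borel_measurable_sum measurable_incr[OF part]) simp_all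

text \<open>A linear combination of the cell counts is a linear statistic, so its characteristic
  function is covered by the central limit theorem. The same combination of bridge increments is a
  step integral with recentred coefficients, Gaussian with the matching variance.\<close>

lemma cells_converge: "converges_in_distribution {..<m} (%_. cube) (%n w. \<lambda>k\<in>{..<m}. cells n w k) N (%ww. \<lambda>k\<in>{..<m}. bridge ww k)"
proof (rule converges_in_distribution_char)
 show "prob_space cube" by (rule prob_space_cube)
 show "prob_space N" by (rule prob_space_axioms)
 show "(%w. \<lambda>k\<in>{..<m}. cells n w k) : cube \<rightarrow>\<^sub>M (\<Pi>\<^sub>M i\<in>{..<m}. borel)" for n
  by (rule measurable_restrict) (rule bdm_measurable[OF bdm_cells])
 show "(%ww. \<lambda>k\<in>{..<m}. bridge ww k) : N \<rightarrow>\<^sub>M (\<Pi>\<^sub>M i\<in>{..<m}. borel)"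
  by (rule measurable_restrict) (rule measurable_bridge, simp)
 fix a :: "nat => real"
 let ?h = "%x. SUM k<m. a k * ctr k x"
 have r: "(SUM i:{..<m}. a i * (\<lambda>k\<in>{..<m}. x k) i) = (SUM i<m. a i * x i)" for x :: "nat => real" by (rule sum.cong) simp_all
 have b: "bdm unit_unif ?h" by (intro bdm_sum bdm_mult bdm_const bdm_ctr)
 have z: "(LINT x|unit_unif. ?h x) = 0"
 proof -
  have "(LINT x|unit_unif. ?h x) = (SUM k<m. LINT x|unit_unif. a k * ctr k x)"
   by (intro lint_sum bdm_integrable[OF finite_measure_unit_unif] bdm_mult bdm_const bdm_ctr)
  then show ?thesis by (simp add: integral_ctr)
 qed
 have "(CLINT ww|N. iexp (SUM i<m. a i * bridge ww i)) = of_real (exp (- (LINT x|unit_unif. (?h x)^2) / 2))"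
  unfolding sum_bridge_step1_integral char_step1_integral[OF part] integral_ctr_sum_sq mesh_def[symmetric] ..
 then show "(%n. CLINT w|cube. iexp (SUM i:{..<m}. a i * (\<lambda>k\<in>{..<m}. cells n w k) i)) \<longlonglongrightarrow>
   (CLINT ww|N. iexp (SUM i:{..<m}. a i * (\<lambda>k\<in>{..<m}. bridge ww k) i))"
  unfolding r sum_cells using lin_stat_clt[OF b z] by (simp only:)
next
 fix i assume i: "i : {..<m}"
 let ?C = "2 * (LINT x|unit_unif. (ctr i x)^2)"
 have le: "(LINT w|cube. (cells n w i)^2) <= ?C" if n: "1 <= n" for n
 proof -
  have "(LINT w|cube. (cells n w i)^2) = (LINT w|cube. (lin_stat n (ctr i) w)^2) / real n"
   unfolding cells_def power_divide by simp
  also have "... <= ?C * real n / real n"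
   by (intro divide_right_mono lin_stat_sq_le[OF bdm_ctr integral_ctr order_refl n]) (use i in auto)
  finally show ?thesis using n by simp
 qed
 show "EX C. \<forall>\<^sub>F n in sequentially. integrable cube (%w. ((\<lambda>k\<in>{..<m}. cells n w k) i)^2) &
   (LINT w|cube. ((\<lambda>k\<in>{..<m}. cells n w k) i)^2) <= C"
 proof (intro exI[of _ ?C] eventually_sequentiallyI[of 1] conjI)
  fix n :: nat assume n: "1 <= n"
  have e: "(\<lambda>k\<in>{..<m}. cells n w k) i = cells n w i" for w using i by simp
  show "integrable cube (%w. ((\<lambda>k\<in>{..<m}. cells n w k) i)^2)"
   unfolding e by (rule integrable_cube[OF bdm_power[OF bdm_cells]])
  show "(LINT w|cube. ((\<lambda>k\<in>{..<m}. cells n w k) i)^2) <= ?C" unfolding e by (rule le[OF n])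
 qed
qed simp

text \<open>The polynomial is unbounded, but its sine and cosine are bounded continuous test
  functions of the cell counts. Weak convergence speaks of real functions, hence the split into real
  and imaginary parts.\<close>

lemma chaos_bridge_limit:
 "(%n. CLINT w|cube. iexp (chaos (cells n w))) \<longlonglongrightarrow> (CLINT ww|N. iexp (chaos (bridge ww)))"
proof -
 have r: "chaos (\<lambda>k\<in>{..<m}. x k) = chaos x" for x
  unfolding chaos_def by (intro arg_cong2[where f = "(+)"] sum.cong refl) simp_all
 let ?X = "product_topology (%_. euclideanreal) {..<m}"
 have cont: "continuous_map ?X euclideanreal chaos"
  unfolding chaos_def
  by (intro continuous_map_add continuous_map_sum continuous_map_real_mult continuous_map_product_projection) simp_all
 have lim: "(%n. LINT w|cube. h (chaos (cells n w))) \<longlonglongrightarrow> (LINT ww|N. h (chaos (bridge ww)))"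
  if h: "continuous_on UNIV h" "!!y. \<bar>h y\<bar> <= 1" for h :: "real => real"
 proof -
  have "continuous_map ?X euclideanreal (h \<circ> chaos)"
   by (rule continuous_map_compose[OF cont]) (use h(1) in simp)
  moreover have "bounded ((h \<circ> chaos) ` (\<Pi>\<^sub>E i\<in>{..<m}. UNIV))"
   by (rule boundedI[where B = 1]) (use h(2) in auto)
  ultimately have "(%n. LINT w|cube. (h \<circ> chaos) (\<lambda>k\<in>{..<m}. cells n w k)) \<longlonglongrightarrow> (LINT ww|N. (h \<circ> chaos) (\<lambda>k\<in>{..<m}. bridge ww k))"
   using cells_converge unfolding converges_in_distribution_def by (elim conjE allE) (erule mp, rule conjI)
  then show ?thesis by (simp only: o_def r)
 qed
 have mc: "(%w. chaos (cells n w)) : borm cube" for n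
  unfolding chaos_def
  by (intro borel_measurable_add borel_measurable_sum borel_measurable_times borel_measurable_const bdm_measurable[OF bdm_cells])
 have mb: "(%ww. chaos (bridge ww)) : borm N"
  unfolding chaos_def
  by (intro borel_measurable_add borel_measurable_sum borel_measurable_times borel_measurable_const measurable_bridge) simp_all
 have re: "Re (CLINT x|M. iexp (Y x)) = (LINT x|M. cos (Y x))" "Im (CLINT x|M. iexp (Y x)) = (LINT x|M. sin (Y x))"
  if "prob_space M" "Y : borm M" for M :: "'c measure" and Y
 proof -
  interpret M: prob_space M by fact
  have i: "integrable M (%x. iexp (Y x))" by (rule bdm_integrable[OF M.finite_measure_axioms bdm_iexp[OF that(2)]])
  show "Re (CLINT x|M. iexp (Y x)) = (LINT x|M. cos (Y x))" "Im (CLINT x|M. iexp (Y x)) = (LINT x|M. sin (Y x))"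
   unfolding integral_bounded_linear[OF bounded_linear_Re i, symmetric] integral_bounded_linear[OF bounded_linear_Im i, symmetric]
   by (simp_all add: Re_exp Im_exp)
 qed
 show ?thesis
  unfolding tendsto_complex_iff re[OF prob_space_cube mc] re[OF prob_space_axioms mb]
  by (intro conjI lim continuous_intros) simp_all
qed

text \<open>Expanding the polynomial at the bridge leaves an explicit discrepancy in which the total
  displacement \<open>bsum\<close> is multiplied by \<open>cb\<close>, by the integrals of the two
  marginals, or enters quadratically with factor \<open>dl\<close>. All these coefficients are of
  size \<open>s\<close>.\<close>

lemma bridge_approx:
 assumes s: "0 < s" and cb: "\<bar>cb\<bar> <= s" and dl: "\<bar>dl\<bar> <= s"
  and r: "(SUM j<m. (rw j)^2 * mesh j) <= s^2" and l: "(SUM k<m. (cl k)^2 * mesh k) <= s^2"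
 shows "norm ((CLINT ww|N. iexp (chaos (bridge ww))) - (CLINT ww|N. iexp (step1_integral B m t c ww + step2_integral B m t d ww))) <= 5 * s"
proof -
 let ?R = "step1_integral B m t rw" and ?L = "step1_integral B m t cl"
 let ?Y = "%ww. step1_integral B m t c ww + step2_integral B m t d ww"
 have b1: "bsum = step1_integral B m t (%_. 1)" unfolding step1_integral_def bsum_def by simp
 have ib: "integrable N (%ww. (bsum ww)^2)" "(LINT ww|N. (bsum ww)^2) = 1"
  unfolding b1 using step1_integral_sq[OF part, of "%_. 1"] sum_mesh by (simp_all add: mesh_def)
 have iR: "integrable N (%ww. (?R ww)^2)" "(LINT ww|N. (?R ww)^2) <= s^2"
  using step1_integral_sq[OF part, of rw] r by (simp_all add: mesh_def)
 have iL: "integrable N (%ww. (?L ww)^2)" "(LINT ww|N. (?L ww)^2) <= s^2"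
  using step1_integral_sq[OF part, of cl] l by (simp_all add: mesh_def)
 have diff: "chaos (bridge ww) - ?Y ww = - cb * bsum ww - bsum ww * ?R ww - bsum ww * ?L ww + dl * ((bsum ww)^2 + 1)" for ww
 proof -
  have 1: "(SUM k<m. c k * bridge ww k) = step1_integral B m t c ww - cb * bsum ww"
   unfolding sum_bridge step1_integral_def cb_def ..
  have 2: "(SUM j<m. SUM k<m. D j k * (bridge ww j * bridge ww k)) = step2_integral B m t d ww
    - (SUM j<m. (SUM k<m. D j k * (mesh k * bsum ww)) * incr t j ww) - (SUM k<m. (SUM j<m. D j k * (mesh j * bsum ww)) * incr t k ww)
    + (SUM j<m. SUM k<m. D j k * ((mesh j * bsum ww) * (mesh k * bsum ww)))"
   unfolding bridge_def bilinear_centre step2_integral_D ..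
  have 3: "(SUM j<m. (SUM k<m. D j k * (mesh k * bsum ww)) * incr t j ww) = bsum ww * ?R ww"
   unfolding step1_integral_def rw_def sum_distrib_left sum_distrib_right by (intro sum.cong refl) (simp only: ac_simps)
  have 4: "(SUM k<m. (SUM j<m. D j k * (mesh j * bsum ww)) * incr t k ww) = bsum ww * ?L ww"
   unfolding step1_integral_def cl_def sum_distrib_left sum_distrib_right by (intro sum.cong refl) (simp only: ac_simps)
  have 5: "(SUM j<m. SUM k<m. D j k * ((mesh j * bsum ww) * (mesh k * bsum ww))) = dl * (bsum ww)^2"
   unfolding dl_def sum_distrib_right power2_eq_square by (intro sum.cong refl) (simp only: ac_simps)
  show ?thesis unfolding chaos_def 1 2 3 4 5 by (simp add: algebra_simps)
 qed
 \<comment> \<open>A majorant with computable mean. The weights \<open>s\<close> and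
   \<open>1 / s\<close> balance a product of \<open>bsum\<close>, of variance 1, with an integral of
   second moment at most s^2. The four summands have means at most \<open>s\<close>,
   \<open>s\<close>, \<open>s\<close> and \<open>2 * s\<close>.\<close>
 define h where "h ww = s * ((bsum ww)^2 + 1) / 2 + (s * (bsum ww)^2 + (?R ww)^2 / s) / 2 + (s * (bsum ww)^2 + (?L ww)^2 / s) / 2 + s * ((bsum ww)^2 + 1)" for ww
 have ih: "integrable N h" unfolding h_def[abs_def] using ib(1) iR(1) iL(1) by simp
 have "(LINT ww|N. h ww) = s * (1 + 1) / 2 + (s * 1 + (LINT ww|N. (?R ww)^2) / s) / 2 + (s * 1 + (LINT ww|N. (?L ww)^2) / s) / 2 + s * (1 + 1)"
  unfolding h_def using ib iR(1) iL(1) by (simp add: prob_space)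
 also have "... <= s * (1 + 1) / 2 + (s * 1 + s) / 2 + (s * 1 + s) / 2 + s * (1 + 1)"
 proof -
  have "x / s <= s" if "x <= s^2" for x using that s by (simp add: pos_divide_le_eq power2_eq_square)
  from this[OF iR(2)] this[OF iL(2)] s show ?thesis by (intro add_mono divide_right_mono order_refl) simp_all
 qed
 finally have h5: "(LINT ww|N. h ww) <= 5 * s" by simp
 have le: "\<bar>chaos (bridge ww) - ?Y ww\<bar> <= h ww" for ww
 proof -
  let ?b = "bsum ww"
  have am: "\<bar>?b * x\<bar> <= (s * ?b^2 + x^2 / s) / 2" for x
  proof -
   have "(s * \<bar>?b\<bar>)^2 + \<bar>x\<bar>^2 = s * (s * ?b^2) + x^2" "2 * (s * \<bar>?b\<bar>) * \<bar>x\<bar> = 2 * (s * \<bar>?b * x\<bar>)"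
    by (simp_all add: power_mult_distrib power2_eq_square abs_mult)
   then have "2 * (s * \<bar>?b * x\<bar>) <= s * (s * ?b^2) + x^2" using sum_squares_bound[of "s * \<bar>?b\<bar>" "\<bar>x\<bar>"] by linarith
   also have "... = s * (s * ?b^2 + x^2 / s)" using s by (simp add: distrib_left)
   finally have "s * (2 * \<bar>?b * x\<bar>) <= s * (s * ?b^2 + x^2 / s)" by (simp only: mult.left_commute)
   then have "2 * \<bar>?b * x\<bar> <= s * ?b^2 + x^2 / s" using s by (simp only: mult_le_cancel_left_pos)
   then show ?thesis by simp
  qed
  have "\<bar>?b\<bar> <= (?b^2 + 1) / 2"
   using zero_le_power2[of "\<bar>?b\<bar> - 1"] by (simp add: power2_diff)
  then have "\<bar>cb\<bar> * \<bar>?b\<bar> <= s * ((?b^2 + 1) / 2)" using cb s by (intro mult_mono) auto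
  then have c1: "\<bar>- cb * ?b\<bar> <= s * (?b^2 + 1) / 2" by (simp add: abs_mult)
  have "\<bar>dl\<bar> * (?b^2 + 1) <= s * (?b^2 + 1)" using dl by (intro mult_right_mono) auto
  then have c2: "\<bar>dl * (?b^2 + 1)\<bar> <= s * (?b^2 + 1)" by (simp add: abs_mult)
  show ?thesis unfolding diff h_def using c1 c2 am[of "?R ww"] am[of "?L ww"] by linarith
 qed
 have mb: "(%ww. chaos (bridge ww)) : borm N"
  unfolding chaos_def
  by (intro borel_measurable_add borel_measurable_sum borel_measurable_times borel_measurable_const measurable_bridge) simp_all
 have mY: "?Y : borm N"
  by (intro borel_measurable_add measurable_step1_integral[OF part] measurable_step2_integral[OF part])
 have i: "integrable N (%ww. chaos (bridge ww) - ?Y ww)"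
  by (rule Bochner_Integration.integrable_bound[OF ih borel_measurable_diff[OF mb mY] AE_I2]) (use le abs_ge_self order_trans in fastforce)
 have "(LINT ww|N. \<bar>chaos (bridge ww) - ?Y ww\<bar>) <= (LINT ww|N. h ww)"
  by (rule integral_mono[OF integrable_abs[OF i] ih le])
 with iexp_integral_diff_le[OF prob_space_axioms mb mY i] h5 show ?thesis by linarith
qed

end

theorem (in brownian_space) chaos_limit:
 assumes f: "bdm unit_unif f" "(LINT x|unit_unif. f x) = 0" and K: "bdm unit_square K"
  and z: "AE x in unit_unif. (LINT y|unit_unif. K (x, y)) = 0" "AE y in unit_unif. (LINT x|unit_unif. K (x, y)) = 0"
  and X: "chaos_approx f K X"
 shows "(%n. CLINT w|cube. iexp (lin_stat n f w / sqrt (real n) + quad_stat n K w / real n)) \<longlonglongrightarrow> (CLINT ww|N. iexp (X ww))"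
proof (rule tendstoI)
 fix e :: real assume e: "0 < e"
 \<comment> \<open>27 = 19 + 1 + 1 + 5 + 1: the step kernels on the graph side, their vanishing
   error in n, the weak limit, the passage from bridge to motion, and the passage from step
   integrals to \<open>X\<close>.\<close>
 define s where "s = e / 27"
 have s: "0 < s" "0 < s^2" using e by (simp_all add: s_def)
 obtain m t c d where part: "unit_partition m t"
  and e1: "sq_norm unit_unif (%x. f x - step1 m t c x) <= ennreal (s^2)"
  and e2: "sq_norm unit_square (%p. K p - case_prod (step2 m t d) p) <= ennreal (s^2)"
  and e3: "sq_norm N (%ww. X ww - (step1_integral B m t c ww + step2_integral B m t d ww)) <= ennreal (s^2)"
  using X s(2) unfolding chaos_approx_def by meson
 have mX: "X : borm N" using X unfolding chaos_approx_def by (elim conjE)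
 interpret S: brownian_steps N B m t c d by unfold_locales (rule part)
 note b = S.chaos_approx_bounds[OF f K z s(1) e1 e2]
 let ?A = "%n. CLINT w|cube. iexp (lin_stat n f w / sqrt (real n) + quad_stat n K w / real n)"
 let ?C = "%n. CLINT w|cube. iexp (S.chaos (S.cells n w))" and ?b = "CLINT ww|N. iexp (S.chaos (S.bridge ww))"
 let ?Y = "CLINT ww|N. iexp (step1_integral B m t c ww + step2_integral B m t d ww)"
 obtain Z where Z: "!!n. 1 <= n ==> norm (?A n - ?C n) <= 19 * s + sqrt (Z * (1 / real n))" using b(5) by blast
 have 3: "norm (?b - ?Y) <= 5 * s" by (rule S.bridge_approx[OF s(1) b(1,4,2,3)])
 have 4: "norm (?Y - (CLINT ww|N. iexp (X ww))) <= s"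
  unfolding norm_minus_commute[of ?Y]
  by (rule iexp_integral_diff_le_sq_norm[OF prob_space_axioms mX _ e3 s(1)])
   (intro borel_measurable_add measurable_step1_integral[OF part] measurable_step2_integral[OF part])
 have "(%n. sqrt (Z * (1 / real n))) \<longlonglongrightarrow> sqrt (Z * 0)" by (intro tendsto_intros lim_1_over_n)
 then have "\<forall>\<^sub>F n in sequentially. sqrt (Z * (1 / real n)) < s" using s(1) by (intro order_tendstoD(2)) simp_all
 with eventually_ge_at_top[of 1] tendstoD[OF S.chaos_bridge_limit s(1)]
 show "\<forall>\<^sub>F n in sequentially. dist (?A n) (CLINT ww|N. iexp (X ww)) < e"
 proof eventually_elim
  case (elim n)
  have "norm (?A n - (CLINT ww|N. iexp (X ww))) <= norm (?A n - ?C n) + norm (?C n - ?b) + norm (?b - ?Y) + norm (?Y - (CLINT ww|N. iexp (X ww)))"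
   using norm_diff_triangle_ineq'[of "?A n" "CLINT ww|N. iexp (X ww)" "?C n"] norm_diff_triangle_ineq'[of "?C n" "CLINT ww|N. iexp (X ww)" ?b]
    norm_diff_triangle_ineq'[of ?b "CLINT ww|N. iexp (X ww)" ?Y] by linarith
  moreover have "norm (?C n - ?b) < s" using elim unfolding dist_norm by simp
  moreover have "27 * s = e" by (simp add: s_def)
  ultimately show ?case unfolding dist_norm using Z[of n] elim 3 4 by linarith
 qed
qed

section \<open>The covariance of the Gaussian part\<close>

text \<open>The two graphs share only the vertices \<open>Inl a\<close> and \<open>Inl b\<close>.
  Averaging first over the private vertices of \<open>H\<close> and then over those of
  \<open>H'\<close> splits the weight into two conditional densities. The set \<open>E'\<close>
  allows for both joins, with the second edge kept or deleted.\<close>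

lemma join_density:
 assumes W: "graphon W" and H: "simple_graph H" and H': "simple_graph H'"
  and ab: "(a, b) : ordered_edges H" and cd: "(c, d) : ordered_edges H'" and E': "E' <= edges H'"
 defines "J \<equiv> join_embed (a, b) (c, d)"
 shows "hom_density \<lparr>mverts = Inl ` verts H \<union> J ` verts H',
   medges = image_mset (map_prod Inl Inl) (mset_set (edges H)) + image_mset (map_prod J J) (mset_set E')\<rparr> W =
  (LINT p|unit_square. tdens2 a b (fst p) (snd p) H W * partial_density W E' (verts H') {c, d} (%v. if v = c then fst p else snd p))"
  (is "hom_density ?F W = _")
proof -
 let ?I = "mverts ?F"
 let ?P1 = "%x. \<Prod>(u, v)\<in>edges H. W (x (Inl u)) (x (Inl v))" and ?P2 = "%x. \<Prod>(u, v)\<in>E'. W (x (J u)) (x (J v))"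
 note v = ordered_edges_verts[OF H ab] and v' = ordered_edges_verts[OF H' cd]
 have J: "J u = (if u = c then Inl a else if u = d then Inl b else Inr u)" for u by (simp add: J_def join_embed_def)
 have injJ: "inj_on J (verts H')" using v v' by (auto simp: inj_on_def J split: if_splits)
 have E: "fst e : verts H" "snd e : verts H" if "e : edges H" for e using simple_graph_edges_subset[OF H] that by auto
 have E'2: "fst e : verts H'" "snd e : verts H'" if "e : E'" for e using simple_graph_edges_subset[OF H'] E' that by auto
 have ew: "edge_weight W ?F x = ?P1 x * ?P2 x" for x
  by (simp add: edge_weight_def prod_unfold_prod_mset multiset.map_comp o_def split_beta')
 have m: "(%z. ?P1 z * ?P2 z) : borm (\<Pi>\<^sub>M i\<in>?I. unit_unif)"
  unfolding split_beta'
  by (intro borel_measurable_times borel_measurable_prod measurable_graphon[OF W] measurable_component_singleton) (auto dest: E E'2)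
 have "hom_density ?F W = (LINT z|(\<Pi>\<^sub>M i\<in>?I. unit_unif). ?P1 z * ?P2 z)" unfolding hom_density_def ew ..
 also have "... = (LINT w|cube. ?P1 (\<lambda>i\<in>?I. w i) * ?P2 (\<lambda>i\<in>?I. w i))"
  using integral_PiM_cube[OF inj_on_id m] by simp
 also have "... = (LINT w|cube. ?P1 w * ?P2 w)"
 proof (intro lint_cong refl arg_cong2[where f = "(*)"] prod.cong)
  fix w :: "nat + nat => real" and e
  show "(case e of (u, v) => W ((\<lambda>i\<in>?I. w i) (Inl u)) ((\<lambda>i\<in>?I. w i) (Inl v))) = (case e of (u, v) => W (w (Inl u)) (w (Inl v)))" if "e : edges H"
   using E[OF that] by (simp add: split_beta')
  show "(case e of (u, v) => W ((\<lambda>i\<in>?I. w i) (J u)) ((\<lambda>i\<in>?I. w i) (J v))) = (case e of (u, v) => W (w (J u)) (w (J v)))" if "e : E'"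
   using E'2[OF that] by (simp add: split_beta')
 qed
 also have "... = (LINT w|cube. cond_mean (J ` verts H') ?P1 w * ?P2 w)"
 proof (rule integral_mult_cond_mean)
  show "bdm cube ?P1" "bdm cube ?P2" by (rule bdm_graphon_prod[OF W])+
  show "depends_on (J ` verts H') ?P2"
   unfolding split_beta' by (intro depends_on_prod depends_on_vertex2 imageI E'2)
 qed
 also have "... = (LINT w|cube. ?P2 w * tdens2 a b (w (Inl a)) (w (Inl b)) H W)"
 proof (intro lint_cong refl)
  fix w :: "nat + nat => real" assume w: "w : space cube"
  have "cond_mean (J ` verts H') ?P1 w = partial_density W (edges H) (verts H) {a, b} (%u. w (Inl u))"
  proof (rule cond_mean_prod_graphon[OF W _ simple_graph_edges_subset[OF H] _ _ w])
   show "Inl u : J ` verts H' \<longleftrightarrow> u : {a, b}" for u :: nat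
    using v' by (auto simp: J image_iff split: if_splits)
  qed (use v in auto)
  also have "... = tdens2 a b (w (Inl a)) (w (Inl b)) H W" using tdens2_partial[of a b "%u. w (Inl u)" H W] v by simp
  finally show "cond_mean (J ` verts H') ?P1 w * ?P2 w = ?P2 w * tdens2 a b (w (Inl a)) (w (Inl b)) H W" by simp
 qed
 also have "... = (LINT w|cube. cond_mean {Inl a, Inl b} ?P2 w * tdens2 a b (w (Inl a)) (w (Inl b)) H W)"
 proof (rule integral_mult_cond_mean)
  show "bdm cube ?P2" by (rule bdm_graphon_prod[OF W])
  show "bdm cube (%w :: nat + nat => real. tdens2 a b (w (Inl a)) (w (Inl b)) H W)"
   using bdm_vertex2[OF bdm_tdens2[OF W H], of a b "Inl a" "Inl b"] v by simp
  show "depends_on {Inl a, Inl b} (%w :: nat + nat => real. tdens2 a b (w (Inl a)) (w (Inl b)) H W)"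
   by (rule depends_on_vertex2) simp_all
 qed
 also have "... = (LINT w|cube. (%p. tdens2 a b (fst p) (snd p) H W * partial_density W E' (verts H') {c, d} (%v. if v = c then fst p else snd p)) (w (Inl a :: nat + nat), w (Inl b)))"
 proof (rule lint_cong[OF refl])
  fix w :: "nat + nat => real" assume w: "w : space cube"
  have "cond_mean {Inl a, Inl b} ?P2 w = partial_density W E' (verts H') {c, d} (%u. w (J u))"
  proof (rule cond_mean_prod_graphon[OF W injJ _ _ _ w])
   show "E' <= verts H' \<times> verts H'" using simple_graph_edges_subset[OF H'] E' by auto
   show "J u : {Inl a, Inl b} \<longleftrightarrow> u : {c, d}" for u using v v' by (auto simp: J)
  qed (use v' in auto)
  also have "... = partial_density W E' (verts H') {c, d} (%v. if v = c then w (Inl a) else w (Inl b))"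
   by (rule partial_density_cong) (use v' in \<open>auto simp: J\<close>)
  finally show "cond_mean {Inl a, Inl b} ?P2 w * tdens2 a b (w (Inl a)) (w (Inl b)) H W =
    (%p. tdens2 a b (fst p) (snd p) H W * partial_density W E' (verts H') {c, d} (%v. if v = c then fst p else snd p)) (w (Inl a), w (Inl b))"
   by (simp only: fst_conv snd_conv mult.commute)
 qed
 also have "... = (LINT p|unit_square. tdens2 a b (fst p) (snd p) H W * partial_density W E' (verts H') {c, d} (%v. if v = c then fst p else snd p))"
 proof (rule integral_cube_pair)
  show "Inl a ~= Inl b" using v by simp
  show "(%p. tdens2 a b (fst p) (snd p) H W * partial_density W E' (verts H') {c, d} (%v. if v = c then fst p else snd p)) : borm unit_square"
   using v simple_graph_edges_subset[OF H'] E'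
   by (intro bdm_measurable bdm_mult bdm_tdens2[OF W H] bdm_partial_density[OF W _ measurable_pair_choice]) auto
 qed
 finally show ?thesis .
qed

text \<open>With T and T' the conditional densities without the joined edge, the weak join
  integrates W T T' and the strong join W T W T'. The difference carries the Bernoulli variance
  \<open>W * (1 - W)\<close>, which identifies the covariance of the statement as that of the
  noise.\<close>

lemma weak_minus_strong:
 assumes W: "graphon W" and H: "simple_graph H" and H': "simple_graph H'"
  and e: "e : ordered_edges H" and e': "e' : ordered_edges H'"
 shows "hom_density (weak_join H e H' e') W - hom_density (strong_join H e H' e') W =
  (LINT p|unit_square. W (fst p) (snd p) * (1 - W (fst p) (snd p)) *
   (tdens_minus (fst e) (snd e) (fst p) (snd p) H W * tdens_minus (fst e') (snd e') (fst p) (snd p) H' W))"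
proof -
 interpret S: prob_space unit_square by (rule prob_space_unit_square)
 obtain a b c d where ee: "e = (a, b)" "e' = (c, d)" by (cases e, cases e')
 note ab = e[unfolded ee] and cd = e'[unfolded ee]
 have ne: "c ~= d" using ordered_edges_verts[OF H' cd] by simp
 let ?W = "%p. W (fst p) (snd p)" and ?T = "%p. tdens_minus a b (fst p) (snd p) H W" and ?T' = "%p. tdens_minus c d (fst p) (snd p) H' W"
 have less: "u < v" if "(u, v) : edges H'" for u v using H' that by (auto simp: simple_graph_def)
 have E: "edges H' - {(c, d), prod.swap (c, d)} = {(u, v)\<in>edges H'. \<not> (u : {c, d} & v : {c, d})}"
  using less[of c c] less[of d d] by auto
 have sp: "tdens2 a b (fst p) (snd p) H W = ?W p * ?T p" "tdens2 c d (fst p) (snd p) H' W = ?W p * ?T' p"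
  if "p : space unit_square" for p
  using that tdens2_split[OF W H ab, of "fst p" "snd p"] tdens2_split[OF W H' cd, of "fst p" "snd p"]
  by (simp_all add: space_pair_measure mem_Times_iff)
 have "hom_density (weak_join H e H' e') W = (LINT p|unit_square. tdens2 a b (fst p) (snd p) H W * ?T' p)"
  unfolding weak_join_def ee join_density[OF W H H' ab cd Diff_subset] unfolding E tdens_minus_def ..
 then have w: "hom_density (weak_join H e H' e') W = (LINT p|unit_square. ?W p * ?T p * ?T' p)"
  using sp(1) by (simp cong: lint_cong)
 have "hom_density (strong_join H e H' e') W = (LINT p|unit_square. tdens2 a b (fst p) (snd p) H W * tdens2 c d (fst p) (snd p) H' W)"
  unfolding strong_join_def ee join_density[OF W H H' ab cd subset_refl]
  using tdens2_partial[OF ne, of "%v. if v = c then fst p else snd p" H' W for p] ne by simp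
 then have s: "hom_density (strong_join H e H' e') W = (LINT p|unit_square. (?W p * ?T p) * (?W p * ?T' p))"
  using sp by (simp cong: lint_cong)
 have i: "integrable unit_square (%p. ?W p * ?T p * ?T' p)" "integrable unit_square (%p. (?W p * ?T p) * (?W p * ?T' p))"
  by (intro bdm_integrable[OF S.finite_measure_axioms] bdm_mult bdm_graphon[OF W]
    bdm_tdens_minus[OF W H] bdm_tdens_minus[OF W H'])+
 have "hom_density (weak_join H e H' e') W - hom_density (strong_join H e H' e') W =
   (LINT p|unit_square. ?W p * ?T p * ?T' p - (?W p * ?T p) * (?W p * ?T' p))"
  unfolding w s by (rule lint_diff[OF i, symmetric])
 also have "... = (LINT p|unit_square. ?W p * (1 - ?W p) * (?T p * ?T' p))"
  by (rule lint_cong[OF refl]) (simp add: algebra_simps)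
 finally show ?thesis unfolding ee fst_conv snd_conv .
qed

lemma limit_cov_noise_kernel:
 assumes W: "graphon W" and H: "simple_graph H" and H': "simple_graph H'"
 shows "(LINT p|unit_square. W (fst p) (snd p) * (1 - W (fst p) (snd p)) * (case_prod (noise_kernel H W) p * case_prod (noise_kernel H' W) p)) =
  2 * limit_cov H H' W"
proof -
 interpret S: prob_space unit_square by (rule prob_space_unit_square)
 let ?A = "real (card (Aut H))" and ?A' = "real (card (Aut H'))"
 let ?W = "%p. W (fst p) (snd p) * (1 - W (fst p) (snd p))"
 let ?T = "%e p. tdens_minus (fst e) (snd e) (fst p) (snd p) H W" and ?T' = "%e p. tdens_minus (fst e) (snd e) (fst p) (snd p) H' W"
 have "?W p * (case_prod (noise_kernel H W) p * case_prod (noise_kernel H' W) p) =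
   (1 / (?A * ?A')) * (SUM (e, e'):ordered_edges H \<times> ordered_edges H'. ?W p * (?T e p * ?T' e' p))" for p
 proof -
  have *: "(SUM z:S \<times> S'. x * (F (fst z) * F' (snd z))) = x * ((SUM e:S. F e) * (SUM e':S'. F' e'))"
   for x :: real and F F' :: "nat \<times> nat => real" and S S'
   unfolding sum_product sum.cartesian_product split_beta' by (rule sum_distrib_left[symmetric])
  show ?thesis
   unfolding noise_kernel_def split_beta' *[of "?W p" "%e. ?T e p" "%e'. ?T' e' p" "ordered_edges H" "ordered_edges H'"] by simp
 qed
 then have "(LINT p|unit_square. ?W p * (case_prod (noise_kernel H W) p * case_prod (noise_kernel H' W) p)) =
   (1 / (?A * ?A')) * (LINT p|unit_square. (SUM x:ordered_edges H \<times> ordered_edges H'. ?W p * (?T (fst x) p * ?T' (snd x) p)))"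
  by (simp only: split_beta' integral_mult_right_zero)
 also have "(LINT p|unit_square. (SUM x:ordered_edges H \<times> ordered_edges H'. ?W p * (?T (fst x) p * ?T' (snd x) p))) =
   (SUM x:ordered_edges H \<times> ordered_edges H'. LINT p|unit_square. ?W p * (?T (fst x) p * ?T' (snd x) p))"
  by (intro lint_sum bdm_integrable[OF S.finite_measure_axioms] bdm_mult bdm_diff bdm_const
    bdm_graphon[OF W] bdm_tdens_minus[OF W H] bdm_tdens_minus[OF W H'])
 also have "... = (SUM x:ordered_edges H \<times> ordered_edges H'. hom_density (weak_join H (fst x) H' (snd x)) W - hom_density (strong_join H (fst x) H' (snd x)) W)"
  by (intro sum.cong refl weak_minus_strong[OF W H H', symmetric]) auto
 finally show ?thesis unfolding limit_cov_def split_beta' by simp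
qed

lemma noise_kernel_sym: "noise_kernel H W x y = noise_kernel H W y x"
proof -
 have "tdens_minus a b x y H W = tdens_minus b a y x H W" if "a ~= b" for a b
  unfolding tdens_minus_def insert_commute[of b a]
  by (rule partial_density_cong) (use that in auto)
 then have "(SUM (a, b):ordered_edges H. tdens_minus a b x y H W) = (SUM (a, b):ordered_edges H. tdens_minus a b y x H W)"
  by (intro sum.reindex_bij_witness[where i = prod.swap and j = prod.swap]) (auto simp: ordered_edges_def)
 then show ?thesis unfolding noise_kernel_def by simp
qed

text \<open>Twice the covariance form: the factor with exponent minus one quarter of this integral,
  left behind by the noise, is therefore exactly the Gaussian characteristic function.\<close>

lemma integral_noise_var_sum:
 fixes H :: "'a => sgraph"
 assumes W: "graphon W" and H: "!!i. i : I ==> simple_graph (H i)"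
 shows "(LINT p|unit_square. noise_var W (%p. SUM i:I. a i * case_prod (noise_kernel (H i) W) p) p) =
  2 * (SUM i:I. SUM j:I. a i * limit_cov (H i) (H j) W * a j)"
proof -
 interpret S: prob_space unit_square by (rule prob_space_unit_square)
 let ?W = "%p. W (fst p) (snd p) * (1 - W (fst p) (snd p))"
 let ?f = "%i j p. ?W p * (case_prod (noise_kernel (H i) W) p * case_prod (noise_kernel (H j) W) p)"
 have i: "integrable unit_square (?f i j)" if "i : I" "j : I" for i j
  by (intro bdm_integrable[OF S.finite_measure_axioms] bdm_mult bdm_diff bdm_const
    bdm_graphon[OF W] bdm_noise_kernel[OF W] H that)
 have "noise_var W (%p. SUM i:I. a i * case_prod (noise_kernel (H i) W) p) p = (SUM i:I. SUM j:I. (a i * a j) * ?f i j p)" for p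
 proof -
  have "x * (SUM i:I. a i * k i)^2 = (SUM i:I. SUM j:I. (a i * a j) * (x * (k i * k j)))" for x and k :: "'a => real"
  proof -
   have "x * (SUM i:I. a i * k i)^2 = x * (SUM i:I. SUM j:I. (a i * k i) * (a j * k j))" unfolding power2_eq_square sum_product ..
   also have "... = (SUM i:I. SUM j:I. x * ((a i * k i) * (a j * k j)))" unfolding sum_distrib_left ..
   also have "... = (SUM i:I. SUM j:I. (a i * a j) * (x * (k i * k j)))" by (intro sum.cong refl) (simp only: ac_simps)
   finally show ?thesis .
  qed
  then show ?thesis unfolding noise_var_def .
 qed
 then have "(LINT p|unit_square. noise_var W (%p. SUM i:I. a i * case_prod (noise_kernel (H i) W) p) p) =
   (LINT p|unit_square. (SUM i:I. SUM j:I. (a i * a j) * ?f i j p))" by (simp only:)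
 also have "... = (SUM i:I. SUM j:I. (a i * a j) * (LINT p|unit_square. ?f i j p))" by (rule integral_double_sum) (rule i)
 also have "... = (SUM i:I. SUM j:I. (a i * a j) * (2 * limit_cov (H i) (H j) W))"
  by (intro sum.cong refl arg_cong2[where f = "(*)"] limit_cov_noise_kernel[OF W] H)
 finally show ?thesis by (simp add: sum_distrib_left ac_simps)
qed

section \<open>Independence of the Gaussian part and the Brownian motion\<close>

lemma (in prob_space) indep_var_of_algebras:
 assumes ind: "indep_set (sets A) (sets C)" and sp: "space A = space M" "space C = space M"
  and X: "X : A \<rightarrow>\<^sub>M S" and Y: "Y : C \<rightarrow>\<^sub>M T"
 shows "indep_var S X T Y"
proof -
 have sub: "sets A <= events" "sets C <= events" using ind unfolding indep_sets2_eq by auto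
 have rv: "random_variable S X" "random_variable T Y"
  using sub measurable_sets[OF X] measurable_sets[OF Y] measurable_space[OF X] measurable_space[OF Y] unfolding sp
  by (auto intro!: measurableI)
 have "sigma_sets (space M) {X -` B Int space M |B. B : sets S} <= sets A"
  using measurable_sets[OF X] unfolding sp[symmetric] by (intro sets.sigma_sets_subset) (auto simp: sp)
 moreover have "sigma_sets (space M) {Y -` B Int space M |B. B : sets T} <= sets C"
  using measurable_sets[OF Y] unfolding sp(2)[symmetric] by (intro sets.sigma_sets_subset) auto
 ultimately have "indep_set (sigma_sets (space M) {X -` B Int space M |B. B : sets S}) (sigma_sets (space M) {Y -` B Int space M |B. B : sets T})"
  using ind unfolding indep_sets2_eq by blast
 then show ?thesis unfolding indep_var_eq using rv by simp
qed

text \<open>The integrals are chosen versions and need not be measurable with respect to the values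
  of \<open>B\<close>. Independence is therefore applied to step integrals, which are polynomials in
  finitely many values of \<open>B\<close>, and transferred by L2 approximation with total error
  \<open>2 * s\<close>.\<close>

lemma (in brownian_space) char_add_independent:
 assumes X: "chaos_approx f K X" and g: "!!i. i : I ==> g i : borm N"
  and ind: "independent_families N I g {0..1} B"
 shows "(CLINT ww|N. iexp (X ww + (SUM i:I. a i * g i ww))) = (CLINT ww|N. iexp (X ww)) * (CLINT ww|N. iexp (SUM i:I. a i * g i ww))"
proof -
 let ?G = "%ww. SUM i:I. a i * g i ww"
 let ?Ag = "vimage_algebra (space N) (%ww. \<lambda>i\<in>I. g i ww) (\<Pi>\<^sub>M i\<in>I. borel)"
 let ?AB = "vimage_algebra (space N) (%ww. \<lambda>j\<in>{0..1}. B j ww) (\<Pi>\<^sub>M j\<in>{0..1}. borel)"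
 have G: "?G : borm N" by (intro borel_measurable_sum borel_measurable_times borel_measurable_const g)
 have mX: "X : borm N" using X unfolding chaos_approx_def by (elim conjE)
 have Gm: "?G : borm ?Ag"
 proof (intro borel_measurable_sum borel_measurable_times borel_measurable_const)
  fix i assume i: "i : I"
  have "(%ww. \<lambda>i\<in>I. g i ww) : ?Ag \<rightarrow>\<^sub>M (\<Pi>\<^sub>M i\<in>I. borel)" by (rule measurable_vimage_algebra1) (auto simp: space_PiM)
  from measurable_compose[OF this measurable_component_singleton[OF i]] show "g i : borm ?Ag" using i by simp
 qed
 have Bm: "B s : borm ?AB" if s: "s : {0..1}" for s
 proof -
  have "(%ww. \<lambda>j\<in>{0..1}. B j ww) : ?AB \<rightarrow>\<^sub>M (\<Pi>\<^sub>M j\<in>{0..1}. borel)" by (rule measurable_vimage_algebra1) (auto simp: space_PiM)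
  from measurable_compose[OF this measurable_component_singleton[OF s]] show ?thesis using s by simp
 qed
 note int = bdm_integrable[OF finite_measure_axioms bdm_iexp]
 have le: "norm ((CLINT ww|N. iexp (X ww + ?G ww)) - (CLINT ww|N. iexp (X ww)) * (CLINT ww|N. iexp (?G ww))) <= 2 * s" if s: "0 < s" for s
 proof -
  have "0 < s^2" using s by simp
  then obtain m t c d where part: "unit_partition m t"
   and e3: "sq_norm N (%ww. X ww - (step1_integral B m t c ww + step2_integral B m t d ww)) <= ennreal (s^2)"
   using X unfolding chaos_approx_def by meson
  let ?Y = "%ww. step1_integral B m t c ww + step2_integral B m t d ww"
  have Y: "?Y : borm N"
   by (intro borel_measurable_add measurable_step1_integral[OF part] measurable_step2_integral[OF part])
  have inc: "(%ww. B (t (Suc k)) ww - B (t k) ww) : borm ?AB" if "k < m" for k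
   using that by (intro borel_measurable_diff Bm unit_partition_range[OF part]) auto
  have Ym: "?Y : borm ?AB"
   unfolding step1_integral_def step2_integral_def split_beta'
   by (intro borel_measurable_add borel_measurable_sum borel_measurable_times borel_measurable_const inc) auto
  have "indep_var borel (%ww. iexp (?G ww)) borel (%ww. iexp (?Y ww))"
   by (rule indep_var_of_algebras[OF ind[unfolded independent_families_def] space_vimage_algebra space_vimage_algebra
    bdm_measurable[OF bdm_iexp[OF Gm]] bdm_measurable[OF bdm_iexp[OF Ym]]])
  from indep_var_lebesgue_integral[OF this int[OF G] int[OF Y]]
  have p: "(CLINT ww|N. iexp (?Y ww + ?G ww)) = (CLINT ww|N. iexp (?Y ww)) * (CLINT ww|N. iexp (?G ww))"
   by (simp add: exp_add distrib_left mult.commute)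
  have 1: "norm ((CLINT ww|N. iexp (X ww + ?G ww)) - (CLINT ww|N. iexp (?Y ww + ?G ww))) <= s"
  proof (rule iexp_integral_diff_le_sq_norm[OF prob_space_axioms _ _ _ s])
   show "(%ww. X ww + ?G ww) : borm N" by (rule borel_measurable_add[OF mX G])
   show "(%ww. ?Y ww + ?G ww) : borm N" by (rule borel_measurable_add[OF Y G])
   show "sq_norm N (%ww. X ww + ?G ww - (?Y ww + ?G ww)) <= ennreal (s^2)" using e3 by simp
  qed
  have 2: "norm ((CLINT ww|N. iexp (?Y ww)) - (CLINT ww|N. iexp (X ww))) <= s"
   unfolding norm_minus_commute[of "CLINT ww|N. iexp (?Y ww)"] by (rule iexp_integral_diff_le_sq_norm[OF prob_space_axioms mX Y e3 s])
  have "norm (CLINT ww|N. iexp (?G ww)) <= (LINT ww|N. norm (iexp (?G ww)))" by (rule integral_norm_bound)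
  then have 3: "norm (CLINT ww|N. iexp (?G ww)) <= 1" by (simp add: prob_space)
  have "norm ((CLINT ww|N. iexp (?Y ww + ?G ww)) - (CLINT ww|N. iexp (X ww)) * (CLINT ww|N. iexp (?G ww))) <= s * 1"
   unfolding p left_diff_distrib[symmetric] norm_mult by (rule mult_mono[OF 2 3]) (use s in simp_all)
  with 1 norm_diff_triangle_ineq'[of "CLINT ww|N. iexp (X ww + ?G ww)" "(CLINT ww|N. iexp (X ww)) * (CLINT ww|N. iexp (?G ww))" "CLINT ww|N. iexp (?Y ww + ?G ww)"]
  show ?thesis by linarith
 qed
 have "norm ((CLINT ww|N. iexp (X ww + ?G ww)) - (CLINT ww|N. iexp (X ww)) * (CLINT ww|N. iexp (?G ww))) <= 0"
 proof (rule field_le_epsilon)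
  fix e :: real assume "0 < e"
  then show "norm ((CLINT ww|N. iexp (X ww + ?G ww)) - (CLINT ww|N. iexp (X ww)) * (CLINT ww|N. iexp (?G ww))) <= 0 + e" using le[of "e / 2"] by simp
 qed
 then show ?thesis by simp
qed


section \<open>Convergence of the joint characteristic function\<close>

lemma lin_stat_sum: "lin_stat n (%x. SUM i:I. a i * f i x) w = (SUM i:I. a i * lin_stat n (f i) w)"
 unfolding lin_stat_def sum_distrib_left by (rule sum.swap)

lemma quad_stat_sum: "quad_stat n (%p. SUM i:I. a i * K i p) w = (SUM i:I. a i * quad_stat n (K i) w)"
 unfolding quad_stat_def split_beta' sum_distrib_left by (rule sum.swap)

lemma noise_stat_sum: "noise_stat n W (%p. SUM i:I. a i * g i p) w = (SUM i:I. a i * noise_stat n W (g i) w)"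
proof -
 have "noise_stat n W (%p. SUM i:I. a i * g i p) w =
   (SUM e:distinct_pairs n. SUM i:I. a i * ((edge_ind W (fst e) (snd e) w - W (w (fst e, fst e)) (w (snd e, snd e))) * g i (w (fst e, fst e), w (snd e, snd e))))"
  unfolding noise_stat_def split_beta' sum_distrib_left by (intro sum.cong refl) (simp only: ac_simps)
 also have "... = (SUM i:I. a i * noise_stat n W (g i) w)"
  unfolding noise_stat_def split_beta' sum_distrib_left by (rule sum.swap)
 finally show ?thesis .
qed

definition approx_stat :: "nat => sgraph => (real => real => real) => (nat \<times> nat => real) => real" where
 "approx_stat n H W w = (if H_regular H W
   then (quad_stat n (case_prod (reg_kernel H W)) w + noise_stat n W (case_prod (noise_kernel H W)) w / 2) / real n
   else lin_stat n (irr_kernel H W) w / sqrt (real n))"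

lemma bdm_approx_stat:
 assumes W: "graphon W" and H: "simple_graph H"
 shows "bdm cube (approx_stat n H W)"
proof -
 have "bdm cube (%w. (quad_stat n (case_prod (reg_kernel H W)) w + noise_stat n W (case_prod (noise_kernel H W)) w * (1 / 2)) * (1 / real n))"
  by (intro bdm_mult bdm_add bdm_const bdm_quad_stat bdm_noise_stat bdm_reg_kernel bdm_noise_kernel W H)
 moreover have "bdm cube (%w. lin_stat n (irr_kernel H W) w * (1 / sqrt (real n)))"
  by (intro bdm_mult bdm_const bdm_lin_stat bdm_irr_kernel W H)
 ultimately show ?thesis unfolding approx_stat_def[abs_def] by (cases "H_regular H W") simp_all
qed

lemma Z_stat_approx:
 assumes "graphon W" "pattern_graph H"
 shows "(%n. LINT w|cube. (Z_stat n H W (cube_graph n W w) - approx_stat n H W w)^2) \<longlonglongrightarrow> 0"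
 using Z_stat_regular_approx[OF assms] Z_stat_irregular_approx[OF assms] unfolding approx_stat_def by (cases "H_regular H W") simp_all

lemma reg_kernel_degenerate:
 assumes W: "graphon W" and H: "pattern_graph H" and reg: "H_regular H W"
 shows "AE x in unit_unif. (LINT y|unit_unif. case_prod (reg_kernel H W) (x, y)) = 0"
  "AE y in unit_unif. (LINT x|unit_unif. case_prod (reg_kernel H W) (x, y)) = 0"
proof -
 show "AE x in unit_unif. (LINT y|unit_unif. case_prod (reg_kernel H W) (x, y)) = 0"
  using H_regular_irr_kernel[OF H reg] AE_space by eventually_elim (simp add: integral_reg_kernel[OF W H])
 show "AE y in unit_unif. (LINT x|unit_unif. case_prod (reg_kernel H W) (x, y)) = 0"
  using H_regular_irr_kernel[OF H reg] AE_space by eventually_elim (simp add: integral_reg_kernel[OF W H])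
qed

text \<open>Supplies the tightness. In the regular case it is the degeneracy of
  \<open>reg_kernel\<close> that keeps the quadratic part bounded after division by n.\<close>

lemma approx_stat_sq_le:
 assumes W: "graphon W" and H: "pattern_graph H"
 shows "EX C. \<forall>n\<ge>1. (LINT w|cube. (approx_stat n H W w)^2) <= C"
proof (cases "H_regular H W")
 case False
 note H' = pattern_graphD[OF H]
 let ?D = "LINT x|unit_unif. (irr_kernel H W x)^2"
 show ?thesis
 proof (intro exI[of _ "2 * ?D"] allI impI)
  fix n :: nat assume n: "1 <= n"
  have "(LINT w|cube. (approx_stat n H W w)^2) = (LINT w|cube. (lin_stat n (irr_kernel H W) w)^2) / real n"
   unfolding approx_stat_def using False by (simp add: power_divide)
  also have "... <= 2 * ?D * real n / real n"
   by (intro divide_right_mono lin_stat_sq_le[OF bdm_irr_kernel[OF W H'(1)] integral_irr_kernel[OF W H] order_refl n]) simp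
  finally show "(LINT w|cube. (approx_stat n H W w)^2) <= 2 * ?D" using n by simp
 qed
next
 case True
 note H' = pattern_graphD[OF H]
 let ?K = "case_prod (reg_kernel H W)" and ?g = "case_prod (noise_kernel H W)"
 let ?D = "LINT p|unit_square. (?K p)^2" and ?E = "LINT p|unit_square. (?g p)^2"
 note bK = bdm_reg_kernel[OF W H'(1)] and bg = bdm_noise_kernel[OF W H'(1)]
 note z = reg_kernel_degenerate[OF W H True]
 have z0: "(LINT p|unit_square. ?K p) = 0" unfolding integral_unit_square(1)[OF bK] by (rule integral_eq_zero_AE[OF z(1)])
 show ?thesis
 proof (intro exI[of _ "32 * ?D + 8 * ?E"] allI impI)
  fix n :: nat assume n: "1 <= n"
  have bh: "bdm cube (%w. (1 / 2) * noise_stat n W ?g w)"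
   by (intro bdm_mult bdm_const bdm_noise_stat[OF W bg])
  have "(LINT w|cube. (approx_stat n H W w)^2) = (LINT w|cube. (quad_stat n ?K w + (1 / 2) * noise_stat n W ?g w)^2) / (real n)^2"
   unfolding approx_stat_def using True by (simp add: power_divide)
  also have "... <= (2 * (LINT w|cube. (quad_stat n ?K w)^2) + 2 * (LINT w|cube. ((1 / 2) * noise_stat n W ?g w)^2)) / (real n)^2"
   by (intro divide_right_mono integral_square_add_le bdm_quad_stat bK bh) simp
  also have "(LINT w|cube. ((1 / 2) * noise_stat n W ?g w)^2) = (1 / 2)^2 * (LINT w|cube. (noise_stat n W ?g w)^2)"
   unfolding power_mult_distrib by (rule integral_mult_right_zero)
  also have "(2 * (LINT w|cube. (quad_stat n ?K w)^2) + 2 * ((1 / 2)^2 * (LINT w|cube. (noise_stat n W ?g w)^2))) / (real n)^2 <=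
    (2 * (16 * ?D * (real n ^ 4 / real n ^ 2)) + 2 * ((1 / 2)^2 * (16 * ?E * (real n)^2))) / (real n)^2"
   by (intro divide_right_mono add_mono mult_left_mono noise_stat_sq_le[OF W bg n] quad_stat_sq_le[OF bK order_refl n _ z0 z]) simp_all
  also have "... = 32 * ?D + 8 * ?E"
  proof -
   have "real n ^ 4 / real n ^ 2 = (real n)^2" using n by (simp add: power2_eq_square power4_eq_xxxx)
   then show ?thesis using n by (simp add: add_divide_distrib power2_eq_square)
  qed
  finally show "(LINT w|cube. (approx_stat n H W w)^2) <= 32 * ?D + 8 * ?E" .
 qed
qed

lemma Z_stat_approx_char:
 assumes W: "graphon W" and H: "!!i. i : I ==> pattern_graph (H i)"
 shows "(%n. (CLINT w|cube. iexp (SUM i:I. a i * Z_stat n (H i) W (cube_graph n W w))) - (CLINT w|cube. iexp (SUM i:I. a i * approx_stat n (H i) W w))) \<longlonglongrightarrow> 0"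
proof -
 let ?Z = "%n i w. Z_stat n (H i) W (cube_graph n W w)" and ?A = "%n i. approx_stat n (H i) W"
 let ?r = "%n. SUM i:I. \<bar>a i\<bar> * sqrt (LINT w|cube. (?Z n i w - ?A n i w)^2)"
 have bA: "bdm cube (?A n i)" if "i : I" for n i by (rule bdm_approx_stat[OF W pattern_graphD(1)[OF H[OF that]]])
 have bZ: "bdm cube (?Z n i)" for n i by (rule bdm_of_graph[OF W])
 have le: "norm ((CLINT w|cube. iexp (SUM i:I. a i * ?Z n i w)) - (CLINT w|cube. iexp (SUM i:I. a i * ?A n i w))) <= ?r n" for n
 proof -
  have b: "bdm cube (%w. SUM i:I. a i * ?Z n i w)" "bdm cube (%w. SUM i:I. a i * ?A n i w)"
   by (intro bdm_sum bdm_mult bdm_const bZ bA; assumption)+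
  have i: "integrable cube (%w. \<bar>?Z n i w - ?A n i w\<bar>)" if "i : I" for i
   by (intro integrable_abs integrable_cube bdm_diff bZ bA that)
  have "norm ((CLINT w|cube. iexp (SUM i:I. a i * ?Z n i w)) - (CLINT w|cube. iexp (SUM i:I. a i * ?A n i w))) <=
    (LINT w|cube. \<bar>(SUM i:I. a i * ?Z n i w) - (SUM i:I. a i * ?A n i w)\<bar>)"
   by (rule iexp_integral_diff_le[OF prob_space_cube bdm_measurable[OF b(1)] bdm_measurable[OF b(2)] integrable_cube[OF bdm_diff[OF b]]])
  also have "... <= (LINT w|cube. (SUM i:I. \<bar>a i\<bar> * \<bar>?Z n i w - ?A n i w\<bar>))"
  proof (rule integral_mono[OF integrable_abs[OF integrable_cube[OF bdm_diff[OF b]]]])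
   show "integrable cube (%w. SUM i:I. \<bar>a i\<bar> * \<bar>?Z n i w - ?A n i w\<bar>)"
    by (intro lintb_sum integrable_mult_right i)
   fix w :: "nat \<times> nat => real"
   have "\<bar>(SUM i:I. a i * ?Z n i w) - (SUM i:I. a i * ?A n i w)\<bar> = \<bar>SUM i:I. a i * (?Z n i w - ?A n i w)\<bar>"
    by (simp only: sum_subtractf right_diff_distrib)
   also have "... <= (SUM i:I. \<bar>a i * (?Z n i w - ?A n i w)\<bar>)" by (rule sum_abs)
   finally show "\<bar>(SUM i:I. a i * ?Z n i w) - (SUM i:I. a i * ?A n i w)\<bar> <= (SUM i:I. \<bar>a i\<bar> * \<bar>?Z n i w - ?A n i w\<bar>)" by (simp only: abs_mult)
  qed
  also have "... = (SUM i:I. LINT w|cube. \<bar>a i\<bar> * \<bar>?Z n i w - ?A n i w\<bar>)"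
   by (intro lint_sum integrable_mult_right i)
  also have "... <= ?r n"
   unfolding integral_mult_right_zero
   by (intro sum_mono mult_left_mono integral_abs_le_sqrt prob_space_cube bdm_diff bZ bA) simp_all
  finally show ?thesis .
 qed
 have "?r \<longlonglongrightarrow> (SUM i:I. \<bar>a i\<bar> * sqrt 0)" by (intro tendsto_intros Z_stat_approx[OF W] H)
 then have "?r \<longlonglongrightarrow> 0" by simp
 then show ?thesis by (rule Lim_null_comparison[OF always_eventually[OF allI[OF le]]])
qed


lemma sum_tail:
 fixes x :: "nat => real"
 shows "(SUM i:{1..r}. a i * (if i <= q then 0 else x i)) = (SUM i:{q+1..r}. a i * x i)"
 by (rule sum.mono_neutral_cong_right) auto

text \<open>The graphs of the statement live on arbitrary spaces; integrals depend only on their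
  law, so they may be computed on the cube.\<close>

lemma integral_random_graph:
 fixes F :: "sgraph => 'c::{banach, second_countable_topology}"
 assumes W: "graphon W" and G: "G : M \<rightarrow>\<^sub>M count_space (graphs_on n)"
  and d: "distr M (count_space (graphs_on n)) G = graphon_random_graph n W"
 shows "(LINT ww|M. F (G ww)) = (LINT w|cube. F (cube_graph n W w))"
proof -
 have "(LINT ww|M. F (G ww)) = (\<integral>g. F g \<partial>distr M (count_space (graphs_on n)) G)" by (rule integral_distr[symmetric, OF G]) simp
 then show ?thesis unfolding d integral_graphon_random_graph[OF W] .
qed

lemma (in brownian_space) chaos_approx_limit:
 assumes W: "graphon W" and H: "pattern_graph (H i)"
 shows "\<not> H_regular (H i) W ==> chaos_approx (irr_kernel (H i) W) (%_. 0) (Z_irregular N B (H i) W)"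
  "chaos_approx (%_. 0) (case_prod (reg_kernel (H i) W)) (wiener2 N B (reg_kernel (H i) W))"
proof -
 note H' = pattern_graphD[OF H]
 have e: "Z_irregular N B (H i) W = wiener1 N B (irr_kernel (H i) W)" unfolding Z_irregular_def irr_kernel_def[abs_def] ..
 show "chaos_approx (irr_kernel (H i) W) (%_. 0) (Z_irregular N B (H i) W)"
  unfolding e by (rule chaos_approx_wiener1[OF has_wiener1_exists[OF bdm_irr_kernel[OF W H'(1)]]])
 show "chaos_approx (%_. 0) (case_prod (reg_kernel (H i) W)) (wiener2 N B (reg_kernel (H i) W))"
  by (rule chaos_approx_wiener2[OF has_wiener2_exists[OF bdm_reg_kernel[OF W H'(1)]]])
qed

theorem theorem2p1:
  fixes W :: "real \<Rightarrow> real \<Rightarrow> real" and H :: "nat \<Rightarrow> sgraph" and q r :: nat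
    and M :: "nat \<Rightarrow> 'a measure" and G :: "nat \<Rightarrow> 'a \<Rightarrow> sgraph"
    and N :: "'b measure" and B :: "real \<Rightarrow> 'b \<Rightarrow> real" and g :: "nat \<Rightarrow> 'b \<Rightarrow> real"
  assumes "graphon W"
    and "\<forall>i\<in>{1..r}. pattern_graph (H i) \<and> edges (H i) \<noteq> {}"
    and "1 \<le> q" and "q \<le> r"
    and "\<forall>i\<in>{1..q}. \<not> H_regular (H i) W"
    and "\<forall>i\<in>{q+1..r}. H_regular (H i) W"
    and "\<forall>n. prob_space (M n)"
    and "\<forall>n. G n \<in> M n \<rightarrow>\<^sub>M count_space (graphs_on n)"
    and "\<forall>n. distr (M n) (count_space (graphs_on n)) (G n) = graphon_random_graph n W"
    and "brownian_motion N B"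
    and "centred_gaussian N {q+1..r} (\<lambda>i j. limit_cov (H i) (H j) W) g"
    and "independent_families N {q+1..r} g {0..1} B"
  shows "converges_in_distribution {1..r}
           M (\<lambda>n \<omega>. \<lambda>i\<in>{1..r}. Z_stat n (H i) W (G n \<omega>))
           N (\<lambda>\<omega>. \<lambda>i\<in>{1..r}.
                if i \<le> q then Z_irregular N B (H i) W \<omega> else Z_regular N B (g i) (H i) W \<omega>)"
proof -
 have W: "graphon W" by fact
 have H: "pattern_graph (H i)" if "i : {1..r}" for i using assms(2) that by blast
 have irr: "\<not> H_regular (H i) W" if "i : {1..r}" "i <= q" for i using assms(5) that by simp
 have reg: "H_regular (H i) W" if "i : {1..r}" "\<not> i <= q" for i using assms(6) that by simp
 have Gm: "G n : M n \<rightarrow>\<^sub>M count_space (graphs_on n)" for n using assms(8) by blast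
 have Gd: "distr (M n) (count_space (graphs_on n)) (G n) = graphon_random_graph n W" for n using assms(9) by blast
 have Mp: "prob_space (M n)" for n using assms(7) by blast
 have gm: "g i : borm N" if "i : {q+1..r}" for i using assms(11) that unfolding centred_gaussian_def by blast
 have gc: "(CLINT ww|N. iexp (SUM i:{q+1..r}. a i * g i ww)) =
   of_real (exp (- (1 / 2) * (SUM i:{q+1..r}. SUM j:{q+1..r}. a i * limit_cov (H i) (H j) W * a j)))" for a
  using assms(11) unfolding centred_gaussian_def by blast
 have NP: "prob_space N" using assms(10) unfolding brownian_motion_def by (elim conjE)
 interpret BS: brownian_space N B by (intro brownian_space.intro NP brownian_space_axioms.intro assms(10))
 interpret U: prob_space unit_unif by (rule prob_space_unit_unif)
 note Hs = pattern_graphD(1)[OF H]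
 \<comment> \<open>Padding with zero kernels gives every coordinate the same shape, a linear plus a
   quadratic statistic plus possibly noise. A linear combination of the coordinates then has this
   shape again, and the limit theorem for one pair of kernels yields the joint law.\<close>
 define f where "f i = (if i <= q then irr_kernel (H i) W else (%_. 0))" for i
 define K where "K i = (if i <= q then (%_. 0) else case_prod (reg_kernel (H i) W))" for i
 define X where "X i = (if i <= q then Z_irregular N B (H i) W else wiener2 N B (reg_kernel (H i) W))" for i
 let ?Y = "%i ww. if i <= q then Z_irregular N B (H i) W ww else Z_regular N B (g i) (H i) W ww"
 have Y: "?Y i ww = X i ww + (if i <= q then 0 else g i ww)" for i ww
  unfolding X_def Z_regular_def reg_kernel_def[abs_def] by simp
 have bf: "bdm unit_unif (f i)" if "i : {1..r}" for i
  using bdm_irr_kernel[OF W Hs[OF that]] by (simp add: f_def)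
 have f0: "(LINT x|unit_unif. f i x) = 0" if "i : {1..r}" for i
  using integral_irr_kernel[OF W H[OF that]] by (simp add: f_def)
 have bK: "bdm unit_square (K i)" if "i : {1..r}" for i
  using bdm_reg_kernel[OF W Hs[OF that]] by (simp add: K_def)
 have K0: "AE x in unit_unif. (LINT y|unit_unif. K i (x, y)) = 0" "AE y in unit_unif. (LINT x|unit_unif. K i (x, y)) = 0" if "i : {1..r}" for i
  using reg_kernel_degenerate[OF W H[OF that] reg[OF that]] by (cases "i <= q"; simp add: K_def)+
 have cX: "BS.chaos_approx (f i) (K i) (X i)" if "i : {1..r}" for i
  using BS.chaos_approx_limit[where H = H, OF W H[OF that]] irr[OF that] by (cases "i <= q") (simp_all add: f_def K_def X_def)
 have mX: "X i : borm N" if "i : {1..r}" for i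
  using cX[OF that] unfolding BS.chaos_approx_def by (elim conjE)
 have mY: "?Y i : borm N" if "i : {1..r}" for i
 proof (cases "i <= q")
  case True
  then show ?thesis using mX[OF that] by (simp add: X_def)
 next
  case False
  then have "(%ww. X i ww + g i ww) : borm N" using that by (intro borel_measurable_add mX gm) auto
  then show ?thesis unfolding Y using False by simp
 qed
 have A: "approx_stat n (H i) W w = lin_stat n (f i) w / sqrt (real n) + quad_stat n (K i) w / real n +
   (if i <= q then 0 else noise_stat n W (case_prod (noise_kernel (H i) W)) w) / 2 / real n" if "i : {1..r}" for i n w
  using irr[OF that] reg[OF that]
  by (cases "i <= q") (simp_all add: approx_stat_def f_def K_def lin_stat_def quad_stat_def add_divide_distrib)
 show ?thesis
 proof (rule converges_in_distribution_char)
  show "prob_space (M n)" for n by (rule Mp)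
  show "prob_space N" by (rule NP)
  show "(%ww. \<lambda>i\<in>{1..r}. Z_stat n (H i) W (G n ww)) : M n \<rightarrow>\<^sub>M (\<Pi>\<^sub>M i\<in>{1..r}. borel)" for n
   by (rule measurable_restrict) (rule measurable_compose[OF Gm], simp)
  show "(%ww. \<lambda>i\<in>{1..r}. ?Y i ww) : N \<rightarrow>\<^sub>M (\<Pi>\<^sub>M i\<in>{1..r}. borel)"
   by (rule measurable_restrict) (rule mY)
  fix a :: "nat => real"
  let ?F = "%x. SUM i:{1..r}. a i * f i x" and ?K = "%p. SUM i:{1..r}. a i * K i p"
  let ?g = "%p. SUM i:{q+1..r}. a i * case_prod (noise_kernel (H i) W) p"
  let ?X = "%ww. SUM i:{1..r}. a i * X i ww"
  let ?L = "%n w. lin_stat n ?F w / sqrt (real n) + quad_stat n ?K w / real n"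
  let ?S = "SUM i:{q+1..r}. SUM j:{q+1..r}. a i * limit_cov (H i) (H j) W * a j"
  have bF: "bdm unit_unif ?F" and bKK: "bdm unit_square ?K"
   by (intro bdm_sum bdm_mult bdm_const bf bK; assumption)+
  have bg: "bdm unit_square ?g"
   by (intro bdm_sum bdm_mult bdm_const bdm_noise_kernel W Hs) simp
  have F0: "(LINT x|unit_unif. ?F x) = 0"
  proof -
   have "(LINT x|unit_unif. ?F x) = (SUM i:{1..r}. LINT x|unit_unif. a i * f i x)"
    by (intro lint_sum bdm_integrable[OF finite_measure_unit_unif] bdm_mult bdm_const bf)
   then show ?thesis by (simp add: f0)
  qed
  have KK0: "AE x in unit_unif. (LINT y|unit_unif. ?K (x, y)) = 0" "AE y in unit_unif. (LINT x|unit_unif. ?K (x, y)) = 0"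
  proof -
   have s: "(LINT z|unit_unif. ?K (h z)) = (SUM i:{1..r}. a i * (LINT z|unit_unif. K i (h z)))"
    if "!!i. i : {1..r} ==> bdm unit_unif (%z. K i (h z))" for h :: "real => real \<times> real"
   proof -
    have "(LINT z|unit_unif. ?K (h z)) = (SUM i:{1..r}. LINT z|unit_unif. a i * K i (h z))"
     by (intro lint_sum bdm_integrable[OF finite_measure_unit_unif] bdm_mult bdm_const that)
    then show ?thesis by (simp only: integral_mult_right_zero)
   qed
   \<comment> \<open>Finitely many null sets are merged, so that degeneracy passes to the combined
     kernel.\<close>
   have "AE x in unit_unif. ALL i:{1..r}. (LINT y|unit_unif. K i (x, y)) = 0" by (rule AE_finite_allI) (simp_all add: K0)
   then show "AE x in unit_unif. (LINT y|unit_unif. ?K (x, y)) = 0" using AE_space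
   proof eventually_elim
    case (elim x)
    then have x: "x : {0..1}" by simp
    show ?case using elim by (subst s[of "%y. (x, y)"]) (simp_all add: bdm_section(1)[OF bK x])
   qed
   have "AE y in unit_unif. ALL i:{1..r}. (LINT x|unit_unif. K i (x, y)) = 0" by (rule AE_finite_allI) (simp_all add: K0)
   then show "AE y in unit_unif. (LINT x|unit_unif. ?K (x, y)) = 0" using AE_space
   proof eventually_elim
    case (elim y)
    then have y: "y : {0..1}" by simp
    show ?case using elim by (subst s[of "%x. (x, y)"]) (simp_all add: bdm_section(2)[OF bK y])
   qed
  qed
  have cXX: "BS.chaos_approx ?F ?K ?X" by (rule BS.chaos_approx_sum[OF finite_atLeastAtMost cX])
  have L: "(SUM i:{1..r}. a i * approx_stat n (H i) W w) = ?L n w + noise_stat n W ?g w / 2 / real n" for n w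
  proof -
   have "(SUM i:{1..r}. a i * approx_stat n (H i) W w) = (SUM i:{1..r}. a i * lin_stat n (f i) w / sqrt (real n) + a i * quad_stat n (K i) w / real n +
     a i * (if i <= q then 0 else noise_stat n W (case_prod (noise_kernel (H i) W)) w) / 2 / real n)"
    by (intro sum.cong refl) (simp only: A distrib_left times_divide_eq_right)
   then show ?thesis
    unfolding sum.distrib sum_divide_distrib[symmetric] sum_tail lin_stat_sum quad_stat_sum noise_stat_sum .
  qed
  have lim: "(%n. CLINT w|cube. iexp (?L n w)) \<longlonglongrightarrow> (CLINT ww|N. iexp (?X ww))"
   by (rule BS.chaos_limit[OF bF F0 bKK KK0 cXX])
  have bL: "bdm cube (?L n)" for n
  proof -
   have "bdm cube (%w. lin_stat n ?F w * (1 / sqrt (real n)) + quad_stat n ?K w * (1 / real n))"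
    by (intro bdm_add bdm_mult bdm_const bdm_lin_stat bdm_quad_stat bF bKK)
   then show ?thesis by simp
  qed
  \<comment> \<open>The part without noise reads vertex coordinates only, as required for
    conditioning the noise on the vertices.\<close>
  have dL: "depends_on (range (%i. (i, i))) (?L n)" for n
   unfolding depends_on_def lin_stat_def quad_stat_def by (intro ballI impI arg_cong2[where f = "(+)"] arg_cong2[where f = "(/)"] sum.cong refl) auto
  have "(%n. (CLINT w|cube. iexp (?L n w + noise_stat n W ?g w / 2 / real n)) -
    of_real (exp (- (LINT p|unit_square. noise_var W ?g p) / 4)) * (CLINT w|cube. iexp (?L n w))) \<longlonglongrightarrow> 0"
  proof (rule noise_removal[OF W bg _ bL dL])
   show "?g (x, y) = ?g (y, x)" for x y by (intro sum.cong refl) (simp add: noise_kernel_sym[of _ W x])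
  qed
  moreover have "of_real (exp (- (LINT p|unit_square. noise_var W ?g p) / 4)) = (CLINT ww|N. iexp (SUM i:{q+1..r}. a i * g i ww))"
  proof -
   have v: "(LINT p|unit_square. noise_var W ?g p) = 2 * ?S" by (rule integral_noise_var_sum[OF W Hs]) simp
   show ?thesis unfolding v gc by simp
  qed
  \<comment> \<open>Adding back the product of the constant noise factor and the convergent vertex
    factor gives the limit of the joint characteristic function as a product, which independence of
    \<open>g\<close> and \<open>B\<close> then recombines.\<close>
  ultimately have "(%n. ((CLINT w|cube. iexp (SUM i:{1..r}. a i * approx_stat n (H i) W w)) -
    (CLINT ww|N. iexp (SUM i:{q+1..r}. a i * g i ww)) * (CLINT w|cube. iexp (?L n w))) +
    (CLINT ww|N. iexp (SUM i:{q+1..r}. a i * g i ww)) * (CLINT w|cube. iexp (?L n w))) \<longlonglongrightarrow>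
    0 + (CLINT ww|N. iexp (SUM i:{q+1..r}. a i * g i ww)) * (CLINT ww|N. iexp (?X ww))"
   unfolding L by (intro tendsto_add tendsto_mult tendsto_const lim) simp_all
  then have "(%n. CLINT w|cube. iexp (SUM i:{1..r}. a i * approx_stat n (H i) W w)) \<longlonglongrightarrow>
    (CLINT ww|N. iexp (?X ww)) * (CLINT ww|N. iexp (SUM i:{q+1..r}. a i * g i ww))" by (simp only: diff_add_cancel add_0 mult.commute)
  also have "(CLINT ww|N. iexp (?X ww)) * (CLINT ww|N. iexp (SUM i:{q+1..r}. a i * g i ww)) =
    (CLINT ww|N. iexp (SUM i:{1..r}. a i * (\<lambda>i\<in>{1..r}. ?Y i ww) i))"
  proof -
   have e: "(SUM i:{1..r}. a i * (\<lambda>i\<in>{1..r}. ?Y i ww) i) = ?X ww + (SUM i:{q+1..r}. a i * g i ww)" for ww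
   proof -
    have "(SUM i:{1..r}. a i * (\<lambda>i\<in>{1..r}. ?Y i ww) i) = (SUM i:{1..r}. a i * X i ww + a i * (if i <= q then 0 else g i ww))"
     by (intro sum.cong refl) (simp only: restrict_apply if_True Y distrib_left)
    then show ?thesis unfolding sum.distrib sum_tail .
   qed
   show ?thesis unfolding e by (rule BS.char_add_independent[symmetric, OF cXX gm assms(12)])
  qed
  finally have 1: "(%n. CLINT w|cube. iexp (SUM i:{1..r}. a i * approx_stat n (H i) W w)) \<longlonglongrightarrow>
    (CLINT ww|N. iexp (SUM i:{1..r}. a i * (\<lambda>i\<in>{1..r}. ?Y i ww) i))" .
  have 2: "(CLINT ww|M n. iexp (SUM i:{1..r}. a i * (\<lambda>i\<in>{1..r}. Z_stat n (H i) W (G n ww)) i)) =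
    (CLINT w|cube. iexp (SUM i:{1..r}. a i * Z_stat n (H i) W (cube_graph n W w)))" for n
  proof -
   have "(SUM i:{1..r}. a i * (\<lambda>i\<in>{1..r}. Z_stat n (H i) W (G n ww)) i) = (SUM i:{1..r}. a i * Z_stat n (H i) W (G n ww))" for ww
    by (intro sum.cong refl) simp
   then show ?thesis using integral_random_graph[OF W Gm Gd, where F = "%g. iexp (SUM i:{1..r}. a i * Z_stat n (H i) W g)"] by (simp only:)
  qed
  have "(%n. (CLINT w|cube. iexp (SUM i:{1..r}. a i * Z_stat n (H i) W (cube_graph n W w)))) \<longlonglongrightarrow>
    0 + (CLINT ww|N. iexp (SUM i:{1..r}. a i * (\<lambda>i\<in>{1..r}. ?Y i ww) i))"
   using tendsto_add[OF Z_stat_approx_char[where I = "{1..r}" and H = H and a = a, OF W H] 1] by (simp only: diff_add_cancel)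
  then show "(%n. CLINT ww|M n. iexp (SUM i:{1..r}. a i * (\<lambda>i\<in>{1..r}. Z_stat n (H i) W (G n ww)) i)) \<longlonglongrightarrow>
    (CLINT ww|N. iexp (SUM i:{1..r}. a i * (\<lambda>i\<in>{1..r}. ?Y i ww) i))"
   unfolding 2 by (simp only: add_0)
 next
  fix i assume i: "i : {1..r}"
  let ?Z = "%n w. Z_stat n (H i) W (cube_graph n W w)" and ?A = "%n. approx_stat n (H i) W"
  \<comment> \<open>Tightness: the normalised count differs from its approximation by less than 1 in
    mean square for large n, and the approximation has bounded second moments.\<close>
  obtain C where C: "!!n. 1 <= n ==> (LINT w|cube. (?A n w)^2) <= C" using approx_stat_sq_le[OF W H[OF i]] by blast
  have "\<forall>\<^sub>F n in sequentially. (LINT w|cube. (?Z n w - ?A n w)^2) < 1"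
   by (rule order_tendstoD(2)[OF Z_stat_approx[OF W H[OF i]]]) simp
  with eventually_ge_at_top[of 1]
  have "\<forall>\<^sub>F n in sequentially. integrable (M n) (%ww. ((\<lambda>i\<in>{1..r}. Z_stat n (H i) W (G n ww)) i)^2) &
    (LINT ww|M n. ((\<lambda>i\<in>{1..r}. Z_stat n (H i) W (G n ww)) i)^2) <= 2 + 2 * C"
  proof eventually_elim
   case (elim n)
   interpret Mn: prob_space "M n" by (rule Mp)
   have e: "(\<lambda>i\<in>{1..r}. Z_stat n (H i) W (G n ww)) i = Z_stat n (H i) W (G n ww)" for ww using i by simp
   have "bdm (M n) (%ww. Z_stat n (H i) W (G n ww))"
   proof (rule bdmI[where C = "SUM G:graphs_on n. \<bar>Z_stat n (H i) W G\<bar>"])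
    show "(%ww. Z_stat n (H i) W (G n ww)) : borm (M n)" by (rule measurable_compose[OF Gm]) simp
    fix ww assume "ww : space (M n)"
    then have "G n ww : graphs_on n" using measurable_space[OF Gm[of n]] by simp
    then show "norm (Z_stat n (H i) W (G n ww)) <= (SUM G:graphs_on n. \<bar>Z_stat n (H i) W G\<bar>)"
     using member_le_sum[of _ "graphs_on n" "%G. \<bar>Z_stat n (H i) W G\<bar>"] finite_graphs_on[of n] by simp
   qed
   then have int: "integrable (M n) (%ww. (Z_stat n (H i) W (G n ww))^2)"
    by (rule bdm_integrable[OF Mn.finite_measure_axioms bdm_power])
   have bA: "bdm cube (?A n)" by (rule bdm_approx_stat[OF W Hs[OF i]])
   have "(LINT ww|M n. (Z_stat n (H i) W (G n ww))^2) = (LINT w|cube. ((?Z n w - ?A n w) + ?A n w)^2)"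
    using integral_random_graph[OF W Gm Gd, where F = "%g. (Z_stat n (H i) W g)^2"] by simp
   also have "... <= 2 * (LINT w|cube. (?Z n w - ?A n w)^2) + 2 * (LINT w|cube. (?A n w)^2)"
    by (rule integral_square_add_le[OF bdm_diff[OF bdm_of_graph[OF W] bA] bA])
   also have "... <= 2 + 2 * C" using elim C[of n] by simp
   finally show ?case unfolding e using int by simp
  qed
  then show "EX C. \<forall>\<^sub>F n in sequentially. integrable (M n) (%ww. ((\<lambda>i\<in>{1..r}. Z_stat n (H i) W (G n ww)) i)^2) &
    (LINT ww|M n. ((\<lambda>i\<in>{1..r}. Z_stat n (H i) W (G n ww)) i)^2) <= C" by (rule exI)
 qed simp
qed

end
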